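(* Let $q$ be a prime, let $E$ be an étale cubic $\mathbb{Q}_q$-algebra, and let $A\subset E$ be a Gorenstein cubic $\mathbb{Z}_q$-order. With $t=q^{-s}$, one has $$J_A(s)=\widetilde L_A(t).$$ Equivalently, $$\widetilde J_A(s)=\widetilde L_q(s,A).$$
   Context: Notation. $\mathcal{O}_E$ is the maximal order (integral closure of $\mathbb{Z}_q$) of the étale cubic $\mathbb{Q}_q$-algebra $E$. A cubic $\mathbb{Z}_q$-order in $E$ is a $\mathbb{Z}_q$-subalgebra $A\subseteq\mathcal{O}_E$, free of rank $3$ over $\mathbb{Z}_q$ (so spanning $E$ over $\mathbb{Q}_q$). An overorder of $A$ is an order $S$ with $A\subseteq S\subseteq\mathcal{O}_E$. For a finite $\mathbb{Z}_q$-module $M$, $\ell_{\mathbb{Z}_q}(M)$ is its length. Put $\delta(A)=\ell_{\mathbb{Z}_q}(\mathcal{O}_E/A)$, and for $A\subseteq T$ put $\delta(T/A)=\ell_{\mathbb{Z}_q}(T/A)$, so $[T:A]=q^{\delta(T/A)}$. Yun's local zeta factor. Let $A^\vee=\{x\in E:\mathrm{Tr}_{E/\mathbb{Q}_q}(xA)\subseteq\mathbb{Z}_q\}\cong\mathrm{Hom}_{\mathbb{Z}_q}(A,\mathbb{Z}_q)$, an $A$-module. Then $$J_A(s)=\sum_{n\ge0}b_A(n)t^n,\qquad b_A(n)=\#\{I\subseteq A^\vee: I\text{ an }A\text{-submodule},\ [A^\vee:I]=q^n\},\qquad t=q^{-s}.$$ Local factors. For an order $S$ in $E$ with maximal ideals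 $\mathfrak m_i$ and residue fields $k_i=S/\mathfrak m_i$, let $\zeta_S(s)=\prod_i(1-|k_i|^{-s})^{-1}$, let $h_S(s)=1$ if $S$ is Gorenstein and $h_S(s)=1+q^{1-s}=1+qt$ otherwise. The local overorder series is $$\widetilde L_A(t)=\sum_{A\subseteq T\subseteq\mathcal{O}_E}h_T(s)\zeta_T(s)[T:A]^{1-2s}=\sum_{A\subseteq T\subseteq\mathcal{O}_E}q^{\delta(T/A)}t^{2\delta(T/A)}h_T(s)\zeta_T(s).$$ Everything is regarded as a power series (rational function) in $t=q^{-s}$. Normalized versions. Write $E=\prod_iE_i$ with $E_i$ fields of residue degree $n_i$ over $\mathbb{Q}_q$, and $\zeta_E(s)=\prod_i(1-q^{-n_is})^{-1}$. Then $$\widetilde J_A(s)=q^{\delta(A)s}\,\zeta_E(s)^{-1}J_A(s),\qquad \widetilde L_q(s,A)=q^{\delta(A)s}\sum_{A\subseteq S\subseteq\mathcal{O}_E}h_S(s)\frac{\zeta_S(s)}{\zeta_E(s)}[S:A]^{1-2s}.$$ *)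

theory Defs
  imports
    "HOL-Computational_Algebra.Computational_Algebra"
    "Berlekamp_Zassenhaus.Finite_Field"
begin

section \<open>The \<open>q\<close>-adic integers and numbers\<close>

text \<open>
  The prime is \<open>q = CARD('q)\<close> for a type \<open>'q\<close> of class \<open>prime_card\<close>. The ring \<open>\<int>\<^sub>q\<close> is the
  inverse limit of the rings \<open>\<int>/q\<^sup>n\<close>, with residue classes represented in \<open>{0..<q^n}\<close>, and
  \<open>\<rat>\<^sub>q\<close> is its field of fractions.
\<close>

typedef (overloaded) ('q :: prime_card) padic_int =
  "{x :: nat \<Rightarrow> int. \<forall>n. 0 \<le> x n \<and> x n < int CARD('q) ^ n \<and> x (Suc n) mod int CARD('q) ^ n = x n}"
  morphisms padic_res Abs_padic_int
  by (rule exI[of _ "\<lambda>_. 0"]) (auto simp: prime_gt_0_nat prime_card)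

setup_lifting type_definition_padic_int

lemma card_prime_pos: "0 < int CARD('q :: prime_card)"
  using prime_gt_0_nat[OF prime_card[where 'a = 'q]] by simp

lemma padic_mod_Suc:
  "(a mod int CARD('q :: prime_card) ^ Suc n) mod int CARD('q) ^ n = a mod int CARD('q) ^ n"
  by (rule mod_mod_cancel) simp

instantiation padic_int :: (prime_card) comm_ring_1
begin

lift_definition zero_padic_int :: "'a padic_int" is "\<lambda>_. 0"
  using card_prime_pos[where 'q = 'a] by simp

lift_definition one_padic_int :: "'a padic_int" is "\<lambda>n. 1 mod int CARD('a) ^ n"
  using card_prime_pos[where 'q = 'a] padic_mod_Suc[where 'q = 'a] by simp

lift_definition plus_padic_int :: "'a padic_int \<Rightarrow> 'a padic_int \<Rightarrow> 'a padic_int"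
  is "\<lambda>x y n. (x n + y n) mod int CARD('a) ^ n"
  using card_prime_pos[where 'q = 'a] padic_mod_Suc[where 'q = 'a]
  by (metis mod_add_eq pos_mod_bound pos_mod_sign zero_less_power)

lift_definition minus_padic_int :: "'a padic_int \<Rightarrow> 'a padic_int \<Rightarrow> 'a padic_int"
  is "\<lambda>x y n. (x n - y n) mod int CARD('a) ^ n"
  using card_prime_pos[where 'q = 'a] padic_mod_Suc[where 'q = 'a]
  by (metis mod_diff_eq pos_mod_bound pos_mod_sign zero_less_power)

lift_definition uminus_padic_int :: "'a padic_int \<Rightarrow> 'a padic_int"
  is "\<lambda>x n. (- x n) mod int CARD('a) ^ n"
  using card_prime_pos[where 'q = 'a] padic_mod_Suc[where 'q = 'a]
  by (metis mod_minus_eq pos_mod_bound pos_mod_sign zero_less_power)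

lift_definition times_padic_int :: "'a padic_int \<Rightarrow> 'a padic_int \<Rightarrow> 'a padic_int"
  is "\<lambda>x y n. (x n * y n) mod int CARD('a) ^ n"
  using card_prime_pos[where 'q = 'a] padic_mod_Suc[where 'q = 'a]
  by (metis mod_mult_eq pos_mod_bound pos_mod_sign zero_less_power)

instance
proof
  fix a b c :: "'a padic_int"
  show "a * b * c = a * (b * c)"
    by transfer (auto simp: mod_simps mult.assoc)
  show "a * b = b * a"
    by transfer (auto simp: mult.commute)
  show "1 * a = a"
    by transfer (auto simp: mod_simps)
  show "a + b + c = a + (b + c)"
    by transfer (auto simp: mod_simps add.assoc)
  show "a + b = b + a"
    by transfer (auto simp: add.commute)
  show "0 + a = a"
    by transfer auto
  show "- a + a = 0"
    by transfer (auto simp: mod_simps)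
  show "a - b = a + - b"
    by transfer (auto simp: mod_simps)
  show "(a + b) * c = a * c + b * c"
    by transfer (auto simp: mod_simps distrib_right)
  have "int CARD('a) > 1"
    using prime_gt_1_nat[OF prime_card[where 'a = 'a]] by simp
  then have "0 \<noteq> (1 :: int) mod int CARD('a) ^ 1" by simp
  then show "0 \<noteq> (1 :: 'a padic_int)"
    by transfer metis
qed

end

lemma padic_res_nonneg: "0 \<le> padic_res x n"
  using padic_res[of x] by auto

lemma padic_res_less: "padic_res (x :: 'q :: prime_card padic_int) n < int CARD('q) ^ n"
  using padic_res[of x] by auto

lemma padic_res_mod:
  "padic_res (x :: 'q :: prime_card padic_int) (n + k) mod int CARD('q) ^ n = padic_res x n"
proof (induction k)
  case 0
  then show ?case using padic_res_nonneg[of x n] padic_res_less[of x n] by simp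
next
  case (Suc k)
  have "padic_res x (n + Suc k) mod int CARD('q) ^ n
      = padic_res x (Suc (n + k)) mod int CARD('q) ^ (n + k) mod int CARD('q) ^ n"
    by (simp add: mod_mod_cancel le_imp_power_dvd)
  also have "padic_res x (Suc (n + k)) mod int CARD('q) ^ (n + k) = padic_res x (n + k)"
    using padic_res[of x] by auto
  finally show ?case using Suc by simp
qed

instance padic_int :: (prime_card) idom
proof
  fix a b :: "'a padic_int"
  let ?q = "int CARD('a)"
  assume "a \<noteq> 0" and "b \<noteq> 0"
  then obtain m n where m: "padic_res a m \<noteq> 0" and n: "padic_res b n \<noteq> 0"
    by (metis (no_types, lifting) ext padic_res_inject zero_padic_int.rep_eq)
  have "\<not> ?q ^ m dvd padic_res a (m + n)"
    using m padic_res_mod[of a m n] by (simp add: dvd_eq_mod_eq_0)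
  moreover have "\<not> ?q ^ n dvd padic_res b (m + n)"
    using n padic_res_mod[of b n m] by (simp add: dvd_eq_mod_eq_0 add.commute)
  ultimately have "\<not> ?q ^ (m + n) dvd padic_res a (m + n) * padic_res b (m + n)"
  proof -
    have False if 0: "?q ^ (m + n) dvd padic_res a (m + n) * padic_res b (m + n)"
      and 1: "\<not> ?q ^ m dvd padic_res a (m + n)" and 2: "\<not> ?q ^ n dvd padic_res b (m + n)"
    proof -
      obtain i j where ij: "i + j = m + n" "?q ^ i dvd padic_res a (m + n)"
        "?q ^ j dvd padic_res b (m + n)"
        using prime_elem_power_dvd_prod[OF 0 prime_imp_prime_elem[OF prime_card_int]] by blast
      have "i < m" using 1 ij(2) by (meson dvd_trans le_imp_power_dvd not_le)
      moreover have "j < n" using 2 ij(3) by (meson dvd_trans le_imp_power_dvd not_le)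
      ultimately show False using ij(1) by simp
    qed
    then show ?thesis
      using \<open>\<not> ?q ^ m dvd padic_res a (m + n)\<close> \<open>\<not> ?q ^ n dvd padic_res b (m + n)\<close> by blast
  qed
  then have "padic_res (a * b) (m + n) \<noteq> padic_res 0 (m + n)"
    by (simp add: times_padic_int.rep_eq zero_padic_int.rep_eq dvd_eq_mod_eq_0)
  then show "a * b \<noteq> 0" by metis
qed

type_synonym 'q padic = "'q padic_int fract"


section \<open>Modules, ideals and zeta factors inside a commutative ring\<close>

definition additive_subgroup :: "'e :: comm_ring_1 set \<Rightarrow> bool" where
  "additive_subgroup M \<longleftrightarrow> 0 \<in> M \<and> (\<forall>x\<in>M. \<forall>y\<in>M. x - y \<in> M)"

definition submodule_over :: "'e :: comm_ring_1 set \<Rightarrow> 'e set \<Rightarrow> bool" where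
  "submodule_over S M \<longleftrightarrow> additive_subgroup M \<and> (\<forall>a\<in>S. \<forall>x\<in>M. a * x \<in> M)"

text \<open>The index \<open>[M : N]\<close> of additive subgroups \<open>N \<subseteq> M\<close>; it is \<open>0\<close> if \<open>M/N\<close> is infinite.\<close>

definition subgroup_index :: "'e :: comm_ring_1 set \<Rightarrow> 'e set \<Rightarrow> nat" where
  "subgroup_index M N = card (M // {(x, y). x \<in> M \<and> y \<in> M \<and> x - y \<in> N})"

text \<open>
  In the next three definitions \<open>S\<close> is a commutative ring whose addition and multiplication are
  those of the surrounding ring, but whose unit element need not be \<open>1\<close>; this covers both the
  orders of \<open>E\<close> and the maximal orders of the factors \<open>E\<^sub>i\<close> of \<open>E\<close>.
\<close>

definition maximal_ideals :: "'e :: comm_ring_1 set \<Rightarrow> 'e set set" where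
  "maximal_ideals S = {\<mm>. submodule_over S \<mm> \<and> \<mm> \<subset> S \<and>
     (\<forall>I. submodule_over S I \<and> \<mm> \<subseteq> I \<and> I \<subseteq> S \<longrightarrow> I = \<mm> \<or> I = S)}"

text \<open>The residue degree \<open>f\<close> of a maximal ideal, \<open>|S/\<mm>| = q^f\<close>.\<close>

definition residue_degree :: "nat \<Rightarrow> 'e :: comm_ring_1 set \<Rightarrow> 'e set \<Rightarrow> nat" where
  "residue_degree q S \<mm> = (THE f. subgroup_index S \<mm> = q ^ f)"

text \<open>
  All series are formal power series in \<open>t = q\<^sup>-\<^sup>s\<close>, so \<open>|S/\<mm>|\<^sup>-\<^sup>s\<close> is \<open>t^f\<close>
  for the residue degree \<open>f\<close>.
\<close>

definition zeta_order :: "nat \<Rightarrow> 'e :: comm_ring_1 set \<Rightarrow> rat fps" where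
  "zeta_order q S = (\<Prod>\<mm>\<in>maximal_ideals S. inverse (1 - fps_X ^ residue_degree q S \<mm>))"

text \<open>The product \<open>MN\<close> of submodules: all finite sums of products.\<close>

definition submodule_product :: "'e :: comm_ring_1 set \<Rightarrow> 'e set \<Rightarrow> 'e set" where
  "submodule_product M N = \<Inter>{P. additive_subgroup P \<and> (\<forall>x\<in>M. \<forall>y\<in>N. x * y \<in> P)}"

text \<open>
  An idempotent \<open>e\<close> such that the ring \<open>eE\<close>, with unit element \<open>e\<close>, is a field. If \<open>E\<close> is a product
  of fields \<open>E\<^sub>i\<close>, these \<open>e\<close> are precisely the unit elements of the factors, and \<open>E\<^sub>i = eE\<close>.
\<close>

definition field_idempotent :: "'e :: comm_ring_1 \<Rightarrow> bool" where
  "field_idempotent e \<longleftrightarrow> e * e = e \<and> e \<noteq> 0 \<and>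
     (\<forall>x \<in> range ((*) e). x \<noteq> 0 \<longrightarrow> (\<exists>y \<in> range ((*) e). x * y = e))"

definition field_idempotents :: "'e :: comm_ring_1 set" where
  "field_idempotents = {e. field_idempotent e}"


section \<open>Cubic algebras over the \<open>q\<close>-adic numbers and their orders\<close>

context
  fixes scl :: "'q :: prime_card padic \<Rightarrow> 'e :: comm_ring_1 \<Rightarrow> 'e"
begin

definition zscl :: "'q padic_int \<Rightarrow> 'e \<Rightarrow> 'e" where
  "zscl a x = scl (to_fract a) x"

text \<open>The value of a polynomial at \<open>x\<close> in the algebra \<open>eE\<close>, whose unit element is \<open>e\<close>.\<close>

definition alg_eval :: "'e \<Rightarrow> 'q padic poly \<Rightarrow> 'e \<Rightarrow> 'e" where
  "alg_eval e p x = (\<Sum>i\<le>degree p. scl (Polynomial.coeff p i) (e * x ^ i))"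

text \<open>
  \<open>E\<close> is etale over \<open>\<rat>\<^sub>q\<close> if it is a finite product of finite separable field extensions. The
  product decomposition is expressed by orthogonal idempotents with sum \<open>1\<close>. The polynomial in
  the last clause is, up to a scalar, the minimal polynomial of \<open>x\<close>.
\<close>

definition etale_cubic_algebra :: bool where
  "etale_cubic_algebra \<longleftrightarrow>
     vector_space scl \<and> (\<forall>c x y. scl c (x * y) = scl c x * y) \<and>
     vector_space.dim scl (UNIV :: 'e set) = 3 \<and>
     (\<exists>I. finite I \<and> (\<forall>e\<in>I. field_idempotent e) \<and>
        (\<forall>e\<in>I. \<forall>e'\<in>I. e \<noteq> e' \<longrightarrow> e * e' = 0) \<and> \<Sum>I = 1 \<and>
        (\<forall>e\<in>I. \<forall>x \<in> range ((*) e).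
           \<exists>p. Factorial_Ring.irreducible p \<and> coprime p (pderiv p) \<and> alg_eval e p x = 0))"

text \<open>The integral closure of \<open>\<int>\<^sub>q\<close> in the algebra \<open>eE\<close>; for \<open>e = 1\<close> this is \<open>\<O>\<^sub>E\<close>.\<close>

definition integral_closure :: "'e \<Rightarrow> 'e set" where
  "integral_closure e = {x \<in> range ((*) e).
     \<exists>p :: 'q padic_int poly. lead_coeff p = 1 \<and> alg_eval e (map_poly to_fract p) x = 0}"

definition maximal_order :: "'e set" where
  "maximal_order = integral_closure 1"

definition cubic_order :: "'e set \<Rightarrow> bool" where
  "cubic_order A \<longleftrightarrow> A \<subseteq> maximal_order \<and>
     1 \<in> A \<and> (\<forall>x\<in>A. \<forall>y\<in>A. x * y \<in> A) \<and> module.subspace zscl A \<and>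
     (\<exists>B. finite B \<and> card B = 3 \<and> \<not> module.dependent zscl B \<and> module.span zscl B = A)"

text \<open>
  The length of the \<open>\<int>\<^sub>q\<close>-module \<open>M/N\<close>: the largest length of a chain of \<open>\<int>\<^sub>q\<close>-submodules from
  \<open>N\<close> to \<open>M\<close>. It is only used for finite \<open>M/N\<close>.
\<close>

definition quotient_length :: "'e set \<Rightarrow> 'e set \<Rightarrow> nat" where
  "quotient_length M N = (GREATEST n. \<exists>C :: nat \<Rightarrow> 'e set.
     C 0 = N \<and> C n = M \<and> (\<forall>i\<le>n. module.subspace zscl (C i)) \<and> (\<forall>i<n. C i \<subset> C (Suc i)))"

text \<open>The trace of multiplication by \<open>x\<close>; it does not depend on the basis \<open>B\<close>.\<close>

definition alg_trace :: "'e \<Rightarrow> 'q padic" where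
  "alg_trace x =
     (let B = (SOME B. \<not> module.dependent scl B \<and> module.span scl B = UNIV)
      in \<Sum>b\<in>B. module.representation scl B (x * b) b)"

definition trace_dual :: "'e set \<Rightarrow> 'e set" where
  "trace_dual A = {x. \<forall>a\<in>A. alg_trace (x * a) \<in> range to_fract}"

text \<open>An order \<open>S\<close> is Gorenstein if its dualizing module \<open>S\<^sup>\<or>\<close> is an invertible \<open>S\<close>-module.\<close>

definition gorenstein :: "'e set \<Rightarrow> bool" where
  "gorenstein S \<longleftrightarrow> (\<exists>J. submodule_over S J \<and> submodule_product (trace_dual S) J = S)"

definition yun_coeff :: "'e set \<Rightarrow> nat \<Rightarrow> nat" where
  "yun_coeff A n = card {I. I \<subseteq> trace_dual A \<and> submodule_over A I \<and>
     subgroup_index (trace_dual A) I = CARD('q) ^ n}"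

definition yun_J :: "'e set \<Rightarrow> rat fps" where
  "yun_J A = Abs_fps (\<lambda>n. of_nat (yun_coeff A n))"

definition overorders :: "'e set \<Rightarrow> 'e set set" where
  "overorders A = {T. cubic_order T \<and> A \<subseteq> T}"

definition h_factor :: "'e set \<Rightarrow> rat fps" where
  "h_factor S = (if gorenstein S then 1 else 1 + of_nat CARD('q) * fps_X)"

text \<open>The factor \<open>[T : A]\<^sup>1\<^sup>-\<^sup>2\<^sup>s = q\<^sup>\<delta> t\<^sup>2\<^sup>\<delta>\<close> for \<open>\<delta> = \<delta>(T/A)\<close>.\<close>

definition index_factor :: "'e set \<Rightarrow> 'e set \<Rightarrow> rat fps" where
  "index_factor T A = of_nat (CARD('q) ^ quotient_length T A) * fps_X ^ (2 * quotient_length T A)"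

definition overorder_series :: "'e set \<Rightarrow> rat fps" where
  "overorder_series A =
     (\<Sum>T\<in>overorders A. index_factor T A * h_factor T * zeta_order CARD('q) T)"

text \<open>
  The residue degree of \<open>E\<^sub>i = eE\<close> is that of its ring of integers, which is a local ring.
\<close>

definition field_residue_degree :: "'e \<Rightarrow> nat" where
  "field_residue_degree e = residue_degree CARD('q) (integral_closure e)
     (THE \<mm>. \<mm> \<in> maximal_ideals (integral_closure e))"

definition zeta_algebra :: "rat fps" where
  "zeta_algebra = (\<Prod>e\<in>field_idempotents. inverse (1 - fps_X ^ field_residue_degree e))"

text \<open>
  The normalized series are Laurent series in \<open>t\<close>: the factor \<open>q\<^sup>\<delta>\<^sup>s\<close> is \<open>t\<^sup>-\<^sup>\<delta>\<close>.
\<close>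

definition normalized_J :: "'e set \<Rightarrow> rat fls" where
  "normalized_J A = fls_X_intpow (- int (quotient_length maximal_order A)) *
     inverse (fps_to_fls zeta_algebra) * fps_to_fls (yun_J A)"

definition normalized_overorder_series :: "'e set \<Rightarrow> rat fls" where
  "normalized_overorder_series A = fls_X_intpow (- int (quotient_length maximal_order A)) *
     (\<Sum>S\<in>overorders A. fps_to_fls (h_factor S) *
        (fps_to_fls (zeta_order CARD('q) S) / fps_to_fls zeta_algebra) *
        fps_to_fls (index_factor S A))"

end

end

theory Submission
  imports Defs
begin

text \<open>
  The trace form turns the submodules of \<open>A\<^sup>\<or>\<close> of index \<open>q^n\<close> into the \<open>A\<close>-lattices \<open>M \<supseteq> A\<close> of index
  \<open>q^n\<close>, so \<open>J\<^sub>A\<close> counts the latter (\<open>yun_coeff_eq\<close>). In this form \<open>J\<^sub>T\<close> and the overorder series \<open>L\<^sub>T\<close> are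
  defined for all orders \<open>T \<supseteq> A\<close>. The identity is proved by induction over the overorders, together with a
  corrected identity for those that are not Gorenstein.

  The structure of \<open>T\<close> is governed by the fact that \<open>T/qT\<close> has length three. An order that is not Gorenstein
  is \<open>\<int>\<^sub>q + qC\<close> for an order \<open>C\<close> (\<open>not_gor_thin\<close>). A Gorenstein order has at most one maximal ideal \<open>m\<close> that is
  not invertible. If there is none, both series are \<open>\<zeta>\<^sub>T\<close> (\<open>all_invertible\<close>). If there is one, \<open>C = (T : m)\<close>
  is the smallest larger order and has index \<open>q\<close>, so \<open>L\<^sub>T = \<zeta>\<^sub>T + q t\<^sup>2 L\<^sub>C\<close> (\<open>L_gor\<close>). For \<open>J\<^sub>T\<close>, pairs of
  lattices \<open>N \<subseteq> M\<close> with \<open>M/N \<cong> T/m\<close> are counted in two ways, a Hecke correspondence. If \<open>C\<close> is Gorenstein, this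
  gives \<open>J\<^sub>T = \<zeta>\<^sub>T + q t\<^sup>2 J\<^sub>C\<close> (\<open>J_gor_gor\<close>), the same recursion.

  If \<open>C\<close> is not Gorenstein, then \<open>C = \<int>\<^sub>q + qD\<close> and \<open>\<zeta>\<^sub>T = (1 - t)\<^sup>-\<^sup>1\<close>, and the count gives
  \<open>J\<^sub>T = \<zeta>\<^sub>T + q t\<^sup>2 (J\<^sub>C + q t\<^sup>2 (1 - qt) J\<^sub>D)\<close> (\<open>J_gor_thin\<close>). So \<open>L\<^sub>C\<close> has to be this bracket, and for
  arbitrary \<open>D\<close> the correct formula is \<open>L\<^sub>C = J\<^sub>C + q t\<^sup>2 (L\<^sub>D - qt J\<^sub>D)\<close>. To prove it, the lattices over
  \<open>\<int>\<^sub>q + qD\<close> are sorted by the largest \<open>D\<close>-lattice in them and the smallest one that contains them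
  (\<open>J_thin\<close>, \<open>Alo_eq\<close>, \<open>Bet_eq\<close>), and the overorders by the orders \<open>\<int>\<^sub>q + K\<close> of index \<open>q\<close> in \<open>D\<close> (\<open>L_thin\<close>).
  There remains a relation between the series of \<open>D\<close> and its overorders, which follows from the induction
  hypothesis if \<open>D\<close> is Gorenstein (\<open>balanced_gor\<close>) and if it is not (\<open>balanced_thin\<close>).

  The counting takes place in the locale \<open>cubic_lattices\<close>. That \<open>E\<close> is an instance rests on the facts that
  \<open>\<int>\<^sub>q\<close> is a discrete valuation ring, and that the trace form of an etale algebra is nondegenerate.
\<close>

section \<open>Indices of additive subgroups\<close>

lemmas poly_simps = algebra_simps power2_eq_square power3_eq_cube

lemma subgroupD:
  assumes "additive_subgroup M"
  shows "0 \<in> M" "x \<in> M \<Longrightarrow> y \<in> M \<Longrightarrow> x - y \<in> M" "x \<in> M \<Longrightarrow> - x \<in> M"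
    "x \<in> M \<Longrightarrow> y \<in> M \<Longrightarrow> x + y \<in> M"
proof -
  have 0: "0 \<in> M" and d: "\<And>x y. x \<in> M \<Longrightarrow> y \<in> M \<Longrightarrow> x - y \<in> M"
    using assms by (auto simp: additive_subgroup_def)
  have m: "- x \<in> M" if "x \<in> M" for x using d[OF 0 that] by simp
  have p: "x + y \<in> M" if "x \<in> M" "y \<in> M" for x y using d[OF that(1) m[OF that(2)]] by simp
  show "0 \<in> M" "x \<in> M \<Longrightarrow> y \<in> M \<Longrightarrow> x - y \<in> M" "x \<in> M \<Longrightarrow> - x \<in> M"
    "x \<in> M \<Longrightarrow> y \<in> M \<Longrightarrow> x + y \<in> M"
    using 0 d m p by blast+
qed

lemma subgroup_sum:
  assumes "additive_subgroup M" "\<And>i. i \<in> S \<Longrightarrow> f i \<in> M"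
  shows "(\<Sum>i\<in>S. f i) \<in> M"
  using assms(2) by (induction S rule: infinite_finite_induct) (auto intro: subgroupD[OF assms(1)])

lemma subgroup_of_nat:
  assumes "additive_subgroup M" "x \<in> M" shows "of_nat n * x \<in> M"
  by (induction n) (auto simp: algebra_simps intro: subgroupD[OF assms(1)] assms(2))

definition cosets :: "'e :: comm_ring_1 set \<Rightarrow> 'e set \<Rightarrow> 'e set set" where
  "cosets N M = (\<lambda>x. {y. y - x \<in> N}) ` M"

lemma coset_eq_iff:
  assumes "additive_subgroup N"
  shows "{y. y - x \<in> N} = {y. y - x' \<in> N} \<longleftrightarrow> x - x' \<in> N"
proof
  assume "{y. y - x \<in> N} = {y. y - x' \<in> N}"
  moreover have "x \<in> {y. y - x \<in> N}" using subgroupD(1)[OF assms] by simp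
  ultimately show "x - x' \<in> N" by blast
next
  assume h: "x - x' \<in> N"
  have "y - x \<in> N \<longleftrightarrow> y - x' \<in> N" for y
    using subgroupD(4)[OF assms _ h, of "y - x"] subgroupD(2)[OF assms _ h, of "y - x'"]
    by auto
  thus "{y. y - x \<in> N} = {y. y - x' \<in> N}" by blast
qed

lemma index_cosets:
  assumes "additive_subgroup N" "additive_subgroup M" "N \<subseteq> M"
  shows "subgroup_index M N = card (cosets N M)"
proof -
  have "{(x, y). x \<in> M \<and> y \<in> M \<and> x - y \<in> N} `` {x} = {y. y - x \<in> N}" if "x \<in> M" for x
  proof -
    have "y \<in> M \<and> x - y \<in> N \<longleftrightarrow> y - x \<in> N" for y
    proof
      assume "y \<in> M \<and> x - y \<in> N"
      thus "y - x \<in> N" using subgroupD(3)[OF assms(1), of "x - y"] by simp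
    next
      assume h: "y - x \<in> N"
      hence "(y - x) + x \<in> M" using assms that by (intro subgroupD(4)[OF assms(2)]) auto
      thus "y \<in> M \<and> x - y \<in> N" using subgroupD(3)[OF assms(1) h] by simp
    qed
    thus ?thesis using that by auto
  qed
  hence "M // {(x, y). x \<in> M \<and> y \<in> M \<and> x - y \<in> N} = cosets N M"
    unfolding quotient_def cosets_def by auto
  thus ?thesis unfolding subgroup_index_def by simp
qed

lemma card_image_eqI:
  assumes "\<And>x y. x \<in> M \<Longrightarrow> y \<in> M \<Longrightarrow> F x = F y \<longleftrightarrow> G x = G y"
  shows "card (F ` M) = card (G ` M)"
proof -
  let ?h = "\<lambda>X. G (inv_into M F X)"
  have inv: "inv_into M F (F x) \<in> M" "F (inv_into M F (F x)) = F x" if "x \<in> M" for x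
    using that by (auto intro: inv_into_into f_inv_into_f)
  have h: "?h (F x) = G x" if "x \<in> M" for x
    using assms[OF inv(1)[OF that] that] inv(2)[OF that] by simp
  have "bij_betw ?h (F ` M) (G ` M)"
  proof (rule bij_betwI')
    fix X Y assume "X \<in> F ` M" "Y \<in> F ` M"
    thus "?h X = ?h Y \<longleftrightarrow> X = Y" using h assms by (metis imageE)
  next
    fix X assume "X \<in> F ` M" thus "?h X \<in> G ` M" using h by force
  next
    fix Y assume "Y \<in> G ` M" thus "\<exists>X\<in>F ` M. Y = ?h X" using h by force
  qed
  thus ?thesis by (rule bij_betw_same_card)
qed

text \<open>The hypotheses are those of an isomorphism \<open>M/N \<cong> M'/N'\<close> that is only given on representatives.\<close>

lemma index_transfer:
  assumes N: "additive_subgroup N" "additive_subgroup M" "N \<subseteq> M"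
    and N': "additive_subgroup N'" "additive_subgroup M'" "N' \<subseteq> M'"
    and f: "\<And>x. x \<in> M \<Longrightarrow> f x \<in> M'" "\<And>y. y \<in> M' \<Longrightarrow> \<exists>x\<in>M. y - f x \<in> N'"
    and inj: "\<And>x y. x \<in> M \<Longrightarrow> y \<in> M \<Longrightarrow> f x - f y \<in> N' \<longleftrightarrow> x - y \<in> N"
  shows "subgroup_index M' N' = subgroup_index M N"
proof -
  have "cosets N' M' = (\<lambda>x. {y. y - f x \<in> N'}) ` M"
  proof -
    have "{y. y - z \<in> N'} \<in> (\<lambda>x. {y. y - f x \<in> N'}) ` M" if "z \<in> M'" for z
      using f(2)[OF that] coset_eq_iff[OF N'(1)] by fastforce
    thus ?thesis unfolding cosets_def using f(1) by auto
  qed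
  moreover have "card ((\<lambda>x. {y. y - f x \<in> N'}) ` M) = card (cosets N M)"
    unfolding cosets_def
    by (rule card_image_eqI) (use inj coset_eq_iff[OF N(1)] coset_eq_iff[OF N'(1)] in auto)
  ultimately show ?thesis using index_cosets[OF N] index_cosets[OF N'] by simp
qed

lemma index_mult:
  assumes N: "additive_subgroup N" and P: "additive_subgroup P" and M: "additive_subgroup M"
    and "N \<subseteq> P" "P \<subseteq> M"
  shows "subgroup_index M N = subgroup_index M P * subgroup_index P N"
proof -
  define r where "r X = (SOME x. x \<in> X)" for X :: "'a set"
  have r: "r {y. y - x \<in> P} - x \<in> P" for x
  proof -
    have "x \<in> {y. y - x \<in> P}" using subgroupD(1)[OF P] by simp
    hence "r {y. y - x \<in> P} \<in> {y. y - x \<in> P}" unfolding r_def by (rule someI)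
    thus ?thesis by simp
  qed
  let ?g = "\<lambda>(X, Y). {y. y - r X \<in> Y}"
  have g: "?g ({y. y - x \<in> P}, {y. y - p \<in> N}) = {y. y - (r {y. y - x \<in> P} + p) \<in> N}" for x p
    by (simp add: diff_diff_eq)
  have "bij_betw ?g (cosets P M \<times> cosets N P) (cosets N M)"
  proof (rule bij_betwI')
    fix U V assume "U \<in> cosets P M \<times> cosets N P" "V \<in> cosets P M \<times> cosets N P"
    then obtain x p x' p' where U: "U = ({y. y - x \<in> P}, {y. y - p \<in> N})" "x \<in> M" "p \<in> P"
      and V: "V = ({y. y - x' \<in> P}, {y. y - p' \<in> N})" "x' \<in> M" "p' \<in> P"
      unfolding cosets_def by auto
    let ?a = "r {y. y - x \<in> P}" and ?b = "r {y. y - x' \<in> P}"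
    show "?g U = ?g V \<longleftrightarrow> U = V"
    proof
      assume "?g U = ?g V"
      hence h: "(?a + p) - (?b + p') \<in> N" unfolding U V g coset_eq_iff[OF N] .
      have "?a - ?b \<in> P"
        using subgroupD(2)[OF P subgroupD(4)[OF P _ V(3)] U(3), of "(?a + p) - (?b + p')"]
          h \<open>N \<subseteq> P\<close> by (auto simp: algebra_simps)
      hence "(?a - ?b) - (?a - x) + (?b - x') \<in> P"
        using subgroupD(4)[OF P subgroupD(2)[OF P _ r[of x]] r[of x']] by blast
      hence "x - x' \<in> P" by simp
      hence e: "{y. y - x \<in> P} = {y. y - x' \<in> P}" using coset_eq_iff[OF P] by blast
      with h have "p - p' \<in> N" by simp
      thus "U = V" using coset_eq_iff[OF N] e U V by blast
    qed simp
  next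
    fix U assume "U \<in> cosets P M \<times> cosets N P"
    then obtain x p where U: "U = ({y. y - x \<in> P}, {y. y - p \<in> N})" "x \<in> M" "p \<in> P"
      unfolding cosets_def by auto
    let ?a = "r {y. y - x \<in> P}"
    have "(?a - x) + x + p \<in> M"
      using r[of x] U \<open>P \<subseteq> M\<close> by (intro subgroupD(4)[OF M]) auto
    hence "?a + p \<in> M" by simp
    thus "?g U \<in> cosets N M" unfolding U g cosets_def by blast
  next
    fix W assume "W \<in> cosets N M"
    then obtain x where W: "W = {y. y - x \<in> N}" "x \<in> M" unfolding cosets_def by auto
    let ?a = "r {y. y - x \<in> P}"
    have "x - ?a \<in> P" using subgroupD(3)[OF P r[of x]] by simp
    hence "({y. y - x \<in> P}, {y. y - (x - ?a) \<in> N}) \<in> cosets P M \<times> cosets N P"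
      using W unfolding cosets_def by blast
    moreover have "W = ?g ({y. y - x \<in> P}, {y. y - (x - ?a) \<in> N})" unfolding g W by simp
    ultimately show "\<exists>U\<in>cosets P M \<times> cosets N P. W = ?g U" by blast
  qed
  hence "card (cosets N M) = card (cosets P M) * card (cosets N P)"
    using bij_betw_same_card card_cartesian_product by metis
  thus ?thesis
    using index_cosets assms by (metis order_trans)
qed

lemma index_self:
  assumes "additive_subgroup M" shows "subgroup_index M M = 1"
proof -
  have "{y. y - x \<in> M} = M" if "x \<in> M" for x
    using coset_eq_iff[OF assms, of x 0] that by simp
  hence "cosets M M = {M}" using subgroupD(1)[OF assms] unfolding cosets_def by auto
  thus ?thesis using index_cosets[OF assms assms] by simp
qed

lemma index_eq_1:
  assumes "additive_subgroup N" "additive_subgroup M" "N \<subseteq> M" "subgroup_index M N = 1"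
  shows "N = M"
proof -
  obtain X where X: "cosets N M = {X}"
    using assms index_cosets[OF assms(1-3)] by (metis card_1_singletonE)
  have "x \<in> N" if "x \<in> M" for x
  proof -
    have "{y. y - x \<in> N} = {y. y - 0 \<in> N}"
      proof -
      have "{y. y - x \<in> N} \<in> cosets N M" "{y. y - 0 \<in> N} \<in> cosets N M"
        using that subgroupD(1)[OF assms(2)] unfolding cosets_def by blast+
      thus ?thesis unfolding X by simp
    qed
    hence "x - 0 \<in> N" by (simp only: coset_eq_iff[OF assms(1)])
    thus ?thesis by simp
  qed
  with assms(3) show ?thesis by blast
qed

lemma index_le:
  assumes "additive_subgroup N" "additive_subgroup M" "N \<subseteq> M" "finite S"
    and "\<And>x. x \<in> M \<Longrightarrow> \<exists>s\<in>S. x - s \<in> N"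
  shows "subgroup_index M N \<le> card S" "subgroup_index M N \<noteq> 0"
proof -
  have sub: "cosets N M \<subseteq> (\<lambda>s. {y. y - s \<in> N}) ` S"
    unfolding cosets_def using assms(5) coset_eq_iff[OF assms(1)] by fastforce
  hence "card (cosets N M) \<le> card S"
    using assms(4) by (meson card_image_le card_mono finite_imageI order_trans)
  thus "subgroup_index M N \<le> card S" using index_cosets[OF assms(1-3)] by simp
  have "finite (cosets N M)" using sub assms(4) by (rule finite_subset[OF _ finite_imageI])
  moreover have "cosets N M \<noteq> {}"
    using subgroupD(1)[OF assms(2)] unfolding cosets_def by auto
  ultimately have "card (cosets N M) \<noteq> 0" by simp
  thus "subgroup_index M N \<noteq> 0" using index_cosets[OF assms(1-3)] by simp
qed

definition sum_set :: "'e :: comm_ring_1 set \<Rightarrow> 'e set \<Rightarrow> 'e set" where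
  "sum_set M N = {x + y |x y. x \<in> M \<and> y \<in> N}"

definition colon :: "'e :: comm_ring_1 set \<Rightarrow> 'e set \<Rightarrow> 'e set" where
  "colon M N = {x. \<forall>y\<in>N. x * y \<in> M}"

lemma colonI: "(\<And>y. y \<in> N \<Longrightarrow> x * y \<in> M) \<Longrightarrow> x \<in> colon M N" and
  colonD: "x \<in> colon M N \<Longrightarrow> y \<in> N \<Longrightarrow> x * y \<in> M"
  unfolding colon_def by auto

lemma submodD:
  assumes "submodule_over S M"
  shows "additive_subgroup M" "0 \<in> M" "x \<in> M \<Longrightarrow> y \<in> M \<Longrightarrow> x - y \<in> M" "x \<in> M \<Longrightarrow> - x \<in> M"
    "x \<in> M \<Longrightarrow> y \<in> M \<Longrightarrow> x + y \<in> M" "a \<in> S \<Longrightarrow> x \<in> M \<Longrightarrow> a * x \<in> M"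
  using assms subgroupD[of M] unfolding submodule_over_def by auto

lemma submodI:
  assumes "0 \<in> M" "\<And>x y. x \<in> M \<Longrightarrow> y \<in> M \<Longrightarrow> x - y \<in> M" "\<And>a x. a \<in> S \<Longrightarrow> x \<in> M \<Longrightarrow> a * x \<in> M"
  shows "submodule_over S M"
  using assms unfolding submodule_over_def additive_subgroup_def by blast

lemma submod_sum_set:
  assumes "submodule_over S M" "submodule_over S N"
  shows "submodule_over S (sum_set M N)"
proof (rule submodI)
  show "0 \<in> sum_set M N"
    unfolding sum_set_def using submodD(2)[OF assms(1)] submodD(2)[OF assms(2)] by force
next
  fix x y assume "x \<in> sum_set M N" "y \<in> sum_set M N"
  then obtain a b c d where "x = a + b" "y = c + d" "a \<in> M" "b \<in> N" "c \<in> M" "d \<in> N"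
    unfolding sum_set_def by blast
  moreover have "a + b - (c + d) = (a - c) + (b - d)" by simp
  ultimately show "x - y \<in> sum_set M N"
    unfolding sum_set_def using submodD(3)[OF assms(1)] submodD(3)[OF assms(2)] by blast
next
  fix s x assume "s \<in> S" "x \<in> sum_set M N"
  then obtain a b where "x = a + b" "a \<in> M" "b \<in> N" unfolding sum_set_def by blast
  thus "s * x \<in> sum_set M N" unfolding sum_set_def
    using submodD(6)[OF assms(1) \<open>s \<in> S\<close>] submodD(6)[OF assms(2) \<open>s \<in> S\<close>]
    by (metis (mono_tags, lifting) distrib_left mem_Collect_eq)
qed

lemma sum_set_upper:
  assumes "additive_subgroup M" "additive_subgroup N"
  shows "M \<subseteq> sum_set M N" "N \<subseteq> sum_set M N"
  unfolding sum_set_def using subgroupD(1)[OF assms(1)] subgroupD(1)[OF assms(2)]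
  by force+

lemma sum_set_least:
  assumes "additive_subgroup P" "M \<subseteq> P" "N \<subseteq> P" shows "sum_set M N \<subseteq> P"
  unfolding sum_set_def using subgroupD(4)[OF assms(1)] assms(2,3) by blast

lemma sum_setI: "x \<in> M \<Longrightarrow> y \<in> N \<Longrightarrow> x + y \<in> sum_set M N" and
  sum_setE: "z \<in> sum_set M N \<Longrightarrow> (\<And>x y. z = x + y \<Longrightarrow> x \<in> M \<Longrightarrow> y \<in> N \<Longrightarrow> thesis) \<Longrightarrow> thesis"
  unfolding sum_set_def by auto

lemma submod_Int:
  "submodule_over S M \<Longrightarrow> submodule_over S N \<Longrightarrow> submodule_over S (M \<inter> N)"
  unfolding submodule_over_def additive_subgroup_def by auto

lemma submod_colon:
  assumes "submodule_over S M" shows "submodule_over S (colon M N)"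
  using submodD(2,3,6)[OF assms]
  by (intro submodI) (auto simp: colon_def left_diff_distrib mult.assoc)

text \<open>An element of \<open>S\<close> can be moved to the argument in \<open>N\<close>.\<close>

lemma submod_colon':
  assumes "additive_subgroup M" "\<And>a y. a \<in> S \<Longrightarrow> y \<in> N \<Longrightarrow> a * y \<in> N"
  shows "submodule_over S (colon M N)"
proof (rule submodI)
  fix a x assume "a \<in> S" "x \<in> colon M N"
  thus "a * x \<in> colon M N"
    by (intro colonI) (metis assms(2) colonD mult.assoc mult.commute)
qed (use subgroupD(1,2)[OF assms(1)] in \<open>auto simp: colon_def left_diff_distrib\<close>)

lemma submod_image:
  assumes "submodule_over S M" shows "submodule_over S ((*) a ` M)"
proof (rule submodI)
  show "0 \<in> (*) a ` M" using submodD(2)[OF assms] by force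
next
  fix x y assume "x \<in> (*) a ` M" "y \<in> (*) a ` M"
  thus "x - y \<in> (*) a ` M"
    using submodD(3)[OF assms] by (smt (verit) image_iff right_diff_distrib)
next
  fix s x assume "s \<in> S" "x \<in> (*) a ` M"
  thus "s * x \<in> (*) a ` M"
    using submodD(6)[OF assms] by (smt (verit) image_iff mult.left_commute)
qed

lemma submod_mono: "submodule_over S M \<Longrightarrow> R \<subseteq> S \<Longrightarrow> submodule_over R M"
  unfolding submodule_over_def by blast

abbreviation product_infix :: "'e :: comm_ring_1 set \<Rightarrow> 'e set \<Rightarrow> 'e set" (infixl "\<cdot>" 70) where
  "M \<cdot> N \<equiv> submodule_product M N"

lemma product_mem: "x \<in> M \<Longrightarrow> y \<in> N \<Longrightarrow> x * y \<in> M \<cdot> N"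
  unfolding submodule_product_def by blast

lemma product_least:
  assumes "additive_subgroup P" "\<And>x y. x \<in> M \<Longrightarrow> y \<in> N \<Longrightarrow> x * y \<in> P"
  shows "M \<cdot> N \<subseteq> P"
  unfolding submodule_product_def using assms by blast

lemma subgroup_product: "additive_subgroup (M \<cdot> N)"
  unfolding submodule_product_def additive_subgroup_def by blast

lemma product_commute: "M \<cdot> N = N \<cdot> M"
  unfolding submodule_product_def by (metis (lifting) mult.commute)

lemma submod_product:
  assumes "submodule_over S N" shows "submodule_over S (M \<cdot> N)"
proof -
  have "a * x \<in> M \<cdot> N" if a: "a \<in> S" and x: "x \<in> M \<cdot> N" for a x
  proof -
    have "M \<cdot> N \<subseteq> {x. a * x \<in> M \<cdot> N}"
    proof (rule product_least)
      show "additive_subgroup {x. a * x \<in> M \<cdot> N}"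
        using subgroupD[OF subgroup_product[of M N]]
        by (auto simp: additive_subgroup_def right_diff_distrib)
      fix x y assume "x \<in> M" "y \<in> N"
      hence "x * (a * y) \<in> M \<cdot> N"
        using submodD(6)[OF assms a] by (intro product_mem)
      thus "x * y \<in> {x. a * x \<in> M \<cdot> N}" by (simp add: mult.left_commute)
    qed
    with x show ?thesis by blast
  qed
  thus ?thesis using subgroup_product unfolding submodule_over_def by blast
qed

lemma product_mono:
  "M \<subseteq> M' \<Longrightarrow> N \<subseteq> N' \<Longrightarrow> M \<cdot> N \<subseteq> M' \<cdot> N'"
  by (rule product_least) (auto intro: subgroup_product product_mem)

lemma product_assoc:
  "(L \<cdot> M) \<cdot> N = L \<cdot> (M \<cdot> N)"
proof -
  have 1: "(A \<cdot> B) \<cdot> D \<subseteq> A \<cdot> (B \<cdot> D)"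
    for A B D :: "'a set"
  proof (rule product_least[OF subgroup_product])
    fix x y assume x: "x \<in> A \<cdot> B" and y: "y \<in> D"
    have "A \<cdot> B \<subseteq> {x. x * y \<in> A \<cdot> (B \<cdot> D)}"
    proof (rule product_least)
      show "additive_subgroup {x. x * y \<in> A \<cdot> (B \<cdot> D)}"
        using subgroupD[OF subgroup_product[of A "B \<cdot> D"]]
        by (auto simp: additive_subgroup_def left_diff_distrib)
    qed (use y in \<open>auto simp: mult.assoc intro: product_mem\<close>)
    with x show "x * y \<in> A \<cdot> (B \<cdot> D)" by blast
  qed
  have "L \<cdot> (M \<cdot> N) = (N \<cdot> M) \<cdot> L"
    by (metis product_commute)
  also have "\<dots> \<subseteq> N \<cdot> (M \<cdot> L)" by (rule 1)
  also have "\<dots> = (L \<cdot> M) \<cdot> N" by (metis product_commute)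
  finally show ?thesis using 1 by blast
qed

section \<open>Lattices\<close>

text \<open>
  Commensurability with a fixed lattice \<open>\<Lambda>\<close> replaces bases: it passes to sums, intersections, products
  and colon modules without any choice.
\<close>

definition lattice_in :: "nat \<Rightarrow> 'e :: comm_ring_1 set \<Rightarrow> 'e set \<Rightarrow> 'e set \<Rightarrow> bool" where
  "lattice_in q Z \<Lambda> M \<longleftrightarrow> submodule_over Z M \<and>
     (\<exists>k. (\<forall>x\<in>\<Lambda>. of_nat q ^ k * x \<in> M) \<and> (\<forall>x\<in>M. of_nat q ^ k * x \<in> \<Lambda>))"

definition order_in :: "nat \<Rightarrow> 'e :: comm_ring_1 set \<Rightarrow> 'e set \<Rightarrow> 'e set \<Rightarrow> bool" where
  "order_in q Z \<Lambda> T \<longleftrightarrow> lattice_in q Z \<Lambda> T \<and> 1 \<in> T \<and> (\<forall>x\<in>T. \<forall>y\<in>T. x * y \<in> T)"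

text \<open>
  The properties of lattices over \<open>Z = \<int>\<^sub>q\<close> in a cubic algebra on which all counting rests. The degree three
  enters as \<open>[\<Lambda> : q\<Lambda>] = q^3\<close>, and the trace form through the set \<open>I\<close> of elements of integral trace,
  for which \<open>M \<mapsto> (I : M)\<close> is a duality.
\<close>

locale cubic_lattices =
  fixes q :: nat and Z \<Lambda> I :: "'e :: comm_ring_1 set"
  assumes q_prime: "prime q"
    and q_inv: "\<exists>r. of_nat q * r = (1 :: 'e)"
    and Z_mod: "submodule_over Z Z" and Z_one: "1 \<in> Z"
    and Z_res: "z \<in> Z \<Longrightarrow> \<exists>i<q. \<exists>w\<in>Z. z = of_nat i + of_nat q * w"
    and L_mod: "submodule_over Z \<Lambda>" and L_one: "1 \<in> \<Lambda>"
    and L_mult: "x \<in> \<Lambda> \<Longrightarrow> y \<in> \<Lambda> \<Longrightarrow> x * y \<in> \<Lambda>"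
    and L_absorb: "\<exists>k. of_nat q ^ k * x \<in> \<Lambda>"
    and L_index: "subgroup_index \<Lambda> ((*) (of_nat q) ` \<Lambda>) = q ^ 3"
    and nakayama: "lattice_in q Z \<Lambda> M \<Longrightarrow> submodule_over Z N \<Longrightarrow> N \<subseteq> M \<Longrightarrow>
      M \<subseteq> sum_set N ((*) (of_nat q) ` M) \<Longrightarrow> N = M"
    and I_mod: "submodule_over Z I"
    and dual_lat: "lattice_in q Z \<Lambda> M \<Longrightarrow> lattice_in q Z \<Lambda> (colon I M)"
    and dual_dual: "lattice_in q Z \<Lambda> M \<Longrightarrow> colon I (colon I M) = M"
    and order_trace: "order_in q Z \<Lambda> T \<Longrightarrow> T \<subseteq> I"
begin

abbreviation Q :: 'e where "Q \<equiv> of_nat q"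
abbreviation lat :: "'e set \<Rightarrow> bool" where "lat \<equiv> lattice_in q Z \<Lambda>"
abbreviation order :: "'e set \<Rightarrow> bool" where "order \<equiv> order_in q Z \<Lambda>"
abbreviation dual :: "'e set \<Rightarrow> 'e set" where "dual \<equiv> colon I"
abbreviation len :: "'e set \<Rightarrow> 'e set \<Rightarrow> nat" where "len \<equiv> residue_degree q"
abbreviation ind :: "'e set \<Rightarrow> 'e set \<Rightarrow> nat" where "ind \<equiv> subgroup_index"

definition r :: 'e where "r = (SOME r. of_nat q * r = (1 :: 'e))"

lemma Q_r: "Q * r = 1" "r * Q = 1"
  using someI_ex[OF q_inv] by (simp_all add: r_def mult.commute)

lemma Qk_rk: "Q ^ k * r ^ k = 1" "r ^ k * Q ^ k = 1"
  by (simp_all add: Q_r flip: power_mult_distrib)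

lemma Q_r_cancel [simp]: "Q * (r * x) = x" "r * (Q * x) = x"
  using Q_r by (simp_all flip: mult.assoc)

lemma Qk_rk_cancel [simp]: "Q ^ k * (r ^ k * x) = x" "r ^ k * (Q ^ k * x) = x"
  using Qk_rk by (simp_all flip: mult.assoc)

lemma q_gt1: "q > 1" using q_prime prime_gt_1_nat by blast

lemma Q_Z: "Q \<in> Z"
  using subgroup_of_nat[OF submodD(1)[OF Z_mod] Z_one, of q] by simp

lemma of_nat_Z: "of_nat n \<in> Z"
  using subgroup_of_nat[OF submodD(1)[OF Z_mod] Z_one, of n] by simp

lemma Qk_Z: "Q ^ k \<in> Z"
  using of_nat_Z[of "q ^ k"] by simp

lemma lat_mod: "lat M \<Longrightarrow> submodule_over Z M" unfolding lattice_in_def by blast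

lemma lat_add: "lat M \<Longrightarrow> additive_subgroup M" using lat_mod submodD(1) by blast

lemma lat_bound:
  assumes "lat M"
  obtains k where "\<And>j x. j \<ge> k \<Longrightarrow> x \<in> \<Lambda> \<Longrightarrow> Q ^ j * x \<in> M"
    "\<And>j x. j \<ge> k \<Longrightarrow> x \<in> M \<Longrightarrow> Q ^ j * x \<in> \<Lambda>"
proof -
  obtain k where k: "\<forall>x\<in>\<Lambda>. Q ^ k * x \<in> M" "\<forall>x\<in>M. Q ^ k * x \<in> \<Lambda>"
    using assms unfolding lattice_in_def by blast
  have e: "Q ^ j * x = Q ^ (j - k) * (Q ^ k * x)" if "j \<ge> k" for j x
    using that by (metis le_add_diff_inverse2 mult.assoc power_add)
  show ?thesis
    by (rule that[of k]) (use k e submodD(6)[OF lat_mod[OF assms] Qk_Z] submodD(6)[OF L_mod Qk_Z] in metis)+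
qed

lemma latI:
  assumes "submodule_over Z M" "\<And>x. x \<in> \<Lambda> \<Longrightarrow> Q ^ j * x \<in> M" "\<And>x. x \<in> M \<Longrightarrow> Q ^ k * x \<in> \<Lambda>"
  shows "lat M"
proof -
  have "Q ^ (j + k) * x \<in> M" if "x \<in> \<Lambda>" for x
    using submodD(6)[OF assms(1) Qk_Z assms(2)[OF that], of k] by (simp add: power_add mult.left_commute mult.assoc)
  moreover have "Q ^ (j + k) * x \<in> \<Lambda>" if "x \<in> M" for x
    using submodD(6)[OF L_mod Qk_Z assms(3)[OF that], of j] by (simp add: power_add mult.assoc)
  ultimately show ?thesis unfolding lattice_in_def using assms(1) by blast
qed

lemma lat_L: "lat \<Lambda>" by (rule latI[of _ 0 0]) (auto simp: L_mod)

lemma lat_between: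
  assumes "lat P" "lat N" "submodule_over Z M" "P \<subseteq> M" "M \<subseteq> N"
  shows "lat M"
proof -
  obtain j where "\<And>x. x \<in> \<Lambda> \<Longrightarrow> Q ^ j * x \<in> P" using lat_bound[OF assms(1)] by (metis order_refl)
  moreover obtain k where "\<And>x. x \<in> N \<Longrightarrow> Q ^ k * x \<in> \<Lambda>" using lat_bound[OF assms(2)] by (metis order_refl)
  ultimately show ?thesis using assms by (intro latI[of M j k]) auto
qed

lemma lat_Int: assumes "lat M" "lat N" shows "lat (M \<inter> N)"
proof -
  obtain j where j: "\<And>i x. i \<ge> j \<Longrightarrow> x \<in> \<Lambda> \<Longrightarrow> Q ^ i * x \<in> M"
    "\<And>i x. i \<ge> j \<Longrightarrow> x \<in> M \<Longrightarrow> Q ^ i * x \<in> \<Lambda>" using lat_bound[OF assms(1)] by metis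
  obtain k where k: "\<And>i x. i \<ge> k \<Longrightarrow> x \<in> \<Lambda> \<Longrightarrow> Q ^ i * x \<in> N"
    using lat_bound[OF assms(2)] by metis
  show ?thesis
  proof (rule latI[of _ "max j k" j])
    show "submodule_over Z (M \<inter> N)" by (intro submod_Int lat_mod assms)
  qed (use j k in auto)
qed

lemma lat_sum: assumes "lat M" "lat N" shows "lat (sum_set M N)"
proof -
  obtain j where j: "\<And>i x. i \<ge> j \<Longrightarrow> x \<in> \<Lambda> \<Longrightarrow> Q ^ i * x \<in> M"
    "\<And>i x. i \<ge> j \<Longrightarrow> x \<in> M \<Longrightarrow> Q ^ i * x \<in> \<Lambda>" using lat_bound[OF assms(1)] by metis
  obtain k where k: "\<And>i x. i \<ge> k \<Longrightarrow> x \<in> N \<Longrightarrow> Q ^ i * x \<in> \<Lambda>"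
    using lat_bound[OF assms(2)] by metis
  show ?thesis
  proof (rule latI[of _ j "max j k"])
    show "submodule_over Z (sum_set M N)" using assms by (simp add: lat_mod submod_sum_set)
    show "Q ^ j * x \<in> sum_set M N" if "x \<in> \<Lambda>" for x
      using j(1)[OF _ that] sum_set_upper(1)[OF lat_add lat_add] assms by blast
    show "Q ^ max j k * x \<in> \<Lambda>" if x: "x \<in> sum_set M N" for x
    proof -
      obtain a b where ab: "x = a + b" "a \<in> M" "b \<in> N" using x by (rule sum_setE)
      have "Q ^ max j k * a + Q ^ max j k * b \<in> \<Lambda>"
        by (intro submodD(5)[OF L_mod] j(2) k ab) auto
      thus ?thesis by (simp add: ab distrib_left)
    qed
  qed
qed

lemma lat_scale:
  assumes "lat M" "a * b = 1" shows "lat ((*) a ` M)"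
proof -
  obtain j where j: "\<And>i x. i \<ge> j \<Longrightarrow> x \<in> \<Lambda> \<Longrightarrow> Q ^ i * x \<in> M"
    "\<And>i x. i \<ge> j \<Longrightarrow> x \<in> M \<Longrightarrow> Q ^ i * x \<in> \<Lambda>" using lat_bound[OF assms(1)] by metis
  obtain ka kb where k: "Q ^ ka * a \<in> \<Lambda>" "Q ^ kb * b \<in> \<Lambda>" using L_absorb by metis
  show ?thesis
  proof (rule latI[of _ "j + kb" "ka + j"])
    show "submodule_over Z ((*) a ` M)" using assms by (simp add: lat_mod submod_image)
    fix x assume "x \<in> \<Lambda>"
    hence "Q ^ j * (Q ^ kb * b * x) \<in> M" using j(1) L_mult k by blast
    moreover have "a * (Q ^ j * (Q ^ kb * b * x)) = (a * b) * (Q ^ j * (Q ^ kb * x))"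
      by (simp add: mult_ac)
    hence "Q ^ (j + kb) * x = a * (Q ^ j * (Q ^ kb * b * x))"
      by (simp add: assms(2) power_add mult.assoc)
    ultimately show "Q ^ (j + kb) * x \<in> (*) a ` M" by blast
  next
    fix x assume "x \<in> (*) a ` M"
    then obtain m where m: "m \<in> M" "x = a * m" by blast
    hence "(Q ^ ka * a) * (Q ^ j * m) \<in> \<Lambda>" using j(2) L_mult k by blast
    thus "Q ^ (ka + j) * x \<in> \<Lambda>" by (simp add: m power_add mult_ac)
  qed
qed

lemma lat_Q: "lat M \<Longrightarrow> lat ((*) Q ` M)" using lat_scale Q_r by blast
lemma lat_r: "lat M \<Longrightarrow> lat ((*) r ` M)" using lat_scale Q_r by blast

lemma lat_colon: assumes "lat M" "lat N" shows "lat (colon M N)"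
proof -
  obtain j where j: "\<And>i x. i \<ge> j \<Longrightarrow> x \<in> \<Lambda> \<Longrightarrow> Q ^ i * x \<in> M"
    "\<And>i x. i \<ge> j \<Longrightarrow> x \<in> M \<Longrightarrow> Q ^ i * x \<in> \<Lambda>" using lat_bound[OF assms(1)] by metis
  obtain k where k: "\<And>i x. i \<ge> k \<Longrightarrow> x \<in> \<Lambda> \<Longrightarrow> Q ^ i * x \<in> N"
    "\<And>i x. i \<ge> k \<Longrightarrow> x \<in> N \<Longrightarrow> Q ^ i * x \<in> \<Lambda>"
    using lat_bound[OF assms(2)] by metis
  show ?thesis
  proof (rule latI[of _ "j + k" "j + k"])
    show "submodule_over Z (colon M N)" using assms by (simp add: lat_mod submod_colon)
    show "Q ^ (j + k) * x \<in> colon M N" if "x \<in> \<Lambda>" for x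
    proof (rule colonI)
      fix y assume "y \<in> N"
      hence "Q ^ j * (x * (Q ^ k * y)) \<in> M" using j(1) L_mult k(2) that by blast
      thus "Q ^ (j + k) * x * y \<in> M" by (simp add: power_add mult_ac)
    qed
    show "Q ^ (j + k) * x \<in> \<Lambda>" if "x \<in> colon M N" for x
    proof -
      have "x * (Q ^ k * 1) \<in> M" using colonD[OF that] k(1)[OF _ L_one] by blast
      hence "Q ^ j * (x * (Q ^ k * 1)) \<in> \<Lambda>" using j(2) by blast
      thus ?thesis by (simp add: power_add mult_ac)
    qed
  qed
qed

lemma lat_product: assumes "lat M" "lat N" shows "lat (M \<cdot> N)"
proof -
  obtain j where j: "\<And>i x. i \<ge> j \<Longrightarrow> x \<in> \<Lambda> \<Longrightarrow> Q ^ i * x \<in> M"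
    "\<And>i x. i \<ge> j \<Longrightarrow> x \<in> M \<Longrightarrow> Q ^ i * x \<in> \<Lambda>" using lat_bound[OF assms(1)] by metis
  obtain k where k: "\<And>i x. i \<ge> k \<Longrightarrow> x \<in> \<Lambda> \<Longrightarrow> Q ^ i * x \<in> N"
    "\<And>i x. i \<ge> k \<Longrightarrow> x \<in> N \<Longrightarrow> Q ^ i * x \<in> \<Lambda>"
    using lat_bound[OF assms(2)] by metis
  show ?thesis
  proof (rule latI[of _ "j + k" "j + k"])
    show "submodule_over Z (M \<cdot> N)"
      using assms by (simp add: lat_mod submod_product)
    show "Q ^ (j + k) * x \<in> M \<cdot> N" if "x \<in> \<Lambda>" for x
    proof -
      have "(Q ^ j * x) * (Q ^ k * 1) \<in> M \<cdot> N"
        using j(1)[OF _ that] k(1)[OF _ L_one] by (intro product_mem) blast+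
      thus ?thesis by (simp add: power_add mult_ac)
    qed
    have "M \<cdot> N \<subseteq> {x. Q ^ (j + k) * x \<in> \<Lambda>}"
    proof (rule product_least)
      show "additive_subgroup {x. Q ^ (j + k) * x \<in> \<Lambda>}"
        using submodD(2,3)[OF L_mod] by (auto simp: additive_subgroup_def right_diff_distrib)
      fix x y assume "x \<in> M" "y \<in> N"
      hence "(Q ^ j * x) * (Q ^ k * y) \<in> \<Lambda>" using L_mult j(2) k(2) by blast
      thus "x * y \<in> {x. Q ^ (j + k) * x \<in> \<Lambda>}" by (simp add: power_add mult_ac)
    qed
    thus "Q ^ (j + k) * x \<in> \<Lambda>" if "x \<in> M \<cdot> N" for x using that by blast
  qed
qed

subsection \<open>The length of the quotient of two lattices\<close>

lemma unit_cancel: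
  assumes "a * b = (1 :: 'e)" shows "b * (a * x) = x" "a * (b * x) = x"
proof -
  have "b * (a * x) = (a * b) * x" "a * (b * x) = (a * b) * x" by (simp_all add: mult_ac)
  thus "b * (a * x) = x" "a * (b * x) = x" by (simp_all add: assms)
qed

lemma mem_scale_iff:
  assumes "a * b = (1 :: 'e)" shows "x \<in> (*) a ` M \<longleftrightarrow> b * x \<in> M"
proof
  assume "b * x \<in> M"
  hence "a * (b * x) \<in> (*) a ` M" by blast
  thus "x \<in> (*) a ` M" by (simp add: unit_cancel[OF assms])
qed (auto simp: unit_cancel[OF assms])

lemma scale_image_mem: "a * b = (1 :: 'e) \<Longrightarrow> a * x \<in> (*) a ` M \<longleftrightarrow> x \<in> M"
  by (simp add: mem_scale_iff unit_cancel)

lemma mem_Q_iff: "x \<in> (*) Q ` M \<longleftrightarrow> r * x \<in> M" and mem_r_iff: "x \<in> (*) r ` M \<longleftrightarrow> Q * x \<in> M"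
  using mem_scale_iff Q_r by blast+

lemma Q_sub: "lat M \<Longrightarrow> (*) Q ` M \<subseteq> M"
  using submodD(6)[OF lat_mod Q_Z] by blast

lemma scale_scale: "a * b = (1 :: 'e) \<Longrightarrow> (*) a ` (*) b ` M = M"
  by (simp add: image_image unit_cancel)

lemma ind_scale:
  assumes "additive_subgroup N" "additive_subgroup M" "N \<subseteq> M" "a * b = 1"
  shows "ind ((*) a ` M) ((*) a ` N) = ind M N"
proof (rule index_transfer[OF assms(1-3), where f = "(*) a"])
  have ag: "additive_subgroup ((*) a ` P)" if "additive_subgroup P" for P
    using submod_image[of "{}" P a] that by (simp add: submodule_over_def)
  show "additive_subgroup ((*) a ` N)" "additive_subgroup ((*) a ` M)" using ag assms by auto
  show "(*) a ` N \<subseteq> (*) a ` M" using assms by blast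
  show "a * x \<in> (*) a ` M" if "x \<in> M" for x using that by blast
  show "\<exists>x\<in>M. y - a * x \<in> (*) a ` N" if "y \<in> (*) a ` M" for y
    using that subgroupD(1)[OF assms(1)] by force
  show "a * x - a * y \<in> (*) a ` N \<longleftrightarrow> x - y \<in> N" for x y
    using scale_image_mem[OF assms(4), of "x - y" N] by (simp add: right_diff_distrib)
qed

lemma ind_Qk: "ind \<Lambda> ((*) (Q ^ k) ` \<Lambda>) = q ^ (3 * k)"
proof (induction k)
  case 0
  have "(*) 1 ` \<Lambda> = \<Lambda>" by simp
  thus ?case using index_self[OF lat_add[OF lat_L]] by simp
next
  case (Suc k)
  have l: "lat ((*) (Q ^ k) ` \<Lambda>)" using lat_scale[OF lat_L Qk_rk(1)] .
  have sub: "(*) (Q ^ k) ` \<Lambda> \<subseteq> \<Lambda>" using submodD(6)[OF L_mod Qk_Z] by blast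
  have e: "(*) (Q ^ Suc k) ` \<Lambda> = (*) Q ` (*) (Q ^ k) ` \<Lambda>" by (simp add: image_image mult.assoc)
  have "ind \<Lambda> ((*) (Q ^ Suc k) ` \<Lambda>) = ind \<Lambda> ((*) Q ` \<Lambda>) * ind ((*) Q ` \<Lambda>) ((*) Q ` (*) (Q ^ k) ` \<Lambda>)"
    unfolding e using l sub by (intro index_mult lat_add lat_L lat_Q image_mono Q_sub)
  also have "ind ((*) Q ` \<Lambda>) ((*) Q ` (*) (Q ^ k) ` \<Lambda>) = ind \<Lambda> ((*) (Q ^ k) ` \<Lambda>)"
    using ind_scale[OF lat_add[OF l] lat_add[OF lat_L] sub Q_r(1)] .
  finally show ?case using Suc L_index by (simp add: power_add)
qed

text \<open>Both lattices lie between two multiples of \<open>\<Lambda>\<close>, whose index is a power of the prime \<open>q\<close>.\<close>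

lemma ind_len:
  assumes "lat M" "lat N" "N \<subseteq> M"
  shows "ind M N = q ^ len M N"
proof -
  obtain j where j: "\<And>i x. i \<ge> j \<Longrightarrow> x \<in> M \<Longrightarrow> Q ^ i * x \<in> \<Lambda>" using lat_bound[OF assms(1)] by metis
  obtain k where k: "\<And>i x. i \<ge> k \<Longrightarrow> x \<in> \<Lambda> \<Longrightarrow> Q ^ i * x \<in> N" using lat_bound[OF assms(2)] by metis
  let ?k = "max j k"
  let ?B = "(*) (r ^ ?k) ` \<Lambda>" and ?S = "(*) (Q ^ ?k) ` \<Lambda>"
  have B: "lat ?B" "lat ?S" using lat_scale[OF lat_L] Qk_rk by blast+
  have s: "?S \<subseteq> N" using k by auto
  have b: "M \<subseteq> ?B" using j by (auto simp: mem_scale_iff[OF Qk_rk(2)])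
  have "?S = (*) (r ^ ?k) ` (*) (Q ^ (?k + ?k)) ` \<Lambda>"
    by (simp add: image_image power_add mult.assoc)
  hence "ind ?B ?S = ind \<Lambda> ((*) (Q ^ (?k + ?k)) ` \<Lambda>)"
    using submodD(6)[OF L_mod Qk_Z]
    by (simp only:) (intro ind_scale[OF _ _ _ Qk_rk(2)] lat_add lat_L lat_scale[OF _ Qk_rk(1)], blast)
  hence "ind ?B M * ind M N * ind N ?S = q ^ (3 * (?k + ?k))"
    using ind_Qk[of "?k + ?k"]
      index_mult[OF lat_add[OF B(2)] lat_add[OF assms(2)] lat_add[OF B(1)] s order_trans[OF assms(3) b]]
      index_mult[OF lat_add[OF assms(2)] lat_add[OF assms(1)] lat_add[OF B(1)] assms(3) b]
    by simp
  hence "q ^ (3 * (?k + ?k)) = ind M N * (ind ?B M * ind N ?S)" by (simp only: mult_ac)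
  hence "ind M N dvd q ^ (3 * (?k + ?k))" by (rule dvdI)
  then obtain n where n: "ind M N = q ^ n" using divides_primepow_nat[OF q_prime] by blast
  have "len M N = n" unfolding residue_degree_def
    by (rule the_equality) (use n q_gt1 in auto)
  with n show ?thesis by simp
qed

lemma len_eqI:
  assumes "ind M N = q ^ n" shows "len M N = n"
  unfolding residue_degree_def by (rule the_equality) (use assms q_gt1 in auto)

lemma len_add:
  assumes "lat M" "lat P" "lat N" "N \<subseteq> P" "P \<subseteq> M"
  shows "len M N = len M P + len P N"
proof -
  have "q ^ len M N = q ^ (len M P + len P N)"
    using index_mult[OF lat_add[OF assms(3)] lat_add[OF assms(2)] lat_add[OF assms(1)] assms(4,5)]
      ind_len[OF assms(1,3) order_trans[OF assms(4,5)]] ind_len[OF assms(1,2,5)] ind_len[OF assms(2,3,4)]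
    by (simp add: power_add)
  thus ?thesis using q_gt1 by simp
qed

lemma len_self [simp]: "lat M \<Longrightarrow> len M M = 0"
  using index_self[OF lat_add] by (intro len_eqI) simp

lemma len_0: assumes "lat M" "lat N" "N \<subseteq> M" "len M N = 0" shows "N = M"
  using index_eq_1[of N M] ind_len assms lat_add by simp

lemma len_pos: assumes "lat M" "lat N" "N \<subset> M" shows "len M N > 0"
  using len_0[of M N] assms by auto

lemma len_mono:
  assumes "lat M" "lat P" "lat N" "N \<subseteq> P" "P \<subseteq> M" shows "len P N \<le> len M N" "len M P \<le> len M N"
  using len_add[OF assms] by auto

lemma len_eq:
  assumes "lat M" "lat P" "lat N" "N \<subseteq> P" "P \<subseteq> M" "len P N \<ge> len M N" shows "P = M"
  using len_add[OF assms(1-5)] assms len_0 by simp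

lemma len_eq':
  assumes "lat M" "lat P" "lat N" "N \<subseteq> P" "P \<subseteq> M" "len M P \<ge> len M N" shows "P = N"
  using len_add[OF assms(1-5)] assms len_0[of P N] by simp

lemma len_scale:
  assumes "lat M" "lat N" "N \<subseteq> M" "a * b = 1" shows "len ((*) a ` M) ((*) a ` N) = len M N"
  by (rule len_eqI)
    (simp add: ind_scale[OF lat_add[OF assms(2)] lat_add[OF assms(1)] assms(3,4)] ind_len[OF assms(1-3)])

lemma len_sum_Int:
  assumes "lat M" "lat N" shows "len (sum_set M N) N = len M (M \<inter> N)"
proof (rule len_eqI)
  have "ind (sum_set M N) N = ind M (M \<inter> N)"
  proof (rule index_transfer[where f = "\<lambda>x. x"])
    show "additive_subgroup (M \<inter> N)" "additive_subgroup M" "additive_subgroup N"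
      "additive_subgroup (sum_set M N)" using assms lat_add lat_Int lat_sum by blast+
    show "N \<subseteq> sum_set M N" "\<And>x. x \<in> M \<Longrightarrow> x \<in> sum_set M N"
      using sum_set_upper[of M N] assms lat_add by blast+
    show "\<exists>x\<in>M. y - x \<in> N" if "y \<in> sum_set M N" for y
      using that by (elim sum_setE) force
    show "x - y \<in> N \<longleftrightarrow> x - y \<in> M \<inter> N" if "x \<in> M" "y \<in> M" for x y
      using subgroupD(2)[OF lat_add[OF assms(1)]] that by blast
  qed auto
  thus "ind (sum_set M N) N = q ^ len M (M \<inter> N)"
    using ind_len[of M "M \<inter> N"] assms lat_Int by auto
qed

lemma len_Q: assumes "lat M" shows "len M ((*) Q ` M) = 3"
proof -
  let ?N = "sum_set M \<Lambda>"
  have N: "lat ?N" "M \<subseteq> ?N" "\<Lambda> \<subseteq> ?N"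
    using lat_sum[OF assms lat_L] sum_set_upper[OF lat_add[OF assms] lat_add[OF lat_L]] by auto
  have "len ?N P + len P ((*) Q ` P) = len ?N ((*) Q ` ?N) + len ?N P" if "lat P" "P \<subseteq> ?N" for P
    using len_add[OF N(1) that(1) lat_Q[OF that(1)] Q_sub that(2)] that N(1) Q_sub[OF that(1)]
      len_add[OF N(1) lat_Q[OF N(1)] lat_Q[OF that(1)]] Q_sub[OF N(1)] len_scale[OF N(1) that Q_r(1)]
    by (simp add: image_mono)
  from this[OF assms N(2)] this[OF lat_L N(3)] show ?thesis
    using len_eqI[OF L_index] by simp
qed

lemma len_power_Q:
  assumes "lat M" "lat N" "N \<subseteq> M" shows "\<exists>k. (*) (Q ^ k) ` M \<subseteq> N"
proof -
  obtain j where j: "\<And>i x. i \<ge> j \<Longrightarrow> x \<in> M \<Longrightarrow> Q ^ i * x \<in> \<Lambda>" using lat_bound[OF assms(1)] by metis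
  obtain k where k: "\<And>i x. i \<ge> k \<Longrightarrow> x \<in> \<Lambda> \<Longrightarrow> Q ^ i * x \<in> N" using lat_bound[OF assms(2)] by metis
  have "Q ^ (k + j) * x \<in> N" if "x \<in> M" for x
    using k[OF order_refl j[OF order_refl that]] by (simp add: power_add mult.assoc)
  thus ?thesis by blast
qed

subsection \<open>Lines\<close>

definition line :: "'e set \<Rightarrow> 'e \<Rightarrow> 'e set" where
  "line N x = sum_set N ((\<lambda>z. z * x) ` Z)"

lemma submod_multiples: "submodule_over Z ((\<lambda>z. z * x) ` Z)"
proof (rule submodI)
  show "0 \<in> (\<lambda>z. z * x) ` Z" using submodD(2)[OF Z_mod] by force
  show "y - y' \<in> (\<lambda>z. z * x) ` Z" if "y \<in> (\<lambda>z. z * x) ` Z" "y' \<in> (\<lambda>z. z * x) ` Z" for y y'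
    using that submodD(3)[OF Z_mod] by (smt (verit) image_iff left_diff_distrib)
  show "a * y \<in> (\<lambda>z. z * x) ` Z" if "a \<in> Z" "y \<in> (\<lambda>z. z * x) ` Z" for a y
    using that submodD(6)[OF Z_mod] by (smt (verit) image_iff mult.assoc)
qed

lemma line_mod: "submodule_over Z N \<Longrightarrow> submodule_over Z (line N x)"
  unfolding line_def by (intro submod_sum_set submod_multiples)

lemma line_upper: assumes "submodule_over Z N" shows "N \<subseteq> line N x" "x \<in> line N x"
proof -
  have *: "N \<subseteq> line N x" "(\<lambda>z. z * x) ` Z \<subseteq> line N x"
    unfolding line_def using sum_set_upper submodD(1) assms submod_multiples by blast+
  thus "N \<subseteq> line N x" "x \<in> line N x" using Z_one by force+
qed

lemma line_least:
  assumes "submodule_over Z M" "N \<subseteq> M" "x \<in> M" shows "line N x \<subseteq> M"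
  unfolding line_def using assms submodD[OF assms(1)] by (intro sum_set_least) auto

lemma lineE:
  assumes "y \<in> line N x" obtains n z where "y = n + z * x" "n \<in> N" "z \<in> Z"
  using assms unfolding line_def by (elim sum_setE) auto

lemma lineI: "n \<in> N \<Longrightarrow> z \<in> Z \<Longrightarrow> n + z * x \<in> line N x"
  unfolding line_def by (intro sum_setI) auto

lemma line_lat: assumes "lat N" shows "lat (line N x)"
proof -
  obtain k where k: "\<And>j x. j \<ge> k \<Longrightarrow> x \<in> \<Lambda> \<Longrightarrow> Q ^ j * x \<in> N"
    "\<And>j x. j \<ge> k \<Longrightarrow> x \<in> N \<Longrightarrow> Q ^ j * x \<in> \<Lambda>" using lat_bound[OF assms] by metis
  obtain j where j: "Q ^ j * x \<in> \<Lambda>" using L_absorb by blast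
  show ?thesis
  proof (rule latI[of _ k "k + j"])
    show "submodule_over Z (line N x)" using line_mod lat_mod assms by blast
    show "Q ^ k * y \<in> line N x" if "y \<in> \<Lambda>" for y using k(1)[OF _ that] line_upper lat_mod assms by blast
    fix y assume "y \<in> line N x"
    then obtain n z where y: "y = n + z * x" "n \<in> N" "z \<in> Z" by (rule lineE)
    have "Q ^ (k + j) * n \<in> \<Lambda>" using k(2) y by simp
    moreover have "Q ^ k * (z * (Q ^ j * x)) \<in> \<Lambda>"
      by (intro submodD(6)[OF L_mod] Qk_Z y j)
    ultimately have "Q ^ (k + j) * n + Q ^ k * (z * (Q ^ j * x)) \<in> \<Lambda>" by (rule submodD(5)[OF L_mod])
    thus "Q ^ (k + j) * y \<in> \<Lambda>" unfolding y by (simp add: algebra_simps power_add)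
  qed
qed

lemma line_len:
  assumes "lat N" "x \<notin> N" "Q * x \<in> N" shows "len (line N x) N = 1"
proof -
  have sub: "N \<subseteq> line N x" using line_upper lat_mod assms by blast
  have l: "lat (line N x)" using line_lat assms by blast
  have "ind (line N x) N \<le> card ((\<lambda>i. of_nat i * x) ` {..<q})"
  proof (rule index_le(1)[OF lat_add[OF assms(1)] lat_add[OF l] sub])
    fix y assume "y \<in> line N x"
    then obtain n z where y: "y = n + z * x" "n \<in> N" "z \<in> Z" by (rule lineE)
    obtain i w where z: "i < q" "w \<in> Z" "z = of_nat i + Q * w" using Z_res[OF y(3)] by blast
    have "n + w * (Q * x) \<in> N"
      using submodD(5)[OF lat_mod[OF assms(1)] y(2) submodD(6)[OF lat_mod[OF assms(1)] z(2) assms(3)]] .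
    hence "y - of_nat i * x \<in> N" unfolding y z by (simp add: algebra_simps)
    thus "\<exists>s\<in>(\<lambda>i. of_nat i * x) ` {..<q}. y - s \<in> N" using z by blast
  qed simp
  also have "\<dots> \<le> q" using card_image_le[of "{..<q}"] by simp
  finally have "q ^ len (line N x) N \<le> q ^ 1" using ind_len[OF l assms(1) sub] by simp
  hence "len (line N x) N \<le> 1" by (rule power_le_imp_le_exp[OF q_gt1])
  moreover have "N \<noteq> line N x" using line_upper(2)[OF lat_mod] assms by blast
  hence "len (line N x) N > 0" using len_pos[OF l assms(1)] sub by blast
  ultimately show ?thesis by simp
qed

lemma exists_line_element:
  assumes "lat N" "x \<notin> N" obtains k where "Q ^ k * x \<notin> N" "Q * (Q ^ k * x) \<in> N"
proof -
  obtain j where j: "Q ^ j * x \<in> \<Lambda>" using L_absorb by blast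
  obtain i where i: "\<And>x. x \<in> \<Lambda> \<Longrightarrow> Q ^ i * x \<in> N" using lat_bound[OF assms(1)] by (metis order_refl)
  have ex: "Q ^ (i + j) * x \<in> N" using i[OF j] by (simp add: power_add mult.assoc)
  define k where "k = (LEAST k. Q ^ k * x \<in> N)"
  have k: "Q ^ k * x \<in> N" unfolding k_def using ex by (rule LeastI)
  have "k \<noteq> 0" using k assms(2) by (metis mult_1 power_0)
  then obtain m where m: "k = Suc m" using not0_implies_Suc by blast
  have "Q ^ m * x \<notin> N" using not_less_Least[of m "\<lambda>k. Q ^ k * x \<in> N"] m k_def by simp
  moreover have "Q * (Q ^ m * x) \<in> N" using k m by (simp add: mult.assoc)
  ultimately show ?thesis by (rule that)
qed

lemma exists_line:
  assumes "lat N" "lat M" "N \<subset> M"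
  obtains P where "lat P" "N \<subset> P" "P \<subseteq> M" "len P N = 1"
proof -
  obtain x where x: "x \<in> M" "x \<notin> N" using assms by blast
  obtain k where k: "Q ^ k * x \<notin> N" "Q * (Q ^ k * x) \<in> N" using exists_line_element[OF assms(1) x(2)] .
  have "Q ^ k * x \<in> M" using submodD(6)[OF lat_mod[OF assms(2)] Qk_Z x(1)] .
  hence "line N (Q ^ k * x) \<subseteq> M" using line_least[OF lat_mod[OF assms(2)]] assms(3) by blast
  thus ?thesis
    using that[OF line_lat[OF assms(1), of "Q ^ k * x"]] line_len[OF assms(1) k]
      line_upper[OF lat_mod[OF assms(1)], of "Q ^ k * x"] k(1) by blast
qed

lemma len_kills: "lat M \<Longrightarrow> lat N \<Longrightarrow> N \<subseteq> M \<Longrightarrow> (*) (Q ^ len M N) ` M \<subseteq> N"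
proof (induction "len M N" arbitrary: N)
  case 0
  hence "N = M" using len_0 by simp
  thus ?case using 0 by simp
next
  case (Suc n)
  hence "N \<subset> M" by (metis Suc_neq_Zero len_self psubsetI)
  from exists_line[OF Suc(4) Suc(3) this] obtain P
    where P: "lat P" "N \<subset> P" "P \<subseteq> M" "len P N = 1" .
  hence n: "n = len M P" using len_add[of M P N] Suc by auto
  have QP: "(*) Q ` P \<subseteq> N"
  proof
    fix y assume "y \<in> (*) Q ` P"
    then obtain x where x: "x \<in> P" "y = Q * x" by blast
    show "y \<in> N"
    proof (rule ccontr)
      assume "y \<notin> N"
      hence "x \<notin> N" using x submodD(6)[OF lat_mod[OF Suc(4)] Q_Z] by blast
      obtain k where k: "Q ^ k * x \<notin> N" "Q * (Q ^ k * x) \<in> N"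
        using exists_line_element[OF Suc(4) \<open>x \<notin> N\<close>] .
      have "Q ^ k * x \<in> P" using submodD(6)[OF lat_mod[OF P(1)] Qk_Z x(1)] .
      hence sub: "line N (Q ^ k * x) \<subseteq> P" using line_least[OF lat_mod[OF P(1)]] P(2) by blast
      hence "line N (Q ^ k * x) = P"
        using len_eq[OF P(1) line_lat[OF Suc(4)] Suc(4)] line_upper(1)[OF lat_mod[OF Suc(4)]] line_len[OF Suc(4) k] P(4)
        by simp
      with x(1) obtain m z where mz: "x = m + z * (Q ^ k * x)" "m \<in> N" "z \<in> Z" by (metis lineE)
      have "Q * m + z * (Q * (Q ^ k * x)) \<in> N"
        by (intro submodD(5,6)[OF lat_mod[OF Suc(4)]] mz k Q_Z)
      moreover have "Q * m + z * (Q * (Q ^ k * x)) = Q * (m + z * (Q ^ k * x))"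
        by (simp add: algebra_simps)
      ultimately have "Q * x \<in> N" using mz(1) by simp
      thus False using \<open>y \<notin> N\<close> x by simp
    qed
  qed
  have "(*) (Q ^ n) ` M \<subseteq> P" using Suc(1)[OF n Suc(3) P(1) P(3)] n by simp
  hence "(*) Q ` (*) (Q ^ n) ` M \<subseteq> N" using QP by blast
  thus ?case using Suc(2) by (simp add: image_image mult.assoc flip: Suc(2))
qed

lemma finite_between:
  assumes "lat N" "lat M" "N \<subseteq> M" shows "finite {P. lat P \<and> N \<subseteq> P \<and> P \<subseteq> M}"
proof -
  have "\<Union>(cosets N P) = P" if "lat P" "N \<subseteq> P" for P
  proof
    show "\<Union>(cosets N P) \<subseteq> P"
    proof
      fix y assume "y \<in> \<Union>(cosets N P)"
      then obtain x where "x \<in> P" "y - x \<in> N" unfolding cosets_def by blast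
      hence "(y - x) + x \<in> P" using that by (intro subgroupD(4)[OF lat_add]) auto
      thus "y \<in> P" by simp
    qed
    show "P \<subseteq> \<Union>(cosets N P)"
      unfolding cosets_def using subgroupD(1)[OF lat_add[OF assms(1)]] by fastforce
  qed
  hence "inj_on (cosets N) {P. lat P \<and> N \<subseteq> P \<and> P \<subseteq> M}" by (metis (mono_tags, lifting) inj_onI mem_Collect_eq)
  moreover have "finite (cosets N M)"
    using ind_len[OF assms(2,1,3)] index_cosets[of N M] assms lat_add q_gt1
    by (metis card.infinite less_numeral_extra(3) power_eq_0_iff not_one_less_zero)
  moreover have "cosets N ` {P. lat P \<and> N \<subseteq> P \<and> P \<subseteq> M} \<subseteq> Pow (cosets N M)"
    unfolding cosets_def by auto
  ultimately show ?thesis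
    using finite_imageD[of "cosets N" "{P. lat P \<and> N \<subseteq> P \<and> P \<subseteq> M}"] finite_subset[of _ "Pow (cosets N M)"]
    by simp
qed

text \<open>The number of lines in a space of dimension \<open>d\<close> over the field with \<open>q\<close> elements.\<close>

definition gauss :: "nat \<Rightarrow> nat" where "gauss d = (\<Sum>i<d. q ^ i)"

lemma gauss_eq: "gauss d * (q - 1) = q ^ d - 1"
proof -
  have "int (gauss d) * (int q - 1) = int q ^ d - 1"
    unfolding gauss_def by (induction d) (auto simp: algebra_simps)
  hence "int (gauss d * (q - 1)) = int (q ^ d - 1)" using q_gt1 by (simp add: of_nat_diff)
  thus ?thesis by linarith
qed

lemma gauss_simps: "gauss 0 = 0" "gauss 1 = 1" "gauss 2 = 1 + q" "gauss 3 = 1 + q + q ^ 2"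
  "gauss (Suc 0) = 1"
  unfolding gauss_def by (simp_all add: numeral_2_eq_2 numeral_3_eq_3)

definition lines :: "'e set \<Rightarrow> 'e set \<Rightarrow> 'e set set" where
  "lines N M = {P. lat P \<and> N \<subseteq> P \<and> P \<subseteq> M \<and> len P N = 1}"

lemma lines_eq_line:
  assumes "lat N" "(*) Q ` M \<subseteq> N" "P \<in> lines N M" "x \<in> P" "x \<notin> N"
  shows "P = line N x"
proof -
  have P: "lat P" "N \<subseteq> P" "P \<subseteq> M" "len P N = 1" using assms(3) unfolding lines_def by auto
  have "Q * x \<in> N" using assms(2,4) P by blast
  thus ?thesis
    using len_eq[OF P(1) line_lat[OF assms(1), of x] assms(1)] line_len[OF assms(1,5)] P
      line_upper(1)[OF lat_mod[OF assms(1)]] line_least[OF lat_mod[OF P(1)] P(2) assms(4)] by auto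
qed

lemma card_cosets:
  assumes "lat N" "lat M" "N \<subseteq> M" shows "card (cosets N M) = q ^ len M N" "finite (cosets N M)"
proof -
  show c: "card (cosets N M) = q ^ len M N"
    using ind_len[OF assms(2,1,3)] index_cosets[of N M] assms lat_add by simp
  show "finite (cosets N M)"
    using c q_gt1 by (metis card.infinite power_eq_0_iff not_one_less_zero)
qed

text \<open>Lines between \<open>N\<close> and \<open>M\<close> as points of a projective space over the residue field; a property
  of nonzero cosets that only depends on the line can be counted on the lines.\<close>

lemma card_lines_pred:
  assumes N: "lat N" and M: "lat M" and sub: "N \<subseteq> M" and kill: "(*) Q ` M \<subseteq> N"
    and pred: "\<And>P x. P \<in> lines N M \<Longrightarrow> x \<in> P \<Longrightarrow> x \<notin> N \<Longrightarrow> \<Phi> P \<longleftrightarrow> \<phi> x"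
  shows "card {P \<in> lines N M. \<Phi> P} * (q - 1) = card {X \<in> cosets N M. \<exists>x\<in>X. x \<notin> N \<and> \<phi> x}"
    and "finite (lines N M)"
proof -
  show fin: "finite (lines N M)"
    unfolding lines_def by (rule finite_subset[OF _ finite_between[OF N M sub]]) auto
  let ?L = "{P \<in> lines N M. \<Phi> P}"
  let ?A = "\<lambda>P. cosets N P - {N}"
  have N0: "{y. y - 0 \<in> N} = N" by simp
  have zN: "{y. y - x \<in> N} = N \<longleftrightarrow> x \<in> N" for x
    using coset_eq_iff[OF lat_add[OF N], of x 0] by simp
  have self: "x \<in> {y. y - x \<in> N}" for x using subgroupD(1)[OF lat_add[OF N]] by simp
  have cosetD: "y - x \<in> N \<Longrightarrow> x \<in> P \<Longrightarrow> y \<in> P" if "N \<subseteq> P" "lat P" for x y P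
    using subgroupD(4)[OF lat_add[OF that(2)], of "y - x" x] that by auto
  have cA: "card (?A P) = q - 1" if "P \<in> ?L" for P
  proof -
    have P: "lat P" "N \<subseteq> P" "len P N = 1" using that unfolding lines_def by auto
    have "N \<in> cosets N P" unfolding cosets_def using N0 subgroupD(1)[OF lat_add[OF P(1)]] by blast
    thus ?thesis using card_cosets[OF N P(1,2)] P(3) by (simp add: card_Diff_singleton_if)
  qed
  have disj: "?A P \<inter> ?A P' = {}" if "P \<in> ?L" "P' \<in> ?L" "P \<noteq> P'" for P P'
  proof (rule ccontr)
    assume "?A P \<inter> ?A P' \<noteq> {}"
    then obtain x x' where x: "x \<in> P" "x' \<in> P'" "{y. y - x \<in> N} = {y. y - x' \<in> N}" "x \<notin> N"
      unfolding cosets_def using zN by blast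
    have "lat P'" "N \<subseteq> P'" using that unfolding lines_def by auto
    hence "x \<in> P'" using cosetD x self by blast
    hence "P = P'" using lines_eq_line[OF N kill _ _ x(4)] that x by blast
    thus False using that by simp
  qed
  have "(\<Union>P\<in>?L. ?A P) = {X \<in> cosets N M. \<exists>x\<in>X. x \<notin> N \<and> \<phi> x}"
  proof (intro equalityI subsetI)
    fix X assume "X \<in> (\<Union>P\<in>?L. ?A P)"
    then obtain P x where P: "P \<in> lines N M" "\<Phi> P" "x \<in> P" "X = {y. y - x \<in> N}" "X \<noteq> N"
      unfolding cosets_def by blast
    hence "x \<notin> N" using zN by simp
    moreover have "X \<in> cosets N M" using P unfolding cosets_def lines_def by blast
    ultimately show "X \<in> {X \<in> cosets N M. \<exists>x\<in>X. x \<notin> N \<and> \<phi> x}" using P pred self by blast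
  next
    fix X assume "X \<in> {X \<in> cosets N M. \<exists>x\<in>X. x \<notin> N \<and> \<phi> x}"
    then obtain x0 x where x: "x0 \<in> M" "X = {y. y - x0 \<in> N}" "x \<in> X" "x \<notin> N" "\<phi> x"
      unfolding cosets_def by blast
    hence X: "X = {y. y - x \<in> N}" and "x \<in> M"
      using coset_eq_iff[OF lat_add[OF N], of x x0] cosetD[OF sub M] by auto
    have "Q * x \<in> N" using kill \<open>x \<in> M\<close> by blast
    hence L: "line N x \<in> lines N M" unfolding lines_def
      using line_lat[OF N] line_upper(1)[OF lat_mod[OF N]] line_least[OF lat_mod[OF M] sub \<open>x \<in> M\<close>]
        line_len[OF N x(4)] by blast
    moreover have "x \<in> line N x" using line_upper(2)[OF lat_mod[OF N]] .
    ultimately have "line N x \<in> ?L" using pred x by blast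
    moreover have "X \<in> ?A (line N x)"
      using X \<open>x \<in> line N x\<close> zN x(4) unfolding cosets_def by blast
    ultimately show "X \<in> (\<Union>P\<in>?L. ?A P)" by blast
  qed
  moreover have "card (\<Union>P\<in>?L. ?A P) = (\<Sum>P\<in>?L. card (?A P))"
  proof (rule card_UN_disjoint)
    show "finite ?L" using fin by simp
    show "\<forall>P\<in>?L. finite (?A P)"
      using card_cosets(2)[OF N] unfolding lines_def by blast
  qed (use disj in blast)
  ultimately show "card ?L * (q - 1) = card {X \<in> cosets N M. \<exists>x\<in>X. x \<notin> N \<and> \<phi> x}"
    using cA by simp
qed

lemma card_lines:
  assumes N: "lat N" and M: "lat M" and sub: "N \<subseteq> M" and kill: "(*) Q ` M \<subseteq> N"
  shows "card (lines N M) = gauss (len M N)"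
proof -
  have zN: "{y. y - x \<in> N} = N \<longleftrightarrow> x \<in> N" for x
    using coset_eq_iff[OF lat_add[OF N], of x 0] by simp
  have self: "x \<in> {y. y - x \<in> N}" for x using subgroupD(1)[OF lat_add[OF N]] by simp
  have "{X \<in> cosets N M. \<exists>x\<in>X. x \<notin> N \<and> True} = cosets N M - {N}"
  proof (intro equalityI subsetI)
    fix X assume "X \<in> cosets N M - {N}"
    then obtain x where x: "x \<in> M" "X = {y. y - x \<in> N}" "X \<noteq> N" unfolding cosets_def by blast
    hence "x \<in> X" "x \<notin> N" using self zN by auto
    moreover have "X \<in> cosets N M" using x unfolding cosets_def by blast
    ultimately show "X \<in> {X \<in> cosets N M. \<exists>x\<in>X. x \<notin> N \<and> True}" by blast
  qed blast
  moreover have "N \<in> cosets N M" unfolding cosets_def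
    using zN[of 0] subgroupD(1) lat_add N M by blast
  ultimately have "card (lines N M) * (q - 1) = q ^ len M N - 1"
    using card_lines_pred(1)[OF N M sub kill, of "\<lambda>_. True" "\<lambda>_. True"] card_cosets[OF N M sub]
    by (simp add: card_Diff_singleton_if)
  thus ?thesis using gauss_eq[of "len M N"] q_gt1
    by (metis gr0I mult_cancel2 less_numeral_extra(4) zero_less_diff)
qed

subsection \<open>Duality\<close>

lemma dual_antimono: "M \<subseteq> N \<Longrightarrow> dual N \<subseteq> dual M"
  unfolding colon_def by blast

lemma dual_inj: "lat M \<Longrightarrow> lat N \<Longrightarrow> dual M = dual N \<Longrightarrow> M = N"
  using dual_dual by metis

text \<open>Duality reverses inclusions, so it preserves the length of a maximal chain.\<close>

lemma len_dual:
  assumes "lat M" "lat N" "N \<subseteq> M" shows "len (dual N) (dual M) = len M N"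
proof -
  have ge: "len (dual N) (dual M) \<ge> len M N" if "lat M" "lat N" "N \<subseteq> M" for M N
    using that
  proof (induction "len M N" arbitrary: N)
    case (Suc n)
    hence "N \<subset> M" by (metis Suc_neq_Zero len_self psubsetI)
    from exists_line[OF Suc(4) Suc(3) this] obtain P
      where P: "lat P" "N \<subset> P" "P \<subseteq> M" "len P N = 1" .
    have "len M P = n" using len_add[of M P N] P Suc by auto
    hence "len (dual P) (dual M) \<ge> n" using Suc(1)[of P] Suc P by auto
    moreover have "dual P \<subset> dual N" using P dual_antimono dual_inj Suc(4)
      by (metis psubset_eq)
    hence "len (dual N) (dual P) > 0" using len_pos dual_lat P(1) Suc(4) by blast
    moreover have "len (dual N) (dual M) = len (dual N) (dual P) + len (dual P) (dual M)"
      using P Suc dual_lat dual_antimono by (intro len_add) auto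
    ultimately show ?case using Suc by simp
  qed simp
  show ?thesis
    using ge[OF assms] ge[of "dual N" "dual M"] dual_lat dual_dual dual_antimono assms
    by (simp add: order_antisym)
qed

definition hyperplanes :: "'e set \<Rightarrow> 'e set \<Rightarrow> 'e set set" where
  "hyperplanes N M = {P. lat P \<and> N \<subseteq> P \<and> P \<subseteq> M \<and> len M P = 1}"

text \<open>Duality turns hyperplanes into lines.\<close>

lemma card_hyperplanes:
  assumes N: "lat N" and M: "lat M" and sub: "N \<subseteq> M" and kill: "(*) Q ` M \<subseteq> N"
  shows "card (hyperplanes N M) = gauss (len M N)" and "finite (hyperplanes N M)"
proof -
  show "finite (hyperplanes N M)"
    unfolding hyperplanes_def by (rule finite_subset[OF _ finite_between[OF N M sub]]) auto
  have dl: "(*) Q ` dual N \<subseteq> dual M"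
  proof
    fix y assume "y \<in> (*) Q ` dual N"
    then obtain x where x: "x \<in> dual N" "y = Q * x" by blast
    show "y \<in> dual M"
    proof (rule colonI)
      fix m assume "m \<in> M"
      hence "x * (Q * m) \<in> I" using kill x(1) colonD by blast
      thus "y * m \<in> I" by (simp add: x mult_ac)
    qed
  qed
  have "bij_betw dual (hyperplanes N M) (lines (dual M) (dual N))"
  proof (rule bij_betw_byWitness[where f' = dual])
    show "\<forall>a\<in>hyperplanes N M. dual (dual a) = a" using dual_dual unfolding hyperplanes_def by blast
    show "\<forall>a'\<in>lines (dual M) (dual N). dual (dual a') = a'" using dual_dual unfolding lines_def by blast
    show "dual ` hyperplanes N M \<subseteq> lines (dual M) (dual N)"
      using dual_lat dual_antimono len_dual M unfolding hyperplanes_def lines_def by auto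
    show "dual ` lines (dual M) (dual N) \<subseteq> hyperplanes N M"
    proof
      fix P assume "P \<in> dual ` lines (dual M) (dual N)"
      then obtain P' where P': "P = dual P'" "lat P'" "dual M \<subseteq> P'" "P' \<subseteq> dual N" "len P' (dual M) = 1"
        unfolding lines_def by auto
      hence "len (dual (dual M)) P = 1" "P \<subseteq> dual (dual M)" "dual (dual N) \<subseteq> P"
        using len_dual[OF P'(2) dual_lat[OF M] P'(3)] dual_antimono by auto
      thus "P \<in> hyperplanes N M" unfolding hyperplanes_def
        using P' dual_lat dual_dual[OF M] dual_dual[OF N] by auto
    qed
  qed
  hence "card (hyperplanes N M) = card (lines (dual M) (dual N))" by (rule bij_betw_same_card)
  also have "\<dots> = gauss (len (dual N) (dual M))"
    using dl dual_antimono[OF sub] dual_lat N M by (intro card_lines)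
  finally show "card (hyperplanes N M) = gauss (len M N)" using len_dual[OF M N sub] by simp
qed

section \<open>Orders and their maximal ideals\<close>

definition tl :: "'e set \<Rightarrow> 'e set \<Rightarrow> bool" where
  "tl T M \<longleftrightarrow> lat M \<and> submodule_over T M"

lemma tlD: assumes "tl T M" shows "lat M" "submodule_over T M" "additive_subgroup M"
  using assms submodD(1) unfolding tl_def by auto

lemma tl_mult: "tl T M \<Longrightarrow> a \<in> T \<Longrightarrow> x \<in> M \<Longrightarrow> a * x \<in> M"
  using submodD(6) unfolding tl_def by blast

lemma tl_mult': "tl T M \<Longrightarrow> a \<in> T \<Longrightarrow> x \<in> M \<Longrightarrow> x * a \<in> M"
  using tl_mult[of T M a x] by (simp add: mult.commute)

lemma tl_multiples: "tl T M \<Longrightarrow> x \<in> M \<Longrightarrow> (*) x ` T \<subseteq> M"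
  using tl_mult' by blast

lemma tl_add: "tl T M \<Longrightarrow> x \<in> M \<Longrightarrow> y \<in> M \<Longrightarrow> x + y \<in> M"
  and tl_diff: "tl T M \<Longrightarrow> x \<in> M \<Longrightarrow> y \<in> M \<Longrightarrow> x - y \<in> M"
  and tl_0: "tl T M \<Longrightarrow> 0 \<in> M"
  using subgroupD[OF tlD(3)] by blast+

lemma ordD: assumes "order T"
  shows "lat T" "1 \<in> T" "x \<in> T \<Longrightarrow> y \<in> T \<Longrightarrow> x * y \<in> T" "submodule_over T T" "tl T T"
  using assms lat_add unfolding order_in_def tl_def submodule_over_def by blast+

lemma order_Z: assumes "order T" shows "Z \<subseteq> T"
proof
  fix z assume "z \<in> Z"
  thus "z \<in> T" using submodD(6)[OF lat_mod[OF ordD(1)[OF assms]] _ ordD(2)[OF assms], of z] by simp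
qed

lemma order_submod: "order T \<Longrightarrow> submodule_over T M \<Longrightarrow> submodule_over Z M"
  using submod_mono order_Z by blast

lemma tl_between:
  assumes "order T" "lat P" "lat N" "submodule_over T M" "P \<subseteq> M" "M \<subseteq> N" shows "tl T M"
  using lat_between[OF assms(2,3) order_submod[OF assms(1,4)] assms(5,6)] assms(4) unfolding tl_def by blast

lemma tl_Int: "tl T M \<Longrightarrow> tl T N \<Longrightarrow> tl T (M \<inter> N)"
  unfolding tl_def using lat_Int submod_Int by blast

lemma tl_sum: "tl T M \<Longrightarrow> tl T N \<Longrightarrow> tl T (sum_set M N)"
  unfolding tl_def using lat_sum submod_sum_set by blast

lemma tl_scale: "tl T M \<Longrightarrow> a * b = 1 \<Longrightarrow> tl T ((*) a ` M)"
  unfolding tl_def using lat_scale submod_image by blast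

lemma tl_Q: "tl T M \<Longrightarrow> tl T ((*) Q ` M)" and tl_r: "tl T M \<Longrightarrow> tl T ((*) r ` M)"
  using tl_scale Q_r by blast+

lemma tl_mono: "tl T M \<Longrightarrow> S \<subseteq> T \<Longrightarrow> tl S M"
  unfolding tl_def using submod_mono by blast

lemma tl_colon: "tl T M \<Longrightarrow> lat N \<Longrightarrow> tl T (colon M N)"
  unfolding tl_def using lat_colon submod_colon by blast

lemma tl_colon': "lat M \<Longrightarrow> tl T N \<Longrightarrow> tl T (colon M N)"
  unfolding tl_def using lat_colon submod_colon'[of M T N] submodD(6) lat_add by blast

lemma tl_product: "lat M \<Longrightarrow> tl T N \<Longrightarrow> tl T (M \<cdot> N)"
  unfolding tl_def using lat_product submod_product by blast

lemma tl_product': "tl T M \<Longrightarrow> lat N \<Longrightarrow> tl T (M \<cdot> N)"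
  using tl_product product_commute by metis

lemma tl_dual: "lat M \<Longrightarrow> submodule_over T M \<Longrightarrow> tl T (dual M)"
  unfolding tl_def using dual_lat submod_colon'[of I T M] submodD(1)[OF I_mod] submodD(6)
  by blast

lemma product_sub: "tl T M \<Longrightarrow> J \<subseteq> T \<Longrightarrow> J \<cdot> M \<subseteq> M"
  using product_least[of M J M] tlD(3) tl_mult by blast

lemma product_unit: "order T \<Longrightarrow> tl T M \<Longrightarrow> T \<cdot> M = M"
  using product_sub[of T M T] product_mem[of 1 T _ M] ordD(2) by fastforce

lemma cyclic_sumE:
  assumes "y \<in> sum_set P ((*) x ` T)" obtains p t where "y = p + x * t" "p \<in> P" "t \<in> T"
proof -
  obtain p u where "y = p + u" "p \<in> P" "u \<in> (*) x ` T" using assms by (rule sum_setE)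
  thus ?thesis using that by blast
qed

text \<open>A cyclic quotient \<open>(P + Tx)/P\<close> is isomorphic to \<open>T\<close> modulo the annihilator of \<open>x\<close>.\<close>

lemma cyclic_quotient:
  assumes T: "order T" and P: "tl T P" and M: "tl T M" and sub: "P \<subseteq> M" and x: "x \<in> M"
  shows "tl T (sum_set P ((*) x ` T))" "tl T {a \<in> T. a * x \<in> P}" "P \<subseteq> sum_set P ((*) x ` T)"
    "x \<in> sum_set P ((*) x ` T)" "sum_set P ((*) x ` T) \<subseteq> M"
    "len (sum_set P ((*) x ` T)) P = len T {a \<in> T. a * x \<in> P}"
proof -
  let ?N = "sum_set P ((*) x ` T)" and ?m = "{a \<in> T. a * x \<in> P}"
  have mx: "submodule_over T ((*) x ` T)" using submod_image ordD(4)[OF T] by blast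
  show sN: "P \<subseteq> ?N" and xN: "x \<in> ?N"
    using sum_set_upper[OF tlD(3)[OF P] submodD(1)[OF mx]] ordD(2)[OF T] by force+
  show NM: "?N \<subseteq> M"
    using sum_set_least[OF tlD(3)[OF M] sub tl_multiples[OF M x]] .
  show N: "tl T ?N"
    using tl_between[OF T tlD(1)[OF P] tlD(1)[OF M] submod_sum_set[OF tlD(2)[OF P] mx] sN NM] .
  have sm: "submodule_over T ?m"
    using submodD[OF ordD(4)[OF T]] submodD[OF tlD(2)[OF P]]
    by (intro submodI) (auto simp: left_diff_distrib mult.assoc)
  obtain k where k: "(*) (Q ^ k) ` M \<subseteq> P" using len_power_Q[OF tlD(1)[OF M] tlD(1)[OF P] sub] by blast
  have "(*) (Q ^ k) ` T \<subseteq> ?m"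
  proof
    fix y assume "y \<in> (*) (Q ^ k) ` T"
    then obtain a where a: "a \<in> T" "y = Q ^ k * a" by blast
    have "y \<in> T" using a submodD(6)[OF lat_mod[OF ordD(1)[OF T]] Qk_Z] by blast
    moreover have "Q ^ k * (a * x) \<in> P" using k tl_mult[OF M a(1) x] by blast
    ultimately show "y \<in> ?m" by (simp add: a(2) mult.assoc)
  qed
  thus m: "tl T ?m"
    using tl_between[OF T lat_scale[OF ordD(1)[OF T] Qk_rk(1)] ordD(1)[OF T] sm] by blast
  have "ind ?N P = ind T ?m"
  proof (rule index_transfer[where f = "\<lambda>a. a * x"])
    show "additive_subgroup ?m" "additive_subgroup T" "additive_subgroup P" "additive_subgroup ?N"
      using tlD(3) m N P ordD(5)[OF T] by auto
    show "a * x \<in> ?N" if "a \<in> T" for a using tl_mult[OF N that xN] .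
    show "\<exists>a\<in>T. y - a * x \<in> P" if y: "y \<in> ?N" for y
    proof -
      obtain p t where p: "y = p + x * t" "p \<in> P" "t \<in> T" using y by (rule cyclic_sumE)
      hence "y - t * x = p" by (simp add: mult.commute)
      thus ?thesis using p by (intro bexI[of _ t]) simp_all
    qed
    show "a * x - b * x \<in> P \<longleftrightarrow> a - b \<in> ?m" if "a \<in> T" "b \<in> T" for a b
      using tl_diff[OF ordD(5)[OF T] that] by (auto simp: left_diff_distrib)
  qed (use sN in auto)
  thus "len ?N P = len T ?m"
    using ind_len[OF ordD(1)[OF T] tlD(1)[OF m]] by (intro len_eqI) simp
qed

abbreviation Specm :: "'e set \<Rightarrow> 'e set set" where "Specm \<equiv> maximal_ideals"

lemma max_lat:
  assumes T: "order T" and m: "m \<in> Specm T"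
  shows "tl T m" "(*) Q ` T \<subseteq> m" "m \<subset> T" "1 \<notin> m"
    "\<And>J. submodule_over T J \<Longrightarrow> m \<subseteq> J \<Longrightarrow> J \<subseteq> T \<Longrightarrow> 1 \<notin> J \<Longrightarrow> J = m"
proof -
  have m': "submodule_over T m" "m \<subset> T"
    "\<And>J. submodule_over T J \<Longrightarrow> m \<subseteq> J \<Longrightarrow> J \<subseteq> T \<Longrightarrow> J = m \<or> J = T"
    using m unfolding maximal_ideals_def by auto
  let ?J = "sum_set m ((*) Q ` T)"
  have J: "submodule_over T ?J" "m \<subseteq> ?J" "(*) Q ` T \<subseteq> ?J" "?J \<subseteq> T"
    using submod_sum_set submod_image ordD[OF T] m'(1,2)
      sum_set_upper[OF submodD(1)[OF m'(1)] tlD(3)[OF tl_Q[OF ordD(5)[OF T]]]]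
      sum_set_least[OF tlD(3)[OF ordD(5)[OF T]], of m "(*) Q ` T"] Q_sub[OF ordD(1)[OF T]] by blast+
  have "?J \<noteq> T"
    using nakayama[OF ordD(1)[OF T] order_submod[OF T m'(1)]] m'(2) by blast
  hence "?J = m" using m'(3)[OF J(1,2,4)] by blast
  thus Q: "(*) Q ` T \<subseteq> m" using J by blast
  show "tl T m"
    using tl_between[OF T lat_Q[OF ordD(1)[OF T]] ordD(1)[OF T] m'(1) Q] m'(2) by blast
  show "m \<subset> T" by fact
  show one: "1 \<notin> m"
  proof
    assume "1 \<in> m"
    hence "T \<subseteq> m" using submodD(6)[OF m'(1), of _ 1] by auto
    thus False using m'(2) by blast
  qed
  show "J = m" if "submodule_over T J" "m \<subseteq> J" "J \<subseteq> T" "1 \<notin> J" for J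
    using m'(3)[OF that(1-3)] that(4) ordD(2)[OF T] by blast
qed

lemma one_in_ideal: "submodule_over T J \<Longrightarrow> 1 \<in> J \<Longrightarrow> T \<subseteq> J"
  using submodD(6)[of T J _ 1] by auto

lemma max_prime:
  assumes T: "order T" and m: "m \<in> Specm T" and x: "x \<in> T" "x \<notin> m"
  obtains u where "u \<in> T" "u * x - 1 \<in> m"
proof -
  note M = max_lat[OF T m]
  have sub: "m \<subseteq> T" using M by blast
  note c = cyclic_quotient[OF T M(1) ordD(5)[OF T] sub x(1)]
  have "1 \<in> sum_set m ((*) x ` T)" using M(5)[OF tlD(2)[OF c(1)] c(3,5)] c(4) x by blast
  then obtain y u where u: "1 = y + x * u" "y \<in> m" "u \<in> T" by (rule cyclic_sumE)
  hence "u * x - 1 = - y" by (simp add: algebra_simps)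
  thus ?thesis using that[OF u(3)] u(2) subgroupD(3)[OF tlD(3)[OF M(1)]] by auto
qed

lemma max_prod:
  assumes T: "order T" and m: "m \<in> Specm T" and "x \<in> T" "x \<notin> m" "y \<in> T" "y \<notin> m"
  shows "x * y \<notin> m"
proof
  assume h: "x * y \<in> m"
  obtain u where u: "u \<in> T" "u * x - 1 \<in> m" using max_prime[OF T m] assms by blast
  note M = max_lat[OF T m]
  have "u * (x * y) - y * (u * x - 1) \<in> m"
    using tl_diff[OF M(1) tl_mult[OF M(1) u(1) h] tl_mult[OF M(1) assms(5) u(2)]] .
  thus False using assms(6) by (simp add: algebra_simps)
qed

lemma finite_max: assumes "order T" shows "finite (Specm T)"
proof (rule finite_subset)
  show "Specm T \<subseteq> {P. lat P \<and> (*) Q ` T \<subseteq> P \<and> P \<subseteq> T}"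
    using max_lat[OF assms] tlD(1) by blast
  show "finite {P. lat P \<and> (*) Q ` T \<subseteq> P \<and> P \<subseteq> T}"
    using finite_between[OF lat_Q ordD(1) Q_sub] ordD(1)[OF assms] assms by blast
qed

lemma max_comaximal:
  assumes T: "order T" and m: "m \<in> Specm T" "n \<in> Specm T" "m \<noteq> n"
  obtains a where "a \<in> m" "a - 1 \<in> n"
proof -
  have "\<not> m \<subseteq> n" using max_lat[OF T m(2)] max_lat(5)[OF T m(1), of n] m(3) tlD(2) by blast
  then obtain x where x: "x \<in> m" "x \<notin> n" by blast
  hence "x \<in> T" using max_lat(3)[OF T m(1)] by blast
  then obtain u where "u \<in> T" "u * x - 1 \<in> n" using max_prime[OF T m(2) _ x(2)] by blast
  thus ?thesis using that[of "u * x"] tl_mult[OF max_lat(1)[OF T m(1)] _ x(1)] by blast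
qed

lemma crt_idempotent:
  assumes T: "order T" and m: "m \<in> Specm T"
  obtains a where "a \<in> T" "a - 1 \<in> m" "\<And>n. n \<in> Specm T \<Longrightarrow> n \<noteq> m \<Longrightarrow> a \<in> n"
proof -
  note M = max_lat[OF T m]
  have "\<exists>a\<in>T. a - 1 \<in> m \<and> (\<forall>n\<in>S. a \<in> n)"
    if "finite S" "S \<subseteq> Specm T - {m}" for S
    using that
  proof (induction S)
    case empty
    thus ?case using ordD(2)[OF T] tl_0[OF M(1)] by (intro bexI[of _ 1]) auto
  next
    case (insert n S)
    then obtain a where a: "a \<in> T" "a - 1 \<in> m" "\<forall>n\<in>S. a \<in> n" by blast
    have n: "n \<in> Specm T" "n \<noteq> m" using insert by auto
    obtain b where b: "b \<in> n" "b - 1 \<in> m" using max_comaximal[OF T n(1) m n(2)] .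
    have bT: "b \<in> T" using b max_lat(3)[OF T n(1)] by blast
    have "a * (b - 1) + (a - 1) \<in> m" using tl_add[OF M(1) tl_mult[OF M(1) a(1) b(2)] a(2)] .
    hence 1: "a * b - 1 \<in> m" by (simp add: algebra_simps)
    have "a * b \<in> n'" if "n' \<in> insert n S" for n'
    proof (cases "n' = n")
      case True thus ?thesis using tl_mult[OF max_lat(1)[OF T n(1)] a(1) b(1)] by simp
    next
      case False
      hence "n' \<in> Specm T" "a \<in> n'" using that insert a by auto
      thus ?thesis using tl_mult[OF max_lat(1)[OF T] bT] by (metis mult.commute)
    qed
    thus ?case using 1 ordD(3)[OF T a(1) bT] by blast
  qed
  from this[of "Specm T - {m}"] show ?thesis using finite_max[OF T] that by auto
qed

definition simple :: "'e set \<Rightarrow> 'e set \<Rightarrow> 'e set \<Rightarrow> bool" where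
  "simple T P N \<longleftrightarrow> tl T P \<and> tl T N \<and> P \<subset> N \<and> (\<forall>X. tl T X \<and> P \<subseteq> X \<and> X \<subseteq> N \<longrightarrow> X = P \<or> X = N)"

definition annq :: "'e set \<Rightarrow> 'e set \<Rightarrow> 'e set \<Rightarrow> 'e set" where
  "annq T P N = {a \<in> T. \<forall>x\<in>N. a * x \<in> P}"

text \<open>A simple quotient is generated by each of its nonzero elements, so it is \<open>T\<close> modulo its annihilator.\<close>

lemma simple_max:
  assumes T: "order T" and s: "simple T P N"
  shows "annq T P N \<in> Specm T" "len N P = len T (annq T P N)"
proof -
  have P: "tl T P" and N: "tl T N" and sub: "P \<subset> N"
    and min: "\<And>X. tl T X \<Longrightarrow> P \<subseteq> X \<Longrightarrow> X \<subseteq> N \<Longrightarrow> X = P \<or> X = N"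
    using s unfolding simple_def by auto
  have sub': "P \<subseteq> N" using sub by blast
  have gen: "sum_set P ((*) x ` T) = N" if "x \<in> N" "x \<notin> P" for x
    using min cyclic_quotient[OF T P N sub' that(1)] that(2) by metis
  have ann: "annq T P N = {a \<in> T. a * x \<in> P}" if x: "x \<in> N" "x \<notin> P" for x
  proof
    show "annq T P N \<subseteq> {a \<in> T. a * x \<in> P}" unfolding annq_def using x by blast
    show "{a \<in> T. a * x \<in> P} \<subseteq> annq T P N"
    proof
      fix a assume a: "a \<in> {a \<in> T. a * x \<in> P}"
      have "a * y \<in> P" if "y \<in> N" for y
      proof -
        have "y \<in> sum_set P ((*) x ` T)" using that gen[OF x] by simp
        then obtain p t where "y = p + x * t" "p \<in> P" "t \<in> T" by (rule cyclic_sumE)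
        moreover have "a * (p + x * t) = a * p + t * (a * x)" by (simp add: algebra_simps)
        ultimately show ?thesis using a tl_add[OF P] tl_mult[OF P] by auto
      qed
      thus "a \<in> annq T P N" using a unfolding annq_def by blast
    qed
  qed
  obtain x where x: "x \<in> N" "x \<notin> P" using sub by blast
  show "len N P = len T (annq T P N)"
    using cyclic_quotient(6)[OF T P N sub' x(1)] gen[OF x] ann[OF x] by simp
  have tla: "tl T (annq T P N)" using cyclic_quotient(2)[OF T P N sub' x(1)] ann[OF x] by simp
  have one: "1 \<notin> annq T P N" using x unfolding annq_def by auto
  have "J = annq T P N \<or> J = T" if J: "submodule_over T J" "annq T P N \<subseteq> J" "J \<subseteq> T" for J
  proof (cases "J = annq T P N")
    case False
    then obtain b where b: "b \<in> J" "b \<notin> annq T P N" using J by blast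
    hence "b * x \<notin> P" using ann[OF x] J by blast
    moreover have "b * x \<in> N" using tl_mult[OF N _ x(1)] b J by blast
    ultimately have "x \<in> sum_set P ((*) (b * x) ` T)" using gen x by blast
    then obtain p t where pt: "x = p + b * x * t" "p \<in> P" "t \<in> T" by (rule cyclic_sumE)
    have "(1 - t * b) * x = p" using pt(1) by (simp add: algebra_simps)
    moreover have tb: "t * b \<in> J" using submodD(6)[OF J(1)] pt b by blast
    moreover have "1 - t * b \<in> T" using tl_diff[OF ordD(5)[OF T] ordD(2)[OF T]] tb J by blast
    ultimately have "1 - t * b \<in> J" using ann[OF x] pt J by blast
    hence "(1 - t * b) + t * b \<in> J" using submodD(5)[OF J(1)] tb by blast
    thus ?thesis using one_in_ideal[OF J(1)] J(3) by auto
  qed simp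
  thus "annq T P N \<in> Specm T"
    unfolding maximal_ideals_def using tlD(2)[OF tla] one ordD(2)[OF T] unfolding annq_def by blast
qed

lemma simple_if_len_1:
  assumes P: "tl T P" and N: "tl T N" and sub: "P \<subseteq> N" and l: "len N P = 1"
  shows "simple T P N"
proof -
  have "X = P \<or> X = N" if "tl T X" "P \<subseteq> X" "X \<subseteq> N" for X
  proof -
    have "len N X + len X P = 1" using len_add[OF tlD(1)[OF N] tlD(1)[OF that(1)] tlD(1)[OF P] that(2,3)] l by simp
    hence "len N X = 0 \<or> len X P = 0" by linarith
    thus ?thesis
      using len_0[OF tlD(1)[OF N] tlD(1)[OF that(1)] that(3)] len_0[OF tlD(1)[OF that(1)] tlD(1)[OF P] that(2)] by blast
  qed
  moreover have "P \<noteq> N" using l tlD(1)[OF P] by auto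
  ultimately show ?thesis unfolding simple_def using P N sub by blast
qed

lemma exists_simple:
  assumes T: "order T" and P: "tl T P" and M: "tl T M" and sub: "P \<subset> M"
  obtains N where "simple T P N" "N \<subseteq> M"
proof -
  let ?S = "\<lambda>N. tl T N \<and> P \<subset> N \<and> N \<subseteq> M"
  obtain N where N: "?S N" "\<And>X. ?S X \<Longrightarrow> len N P \<le> len X P"
    using ex_has_least_nat[of ?S M "\<lambda>N. len N P"] M sub by blast
  have "X = P \<or> X = N" if "tl T X" "P \<subseteq> X" "X \<subseteq> N" for X
    using len_eq[of N X P] N(2)[of X] N(1) that tlD(1) P by blast
  thus ?thesis using that[of N] N(1) P unfolding simple_def by blast
qed

lemma exists_cosimple:
  assumes T: "order T" and P: "tl T P" and M: "tl T M" and sub: "P \<subset> M"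
  obtains N where "simple T N M" "P \<subseteq> N"
proof -
  let ?S = "\<lambda>N. tl T N \<and> P \<subseteq> N \<and> N \<subset> M"
  obtain N where N: "?S N" "\<And>X. ?S X \<Longrightarrow> len M N \<le> len M X"
    using ex_has_least_nat[of ?S P "\<lambda>N. len M N"] P sub by blast
  have "X = N \<or> X = M" if "tl T X" "N \<subseteq> X" "X \<subseteq> M" for X
    using len_eq'[of M X N] N(2)[of X] N(1) that tlD(1) M by blast
  thus ?thesis using that[of N] N(1) M unfolding simple_def by blast
qed

lemma max_exists:
  assumes T: "order T" and J: "submodule_over T J" "J \<subset> T"
  obtains m where "m \<in> Specm T" "J \<subseteq> m"
proof -
  let ?P = "sum_set J ((*) Q ` T)"
  have Q: "tl T ((*) Q ` T)" using tl_Q ordD(5)[OF T] by blast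
  have P: "submodule_over T ?P" "J \<subseteq> ?P" "(*) Q ` T \<subseteq> ?P" "?P \<subseteq> T"
    using submod_sum_set[OF J(1) tlD(2)[OF Q]] J(2)
      sum_set_upper[OF submodD(1)[OF J(1)] tlD(3)[OF Q]]
      sum_set_least[OF tlD(3)[OF ordD(5)[OF T]], of J "(*) Q ` T"] Q_sub[OF ordD(1)[OF T]] by blast+
  have "?P \<noteq> T" using nakayama[OF ordD(1)[OF T] order_submod[OF T J(1)]] J(2) by blast
  moreover have tlP: "tl T ?P" using tl_between[OF T tlD(1)[OF Q] ordD(1)[OF T] P(1,3,4)] .
  ultimately obtain N where N: "simple T N T" "?P \<subseteq> N"
    using exists_cosimple[OF T tlP ordD(5)[OF T]] P(4) by blast
  have tN: "tl T N" "N \<subset> T" using N(1) unfolding simple_def by auto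
  have "annq T N T = N"
  proof
    show "annq T N T \<subseteq> N" using ordD(2)[OF T] unfolding annq_def by force
    show "N \<subseteq> annq T N T" using tl_mult'[OF tN(1)] tN(2) unfolding annq_def by blast
  qed
  thus ?thesis using that[of N] simple_max(1)[OF T N(1)] N(2) P(2) by auto
qed

lemma max_nonempty: assumes "order T" shows "Specm T \<noteq> {}"
proof -
  have "(*) Q ` T \<noteq> T" using len_Q[OF ordD(1)[OF assms]] ordD(1)[OF assms] by force
  hence "(*) Q ` T \<subset> T" using Q_sub[OF ordD(1)[OF assms]] by blast
  then obtain m where "m \<in> Specm T"
    by (rule max_exists[OF assms tlD(2)[OF tl_Q[OF ordD(5)[OF assms]]]])
  thus ?thesis by blast
qed

lemma unit_iff_no_max:
  assumes T: "order T" and x: "x \<in> T" "\<And>m. m \<in> Specm T \<Longrightarrow> x \<notin> m"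
  obtains s where "s \<in> T" "x * s = 1"
proof -
  have "submodule_over T ((*) x ` T)" using submod_image ordD(4)[OF T] by blast
  moreover have "(*) x ` T \<subseteq> T" "x \<in> (*) x ` T" using ordD[OF T] x by force+
  ultimately have "(*) x ` T = T" using max_exists[OF T, of "(*) x ` T"] x(2) by (metis psubsetI subsetD)
  hence "1 \<in> (*) x ` T" using ordD(2)[OF T] by simp
  then obtain s where "s \<in> T" "1 = x * s" by blast
  thus ?thesis using that by metis
qed

lemma len_max_pos: "order T \<Longrightarrow> m \<in> Specm T \<Longrightarrow> len T m > 0"
  by (rule len_pos[OF ordD(1) tlD(1)[OF max_lat(1)] max_lat(3)])

lemma tl_max_prod: "order T \<Longrightarrow> m \<in> Specm T \<Longrightarrow> tl T M \<Longrightarrow> tl T (m \<cdot> M)"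
  using tl_product max_lat(1) tlD(1) by blast

lemma max_prod_sub: "order T \<Longrightarrow> m \<in> Specm T \<Longrightarrow> tl T M \<Longrightarrow> m \<cdot> M \<subseteq> M"
  using product_sub max_lat(3) by blast

text \<open>
  Otherwise \<open>Tx\<close> lies in a submodule \<open>N\<close> with simple quotient \<open>M/N\<close>. This quotient is killed by a
  maximal ideal \<open>m\<close>, so \<open>mM + Tx \<subseteq> N\<close>.
\<close>

lemma cyclic_local_global:
  assumes T: "order T" and M: "tl T M" and x: "x \<in> M"
    and loc: "\<And>m. m \<in> Specm T \<Longrightarrow> M \<subseteq> sum_set (m \<cdot> M) ((*) x ` T)"
  shows "M = (*) x ` T"
proof -
  have xT: "submodule_over T ((*) x ` T)" using submod_image ordD(4)[OF T] by blast
  have xM: "(*) x ` T \<subseteq> M" by (rule tl_multiples[OF M x])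
  let ?P = "sum_set ((*) x ` T) ((*) Q ` M)"
  have Q: "tl T ((*) Q ` M)" using tl_Q M by blast
  have P: "submodule_over T ?P" "(*) x ` T \<subseteq> ?P" "(*) Q ` M \<subseteq> ?P" "?P \<subseteq> M"
    using submod_sum_set[OF xT tlD(2)[OF Q]]
      sum_set_upper[OF submodD(1)[OF xT] tlD(3)[OF Q]]
      sum_set_least[OF tlD(3)[OF M] xM Q_sub[OF tlD(1)[OF M]]] by blast+
  have tlP: "tl T ?P" using tl_between[OF T tlD(1)[OF Q] tlD(1)[OF M] P(1,3,4)] .
  have "?P = M"
  proof (rule ccontr)
    assume "?P \<noteq> M"
    then obtain N where N: "simple T N M" "?P \<subseteq> N" using exists_cosimple[OF T tlP M] P(4) by blast
    have tN: "tl T N" "N \<subset> M" using N(1) unfolding simple_def by auto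
    have "(annq T N M) \<cdot> M \<subseteq> N"
      by (rule product_least[OF tlD(3)[OF tN(1)]]) (auto simp: annq_def)
    hence "sum_set ((annq T N M) \<cdot> M) ((*) x ` T) \<subseteq> N"
      using sum_set_least[OF tlD(3)[OF tN(1)]] P(2) N(2) by blast
    thus False using loc[OF simple_max(1)[OF T N(1)]] tN(2) by blast
  qed
  thus ?thesis using nakayama[OF tlD(1)[OF M] order_submod[OF T xT] xM] by blast
qed

text \<open>The Chinese remainder theorem combines elements outside \<open>mM\<close> for all \<open>m\<close> into one generator.\<close>

lemma cyclic_if_small:
  assumes T: "order T" and M: "tl T M"
    and small: "\<And>m. m \<in> Specm T \<Longrightarrow> len M (m \<cdot> M) \<le> len T m"
  obtains x where "x \<in> M" "M = (*) x ` T"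
proof -
  let ?MM = "Specm T"
  have "\<forall>m\<in>?MM. \<exists>a. a \<in> T \<and> a - 1 \<in> m \<and> (\<forall>n\<in>?MM. n \<noteq> m \<longrightarrow> a \<in> n)"
    using crt_idempotent[OF T] by metis
  then obtain a where a: "\<And>m. m \<in> ?MM \<Longrightarrow> a m \<in> T" "\<And>m. m \<in> ?MM \<Longrightarrow> a m - 1 \<in> m"
    "\<And>m n. m \<in> ?MM \<Longrightarrow> n \<in> ?MM \<Longrightarrow> n \<noteq> m \<Longrightarrow> a m \<in> n" by metis
  define w where "w m = (SOME x. x \<in> M \<and> (m \<cdot> M \<noteq> M \<longrightarrow> x \<notin> m \<cdot> M))" for m
  have w: "w m \<in> M" "m \<cdot> M \<noteq> M \<Longrightarrow> w m \<notin> m \<cdot> M" if "m \<in> ?MM" for m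
  proof -
    have "\<exists>x. x \<in> M \<and> (m \<cdot> M \<noteq> M \<longrightarrow> x \<notin> m \<cdot> M)"
      using max_prod_sub[OF T that M] tl_0[OF M] by blast
    from someI_ex[OF this] show "w m \<in> M" "m \<cdot> M \<noteq> M \<Longrightarrow> w m \<notin> m \<cdot> M"
      unfolding w_def by blast+
  qed
  define x where "x = (\<Sum>m\<in>?MM. a m * w m)"
  have xM: "x \<in> M" unfolding x_def
    using a(1) w(1) tl_mult[OF M] by (intro subgroup_sum[OF tlD(3)[OF M]]) blast
  have notin: "x \<notin> m \<cdot> M" if m: "m \<in> ?MM" "m \<cdot> M \<noteq> M" for m
  proof
    let ?P = "m \<cdot> M"
    note P = subgroupD[OF subgroup_product[of m M]]
    assume "x \<in> ?P"
    have "(\<Sum>n\<in>?MM - {m}. a n * w n) \<in> ?P"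
      using a(3) w(1) m(1) by (intro subgroup_sum[OF subgroup_product] product_mem) auto
    moreover have "x = a m * w m + (\<Sum>n\<in>?MM - {m}. a n * w n)"
      unfolding x_def using finite_max[OF T] m(1) by (intro sum.remove)
    ultimately have "a m * w m \<in> ?P" using P(2)[OF \<open>x \<in> ?P\<close>] by (metis add_diff_cancel_right')
    moreover have "(a m - 1) * w m \<in> ?P" using a(2) w(1) m(1) by (intro product_mem)
    ultimately have "a m * w m - (a m - 1) * w m \<in> ?P" by (rule P(2))
    hence "w m \<in> ?P" by (simp add: algebra_simps)
    thus False using w(2)[OF m] by blast
  qed
  have "M \<subseteq> sum_set (m \<cdot> M) ((*) x ` T)" if m: "m \<in> ?MM" for m
  proof (cases "m \<cdot> M = M")
    case True
    have "submodule_over T ((*) x ` T)" using submod_image ordD(4)[OF T] by blast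
    thus ?thesis using sum_set_upper(1)[OF tlD(3)[OF M]] submodD(1) True by metis
  next
    case False
    let ?P = "m \<cdot> M"
    have P: "tl T ?P" "?P \<subseteq> M" using tl_max_prod max_prod_sub T m M by blast+
    note c = cyclic_quotient[OF T P(1) M P(2) xM]
    have "m \<subseteq> {a \<in> T. a * x \<in> ?P}"
      using max_lat(3)[OF T m] product_mem[OF _ xM] by blast
    hence "{a \<in> T. a * x \<in> ?P} = m"
      using notin[OF m False] by (intro max_lat(5)[OF T m tlD(2)[OF c(2)]]) auto
    hence "len (sum_set ?P ((*) x ` T)) ?P = len T m" using c(6) by simp
    hence "sum_set ?P ((*) x ` T) = M"
      using len_eq[OF tlD(1)[OF M] tlD(1)[OF c(1)] tlD(1)[OF P(1)] c(3,5)] small[OF m] by simp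
    thus ?thesis by simp
  qed
  thus ?thesis using that[OF xM] cyclic_local_global[OF T M xM] by blast
qed

lemma cyclic_gen_unit:
  assumes T: "order T" and M: "tl T M" "M = (*) x ` T"
  obtains y where "x * y = 1"
proof -
  obtain k where "Q ^ k * 1 \<in> M" using lat_bound[OF tlD(1)[OF M(1)]] L_one by (metis order_refl)
  then obtain t where "Q ^ k = x * t" using M(2) by auto
  hence "x * (t * r ^ k) = Q ^ k * r ^ k" by (simp add: mult.assoc)
  thus ?thesis using that Qk_rk by simp
qed

subsection \<open>Invertible maximal ideals\<close>

text \<open>If \<open>(T : m)m\<close> is not in \<open>m\<close>, it is \<open>T\<close>. Otherwise \<open>(T : m)\<close> is a ring, the multiplier ring of \<open>m\<close>.\<close>

definition invertible :: "'e set \<Rightarrow> 'e set \<Rightarrow> bool" where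
  "invertible T m \<longleftrightarrow> \<not> (\<forall>x\<in>colon T m. \<forall>y\<in>m. x * y \<in> m)"

lemma tl_colon_max: "order T \<Longrightarrow> m \<in> Specm T \<Longrightarrow> tl T (colon T m)"
  using tl_colon[OF ordD(5)] tlD(1)[OF max_lat(1)] by blast

lemma colon_upper: "order T \<Longrightarrow> m \<in> Specm T \<Longrightarrow> T \<subseteq> colon T m"
  using max_lat(3) ordD(3) by (blast intro: colonI)

lemma invertible_product:
  assumes T: "order T" and m: "m \<in> Specm T" and inv: "invertible T m"
  shows "m \<cdot> (colon T m) = T"
proof -
  note M = max_lat[OF T m]
  let ?P = "m \<cdot> (colon T m)"
  have P: "tl T ?P" using tl_product'[OF M(1) tlD(1)[OF tl_colon_max[OF T m]]] .
  have PT: "?P \<subseteq> T"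
    by (rule product_least[OF tlD(3)[OF ordD(5)[OF T]]]) (metis colonD mult.commute)
  have "m \<subseteq> ?P"
    using product_mem[of _ m 1 "colon T m"] colon_upper[OF T m] ordD(2)[OF T] by auto
  moreover have "\<not> ?P \<subseteq> m"
    using inv product_mem[of _ m _ "colon T m"] unfolding invertible_def by (metis mult.commute subsetD)
  ultimately have "1 \<in> ?P" using M(5)[OF tlD(2)[OF P] _ PT] by blast
  thus ?thesis using one_in_ideal[OF tlD(2)[OF P]] PT by blast
qed

lemma invertible_cancel:
  assumes T: "order T" and m: "m \<in> Specm T" and inv: "invertible T m" and M: "tl T M"
  shows "m \<cdot> ((colon T m) \<cdot> M) = M"
    "(colon T m) \<cdot> (m \<cdot> M) = M"
  using invertible_product[OF T m inv] product_unit[OF T M]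
  by (metis product_assoc, metis product_assoc product_commute)

lemma tl_colon_product: "order T \<Longrightarrow> m \<in> Specm T \<Longrightarrow> tl T M \<Longrightarrow> tl T ((colon T m) \<cdot> M)"
  using tl_product tlD(1)[OF tl_colon_max] by blast

lemma colon_product_upper:
  "order T \<Longrightarrow> m \<in> Specm T \<Longrightarrow> tl T M \<Longrightarrow> M \<subseteq> (colon T m) \<cdot> M"
  using product_mem[of 1 "colon T m" _ M] colon_upper ordD(2) by fastforce

lemma len_colon_invertible:
  assumes T: "order T" and m: "m \<in> Specm T" and inv: "invertible T m"
  shows "len (colon T m) T = len T m"
proof -
  note M = max_lat[OF T m] and C = tl_colon_max[OF T m] and U = colon_upper[OF T m]
  obtain x y where xy: "x \<in> colon T m" "y \<in> m" "x * y \<notin> m" using inv unfolding invertible_def by blast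
  have yT: "y \<in> T" and xyT: "x * y \<in> T" using xy M(3) colonD by blast+
  obtain a where a: "a \<in> T" "a * (x * y) - 1 \<in> m" using max_prime[OF T m xyT xy(3)] .
  note c = cyclic_quotient[OF T ordD(5)[OF T] C U xy(1)]
  have "colon T m \<subseteq> sum_set T ((*) x ` T)"
  proof
    fix z assume z: "z \<in> colon T m"
    have 1: "- (z * (a * (x * y) - 1)) \<in> T" using colonD[OF z a(2)] tlD(3)[OF ordD(5)[OF T]] subgroupD(3) by blast
    have "a * (z * y) \<in> T" using ordD(3)[OF T a(1) colonD[OF z xy(2)]] .
    hence "- (z * (a * (x * y) - 1)) + x * (a * (z * y)) \<in> sum_set T ((*) x ` T)"
      using 1 by (intro sum_setI) auto
    thus "z \<in> sum_set T ((*) x ` T)" by (simp add: algebra_simps)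
  qed
  hence e: "sum_set T ((*) x ` T) = colon T m" using c(5) by blast
  have "{b \<in> T. b * x \<in> T} = m"
  proof (rule M(5)[OF tlD(2)[OF c(2)]])
    show "m \<subseteq> {b \<in> T. b * x \<in> T}" using M(3) colonD[OF xy(1)] by (auto simp: mult.commute)
    have "x \<notin> T" using tl_mult[OF M(1) _ xy(2)] xy(3) by blast
    thus "1 \<notin> {b \<in> T. b * x \<in> T}" by simp
  qed auto
  thus ?thesis using c(6) e by simp
qed

text \<open>Multiplication by \<open>m\<close> preserves simple quotients and their annihilators.\<close>

lemma len_invertible:
  assumes T: "order T" and m: "m \<in> Specm T" and inv: "invertible T m"
    and "tl T L'" "tl T L" "L \<subseteq> L'"
  shows "len (m \<cdot> L') (m \<cdot> L) = len L' L"
  using assms(4-6)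
proof (induction "len L' L" arbitrary: L rule: less_induct)
  case less
  let ?m = "submodule_product m" and ?n = "submodule_product (colon T m)"
  show ?case
  proof (cases "L = L'")
    case True
    thus ?thesis using tlD(1)[OF less(2)] tlD(1)[OF tl_max_prod[OF T m less(2)]] by simp
  next
    case False
    then obtain N where N: "simple T L N" "N \<subseteq> L'" using exists_simple[OF T less(3,2)] less(4) by blast
    have tN: "tl T N" "L \<subset> N" and min: "\<And>X. tl T X \<Longrightarrow> L \<subseteq> X \<Longrightarrow> X \<subseteq> N \<Longrightarrow> X = L \<or> X = N"
      using N(1) unfolding simple_def by auto
    have mono: "?m A \<subseteq> ?m B" "?n A \<subseteq> ?n B" if "A \<subseteq> B" for A B
      by (rule product_mono[OF order_refl that])+
    have canc: "?m (?n A) = A" "?n (?m A) = A" if "tl T A" for A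
      using invertible_cancel[OF T m inv that] by auto
    have s: "simple T (?m L) (?m N)" unfolding simple_def
    proof (intro conjI allI impI)
      show "tl T (?m L)" "tl T (?m N)" using tl_max_prod[OF T m] less tN by blast+
      show "?m L \<subset> ?m N" using mono(1)[of L N] tN canc(2) less(3) by (metis psubset_eq)
      fix X assume X: "tl T X \<and> ?m L \<subseteq> X \<and> X \<subseteq> ?m N"
      hence "?n X = L \<or> ?n X = N"
        using min[of "?n X"] mono(2)[of "?m L" X] mono(2)[of X "?m N"] canc tl_colon_product[OF T m]
          less(3) tN(1) by auto
      thus "X = ?m L \<or> X = ?m N" using canc(1) X by metis
    qed
    have "annq T L N \<subseteq> annq T (?m L) (?m N)"
    proof
      fix a assume a: "a \<in> annq T L N"
      have aT: "a \<in> T" using a unfolding annq_def by blast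
      have "?m N \<subseteq> {x. a * x \<in> ?m L}"
      proof (rule product_least)
        show "additive_subgroup {x. a * x \<in> ?m L}"
          using subgroupD[OF subgroup_product[of m L]]
          by (auto simp: additive_subgroup_def right_diff_distrib)
        fix x y assume "x \<in> m" "y \<in> N"
        hence "x * (a * y) \<in> ?m L" using a unfolding annq_def by (intro product_mem) auto
        thus "x * y \<in> {x. a * x \<in> ?m L}" by (simp add: mult.left_commute)
      qed
      thus "a \<in> annq T (?m L) (?m N)" using aT unfolding annq_def by blast
    qed
    hence "annq T (?m L) (?m N) = annq T L N"
      using max_lat(5)[OF T simple_max(1)[OF T N(1)]] max_lat[OF T simple_max(1)[OF T s]] tlD(2) by blast
    hence 1: "len (?m N) (?m L) = len N L"
      using simple_max(2)[OF T s] simple_max(2)[OF T N(1)] by simp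
    have a: "len L' L = len L' N + len N L" using len_add tlD(1) less tN N(2) by blast
    have "len N L > 0" using len_pos tlD(1) less tN by blast
    hence "len (?m L') (?m N) = len L' N" using less(1)[of N] a less(2) tN(1) N(2) by simp
    moreover have "len (?m L') (?m L) = len (?m L') (?m N) + len (?m N) (?m L)"
      using len_add tl_max_prod[OF T m] tlD(1) less tN mono(1) N(2) by (meson psubsetE)
    ultimately show ?thesis using 1 a by simp
  qed
qed

lemma len_inv_product:
  assumes T: "order T" and m: "m \<in> Specm T" and inv: "invertible T m" and L: "tl T L"
  shows "len L (m \<cdot> L) = len T m"
proof -
  let ?m = "submodule_product m"
  let ?S = "sum_set L T"
  have S: "tl T ?S" "L \<subseteq> ?S" "T \<subseteq> ?S"
    using tl_sum[OF L ordD(5)[OF T]] sum_set_upper[OF tlD(3)[OF L] tlD(3)[OF ordD(5)[OF T]]] by auto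
  have "len P (?m P) = len ?S (?m ?S)" if P: "tl T P" "P \<subseteq> ?S" for P
  proof -
    have "len ?S P + len P (?m P) = len ?S (?m P)"
      using len_add[OF tlD(1)[OF S(1)] tlD(1)[OF P(1)] tlD(1)[OF tl_max_prod[OF T m P(1)]]]
        max_prod_sub[OF T m P(1)] P(2) by simp
    also have "\<dots> = len ?S (?m ?S) + len (?m ?S) (?m P)"
      using tl_max_prod[OF T m] tlD(1) S P max_prod_sub[OF T m S(1)] product_mono[OF order_refl P(2)]
      by (intro len_add) blast+
    also have "len (?m ?S) (?m P) = len ?S P" using len_invertible[OF T m inv S(1) P] .
    finally show ?thesis by simp
  qed
  from this[OF L S(2)] this[OF ordD(5)[OF T] S(3)]
  have "len L (?m L) = len T (?m T)" by simp
  also have "?m T = m" using product_unit[OF T max_lat(1)[OF T m]] by (simp add: product_commute)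
  finally show ?thesis .
qed

lemma ninv_order:
  assumes T: "order T" and m: "m \<in> Specm T" and ninv: "\<not> invertible T m"
  shows "order (colon T m)" "tl (colon T m) m" "T \<subseteq> colon T m"
proof -
  note M = max_lat[OF T m]
  have h: "x * y \<in> m" if "x \<in> colon T m" "y \<in> m" for x y using ninv that unfolding invertible_def by blast
  show "tl (colon T m) m" using h tlD[OF M(1)] unfolding tl_def submodule_over_def by blast
  have "x * y \<in> colon T m" if "x \<in> colon T m" "y \<in> colon T m" for x y
    using h[OF that(2)] colonD[OF that(1)] by (intro colonI) (simp add: mult.assoc)
  thus "order (colon T m)" unfolding order_in_def
    using tlD(1)[OF tl_colon_max[OF T m]] colon_upper[OF T m] ordD(2)[OF T] by blast
  show "T \<subseteq> colon T m" using colon_upper[OF T m] .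
qed

section \<open>Gorenstein orders\<close>

text \<open>
  The case of a dualizing module that is generated by one element. As orders are semilocal, it is
  equivalent to the invertibility of the dualizing module (\<open>gorenstein_iff_gor\<close>).
\<close>

definition gor :: "'e set \<Rightarrow> bool" where
  "gor T \<longleftrightarrow> (\<exists>p p'. p * p' = 1 \<and> dual T = (*) p ` T)"

lemma colon_product:
  assumes "additive_subgroup P"
  shows "colon P (M \<cdot> N) = colon (colon P N) M"
proof
  show "colon P (M \<cdot> N) \<subseteq> colon (colon P N) M"
  proof
    fix x assume x: "x \<in> colon P (M \<cdot> N)"
    show "x \<in> colon (colon P N) M"
    proof (rule colonI, rule colonI)
      fix y z assume "y \<in> M" "z \<in> N"
      thus "x * y * z \<in> P" using colonD[OF x product_mem[of y M z N]] by (simp add: mult.assoc)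
    qed
  qed
  show "colon (colon P N) M \<subseteq> colon P (M \<cdot> N)"
  proof
    fix x assume x: "x \<in> colon (colon P N) M"
    have "M \<cdot> N \<subseteq> {z. x * z \<in> P}"
    proof (rule product_least)
      show "additive_subgroup {z. x * z \<in> P}"
        using subgroupD[OF assms] by (auto simp: additive_subgroup_def right_diff_distrib)
      fix y z assume "y \<in> M" "z \<in> N"
      thus "y * z \<in> {z. x * z \<in> P}" using colonD[OF colonD[OF x]] by (auto simp: mult.assoc)
    qed
    thus "x \<in> colon P (M \<cdot> N)" by (blast intro: colonI)
  qed
qed

lemma I_add: "additive_subgroup I" using I_mod submodD(1) by blast

lemma len_dual_max:
  assumes T: "order T" and m: "m \<in> Specm T" and M: "tl T M"
  shows "len (dual M) (m \<cdot> (dual M)) = len (colon M m) M"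
proof -
  have D: "tl T (dual M)" using tl_dual tlD[OF M] by blast
  have "dual (m \<cdot> (dual M)) = colon M m"
    using colon_product[OF I_add, of m "dual M"] dual_dual tlD(1)[OF M] by simp
  thus ?thesis
    using len_dual[OF tlD(1)[OF D] tlD(1)[OF tl_max_prod[OF T m D]] max_prod_sub[OF T m D]]
      dual_dual tlD(1)[OF M] by simp
qed

text \<open>By duality \<open>(T : m)/T\<close> has the length of \<open>T\<^sup>\<or>/mT\<^sup>\<or>\<close>, so \<open>T\<^sup>\<or>\<close> is generated by one element.\<close>

lemma gor_if_small:
  assumes T: "order T" and small: "\<And>m. m \<in> Specm T \<Longrightarrow> len (colon T m) T \<le> len T m"
  shows "gor T"
proof -
  have D: "tl T (dual T)" using tl_dual ordD[OF T] by blast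
  obtain x where x: "x \<in> dual T" "dual T = (*) x ` T"
    using cyclic_if_small[OF T D] small len_dual_max[OF T _ ordD(5)[OF T]] by metis
  obtain y where "x * y = 1" using cyclic_gen_unit[OF T D x(2)] .
  thus ?thesis unfolding gor_def using x by blast
qed

text \<open>The order \<open>\<int>\<^sub>q + qC\<close>.\<close>

abbreviation thin :: "'e set \<Rightarrow> 'e set" where "thin C \<equiv> line ((*) Q ` C) 1"

lemma one_notin_Q: assumes "order C" shows "1 \<notin> (*) Q ` C"
proof
  assume "1 \<in> (*) Q ` C"
  hence "r \<in> C" by (simp add: mem_Q_iff)
  hence "(*) Q ` C = C" using ordD(3)[OF assms \<open>r \<in> C\<close>] Q_sub[OF ordD(1)[OF assms]]
    by (auto simp: mem_Q_iff)
  thus False using len_Q[OF ordD(1)[OF assms]] ordD(1)[OF assms] by simp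
qed

lemma thin_facts:
  assumes C: "order C"
  shows "order (thin C)" "len (thin C) ((*) Q ` C) = 1" "len C (thin C) = 2" "(*) Q ` C \<subseteq> thin C"
    "thin C \<subseteq> C"
proof -
  let ?P = "(*) Q ` C" and ?T = "line ((*) Q ` C) 1"
  have P: "tl C ?P" using tl_Q ordD(5)[OF C] by blast
  have Q1: "Q * 1 \<in> ?P" using ordD(2)[OF C] by blast
  show len1: "len ?T ?P = 1" using line_len[OF tlD(1)[OF P] one_notin_Q[OF C] Q1] .
  show s1: "?P \<subseteq> ?T" using line_upper(1)[OF lat_mod[OF tlD(1)[OF P]]] .
  show s2: "?T \<subseteq> C" using line_least[OF lat_mod[OF ordD(1)[OF C]] Q_sub[OF ordD(1)[OF C]] ordD(2)[OF C]] .
  have l: "lat ?T" using line_lat[OF tlD(1)[OF P]] .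
  show "len C ?T = 2"
    using len_add[OF ordD(1)[OF C] l tlD(1)[OF P] s1 s2] len_Q[OF ordD(1)[OF C]] len1 by simp
  have "x * y \<in> ?T" if x: "x \<in> ?T" and y: "y \<in> ?T" for x y
  proof -
    obtain a z where a: "x = a + z * 1" "a \<in> ?P" "z \<in> Z" using x by (rule lineE)
    obtain b w where b: "y = b + w * 1" "b \<in> ?P" "w \<in> Z" using y by (rule lineE)
    have "a * b + z * b + w * a \<in> ?P"
      using a b s2 tl_mult[OF P] tl_add[OF P] order_Z[OF C] Q_sub[OF ordD(1)[OF C]]
      by (meson subsetD)
    moreover have "z * w \<in> Z" using submodD(6)[OF Z_mod] a b by blast
    ultimately have "(a * b + z * b + w * a) + (z * w) * 1 \<in> ?T" by (rule lineI)
    thus ?thesis by (simp add: a b algebra_simps)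
  qed
  thus "order ?T" unfolding order_in_def
    using l line_upper(2)[OF lat_mod[OF tlD(1)[OF P]]] by blast
qed

text \<open>An order that is not Gorenstein has the form \<open>\<int>\<^sub>q + qC\<close>: a maximal ideal \<open>m\<close> at which the
  dual module needs two generators satisfies \<open>qC \<subseteq> m\<close> for \<open>C = (T : m)\<close>, and the length of \<open>T/qT\<close>
  leaves no room for anything but equality.\<close>

lemma not_gor_thin:
  assumes T: "order T" and "\<not> gor T"
  obtains C where "order C" "T = thin C"
proof -
  obtain m where m: "m \<in> Specm T" "len (colon T m) T > len T m"
    using gor_if_small[OF T] assms(2) not_le by blast
  note M = max_lat[OF T m(1)]
  have ninv: "\<not> invertible T m" using len_colon_invertible[OF T m(1)] m(2) by fastforce
  let ?C = "colon T m"
  note C = ninv_order[OF T m(1) ninv]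
  have QC: "(*) Q ` ?C \<subseteq> m"
  proof
    fix y assume "y \<in> (*) Q ` ?C"
    then obtain x where x: "x \<in> ?C" "y = x * Q" by (auto simp: mult.commute)
    have "Q * 1 \<in> m" using M(2) ordD(2)[OF T] by blast
    thus "y \<in> m" using x tl_mult[OF C(2)] by simp
  qed
  have lQC: "lat ((*) Q ` ?C)" using lat_Q ordD(1)[OF C(1)] by blast
  have "len T ((*) Q ` T) = len T m + len m ((*) Q ` ?C) + len ((*) Q ` ?C) ((*) Q ` T)"
    using len_add[OF ordD(1)[OF T] tlD(1)[OF M(1)] lQC QC]
      len_add[OF ordD(1)[OF T] lQC lat_Q[OF ordD(1)[OF T]] image_mono[OF C(3)]] M(3) QC by auto
  moreover have "len ((*) Q ` ?C) ((*) Q ` T) = len ?C T"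
    using len_scale[OF ordD(1)[OF C(1)] ordD(1)[OF T] C(3) Q_r(1)] .
  moreover have "len T m > 0" using len_max_pos[OF T m(1)] .
  ultimately have l: "len T m = 1" "len m ((*) Q ` ?C) = 0"
    using m(2) len_Q[OF ordD(1)[OF T]] by linarith+
  have e: "(*) Q ` ?C = m" using len_0[OF tlD(1)[OF M(1)] lQC QC l(2)] .
  have "thin ?C \<subseteq> T" using line_least[OF lat_mod[OF ordD(1)[OF T]] _ ordD(2)[OF T]] e M(3) by blast
  moreover have "len (thin ?C) m = 1" using thin_facts(2)[OF C(1)] e by simp
  ultimately have "thin ?C = T"
    using len_eq[OF ordD(1)[OF T] ordD(1)[OF thin_facts(1)[OF C(1)]] tlD(1)[OF M(1)]] thin_facts(4)[OF C(1)] e l(1)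
    by simp
  thus ?thesis using that C(1) by metis
qed

lemma thin_max:
  assumes C: "order C"
  shows "Specm (thin C) = {(*) Q ` C}" "colon (thin C) ((*) Q ` C) = C"
proof -
  let ?T = "thin C" and ?m = "(*) Q ` C"
  note t = thin_facts[OF C]
  have sm: "submodule_over ?T ?m"
    using submod_mono[OF tlD(2)[OF tl_Q[OF ordD(5)[OF C]]] t(5)] .
  have lm: "lat ?m" using lat_Q ordD(1)[OF C] by blast
  have "?m \<subset> ?T" using t(4) one_notin_Q[OF C] ordD(2)[OF t(1)] by blast
  moreover have "J = ?m \<or> J = ?T" if J: "submodule_over ?T J" "?m \<subseteq> J" "J \<subseteq> ?T" for J
  proof -
    have lJ: "lat J" using tl_between[OF t(1) lm ordD(1)[OF t(1)] J] tlD(1) by blast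
    have "len ?T J + len J ?m = 1"
      using len_add[OF ordD(1)[OF t(1)] lJ lm J(2,3)] t(2) by simp
    hence "len ?T J = 0 \<or> len J ?m = 0" by linarith
    thus ?thesis using len_0[OF ordD(1)[OF t(1)] lJ J(3)] len_0[OF lJ lm J(2)] by blast
  qed
  ultimately have max: "?m \<in> Specm ?T" unfolding maximal_ideals_def using sm by blast
  have "n = ?m" if n: "n \<in> Specm ?T" for n
  proof -
    have "n \<subseteq> ?m"
    proof
      fix x assume x: "x \<in> n"
      show "x \<in> ?m"
      proof (rule ccontr)
        assume nx: "x \<notin> ?m"
        have "x \<in> ?T" using x max_lat(3)[OF t(1) n] by blast
        then obtain u where u: "u \<in> ?T" "u * x - 1 \<in> ?m" using max_prime[OF t(1) max _ nx] by blast
        have ux: "u * x \<in> n" using tl_mult[OF max_lat(1)[OF t(1) n] u(1) x] .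
        have uxC: "u * x \<in> C" using ux max_lat(3)[OF t(1) n] t(5) by blast
        have "u * x \<notin> k" if k: "k \<in> Specm C" for k
        proof
          assume "u * x \<in> k"
          moreover have "u * x - 1 \<in> k" using u(2) max_lat(2)[OF C k] by blast
          ultimately have "u * x - (u * x - 1) \<in> k" using tl_diff[OF max_lat(1)[OF C k]] by blast
          thus False using max_lat(4)[OF C k] by simp
        qed
        then obtain s where s: "s \<in> C" "u * x * s = 1" using unit_iff_no_max[OF C uxC] by blast
        have "s = 1 - (u * x - 1) * s" using s(2) by (simp add: algebra_simps)
        moreover have "(u * x - 1) * s \<in> ?m"
          using tl_mult[OF tl_Q[OF ordD(5)[OF C]] s(1) u(2)] by (simp add: mult.commute)
        ultimately have "s \<in> ?T"
          using tl_diff[OF ordD(5)[OF t(1)] ordD(2)[OF t(1)]] t(4) by (metis subsetD)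
        hence "s * (u * x) \<in> n" using tl_mult[OF max_lat(1)[OF t(1) n] _ ux] by blast
        thus False using s(2) max_lat(4)[OF t(1) n] by (simp add: mult.commute)
      qed
    qed
    thus ?thesis
      using max_lat(5)[OF t(1) n sm] t(4) one_notin_Q[OF C] by blast
  qed
  thus "Specm ?T = {?m}" using max by blast
  show "colon ?T ?m = C"
  proof
    show "C \<subseteq> colon ?T ?m"
      using tl_mult[OF tl_Q[OF ordD(5)[OF C]]] t(4) by (blast intro: colonI)
    show "colon ?T ?m \<subseteq> C"
    proof
      fix x assume x: "x \<in> colon ?T ?m"
      have Qx: "Q * x \<in> colon ?T C"
      proof (rule colonI)
        fix c assume "c \<in> C"
        thus "Q * x * c \<in> ?T" using colonD[OF x, of "Q * c"] by (simp add: mult_ac)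
      qed
      have tc: "tl C (colon ?T C)" using tl_colon'[OF ordD(1)[OF t(1)] ordD(5)[OF C]] .
      have s: "colon ?T C \<subseteq> ?T" using colonD[of _ ?T C 1] ordD(2)[OF C] by fastforce
      have s': "?m \<subseteq> colon ?T C"
        using tl_mult'[OF tl_Q[OF ordD(5)[OF C]]] t(4) by (blast intro: colonI)
      have "1 \<notin> colon ?T C"
      proof
        assume "1 \<in> colon ?T C"
        hence "C \<subseteq> ?T" using colonD[of 1 ?T C] by auto
        hence "?T = C" using t(5) by blast
        thus False using t(3) ordD(1)[OF C] by simp
      qed
      hence "colon ?T C = ?m"
        using max_lat(5)[OF t(1) max submod_mono[OF tlD(2)[OF tc] t(5)] s' s] by blast
      thus "x \<in> C" using Qx by (simp add: mem_Q_iff)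
    qed
  qed
qed

lemma len_gor_max:
  assumes T: "order T" and g: "gor T" and m: "m \<in> Specm T"
  shows "len (colon T m) T = len T m"
proof -
  obtain p p' where p: "p * p' = 1" "dual T = (*) p ` T" using g unfolding gor_def by blast
  have "m \<cdot> (dual T) = (*) p ` m"
  proof
    show "m \<cdot> (dual T) \<subseteq> (*) p ` m"
    proof (rule product_least)
      show "additive_subgroup ((*) p ` m)" using tlD(3)[OF tl_scale[OF max_lat(1)[OF T m] p(1)]] .
      fix x y assume "x \<in> m" "y \<in> dual T"
      thus "x * y \<in> (*) p ` m" using p(2) tl_mult[OF max_lat(1)[OF T m], of _ x]
        by (auto simp: image_iff) (metis mult.commute mult.left_commute)
    qed
    have "p * 1 \<in> dual T" unfolding p(2) using ordD(2)[OF T] by (rule imageI)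
    hence "x * p \<in> m \<cdot> (dual T)" if "x \<in> m" for x
      using product_mem[OF that, of p "dual T"] by simp
    thus "(*) p ` m \<subseteq> m \<cdot> (dual T)" by (auto simp: mult.commute)
  qed
  hence "len (colon T m) T = len ((*) p ` T) ((*) p ` m)"
    using len_dual_max[OF T m ordD(5)[OF T]] p(2) by simp
  also have "\<dots> = len T m"
    using len_scale[OF ordD(1)[OF T] tlD(1)[OF max_lat(1)[OF T m]] _ p(1)] max_lat(3)[OF T m] by blast
  finally show ?thesis .
qed

lemma thin_not_gor: assumes "order C" shows "\<not> gor (thin C)"
  using len_gor_max[OF thin_facts(1)[OF assms]] thin_max[OF assms] thin_facts(2,3)[OF assms] by auto

text \<open>If \<open>T\<^sup>\<or> = uT\<close>, then \<open>(T : M) = u\<^sup>-\<^sup>1 M\<^sup>\<or>\<close>, so duality holds for the colon modules of \<open>T\<close>.\<close>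

lemma gor_star:
  assumes T: "order T" and g: "gor T"
  obtains p p' where "p * p' = 1" "\<And>M. tl T M \<Longrightarrow> colon T M = (*) p ` dual M"
proof -
  obtain p p' where p: "p * p' = 1" "dual T = (*) p ` T" using g unfolding gor_def by blast
  have "colon T M = (*) p' ` dual M" if M: "tl T M" for M
  proof -
    have "x \<in> colon T M \<longleftrightarrow> p * x \<in> dual M" for x
    proof
      assume x: "x \<in> colon T M"
      show "p * x \<in> dual M"
      proof (rule colonI)
        fix y assume "y \<in> M"
        hence "p * (x * y) \<in> dual T" using colonD[OF x] p(2) by blast
        hence "p * (x * y) * 1 \<in> I" using colonD ordD(2)[OF T] by blast
        thus "p * x * y \<in> I" by (simp add: mult.assoc)
      qed
    next
      assume x: "p * x \<in> dual M"
      show "x \<in> colon T M"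
      proof (rule colonI)
        fix y assume y: "y \<in> M"
        have "p * (x * y) \<in> dual T"
        proof (rule colonI)
          fix t assume "t \<in> T"
          thus "p * (x * y) * t \<in> I" using colonD[OF x tl_mult[OF M _ y, of t]] by (simp add: mult_ac)
        qed
        thus "x * y \<in> T" using scale_image_mem[OF p(1)] p(2) by simp
      qed
    qed
    thus ?thesis using mem_scale_iff[of p' p] p(1) by (auto simp: mult.commute)
  qed
  thus ?thesis using that[of p' p] p(1) by (simp add: mult.commute)
qed

lemma star_facts:
  assumes T: "order T" and g: "gor T" and M: "tl T M"
  shows "tl T (colon T M)" "colon T (colon T M) = M"
    "\<And>N. tl T N \<Longrightarrow> N \<subseteq> M \<Longrightarrow> len (colon T N) (colon T M) = len M N"
proof -
  show t: "tl T (colon T M)" using tl_colon[OF ordD(5)[OF T] tlD(1)[OF M]] .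
  obtain p p' where p: "p * p' = 1" "\<And>M. tl T M \<Longrightarrow> colon T M = (*) p ` dual M"
    using gor_star[OF T g] by metis
  show "colon T (colon T M) = M"
  proof -
    have "x \<in> colon T (colon T M) \<longleftrightarrow> x \<in> M" for x
    proof -
      have "x \<in> colon T (colon T M) \<longleftrightarrow> p' * x \<in> dual (colon T M)"
        using p(2)[OF t] mem_scale_iff[OF p(1)] by simp
      also have "\<dots> \<longleftrightarrow> (\<forall>y\<in>dual M. p' * x * (p * y) \<in> I)"
        unfolding p(2)[OF M] colon_def[of I "(*) p ` dual M"] by blast
      also have "\<dots> \<longleftrightarrow> x \<in> dual (dual M)"
      proof -
        have "p' * x * (p * y) = (p * p') * (x * y)" for y by (simp add: mult_ac)
        thus ?thesis unfolding colon_def[of I "dual M"] by (simp add: p(1))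
      qed
      finally show ?thesis using dual_dual tlD(1)[OF M] by simp
    qed
    thus ?thesis by blast
  qed
  show "len (colon T N) (colon T M) = len M N" if N: "tl T N" "N \<subseteq> M" for N
    using len_scale[OF dual_lat dual_lat dual_antimono p(1)] len_dual tlD(1) M N p(2) by metis
qed

text \<open>If \<open>T\<^sup>\<or>J = T\<close>, then \<open>wj \<notin> m\<close> for some \<open>w \<in> T\<^sup>\<or>\<close> and \<open>j \<in> J\<close>, and \<open>w\<close> generates \<open>T\<^sup>\<or>\<close> modulo \<open>mT\<^sup>\<or>\<close>.\<close>

lemma gorenstein_iff_gor:
  assumes T: "order T"
  shows "(\<exists>J. submodule_over T J \<and> (dual T) \<cdot> J = T) \<longleftrightarrow> gor T"
proof
  assume g: "gor T"
  then obtain p p' where p: "p * p' = 1" "dual T = (*) p ` T" unfolding gor_def by blast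
  have "(dual T) \<cdot> ((*) p' ` T) = T"
  proof
    show "(dual T) \<cdot> ((*) p' ` T) \<subseteq> T"
    proof (rule product_least[OF tlD(3)[OF ordD(5)[OF T]]])
      fix x y assume "x \<in> dual T" "y \<in> (*) p' ` T"
      then obtain a b where ab: "x = p * a" "y = p' * b" "a \<in> T" "b \<in> T" using p(2) by auto
      have "x * y = (p * p') * (a * b)" by (simp add: ab mult_ac)
      thus "x * y \<in> T" using ordD(3)[OF T ab(3,4)] p(1) by simp
    qed
    show "T \<subseteq> (dual T) \<cdot> ((*) p' ` T)"
    proof
      fix t assume t: "t \<in> T"
      have "p * t \<in> dual T" unfolding p(2) using t by (rule imageI)
      hence "(p * t) * (p' * 1) \<in> (dual T) \<cdot> ((*) p' ` T)"
        using ordD(2)[OF T] by (intro product_mem imageI)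
      moreover have "(p * t) * (p' * 1) = (p * p') * t" by (simp add: mult_ac)
      ultimately show "t \<in> (dual T) \<cdot> ((*) p' ` T)" using p(1) by simp
    qed
  qed
  thus "\<exists>J. submodule_over T J \<and> (dual T) \<cdot> J = T"
    using submod_image[OF ordD(4)[OF T]] by blast
next
  assume "\<exists>J. submodule_over T J \<and> (dual T) \<cdot> J = T"
  then obtain J where J: "submodule_over T J" "(dual T) \<cdot> J = T" by blast
  have D: "tl T (dual T)" using tl_dual ordD[OF T] by blast
  have "len (colon T m) T \<le> len T m" if m: "m \<in> Specm T" for m
  proof -
    note M = max_lat[OF T m]
    obtain w j where wj: "w \<in> dual T" "j \<in> J" "w * j \<notin> m"
      using product_least[OF tlD(3)[OF M(1)], of "dual T" J] J(2) M(3) by blast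
    have wjT: "w * j \<in> T" using product_mem[OF wj(1,2)] J(2) by simp
    obtain u where u: "u \<in> T" "u * (w * j) - 1 \<in> m" using max_prime[OF T m wjT wj(3)] .
    let ?P = "m \<cdot> (dual T)"
    have P: "tl T ?P" "?P \<subseteq> dual T" using tl_max_prod[OF T m D] max_prod_sub[OF T m D] by auto
    note c = cyclic_quotient[OF T P(1) D P(2) wj(1)]
    have "dual T \<subseteq> sum_set ?P ((*) w ` T)"
    proof
      fix z assume z: "z \<in> dual T"
      have zj: "z * j \<in> T" using product_mem[OF z wj(2)] J(2) by simp
      have "(u * (w * j) - 1) * (- z) \<in> ?P"
        using u(2) z subgroupD(3)[OF tlD(3)[OF D]] by (intro product_mem)
      moreover have "w * (u * (z * j)) \<in> (*) w ` T" using ordD(3)[OF T u(1) zj] by blast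
      ultimately have "(u * (w * j) - 1) * (- z) + w * (u * (z * j)) \<in> sum_set ?P ((*) w ` T)"
        by (rule sum_setI)
      thus "z \<in> sum_set ?P ((*) w ` T)" by (simp add: algebra_simps)
    qed
    hence "sum_set ?P ((*) w ` T) = dual T" using c(5) by blast
    hence "len (dual T) ?P = len T {a \<in> T. a * w \<in> ?P}" using c(6) by simp
    also have "\<dots> \<le> len T m"
      using product_mem[OF _ wj(1), of _ m] M(3)
      by (intro len_mono[OF ordD(1)[OF T] tlD(1)[OF c(2)] tlD(1)[OF M(1)]]) auto
    finally show ?thesis using len_dual_max[OF T m ordD(5)[OF T]] by simp
  qed
  thus "gor T" using gor_if_small[OF T] by blast
qed

section \<open>Generating series of lattices\<close>

definition LT :: "'e set \<Rightarrow> 'e set set" where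
  "LT T = {M. tl T M \<and> 1 \<in> M}"

lemma LTD: "M \<in> LT T \<Longrightarrow> tl T M" "M \<in> LT T \<Longrightarrow> 1 \<in> M" "M \<in> LT T \<Longrightarrow> lat M" "M \<in> LT T \<Longrightarrow> T \<subseteq> M"
  unfolding LT_def using tlD one_in_ideal by blast+

lemma finite_LT: assumes "order T" shows "finite {M \<in> LT T. len M T = n}"
proof (rule finite_subset)
  show "{M \<in> LT T. len M T = n} \<subseteq> {P. lat P \<and> T \<subseteq> P \<and> P \<subseteq> (*) (r ^ n) ` T}"
  proof (intro subsetI, elim CollectE conjE)
    fix M assume M: "M \<in> LT T" "len M T = n"
    hence "(*) (Q ^ n) ` M \<subseteq> T" using len_kills[OF LTD(3) ordD(1)[OF assms] LTD(4)] by blast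
    hence "M \<subseteq> (*) (r ^ n) ` T" using mem_scale_iff[OF Qk_rk(2)] by blast
    thus "M \<in> {P. lat P \<and> T \<subseteq> P \<and> P \<subseteq> (*) (r ^ n) ` T}" using LTD M by blast
  qed
  have "T \<subseteq> (*) (r ^ n) ` T"
    using submodD(6)[OF lat_mod[OF ordD(1)[OF assms]] Qk_Z] mem_scale_iff[OF Qk_rk(2)] by blast
  thus "finite {P. lat P \<and> T \<subseteq> P \<and> P \<subseteq> (*) (r ^ n) ` T}"
    using finite_between[OF ordD(1)[OF assms] lat_scale[OF ordD(1)[OF assms] Qk_rk(2)]] by blast
qed

lemma finite_LT': assumes "order T" "X \<subseteq> LT T" shows "finite {M \<in> X. len M T = n}"
  by (rule finite_subset[OF _ finite_LT[OF assms(1), of n]]) (use assms(2) in auto)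

text \<open>
  The base \<open>T\<close> may be smaller than the order over which the lattices in \<open>X\<close> are modules; a change of
  base multiplies the series by a power of \<open>t\<close> (\<open>ser_base\<close>).
\<close>

definition ser :: "'e set \<Rightarrow> 'e set set \<Rightarrow> ('e set \<Rightarrow> rat) \<Rightarrow> rat fps" where
  "ser T X w = Abs_fps (\<lambda>n. \<Sum>M\<in>{M \<in> X. len M T = n}. w M)"

abbreviation cnt :: "'e set \<Rightarrow> 'e set set \<Rightarrow> rat fps" where "cnt T X \<equiv> ser T X (\<lambda>_. 1)"

lemma ser_nth: "ser T X w $ n = (\<Sum>M\<in>{M \<in> X. len M T = n}. w M)"
  unfolding ser_def by simp

lemma ser_add: "ser T X (\<lambda>M. w M + w' M) = ser T X w + ser T X w'"
  by (rule fps_ext) (simp add: ser_nth sum.distrib)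

lemma ser_cmult: "ser T X (\<lambda>M. of_nat c * w M) = of_nat c * ser T X w"
  by (rule fps_ext) (simp add: ser_nth sum_distrib_left flip: fps_of_nat)

lemma ser_cong: "X = Y \<Longrightarrow> (\<And>M. M \<in> Y \<Longrightarrow> w M = w' M) \<Longrightarrow> ser T X w = ser T Y w'"
  by (rule fps_ext) (auto simp: ser_nth intro: sum.cong)

lemma ser_Un:
  assumes "order T" "X \<subseteq> LT T" "Y \<subseteq> LT T" "X \<inter> Y = {}"
  shows "ser T (X \<union> Y) w = ser T X w + ser T Y w"
proof (rule fps_ext)
  fix n
  have "{M \<in> X \<union> Y. len M T = n} = {M \<in> X. len M T = n} \<union> {M \<in> Y. len M T = n}" by blast
  moreover have "{M \<in> X. len M T = n} \<inter> {M \<in> Y. len M T = n} = {}" using assms(4) by blast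
  ultimately show "ser T (X \<union> Y) w $ n = (ser T X w + ser T Y w) $ n"
    using finite_LT'[OF assms(1,2)] finite_LT'[OF assms(1,3)] by (simp add: ser_nth sum.union_disjoint)
qed

lemma ser_split:
  assumes "order T" "X \<subseteq> LT T"
  shows "ser T X w = ser T {M \<in> X. P M} w + ser T {M \<in> X. \<not> P M} w"
proof -
  have "X = {M \<in> X. P M} \<union> {M \<in> X. \<not> P M}" by blast
  thus ?thesis using ser_Un[OF assms(1), of "{M \<in> X. P M}" "{M \<in> X. \<not> P M}" w] assms(2) by auto
qed

lemma ser_if:
  assumes "order T" "X \<subseteq> LT T"
  shows "ser T X (\<lambda>M. if P M then w M else 0) = ser T {M \<in> X. P M} w"
proof -
  have "ser T {M \<in> X. \<not> P M} (\<lambda>M. if P M then w M else 0) = 0"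
    by (rule fps_ext) (simp add: ser_nth)
  moreover have "ser T {M \<in> X. P M} (\<lambda>M. if P M then w M else 0) = ser T {M \<in> X. P M} w"
    by (rule ser_cong) auto
  ultimately show ?thesis using ser_split[OF assms, of "\<lambda>M. if P M then w M else 0" P] by simp
qed

lemma ser_zero [simp]: "ser T X (\<lambda>M. 0) = 0"
  by (rule fps_ext) (simp add: ser_nth)

lemma ser_singleton: assumes "order T" shows "ser T {T} w = fps_const (w T)"
proof (rule fps_ext)
  fix n
  have "{M \<in> {T}. len M T = n} = (if n = 0 then {T} else {})" using ordD(1)[OF assms] by auto
  thus "ser T {T} w $ n = fps_const (w T) $ n" by (simp add: ser_nth)
qed

lemma ser_empty [simp]: "ser T {} w = 0"
  by (rule fps_ext) (simp add: ser_nth)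

lemma ser_base:
  assumes "order T" "order C" "T \<subseteq> C" "X \<subseteq> LT C"
  shows "ser T X w = fps_X ^ len C T * ser C X w"
proof (rule fps_ext)
  fix n
  have l: "len M T = len M C + len C T" if "M \<in> X" for M
    using len_add[OF LTD(3) ordD(1)[OF assms(2)] ordD(1)[OF assms(1)] assms(3) LTD(4)] that assms(4) by blast
  have "{M \<in> X. len M T = n} = (if n < len C T then {} else {M \<in> X. len M C = n - len C T})"
    using l by auto
  thus "ser T X w $ n = (fps_X ^ len C T * ser C X w) $ n"
    by (simp add: ser_nth fps_X_power_mult_nth)
qed

lemma ser_bij:
  assumes "bij_betw f X Y" "\<And>M. M \<in> X \<Longrightarrow> len (f M) T = len M T + k"
  shows "ser T Y w = fps_X ^ k * ser T X (\<lambda>M. w (f M))"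
proof (rule fps_ext)
  fix n
  show "ser T Y w $ n = (fps_X ^ k * ser T X (\<lambda>M. w (f M))) $ n"
  proof (cases "n < k")
    case True
    have "{M \<in> Y. len M T = n} = {}"
    proof -
      have "len M T \<ge> k" if "M \<in> Y" for M
        using that assms(2) bij_betw_imp_surj_on[OF assms(1)] by (metis imageE le_add2)
      thus ?thesis using True by fastforce
    qed
    thus ?thesis using True by (simp only: ser_nth fps_X_power_mult_nth sum.empty if_True)
  next
    case False
    have "bij_betw f {M \<in> X. len M T = n - k} {M \<in> Y. len M T = n}"
    proof (rule bij_betw_subset[OF assms(1)])
      show "f ` {M \<in> X. len M T = n - k} = {M \<in> Y. len M T = n}"
      proof (intro equalityI subsetI)
        fix M assume "M \<in> f ` {M \<in> X. len M T = n - k}"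
        thus "M \<in> {M \<in> Y. len M T = n}"
          using assms(2) bij_betw_imp_surj_on[OF assms(1)] False by auto
      next
        fix M assume M: "M \<in> {M \<in> Y. len M T = n}"
        then obtain N where "N \<in> X" "M = f N" using bij_betw_imp_surj_on[OF assms(1)] by blast
        thus "M \<in> f ` {M \<in> X. len M T = n - k}" using M assms(2)[of N] by auto
      qed
    qed blast
    hence "(\<Sum>M\<in>{M \<in> Y. len M T = n}. w M) = (\<Sum>M\<in>{M \<in> X. len M T = n - k}. w (f M))"
      by (rule sum.reindex_bij_betw[symmetric])
    thus ?thesis using False by (simp add: ser_nth fps_X_power_mult_nth)
  qed
qed

text \<open>Both sides count the pairs \<open>(x, y)\<close> with \<open>R x y\<close> by the length of \<open>y\<close>.\<close>

lemma ser_double: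
  assumes T: "order T" and X: "X \<subseteq> LT T" "Y \<subseteq> LT T"
    and R: "\<And>x y. x \<in> X \<Longrightarrow> y \<in> Y \<Longrightarrow> R x y \<Longrightarrow> len y T = len x T + k"
  shows "ser T Y (\<lambda>y. of_nat (card {x \<in> X. R x y})) = fps_X ^ k * ser T X (\<lambda>x. of_nat (card {y \<in> Y. R x y}))"
proof (rule fps_ext)
  fix n
  show "ser T Y (\<lambda>y. of_nat (card {x \<in> X. R x y})) $ n
      = (fps_X ^ k * ser T X (\<lambda>x. of_nat (card {y \<in> Y. R x y}))) $ n"
  proof (cases "n < k")
    case True
    have e: "{x \<in> X. R x y} = {}" if "y \<in> {y \<in> Y. len y T = n}" for y
      using R[of _ y] that True by force
    hence "(\<Sum>y\<in>{y \<in> Y. len y T = n}. of_nat (card {x \<in> X. R x y}) :: rat) = 0"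
      by (intro sum.neutral ballI) (simp only: e card.empty of_nat_0)
    thus ?thesis using True by (simp add: ser_nth fps_X_power_mult_nth)
  next
    case False
    let ?X = "{x \<in> X. len x T = n - k}" and ?Y = "{y \<in> Y. len y T = n}"
    have f: "finite ?X" "finite ?Y" using finite_LT'[OF T] X by auto
    have "{x \<in> X. R x y} = {x \<in> ?X. R x y}" if "y \<in> ?Y" for y
      using R[of _ y] that by force
    moreover have "{y \<in> Y. R x y} = {y \<in> ?Y. R x y}" if "x \<in> ?X" for x
      using R[of x] that False by force
    moreover have "(\<Sum>y\<in>?Y. card {x \<in> ?X. R x y}) = (\<Sum>x\<in>?X. card {y \<in> ?Y. R x y})"
      using sum_multicount_gen[OF f, of R "\<lambda>y. card {x \<in> ?X. R x y}"] by simp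
    ultimately have "(\<Sum>y\<in>?Y. card {x \<in> X. R x y}) = (\<Sum>x\<in>?X. card {y \<in> Y. R x y})" by simp
    hence "(\<Sum>y\<in>?Y. of_nat (card {x \<in> X. R x y}) :: rat) = (\<Sum>x\<in>?X. of_nat (card {y \<in> Y. R x y}))"
      by (simp only: flip: of_nat_sum)
    thus ?thesis using False by (simp add: ser_nth fps_X_power_mult_nth)
  qed
qed

definition J :: "'e set \<Rightarrow> rat fps" where "J T = cnt T (LT T)"

definition zeta :: "'e set \<Rightarrow> rat fps" where
  "zeta T = (\<Prod>m\<in>Specm T. inverse (1 - fps_X ^ len T m))"

definition OV :: "'e set \<Rightarrow> 'e set set" where "OV T = {S. order S \<and> T \<subseteq> S}"

definition h :: "'e set \<Rightarrow> rat fps" where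
  "h T = (if gor T then 1 else 1 + of_nat q * fps_X)"

definition L :: "'e set \<Rightarrow> rat fps" where
  "L T = (\<Sum>S\<in>OV T. of_nat (q ^ len S T) * fps_X ^ (2 * len S T) * h S * zeta S)"

lemma euler_factor_unit:
  assumes "k > 0" shows "(1 - fps_X ^ k) * inverse (1 - fps_X ^ k :: rat fps) = 1"
  by (rule inverse_mult_eq_1') (use assms in \<open>simp add: fps_X_power_nth\<close>)

lemma inverse_unique_fps:
  assumes "a * b = (1 :: rat fps)" "a * c = 1" shows "b = c"
proof -
  have "b = (a * c) * b" by (simp add: assms(2))
  also have "\<dots> = (a * b) * c" by (simp add: mult_ac)
  finally show ?thesis by (simp add: assms(1))
qed

lemma zeta_mult:
  assumes T: "order T" shows "(\<Prod>m\<in>Specm T. 1 - fps_X ^ len T m) * zeta T = 1"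
  unfolding zeta_def prod.distrib[symmetric]
  by (rule prod.neutral) (use euler_factor_unit len_max_pos[OF T] in blast)

lemma finite_OV: assumes "order T" shows "finite (OV T)"
proof (rule finite_subset)
  show "OV T \<subseteq> {P. lat P \<and> T \<subseteq> P \<and> P \<subseteq> dual T}"
  proof
    fix S assume "S \<in> OV T"
    hence S: "order S" "T \<subseteq> S" unfolding OV_def by auto
    have "S \<subseteq> dual T"
    proof (intro subsetI colonI)
      fix x y assume "x \<in> S" "y \<in> T"
      thus "x * y \<in> I" using ordD(3)[OF S(1)] S(2) order_trace[OF S(1)] by blast
    qed
    thus "S \<in> {P. lat P \<and> T \<subseteq> P \<and> P \<subseteq> dual T}" using S ordD(1) by blast
  qed
  have "T \<subseteq> dual T"
    using ordD(3)[OF assms] order_trace[OF assms] by (blast intro: colonI)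
  thus "finite {P. lat P \<and> T \<subseteq> P \<and> P \<subseteq> dual T}"
    using finite_between[OF ordD(1)[OF assms] dual_lat[OF ordD(1)[OF assms]]] by blast
qed

text \<open>
  Multiplication by \<open>(T : n)\<close> is a bijection from the lattices in the first series onto those among them
  with \<open>1 \<in> nM\<close>, and it raises the length by that of \<open>T/n\<close>.
\<close>

lemma euler_step:
  assumes T: "order T" and n: "n \<in> Specm T" "invertible T n"
    and S: "S \<subseteq> Specm T" "n \<notin> S"
    and P: "\<And>M. tl T M \<Longrightarrow> P (n \<cdot> M) \<longleftrightarrow> P M"
  shows "(1 - fps_X ^ len T n) * cnt T {M \<in> LT T. P M \<and> (\<forall>k\<in>S. 1 \<notin> k \<cdot> M)}
    = cnt T {M \<in> LT T. P M \<and> (\<forall>k\<in>insert n S. 1 \<notin> k \<cdot> M)}"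
proof -
  let ?X = "{M \<in> LT T. P M \<and> (\<forall>k\<in>S. 1 \<notin> k \<cdot> M)}"
  let ?n = "submodule_product n" and ?c = "submodule_product (colon T n)"
  have canc: "?n (?c M) = M" "?c (?n M) = M" if "tl T M" for M
    using invertible_cancel[OF T n that] by auto
  have bij: "bij_betw ?c ?X {M \<in> ?X. 1 \<in> ?n M}"
  proof (rule bij_betw_byWitness[where f' = ?n])
    show "\<forall>a\<in>?X. ?n (?c a) = a" "\<forall>a'\<in>{M \<in> ?X. 1 \<in> ?n M}. ?c (?n a') = a'"
      using canc LTD(1) by blast+
    show "?n ` {M \<in> ?X. 1 \<in> ?n M} \<subseteq> ?X"
    proof (intro subsetI)
      fix L assume "L \<in> ?n ` {M \<in> ?X. 1 \<in> ?n M}"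
      then obtain M where M: "M \<in> LT T" "P M" "\<forall>k\<in>S. 1 \<notin> k \<cdot> M" "1 \<in> ?n M" "L = ?n M"
        by blast
      have "1 \<notin> k \<cdot> L" if "k \<in> S" for k
        using M(3) that product_mono[OF order_refl max_prod_sub[OF T n(1) LTD(1)[OF M(1)]], of k] M(5)
        by blast
      thus "L \<in> ?X"
        using M P[OF LTD(1)[OF M(1)]] tl_max_prod[OF T n(1) LTD(1)[OF M(1)]] unfolding LT_def by blast
    qed
    show "?c ` ?X \<subseteq> {M \<in> ?X. 1 \<in> ?n M}"
    proof (intro subsetI)
      fix M assume "M \<in> ?c ` ?X"
      then obtain L where L: "L \<in> LT T" "P L" "\<forall>k\<in>S. 1 \<notin> k \<cdot> L" "M = ?c L" by blast
      have tM: "tl T M" using tl_colon_product[OF T n(1) LTD(1)[OF L(1)]] L(4) by simp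
      have nM: "?n M = L" using canc(1)[OF LTD(1)[OF L(1)]] L(4) by simp
      have one: "1 \<in> M" using colon_product_upper[OF T n(1) LTD(1)[OF L(1)]] LTD(2)[OF L(1)] L(4) by blast
      have "1 \<notin> k \<cdot> M" if k: "k \<in> S" for k
      proof
        assume h: "1 \<in> k \<cdot> M"
        have kk: "k \<in> Specm T" "n \<noteq> k" using k S by auto
        obtain a where a: "a \<in> n" "a - 1 \<in> k" using max_comaximal[OF T n(1) kk] .
        have tk: "tl T (k \<cdot> L)" using tl_max_prod[OF T kk(1) LTD(1)[OF L(1)]] .
        have "a * 1 \<in> n \<cdot> (k \<cdot> M)" using a(1) h by (rule product_mem)
        also have "n \<cdot> (k \<cdot> M) = k \<cdot> L"
          using nM by (metis product_assoc product_commute)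
        finally have "a * 1 \<in> k \<cdot> L" .
        moreover have "(a - 1) * 1 \<in> k \<cdot> L"
          using a(2) LTD(2)[OF L(1)] by (rule product_mem)
        ultimately have "a * 1 - (a - 1) * 1 \<in> k \<cdot> L" by (rule tl_diff[OF tk])
        thus False using L(3) k by simp
      qed
      thus "M \<in> {M \<in> ?X. 1 \<in> ?n M}"
        using tM one nM L(2) P[OF tM] LTD(2)[OF L(1)] unfolding LT_def by simp
    qed
  qed
  have "len (?c M) T = len M T + len T n" if "M \<in> ?X" for M
  proof -
    have M: "M \<in> LT T" using that by blast
    have c: "tl T (?c M)" using tl_colon_product[OF T n(1) LTD(1)[OF M]] .
    have "len (?c M) M = len T n"
      using len_inv_product[OF T n c] canc(1)[OF LTD(1)[OF M]] by simp
    thus ?thesis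
      using len_add[OF tlD(1)[OF c] LTD(3)[OF M] ordD(1)[OF T] LTD(4)[OF M] colon_product_upper[OF T n(1) LTD(1)[OF M]]]
      by simp
  qed
  hence "cnt T {M \<in> ?X. 1 \<in> ?n M} = fps_X ^ len T n * cnt T ?X"
    by (rule ser_bij[OF bij])
  moreover have "cnt T ?X = cnt T {M \<in> ?X. 1 \<in> ?n M} + cnt T {M \<in> ?X. \<not> 1 \<in> ?n M}"
    by (rule ser_split[OF T]) blast
  moreover have "{M \<in> ?X. \<not> 1 \<in> ?n M} = {M \<in> LT T. P M \<and> (\<forall>k\<in>insert n S. 1 \<notin> k \<cdot> M)}"
    by blast
  ultimately show ?thesis by (simp add: algebra_simps)
qed

lemma euler_product:
  assumes T: "order T" and "finite U" "U \<subseteq> {n \<in> Specm T. invertible T n}"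
    and S: "S \<subseteq> Specm T" "S \<inter> U = {}"
    and P: "\<And>M n. n \<in> U \<Longrightarrow> tl T M \<Longrightarrow> P (n \<cdot> M) \<longleftrightarrow> P M"
  shows "(\<Prod>n\<in>U. 1 - fps_X ^ len T n) * cnt T {M \<in> LT T. P M \<and> (\<forall>k\<in>S. 1 \<notin> k \<cdot> M)}
    = cnt T {M \<in> LT T. P M \<and> (\<forall>k\<in>U \<union> S. 1 \<notin> k \<cdot> M)}"
  using assms(2,3,5,6)
proof (induction U)
  case (insert n U)
  let ?s = "\<lambda>V. cnt T {M \<in> LT T. P M \<and> (\<forall>k\<in>V. 1 \<notin> k \<cdot> M)}"
  have IH: "(\<Prod>n\<in>U. 1 - fps_X ^ len T n) * ?s S = ?s (U \<union> S)" using insert by simp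
  have "(\<Prod>n\<in>insert n U. 1 - fps_X ^ len T n) * ?s S = (1 - fps_X ^ len T n) * ?s (U \<union> S)"
    using insert(1,2) by (simp add: mult.assoc IH)
  also have "\<dots> = ?s (insert n (U \<union> S))"
    by (rule euler_step[OF T]) (use insert S in auto)
  finally show ?case by simp
qed simp

lemma simple_colon:
  assumes T: "order T" and s: "simple T T N" and le: "len (colon T (annq T T N)) T = len T (annq T T N)"
  shows "N = colon T (annq T T N)"
proof -
  let ?m = "annq T T N"
  have m: "?m \<in> Specm T" using simple_max(1)[OF T s] .
  have N: "tl T N" "T \<subseteq> N" using s unfolding simple_def by auto
  have "N \<subseteq> colon T ?m" unfolding annq_def by (auto intro!: colonI simp: mult.commute)
  thus ?thesis
    using len_eq[OF tlD(1)[OF tl_colon_max[OF T m]] tlD(1)[OF N(1)] ordD(1)[OF T] N(2)] le simple_max(2)[OF T s] by simp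
qed

lemma invertible_not_sub:
  assumes T: "order T" and S: "order S" "T \<subseteq> S" and m: "m \<in> Specm T" "invertible T m"
  shows "\<not> colon T m \<subseteq> S"
proof
  assume h: "colon T m \<subseteq> S"
  have tS: "tl T S" using tl_mono[OF ordD(5)[OF S(1)] S(2)] .
  let ?P = "m \<cdot> S"
  have "T \<subseteq> ?P" using invertible_product[OF T m] product_mono[OF order_refl h, of m] by simp
  hence "S \<subseteq> ?P"
    using one_in_ideal[OF submod_product[OF ordD(4)[OF S(1)], of m]] ordD(2)[OF T] by blast
  hence "?P = S" using max_prod_sub[OF T m(1) tS] by blast
  thus False
    using len_inv_product[OF T m tS] len_max_pos[OF T m(1)] ordD(1)[OF S(1)] by simp
qed

text \<open>
  The Euler factors of all maximal ideals leave only the lattice \<open>T\<close>. A larger order would contain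
  \<open>(T : m)\<close> for some \<open>m\<close>, which is impossible if \<open>(T : m)m = T\<close>.
\<close>

lemma all_invertible:
  assumes T: "order T" and inv: "\<And>m. m \<in> Specm T \<Longrightarrow> invertible T m"
  shows "gor T" "OV T = {T}" "J T = zeta T" "L T = zeta T"
proof -
  show g: "gor T" using gor_if_small[OF T] len_colon_invertible[OF T _ inv] by simp
  have no: "S = T" if S: "order S" "T \<subseteq> S" for S
  proof (rule ccontr)
    assume "S \<noteq> T"
    then obtain N where N: "simple T T N" "N \<subseteq> S"
      using exists_simple[OF T ordD(5)[OF T] tl_mono[OF ordD(5)[OF S(1)] S(2)]] S(2) by blast
    have m: "annq T T N \<in> Specm T" using simple_max(1)[OF T N(1)] .
    thus False
      using simple_colon[OF T N(1) len_colon_invertible[OF T m inv[OF m]]] N(2) invertible_not_sub[OF T S m inv[OF m]]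
      by simp
  qed
  thus O: "OV T = {T}" unfolding OV_def using T by auto
  let ?MM = "Specm T"
  have "?MM \<subseteq> {n \<in> ?MM. invertible T n}" using inv by blast
  moreover have "{M \<in> LT T. True \<and> (\<forall>k\<in>?MM \<union> {}. 1 \<notin> k \<cdot> M)} = {T}"
  proof (intro equalityI subsetI)
    fix M assume M: "M \<in> {M \<in> LT T. True \<and> (\<forall>k\<in>?MM \<union> {}. 1 \<notin> k \<cdot> M)}"
    show "M \<in> {T}"
    proof (rule ccontr)
      assume "M \<notin> {T}"
      then obtain N where N: "simple T T N" "N \<subseteq> M"
        using exists_simple[OF T ordD(5)[OF T], of M] LTD[of M T] M by blast
      have m: "annq T T N \<in> ?MM" using simple_max(1)[OF T N(1)] .
      have e: "N = colon T (annq T T N)" using simple_colon[OF T N(1) len_colon_invertible[OF T m inv[OF m]]] .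
      have "1 \<in> (annq T T N) \<cdot> N"
        using invertible_product[OF T m inv[OF m]] ordD(2)[OF T] e by simp
      thus False using M m product_mono[OF order_refl N(2)] by blast
    qed
  next
    fix M assume "M \<in> {T}"
    moreover have "k \<cdot> T = k" if "k \<in> ?MM" for k
      using product_unit[OF T max_lat(1)[OF T that]] by (simp add: product_commute)
    ultimately show "M \<in> {M \<in> LT T. True \<and> (\<forall>k\<in>?MM \<union> {}. 1 \<notin> k \<cdot> M)}"
      using max_lat(4)[OF T] ordD[OF T] unfolding LT_def by auto
  qed
  ultimately have "(\<Prod>n\<in>?MM. 1 - fps_X ^ len T n) * J T = 1"
    using euler_product[OF T finite_max[OF T], of "{}" "\<lambda>_. True"] ser_singleton[OF T, of "\<lambda>_. 1"]
    unfolding J_def by simp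
  thus "J T = zeta T"
    using zeta_mult[OF T] by (rule inverse_unique_fps)
  show "L T = zeta T" unfolding L_def O using g ordD(1)[OF T] by (simp add: h_def)
qed

section \<open>A Hecke correspondence\<close>

lemma residue_one:
  assumes T: "order T" and m: "m \<in> Specm T" and l: "len T m = 1"
  shows "T = line m 1"
proof -
  note M = max_lat[OF T m]
  have lm: "lat m" using tlD(1)[OF M(1)] .
  have "Q * 1 \<in> m" using M(2) ordD(2)[OF T] by blast
  hence "len (line m 1) m = 1" using line_len[OF lm M(4)] by simp
  moreover have "line m 1 \<subseteq> T" using line_least[OF lat_mod[OF ordD(1)[OF T]] _ ordD(2)[OF T]] M(3) by blast
  ultimately show ?thesis
    using len_eq[OF ordD(1)[OF T] line_lat[OF lm] lm line_upper(1)[OF lat_mod[OF lm]]] l by (metis order_refl)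
qed

lemma tl_if_killed:
  assumes T: "order T" and m: "m \<in> Specm T" and l: "len T m = 1"
    and N: "tl T N" and P: "lat P" "N \<subseteq> P" "P \<subseteq> colon N m"
  shows "tl T P"
proof -
  have "a * x \<in> P" if a: "a \<in> T" and x: "x \<in> P" for a x
  proof -
    have "a \<in> line m 1" using residue_one[OF T m l] a by simp
    then obtain b z where b: "a = b + z * 1" "b \<in> m" "z \<in> Z" by (rule lineE)
    have "x * b \<in> N" using colonD[OF _ b(2)] P(3) x by blast
    moreover have "z * x \<in> P" using submodD(6)[OF lat_mod[OF P(1)] b(3) x] .
    ultimately have "x * b + z * x \<in> P" using subgroupD(4)[OF lat_add[OF P(1)]] P(2) by blast
    thus ?thesis by (simp add: b(1) algebra_simps)
  qed
  thus ?thesis using P(1) lat_add unfolding tl_def submodule_over_def by blast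
qed

lemma product_sub_iff:
  assumes N: "additive_subgroup N" shows "m \<cdot> M \<subseteq> N \<longleftrightarrow> M \<subseteq> colon N m"
proof
    assume h: "m \<cdot> M \<subseteq> N"
    show "M \<subseteq> colon N m"
    proof (intro subsetI colonI)
      fix x y assume "x \<in> M" "y \<in> m"
      thus "x * y \<in> N" using h product_mem[of y m x M] by (auto simp: mult.commute)
    qed
  next
    assume h: "M \<subseteq> colon N m"
    show "m \<cdot> M \<subseteq> N"
    proof (rule product_least[OF N])
      fix x y assume "x \<in> m" "y \<in> M"
      thus "x * y \<in> N" using h colonD[of y N m x] by (auto simp: mult.commute)
    qed
qed

lemma Q_kills_colon:
  assumes T: "order T" and m: "m \<in> Specm T" and N: "tl T N"
  shows "(*) Q ` colon N m \<subseteq> N" "tl T (colon N m)" "N \<subseteq> colon N m"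
proof -
  have "Q * 1 \<in> m" using max_lat(2)[OF T m] ordD(2)[OF T] by blast
  thus "(*) Q ` colon N m \<subseteq> N" using colonD[of _ N m Q] by (auto simp: mult.commute)
  show "tl T (colon N m)" using tl_colon[OF N tlD(1)[OF max_lat(1)[OF T m]]] .
  show "N \<subseteq> colon N m" using tl_mult[OF N] max_lat(3)[OF T m] by (intro subsetI colonI) (metis mult.commute psubsetD)
qed

lemma Q_kills_quotient:
  assumes T: "order T" and m: "m \<in> Specm T" and M: "tl T M"
  shows "(*) Q ` M \<subseteq> m \<cdot> M"
proof -
  have "Q * 1 \<in> m" using max_lat(2)[OF T m] ordD(2)[OF T] by blast
  thus ?thesis using product_mem[of Q m _ M] by auto
qed

text \<open>As \<open>T = Z + m\<close>, every \<open>Z\<close>-module between \<open>N\<close> and \<open>(N : m)\<close> is a \<open>T\<close>-module.\<close>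

lemma extensions_eq_lines:
  assumes T: "order T" and m: "m \<in> Specm T" and l: "len T m = 1" and N: "N \<in> LT T"
  shows "{M \<in> LT T. N \<subseteq> M \<and> m \<cdot> M \<subseteq> N \<and> len M N = 1} = lines N (colon N m)"
proof (intro equalityI subsetI)
  fix M assume "M \<in> {M \<in> LT T. N \<subseteq> M \<and> m \<cdot> M \<subseteq> N \<and> len M N = 1}"
  thus "M \<in> lines N (colon N m)"
    using LTD(3) product_sub_iff[OF lat_add[OF LTD(3)[OF N]]] unfolding lines_def by blast
next
  fix M assume "M \<in> lines N (colon N m)"
  hence M: "lat M" "N \<subseteq> M" "M \<subseteq> colon N m" "len M N = 1" unfolding lines_def by auto
  thus "M \<in> {M \<in> LT T. N \<subseteq> M \<and> m \<cdot> M \<subseteq> N \<and> len M N = 1}"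
    using tl_if_killed[OF T m l LTD(1)[OF N] M(1-3)] LTD(2)[OF N]
      product_sub_iff[OF lat_add[OF LTD(3)[OF N]], of m M] unfolding LT_def by blast
qed

text \<open>
  Both sides count the pairs \<open>N \<subseteq> M\<close> with \<open>1 \<in> N\<close> and \<open>M/N \<cong> T/m\<close>: for given \<open>N\<close> these are the lines in
  \<open>(N : m)/N\<close>, for given \<open>M\<close> the hyperplanes in \<open>M/mM\<close> that contain the class of \<open>1\<close>.
\<close>

lemma hecke:
  assumes T: "order T" and m: "m \<in> Specm T" and l: "len T m = 1"
  shows "ser T (LT T) (\<lambda>M. of_nat (gauss (len M (m \<cdot> M) -
        (if 1 \<in> m \<cdot> M then 0 else 1))))
    = fps_X * ser T (LT T) (\<lambda>M. of_nat (gauss (len (colon M m) M)))"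
proof -
  let ?m = "submodule_product m"
  let ?R = "\<lambda>N M. N \<subseteq> M \<and> ?m M \<subseteq> N \<and> len M N = 1"
  have up: "card {M \<in> LT T. ?R N M} = gauss (len (colon N m) N)" if N: "N \<in> LT T" for N
  proof -
    note k = Q_kills_colon[OF T m LTD(1)[OF N]]
    have "{M \<in> LT T. ?R N M} = lines N (colon N m)" by (rule extensions_eq_lines[OF T m l N])
    thus ?thesis using card_lines[OF LTD(3)[OF N] tlD(1)[OF k(2)] k(3,1)] by simp
  qed
  have down: "card {N \<in> LT T. ?R N M} = gauss (len M (?m M) - (if 1 \<in> ?m M then 0 else 1))"
    if M: "M \<in> LT T" for M
  proof -
    have mM: "tl T (?m M)" "?m M \<subseteq> M" using tl_max_prod[OF T m] max_prod_sub[OF T m] LTD(1)[OF M] by auto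
    let ?B = "if 1 \<in> ?m M then ?m M else line (?m M) 1"
    have Q1: "Q * 1 \<in> ?m M" using Q_kills_quotient[OF T m LTD(1)[OF M]] LTD(2)[OF M] by blast
    have lm: "lat (?m M)" using tlD(1)[OF mM(1)] .
    have B: "lat ?B" "?m M \<subseteq> ?B" "?B \<subseteq> M" "1 \<in> ?B"
      and lB: "len M ?B = len M (?m M) - (if 1 \<in> ?m M then 0 else 1)"
    proof -
      have l: "lat (line (?m M) 1)" "?m M \<subseteq> line (?m M) 1" "1 \<in> line (?m M) 1" "line (?m M) 1 \<subseteq> M"
        using line_lat[OF lm] line_upper[OF lat_mod[OF lm]]
          line_least[OF lat_mod[OF LTD(3)[OF M]] mM(2) LTD(2)[OF M]] by auto
      thus "lat ?B" "?m M \<subseteq> ?B" "?B \<subseteq> M" "1 \<in> ?B" using lm mM(2) by auto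
      have "len M (line (?m M) 1) = len M (?m M) - 1" if "1 \<notin> ?m M"
        using line_len[OF lm that Q1] len_add[OF LTD(3)[OF M] l(1) lm l(2,4)] by simp
      thus "len M ?B = len M (?m M) - (if 1 \<in> ?m M then 0 else 1)" by simp
    qed
    have "{N \<in> LT T. ?R N M} = hyperplanes ?B M"
    proof (intro equalityI subsetI)
      fix N assume N: "N \<in> {N \<in> LT T. ?R N M}"
      hence "?B \<subseteq> N" using line_least[OF lat_mod[OF LTD(3)], of N T "?m M" 1] LTD(2) by auto
      thus "N \<in> hyperplanes ?B M" using N LTD(3) unfolding hyperplanes_def by blast
    next
      fix N assume "N \<in> hyperplanes ?B M"
      hence N: "lat N" "?B \<subseteq> N" "N \<subseteq> M" "len M N = 1" unfolding hyperplanes_def by auto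
      have "N \<subseteq> colon (?m M) m"
        using N(3) product_sub_iff[OF tlD(3)[OF mM(1)], of m M] by blast
      hence "tl T N" using tl_if_killed[OF T m l mM(1) N(1)] B(2) N(2) by blast
      thus "N \<in> {N \<in> LT T. ?R N M}" using N B(2,4) unfolding LT_def by blast
    qed
    moreover have "(*) Q ` M \<subseteq> ?B" using Q_kills_quotient[OF T m LTD(1)[OF M]] B(2) by blast
    ultimately show ?thesis using card_hyperplanes(1)[OF B(1) LTD(3)[OF M] B(3)] lB by simp
  qed
  have "len M T = len N T + 1" if "N \<in> LT T" "?R N M" "M \<in> LT T" for N M
    using len_add[OF LTD(3)[OF that(3)] LTD(3)[OF that(1)] ordD(1)[OF T] LTD(4)[OF that(1)]] that(2) by simp
  hence "ser T (LT T) (\<lambda>M. of_nat (card {N \<in> LT T. ?R N M}))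
      = fps_X ^ 1 * ser T (LT T) (\<lambda>N. of_nat (card {M \<in> LT T. ?R N M}))"
    by (intro ser_double[OF T order_refl order_refl]) blast
  moreover have "ser T (LT T) (\<lambda>M. of_nat (card {N \<in> LT T. ?R N M}))
      = ser T (LT T) (\<lambda>M. of_nat (gauss (len M (?m M) - (if 1 \<in> ?m M then 0 else 1))))"
    by (rule ser_cong) (use down in simp_all)
  moreover have "ser T (LT T) (\<lambda>N. of_nat (card {M \<in> LT T. ?R N M}))
      = ser T (LT T) (\<lambda>M. of_nat (gauss (len (colon M m) M)))"
    by (rule ser_cong) (use up in simp_all)
  ultimately show ?thesis by simp
qed

section \<open>Residue degrees\<close>

definition inter :: "'e set \<Rightarrow> 'e set set \<Rightarrow> 'e set" where
  "inter T S = {x \<in> T. \<forall>n\<in>S. x \<in> n}"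

lemma inter_facts:
  assumes T: "order T" and "S \<subseteq> Specm T"
  shows "tl T (inter T S) \<and> len T (inter T S) = (\<Sum>n\<in>S. len T n) \<and> (*) Q ` T \<subseteq> inter T S"
proof -
  have "finite S" using assms finite_max finite_subset by blast
  thus ?thesis using assms(2)
  proof (induction S)
    case empty
    have "inter T {} = T" unfolding inter_def by simp
    thus ?case using ordD(5)[OF T] ordD(1)[OF T] Q_sub[OF ordD(1)[OF T]] by simp
  next
    case (insert n S)
    let ?A = "inter T S"
    have n: "n \<in> Specm T" using insert by simp
    note N = max_lat[OF T n]
    have A: "tl T ?A" "len T ?A = (\<Sum>n\<in>S. len T n)" "(*) Q ` T \<subseteq> ?A" using insert by auto
    have AT: "?A \<subseteq> T" unfolding inter_def by blast
    have e: "inter T (insert n S) = ?A \<inter> n" unfolding inter_def by blast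
    obtain a where a: "a \<in> T" "a - 1 \<in> n" "\<And>k. k \<in> Specm T \<Longrightarrow> k \<noteq> n \<Longrightarrow> a \<in> k"
      by (rule crt_idempotent[OF T n]) blast
    have "a \<in> ?A" unfolding inter_def using a insert by blast
    moreover have "- (a - 1) \<in> n" using subgroupD(3)[OF tlD(3)[OF N(1)] a(2)] .
    ultimately have "a + - (a - 1) \<in> sum_set ?A n" by (rule sum_setI)
    hence one: "1 \<in> sum_set ?A n" by simp
    have s: "sum_set ?A n \<subseteq> T" using sum_set_least[OF tlD(3)[OF ordD(5)[OF T]] AT] N(3) by blast
    have "sum_set ?A n = T" using one_in_ideal[OF tlD(2)[OF tl_sum[OF A(1) N(1)]] one] s by blast
    hence "len ?A (?A \<inter> n) = len T n" using len_sum_Int[OF tlD(1)[OF A(1)] tlD(1)[OF N(1)]] by simp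
    moreover have t: "tl T (?A \<inter> n)" using tl_Int[OF A(1) N(1)] .
    ultimately have "len T (?A \<inter> n) = len T ?A + len T n"
      using len_add[OF ordD(1)[OF T] tlD(1)[OF A(1)] tlD(1)[OF t]] AT by simp
    thus ?case using e t A insert(1,2) N(2) by (simp add: add.commute)
  qed
qed

lemma sum_residue_le_3: assumes T: "order T" shows "(\<Sum>n\<in>Specm T. len T n) \<le> 3"
proof -
  have i: "tl T (inter T (Specm T))" "len T (inter T (Specm T)) = (\<Sum>n\<in>Specm T. len T n)"
    "(*) Q ` T \<subseteq> inter T (Specm T)" "inter T (Specm T) \<subseteq> T"
    using inter_facts[OF T order_refl] unfolding inter_def by auto
  thus ?thesis
    using len_mono(2)[OF ordD(1)[OF T] tlD(1)[OF i(1)] lat_Q[OF ordD(1)[OF T]] i(3,4)] len_Q[OF ordD(1)[OF T]]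
    by simp
qed

section \<open>Gorenstein orders with a maximal ideal that is not invertible\<close>

text \<open>For \<open>c \<in> (T : m)\<close> the square of \<open>qc\<close> is in \<open>qT\<close>, because \<open>(T : m)m \<subseteq> m\<close>.\<close>

lemma noninvertible_radical:
  assumes T: "order T" and m: "m \<in> Specm T" and ninv: "\<not> invertible T m"
  shows "tl T ((*) Q ` colon T m)" "(*) Q ` T \<subseteq> (*) Q ` colon T m"
    "(*) Q ` colon T m \<subseteq> inter T (Specm T)"
proof -
  note C = ninv_order[OF T m ninv]
  show "tl T ((*) Q ` colon T m)" using tl_Q[OF tl_colon_max[OF T m]] .
  show "(*) Q ` T \<subseteq> (*) Q ` colon T m" using C(3) by blast
  have Qm: "Q \<in> m" using max_lat(2)[OF T m] ordD(2)[OF T] by (metis image_subset_iff mult_1_right)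
  have QC: "Q * c \<in> m" if "c \<in> colon T m" for c
    using tl_mult[OF C(2) that Qm] by (simp add: mult.commute)
  show "(*) Q ` colon T m \<subseteq> inter T (Specm T)"
  proof
    fix x assume "x \<in> (*) Q ` colon T m"
    then obtain c where c: "c \<in> colon T m" "x = Q * c" by blast
    have xT: "x \<in> T" using QC[OF c(1)] c(2) max_lat(3)[OF T m] by blast
    have "c * (Q * c) \<in> T" using tl_mult[OF C(2) c(1) QC[OF c(1)]] max_lat(3)[OF T m] by blast
    hence "Q * (c * (Q * c)) \<in> (*) Q ` T" by blast
    hence xx: "x * x \<in> (*) Q ` T" by (simp add: c(2) mult.assoc)
    have "x \<in> n" if n: "n \<in> Specm T" for n
    proof (rule ccontr)
      assume "x \<notin> n"
      thus False using max_prod[OF T n xT _ xT] xx max_lat(2)[OF T n] by blast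
    qed
    thus "x \<in> inter T (Specm T)" unfolding inter_def using xT by blast
  qed
qed

text \<open>\<open>T/qT\<close> has length three, and \<open>T\<close> modulo its radical has length \<open>\<Sum>n. len T n\<close>.\<close>

lemma radical_bound:
  assumes T: "order T" and R: "tl T R" "(*) Q ` T \<subseteq> R" "R \<subseteq> inter T (Specm T)"
  shows "(\<Sum>n\<in>Specm T. len T n) + len R ((*) Q ` T) \<le> 3"
proof -
  have i: "tl T (inter T (Specm T))" "len T (inter T (Specm T)) = (\<Sum>n\<in>Specm T. len T n)"
    "inter T (Specm T) \<subseteq> T"
    using inter_facts[OF T order_refl] unfolding inter_def by auto
  have RT: "R \<subseteq> T" using R(3) i(3) by blast
  have "len T (inter T (Specm T)) \<le> len T R"
    using len_mono(2)[OF ordD(1)[OF T] tlD(1)[OF i(1)] tlD(1)[OF R(1)] R(3) i(3)] .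
  moreover have "len T R + len R ((*) Q ` T) = 3"
    using len_add[OF ordD(1)[OF T] tlD(1)[OF R(1)] lat_Q[OF ordD(1)[OF T]] R(2) RT] len_Q[OF ordD(1)[OF T]] by simp
  ultimately show ?thesis using i(2) by linarith
qed

lemma colon_max_inj:
  assumes T: "order T" and g: "gor T" and m: "m \<in> Specm T" "n \<in> Specm T"
    and e: "colon T m = colon T n"
  shows "m = n"
proof -
  have "m = colon T (colon T m)" by (rule star_facts(2)[OF T g max_lat(1)[OF T m(1)], symmetric])
  also have "\<dots> = colon T (colon T n)" by (simp only: e)
  also have "\<dots> = n" by (rule star_facts(2)[OF T g max_lat(1)[OF T m(2)]])
  finally show ?thesis .
qed

lemma len_scaled_colon:
  assumes T: "order T" and m: "m \<in> Specm T"
  shows "len ((*) Q ` colon T m) ((*) Q ` T) = len (colon T m) T"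
  using len_scale[OF tlD(1)[OF tl_colon_max[OF T m]] ordD(1)[OF T] colon_upper[OF T m] Q_r(1)] .

text \<open>
  For a Gorenstein order \<open>(T : m)/T\<close> has the length of \<open>T/m\<close>. As \<open>q(T : m)\<close> lies in the radical,
  \<open>radical_bound\<close> leaves room for one such \<open>m\<close> only, of residue degree one.
\<close>

lemma gor_ninv:
  assumes T: "order T" and g: "gor T" and m: "m \<in> Specm T" and ninv: "\<not> invertible T m"
  shows "len T m = 1" "len (colon T m) T = 1" "\<And>n. n \<in> Specm T \<Longrightarrow> n \<noteq> m \<Longrightarrow> invertible T n"
    "(\<Sum>n\<in>Specm T - {m}. len T n) \<le> 1"
proof -
  let ?MM = "Specm T"
  note R = noninvertible_radical[OF T m ninv]
  have s: "(\<Sum>n\<in>?MM. len T n) = len T m + (\<Sum>n\<in>?MM - {m}. len T n)"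
    using finite_max[OF T] m by (rule sum.remove)
  have b: "(\<Sum>n\<in>?MM. len T n) + len T m \<le> 3"
    using radical_bound[OF T R] len_scaled_colon[OF T m] len_gor_max[OF T g m] by simp
  thus l: "len T m = 1" using s len_max_pos[OF T m] by linarith
  thus lc: "len (colon T m) T = 1" using len_gor_max[OF T g m] by simp
  show "(\<Sum>n\<in>?MM - {m}. len T n) \<le> 1" using s b l by linarith
  show "invertible T n" if n: "n \<in> ?MM" "n \<noteq> m" for n
  proof (rule ccontr)
    assume ninv': "\<not> invertible T n"
    note R' = noninvertible_radical[OF T n(1) ninv']
    let ?A = "(*) Q ` colon T m" and ?B = "(*) Q ` colon T n"
    let ?S = "sum_set ?A ?B"
    have S: "tl T ?S" "?A \<subseteq> ?S" "?B \<subseteq> ?S"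
      using tl_sum[OF R(1) R'(1)] sum_set_upper[OF tlD(3)[OF R(1)] tlD(3)[OF R'(1)]] by auto
    have "additive_subgroup (inter T ?MM)" using inter_facts[OF T order_refl] tlD(3) by blast
    hence Si: "?S \<subseteq> inter T ?MM" using sum_set_least R(3) R'(3) by blast
    have lA: "len ?A ((*) Q ` T) = 1" using len_scaled_colon[OF T m] lc by simp
    have s2: "(\<Sum>k\<in>?MM. len T k) \<ge> len T m + len T n"
    proof -
      have "(\<Sum>k\<in>{m, n}. len T k) \<le> (\<Sum>k\<in>?MM. len T k)"
        using finite_max[OF T] m n by (intro sum_mono2) auto
      thus ?thesis using n(2) by simp
    qed
    have ln: "len T n > 0" using len_max_pos[OF T n(1)] .
    have QS: "(*) Q ` T \<subseteq> ?S" using R(2) S(2) by blast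
    have "len ?S ((*) Q ` T) \<le> 1" using radical_bound[OF T S(1) QS Si] s2 l ln by linarith
    hence A: "?A = ?S"
      using len_eq[OF tlD(1)[OF S(1)] tlD(1)[OF R(1)] lat_Q[OF ordD(1)[OF T]] R(2) S(2)] lA by linarith
    have "len ?B ((*) Q ` T) > 0" using len_scaled_colon[OF T n(1)] len_gor_max[OF T g n(1)] ln by simp
    hence B: "?B = ?S"
      using len_eq[OF tlD(1)[OF S(1)] tlD(1)[OF R'(1)] lat_Q[OF ordD(1)[OF T]] R'(2) S(3)]
        \<open>len ?S ((*) Q ` T) \<le> 1\<close> by linarith
    have "x \<in> colon T m \<longleftrightarrow> x \<in> colon T n" for x
      using A B scale_image_mem[OF Q_r(1), of x] by metis
    hence "colon T m = colon T n" by blast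
    thus False using colon_max_inj[OF T g m n(1)] n(2) by blast
  qed
qed

text \<open>
  With \<open>M\<close>, also \<open>(T : M)\<close> is not a module over \<open>(T : m)\<close>, so some \<open>x \<in> M\<close> and \<open>y \<in> (T : M)\<close> have
  \<open>xy \<notin> m\<close>. Then \<open>x\<close> generates \<open>M\<close> modulo \<open>mM\<close>, since \<open>xyz\<close> is a unit multiple of \<open>z \<in> M\<close> modulo \<open>mM\<close> and
  \<open>yz \<in> T\<close>. The second claim follows by duality.
\<close>

lemma gor_dichotomy:
  assumes T: "order T" and g: "gor T" and m: "m \<in> Specm T" and ninv: "\<not> invertible T m"
    and M: "tl T M" and nM: "\<not> tl (colon T m) M"
  shows "len M (m \<cdot> M) = 1" "len (colon M m) M = 1"
proof -
  let ?C = "colon T m"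
  note C = ninv_order[OF T m ninv]
  note mm = max_lat[OF T m]
  have stab: "tl ?C (colon T N)" if N: "tl T N" and h: "\<forall>x\<in>N. \<forall>y\<in>colon T N. x * y \<in> m" for N
  proof -
    have "z * y \<in> colon T N" if zy: "z \<in> ?C" "y \<in> colon T N" for z y
    proof (rule colonI)
      fix x assume "x \<in> N"
      hence "x * y \<in> m" using h zy(2) by blast
      hence "z * (x * y) \<in> T" using colonD[OF zy(1)] by blast
      thus "z * y * x \<in> T" by (simp add: mult_ac)
    qed
    thus ?thesis using tlD[OF star_facts(1)[OF T g N]] unfolding tl_def submodule_over_def by blast
  qed
  have nS: "\<not> tl ?C (colon T M)"
    using tl_colon'[OF ordD(1)[OF T], of ?C "colon T M"] star_facts(2)[OF T g M] nM by auto
  have pos: "m \<cdot> N \<noteq> N" if "tl T N" "\<not> tl ?C N" for N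
    using tl_product'[OF C(2) tlD(1)[OF that(1)]] that(2) by auto
  have le: "len N (m \<cdot> N) = 1"
    if N: "tl T N" and nN: "\<not> tl ?C N" and xy: "x \<in> N" "y \<in> colon T N" "x * y \<notin> m" for N x y
  proof -
    have xyT: "x * y \<in> T" using colonD[OF xy(2,1)] by (simp add: mult.commute)
    obtain u where u: "u \<in> T" "u * (x * y) - 1 \<in> m" using max_prime[OF T m xyT xy(3)] .
    let ?P = "m \<cdot> N"
    have P: "tl T ?P" "?P \<subseteq> N" using tl_max_prod[OF T m N] max_prod_sub[OF T m N] .
    note c = cyclic_quotient[OF T P(1) N P(2) xy(1)]
    have "N \<subseteq> sum_set ?P ((*) x ` T)"
    proof
      fix z assume z: "z \<in> N"
      have zy: "z * y \<in> T" using colonD[OF xy(2) z] by (simp add: mult.commute)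
      have "- z \<in> N" using subgroupD(3)[OF tlD(3)[OF N] z] .
      hence "(u * (x * y) - 1) * (- z) \<in> ?P" using u(2) by (intro product_mem)
      moreover have "x * (u * (z * y)) \<in> (*) x ` T" using ordD(3)[OF T u(1) zy] by blast
      ultimately have "(u * (x * y) - 1) * (- z) + x * (u * (z * y)) \<in> sum_set ?P ((*) x ` T)" by (rule sum_setI)
      thus "z \<in> sum_set ?P ((*) x ` T)" by (simp add: algebra_simps)
    qed
    hence "sum_set ?P ((*) x ` T) = N" using c(5) by blast
    hence "len N ?P = len T {a \<in> T. a * x \<in> ?P}" using c(6) by simp
    also have "\<dots> \<le> len T m"
      using product_mem[OF _ xy(1), of _ m] mm(3)
      by (intro len_mono(2)[OF ordD(1)[OF T] tlD(1)[OF c(2)] tlD(1)[OF mm(1)]]) auto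
    also have "\<dots> = 1" using gor_ninv(1)[OF T g m ninv] .
    finally show ?thesis using len_pos[OF tlD(1)[OF N] tlD(1)[OF P(1)]] P(2) pos[OF N nN] by fastforce
  qed
  have "\<not> tl ?C (colon T (colon T M))" using star_facts(2)[OF T g M] nM by simp
  then obtain x y where xy: "x \<in> M" "y \<in> colon T M" "x * y \<notin> m"
    using stab[OF M] nS by blast
  show "len M (m \<cdot> M) = 1" using le[OF M nM xy] .
  have MS: "tl T (colon T M)" using star_facts(1)[OF T g M] .
  have xS: "x \<in> colon T (colon T M)" using xy(1) star_facts(2)[OF T g M] by simp
  have "y * x \<notin> m" using xy(3) by (simp add: mult.commute)
  hence l: "len (colon T M) (m \<cdot> (colon T M)) = 1" by (rule le[OF MS nS xy(2) xS])
  have "colon T (m \<cdot> (colon T M)) = colon M m"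
    using colon_product[OF tlD(3)[OF ordD(5)[OF T]], of m "colon T M"] star_facts(2)[OF T g M] by simp
  thus "len (colon M m) M = 1"
    using star_facts(3)[OF T g MS tl_max_prod[OF T m MS] max_prod_sub[OF T m MS]] star_facts(2)[OF T g M] l
    by simp
qed

lemma gor_overorders:
  assumes T: "order T" and g: "gor T" and m: "m \<in> Specm T" and ninv: "\<not> invertible T m"
  shows "OV T = insert T (OV (colon T m))" "T \<notin> OV (colon T m)"
proof -
  let ?C = "colon T m"
  note C = ninv_order[OF T m ninv]
  have "?C \<subseteq> S" if S: "order S" "T \<subseteq> S" "S \<noteq> T" for S
  proof -
    obtain N where N: "simple T T N" "N \<subseteq> S"
      using exists_simple[OF T ordD(5)[OF T] tl_mono[OF ordD(5)[OF S(1)] S(2)]] S(2,3) by blast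
    let ?n = "annq T T N"
    have n: "?n \<in> Specm T" using simple_max(1)[OF T N(1)] .
    have e: "N = colon T ?n" using simple_colon[OF T N(1) len_gor_max[OF T g n]] .
    hence "\<not> invertible T ?n" using invertible_not_sub[OF T S(1,2) n] N(2) by auto
    hence "?n = m" using gor_ninv(3)[OF T g m ninv n] by blast
    thus ?thesis using N(2) e by simp
  qed
  hence "S \<in> OV T \<longleftrightarrow> S \<in> insert T (OV ?C)" for S
    unfolding OV_def using T C(3) by auto
  thus "OV T = insert T (OV ?C)" by blast
  show "T \<notin> OV ?C"
  proof
    assume "T \<in> OV ?C"
    hence "?C = T" using C(3) unfolding OV_def by blast
    thus False using gor_ninv(2)[OF T g m ninv] ordD(1)[OF T] by simp
  qed
qed

definition Lterm :: "'e set \<Rightarrow> 'e set \<Rightarrow> rat fps" where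
  "Lterm T S = of_nat (q ^ len S T) * fps_X ^ (2 * len S T) * h S * zeta S"

lemma L_sum: "L T = (\<Sum>S\<in>OV T. Lterm T S)" unfolding L_def Lterm_def by simp

lemma Lterm_base:
  assumes T: "order T" and C: "order C" "T \<subseteq> C" and S: "S \<in> OV C"
  shows "Lterm T S = (of_nat q * fps_X ^ 2) ^ len C T * Lterm C S"
proof -
  have "order S" "C \<subseteq> S" using S unfolding OV_def by auto
  hence "len S T = len S C + len C T" using len_add[OF ordD(1) ordD(1)[OF C(1)] ordD(1)[OF T] C(2)] by blast
  moreover have "(of_nat q * fps_X ^ 2 :: rat fps) ^ len C T = of_nat (q ^ len C T) * fps_X ^ (2 * len C T)"
    by (simp add: power_mult_distrib power_mult)
  ultimately show ?thesis unfolding Lterm_def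
    by (simp only: power_add distrib_left of_nat_mult mult_ac)
qed

lemma L_base:
  assumes "order T" "order C" "T \<subseteq> C"
  shows "(\<Sum>S\<in>OV C. Lterm T S) = (of_nat q * fps_X ^ 2) ^ len C T * L C"
  unfolding L_sum sum_distrib_left by (rule sum.cong[OF refl Lterm_base[OF assms]])

lemma Lterm_self: "order T \<Longrightarrow> Lterm T T = h T * zeta T"
  using ordD(1) by (simp add: Lterm_def)

text \<open>Every larger order contains \<open>(T : m)\<close>, and \<open>q t\<^sup>2\<close> is the cost of the change of base.\<close>

lemma L_gor:
  assumes T: "order T" and g: "gor T" and m: "m \<in> Specm T" and ninv: "\<not> invertible T m"
  shows "L T = zeta T + of_nat q * fps_X ^ 2 * L (colon T m)"
proof -
  note C = ninv_order[OF T m ninv]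
  have "L T = Lterm T T + (\<Sum>S\<in>OV (colon T m). Lterm T S)"
    unfolding L_sum[of T] gor_overorders(1)[OF assms]
    using finite_OV[OF C(1)] gor_overorders(2)[OF assms] by (rule sum.insert)
  thus ?thesis
    using L_base[OF T C(1,3)] gor_ninv(2)[OF assms] Lterm_self[OF T] g by (simp add: h_def)
qed

lemma product_scale:
  assumes C: "order C" and M: "tl C M"
  shows "((*) z ` C) \<cdot> M = (*) z ` M"
proof
  have z: "submodule_over {} ((*) z ` M)" using submod_image tlD(3)[OF M] unfolding submodule_over_def by blast
  show "((*) z ` C) \<cdot> M \<subseteq> (*) z ` M"
  proof (rule product_least[OF submodD(1)[OF z]])
    fix x y assume "x \<in> (*) z ` C" "y \<in> M"
    then obtain c where c: "c \<in> C" "x = z * c" by blast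
    have "z * (c * y) \<in> (*) z ` M" using tl_mult[OF M c(1) \<open>y \<in> M\<close>] by blast
    thus "x * y \<in> (*) z ` M" by (simp add: c mult.assoc)
  qed
  show "(*) z ` M \<subseteq> ((*) z ` C) \<cdot> M"
  proof
    fix y assume "y \<in> (*) z ` M"
    then obtain x where x: "x \<in> M" "y = z * x" by blast
    have "z * 1 \<in> (*) z ` C" using ordD(2)[OF C] by (rule imageI)
    from product_mem[OF this x(1)] show "y \<in> ((*) z ` C) \<cdot> M" by (simp add: x(2))
  qed
qed

lemma colon_scale:
  assumes C: "order C" and M: "tl C M" and z: "z * z' = 1"
  shows "colon M ((*) z ` C) = (*) z' ` M"
proof -
  have z': "z' * z = 1" using z by (simp add: mult.commute)
  have "x \<in> colon M ((*) z ` C) \<longleftrightarrow> z * x \<in> M" for x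
  proof
    assume x: "x \<in> colon M ((*) z ` C)"
    have "z * 1 \<in> (*) z ` C" using ordD(2)[OF C] by (rule imageI)
    from colonD[OF x this] show "z * x \<in> M" by (simp add: mult.commute)
  next
    assume x: "z * x \<in> M"
    show "x \<in> colon M ((*) z ` C)"
    proof (rule colonI)
      fix y assume "y \<in> (*) z ` C"
      then obtain c where c: "c \<in> C" "y = z * c" by blast
      show "x * y \<in> M" using tl_mult[OF M c(1) x] by (simp add: c(2) mult_ac)
    qed
  qed
  thus ?thesis using mem_scale_iff[OF z'] by blast
qed

lemma len_scale_const:
  assumes M: "lat M" and N: "lat N" and z: "z * z' = 1"
    and sub: "(*) z ` M \<subseteq> M" "(*) z ` N \<subseteq> N"
  shows "len M ((*) z ` M) = len N ((*) z ` N)"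
proof -
  let ?S = "sum_set M N"
  have S: "lat ?S" "M \<subseteq> ?S" "N \<subseteq> ?S"
    using lat_sum[OF M N] sum_set_upper[OF lat_add[OF M] lat_add[OF N]] by auto
  have zS: "(*) z ` ?S \<subseteq> ?S"
  proof
    fix y assume "y \<in> (*) z ` ?S"
    then obtain a b where ab: "y = z * (a + b)" "a \<in> M" "b \<in> N" by (metis imageE sum_setE)
    have "z * a + z * b \<in> ?S" using sub ab by (intro sum_setI) auto
    thus "y \<in> ?S" by (simp add: ab(1) distrib_left)
  qed
  have "len P ((*) z ` P) = len ?S ((*) z ` ?S)" if P: "lat P" "P \<subseteq> ?S" "(*) z ` P \<subseteq> P" for P
  proof -
    have "len ?S P + len P ((*) z ` P) = len ?S ((*) z ` P)"
      using len_add[OF S(1) P(1) lat_scale[OF P(1) z] P(3,2)] by simp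
    also have "\<dots> = len ?S ((*) z ` ?S) + len ((*) z ` ?S) ((*) z ` P)"
      using len_add[OF S(1) lat_scale[OF S(1) z] lat_scale[OF P(1) z] image_mono[OF P(2)] zS] .
    finally show ?thesis using len_scale[OF S(1) P(1,2) z] by simp
  qed
  from this[OF M S(2) sub(1)] this[OF N S(3) sub(2)] show ?thesis by simp
qed

text \<open>When the Euler factors of the invertible maximal ideals are removed, only the lattice \<open>T\<close> is left.\<close>

lemma gor_term:
  assumes T: "order T" and g: "gor T" and m: "m \<in> Specm T" and ninv: "\<not> invertible T m"
  shows "cnt T {M \<in> LT T. \<not> tl (colon T m) M \<and> 1 \<notin> m \<cdot> M} = (1 - fps_X) * zeta T"
proof -
  let ?C = "colon T m" and ?MM = "Specm T"
  let ?U = "?MM - {m}"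
  let ?Term = "cnt T {M \<in> LT T. \<not> tl ?C M \<and> 1 \<notin> m \<cdot> M}"
  note C = ninv_order[OF T m ninv] and G = gor_ninv[OF T g m ninv]
  have U: "?U \<subseteq> {n \<in> ?MM. invertible T n}" using G(3) by blast
  have Pinv: "\<not> tl ?C (n \<cdot> M) \<longleftrightarrow> \<not> tl ?C M" if n: "n \<in> ?U" and M: "tl T M" for n M
  proof -
    have n': "n \<in> ?MM" "invertible T n" using n U by auto
    have "tl ?C (n \<cdot> M)" if "tl ?C M"
      using tl_product[OF tlD(1)[OF max_lat(1)[OF T n'(1)]] that] .
    moreover have "tl ?C M" if h: "tl ?C (n \<cdot> M)"
      using tl_product[OF tlD(1)[OF tl_colon_max[OF T n'(1)]] h] invertible_cancel(2)[OF T n' M] by simp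
    ultimately show ?thesis by blast
  qed
  have "{M \<in> LT T. \<not> tl ?C M \<and> (\<forall>k\<in>?U \<union> {m}. 1 \<notin> k \<cdot> M)} = {T}"
  proof (intro equalityI subsetI)
    fix M assume "M \<in> {M \<in> LT T. \<not> tl ?C M \<and> (\<forall>k\<in>?U \<union> {m}. 1 \<notin> k \<cdot> M)}"
    hence M: "M \<in> LT T" "\<not> tl ?C M" "\<And>k. k \<in> ?MM \<Longrightarrow> 1 \<notin> k \<cdot> M" by auto
    show "M \<in> {T}"
    proof (rule ccontr)
      assume "M \<notin> {T}"
      hence "T \<subset> M" using LTD(4)[OF M(1)] by blast
      then obtain N where N: "simple T T N" "N \<subseteq> M"
        using exists_simple[OF T ordD(5)[OF T] LTD(1)[OF M(1)]] by blast
      let ?n = "annq T T N"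
      have n: "?n \<in> ?MM" using simple_max(1)[OF T N(1)] .
      have e: "N = colon T ?n" using simple_colon[OF T N(1) len_gor_max[OF T g n]] .
      show False
      proof (cases "invertible T ?n")
        case True
        have "1 \<in> ?n \<cdot> N"
          using invertible_product[OF T n True] ordD(2)[OF T] e by simp
        thus False using M(3)[OF n] product_mono[OF order_refl N(2)] by blast
      next
        case False
        hence CM: "?C \<subseteq> M" using G(3)[OF n] e N(2) by metis
        let ?P = "m \<cdot> M"
        have P: "tl T ?P" "?P \<subseteq> M" using tl_max_prod[OF T m LTD(1)[OF M(1)]] max_prod_sub[OF T m LTD(1)[OF M(1)]] .
        have lP: "lat ?P" using tlD(1)[OF P(1)] .
        have PC: "tl ?C ?P" using tl_product'[OF C(2) LTD(3)[OF M(1)]] .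
        have Q1: "Q * 1 \<in> ?P" using Q_kills_quotient[OF T m LTD(1)[OF M(1)]] LTD(2)[OF M(1)] by blast
        have "len (line ?P 1) ?P = 1" using line_len[OF lP M(3)[OF m] Q1] .
        moreover have "len M ?P = 1" using gor_dichotomy(1)[OF T g m ninv LTD(1)[OF M(1)] M(2)] .
        ultimately have lM: "line ?P 1 = M"
          using len_eq[OF LTD(3)[OF M(1)] line_lat[OF lP] lP line_upper(1)[OF lat_mod[OF lP]]
              line_least[OF lat_mod[OF LTD(3)[OF M(1)]] P(2) LTD(2)[OF M(1)]]] by simp
        have "c * x \<in> M" if c: "c \<in> ?C" and x: "x \<in> M" for c x
        proof -
          have "x \<in> line ?P 1" using x lM by simp
          then obtain y w where y: "x = y + w * 1" "y \<in> ?P" "w \<in> Z" by (rule lineE)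
          have "c * y \<in> M" using tl_mult[OF PC c y(2)] P(2) by blast
          moreover have "c * w \<in> M" using ordD(3)[OF C(1) c] order_Z[OF C(1)] y(3) CM by blast
          ultimately have "c * y + c * w \<in> M" by (rule tl_add[OF LTD(1)[OF M(1)]])
          thus ?thesis by (simp add: y(1) distrib_left)
        qed
        hence "tl ?C M" using tlD[OF LTD(1)[OF M(1)]] unfolding tl_def submodule_over_def by blast
        thus False using M(2) by blast
      qed
    qed
  next
    fix M assume M: "M \<in> {T}"
    have "k \<cdot> T = k" if "k \<in> ?MM" for k
      using product_unit[OF T max_lat(1)[OF T that]] by (simp add: product_commute)
    moreover have "\<not> tl ?C T"
    proof
      assume "tl ?C T"
      hence "?C = T" using one_in_ideal[OF tlD(2)] ordD(2)[OF T] C(3) by blast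
      thus False using G(2) ordD(1)[OF T] by simp
    qed
    ultimately show "M \<in> {M \<in> LT T. \<not> tl ?C M \<and> (\<forall>k\<in>?U \<union> {m}. 1 \<notin> k \<cdot> M)}"
      using M max_lat(4)[OF T] m ordD[OF T] unfolding LT_def by auto
  qed
  hence 1: "(\<Prod>n\<in>?U. 1 - fps_X ^ len T n) * ?Term = 1"
    using euler_product[OF T _ U, of "{m}" "\<lambda>M. \<not> tl ?C M", OF _ _ _ Pinv] finite_max[OF T] m
      ser_singleton[OF T, of "\<lambda>_. 1"] by simp
  have "(\<Prod>n\<in>?MM. 1 - fps_X ^ len T n) = (1 - fps_X ^ len T m) * (\<Prod>n\<in>?U. 1 - fps_X ^ len T n :: rat fps)"
    using finite_max[OF T] m by (rule prod.remove)
  hence "(\<Prod>n\<in>?U. 1 - fps_X ^ len T n) * ((1 - fps_X) * zeta T) = 1"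
    using zeta_mult[OF T] G(1) by (simp add: mult_ac)
  from inverse_unique_fps[OF 1 this] show ?thesis .
qed

lemma stable_LT:
  assumes T: "order T" and C: "order C" "T \<subseteq> C"
  shows "{M \<in> LT T. tl C M} = LT C"
proof -
  have "tl T M" if "tl C M" for M using tl_mono[OF that C(2)] .
  thus ?thesis unfolding LT_def by blast
qed

lemma one_X_cancel: "(1 - fps_X) * a = (1 - fps_X) * (b :: rat fps) \<Longrightarrow> a = b"
proof -
  have "(1 - fps_X :: rat fps) $ 0 \<noteq> 0" by simp
  hence "(1 - fps_X :: rat fps) \<noteq> 0" by (metis fps_zero_nth)
  thus "(1 - fps_X) * a = (1 - fps_X) * b \<Longrightarrow> a = b" by simp
qed

text \<open>
  As \<open>C = (T : m)\<close> is Gorenstein, \<open>m\<close> is a principal ideal \<open>zC\<close>. The lengths in the Hecke relation at \<open>m\<close>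
  are then two for the lattices over \<open>C\<close>, and one for the others.
\<close>

lemma J_gor_gor:
  assumes T: "order T" and g: "gor T" and m: "m \<in> Specm T" and ninv: "\<not> invertible T m"
    and gC: "gor (colon T m)"
  shows "J T = zeta T + of_nat q * fps_X ^ 2 * J (colon T m)"
proof -
  let ?C = "colon T m" and ?P = "submodule_product m"
  let ?X = "{M \<in> LT T. \<not> tl ?C M}"
  note C = ninv_order[OF T m ninv] and G = gor_ninv[OF T g m ninv]
  have mT: "m \<subseteq> T" using max_lat(3)[OF T m] by blast
  obtain p p' where p: "p * p' = 1" "\<And>M. tl T M \<Longrightarrow> colon T M = (*) p ` dual M"
    using gor_star[OF T g] by metis
  obtain s s' where s: "s * s' = 1" "dual ?C = (*) s ` ?C" using gC unfolding gor_def by blast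
  define z z' where "z = p * s" and "z' = p' * s'"
  have "z * z' = (p * p') * (s * s')" unfolding z_def z'_def by (simp add: mult_ac)
  hence z: "z * z' = 1" using p(1) s(1) by simp
  have "m = colon T ?C" using star_facts(2)[OF T g max_lat(1)[OF T m]] by simp
  also have "\<dots> = (*) z ` ?C"
    using p(2)[OF tl_colon_max[OF T m]] s(2) by (simp add: z_def image_image mult.assoc)
  finally have mz: "m = (*) z ` ?C" .
  have zM: "?P M = (*) z ` M" "colon M m = (*) z' ` M" if "tl ?C M" for M
    by (rule trans[OF arg_cong[OF mz, of "\<lambda>x. x \<cdot> M"] product_scale[OF C(1) that]],
        rule trans[OF arg_cong[OF mz, of "colon M"] colon_scale[OF C(1) that z]])
  have zsub: "(*) z ` M \<subseteq> M" if M: "tl ?C M" for M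
    using max_prod_sub[OF T m tl_mono[OF M C(3)]] zM(1)[OF M] by simp
  have "len ?C ((*) z ` ?C) = len ?C T + len T m"
    using len_add[OF ordD(1)[OF C(1)] ordD(1)[OF T] tlD(1)[OF max_lat(1)[OF T m]] mT C(3)] unfolding mz[symmetric] .
  hence l2: "len ?C ((*) z ` ?C) = 2" using G(1,2) by simp
  have lz: "len M ((*) z ` M) = 2" if M: "tl ?C M" for M
    using len_scale_const[OF tlD(1)[OF M] ordD(1)[OF C(1)] z zsub[OF M] zsub[OF ordD(5)[OF C(1)]]] l2 by simp
  have z'M: "M \<subseteq> (*) z' ` M" "len ((*) z' ` M) M = 2" "tl ?C ((*) z' ` M)" if M: "tl ?C M" for M
  proof -
    have z'': "z' * z = 1" using z by (simp add: mult.commute)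
    show t: "tl ?C ((*) z' ` M)" using tl_scale[OF M z''] .
    have e: "(*) z ` (*) z' ` M = M" using scale_scale[OF z] .
    show "M \<subseteq> (*) z' ` M" using zsub[OF t] e by simp
    show "len ((*) z' ` M) M = 2" using lz[OF t] e by simp
  qed
  define JC where "JC = cnt T (LT ?C)"
  define Y where "Y = cnt T ?X"
  have JC: "JC = fps_X * J ?C"
    unfolding JC_def J_def using ser_base[OF T C(1,3) order_refl] G(2) by simp
  have sub: "LT ?C \<subseteq> LT T" using stable_LT[OF T C(1,3)] by blast
  have split: "ser T (LT T) w = ser T (LT ?C) w + ser T ?X w" for w
    using ser_split[OF T order_refl, of w "\<lambda>M. tl ?C M"] stable_LT[OF T C(1,3)] by simp
  have JT: "J T = JC + Y" unfolding J_def JC_def Y_def by (rule split)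
  have shift: "cnt T {M \<in> LT ?C. 1 \<in> (*) z ` M} = fps_X ^ 2 * JC"
    unfolding JC_def
  proof (rule ser_bij[where f = "(`) ((*) z')"])
    show "bij_betw ((`) ((*) z')) (LT ?C) {M \<in> LT ?C. 1 \<in> (*) z ` M}"
    proof (rule bij_betw_byWitness[where f' = "(`) ((*) z)"])
      have z'': "z' * z = 1" using z by (simp add: mult.commute)
      show "\<forall>a\<in>LT ?C. (*) z ` (*) z' ` a = a" using scale_scale[OF z] by blast
      show "\<forall>a'\<in>{M \<in> LT ?C. 1 \<in> (*) z ` M}. (*) z' ` (*) z ` a' = a'" using scale_scale[OF z''] by blast
      show "(`) ((*) z') ` LT ?C \<subseteq> {M \<in> LT ?C. 1 \<in> (*) z ` M}"
        using z'M scale_scale[OF z] unfolding LT_def by blast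
      show "(`) ((*) z) ` {M \<in> LT ?C. 1 \<in> (*) z ` M} \<subseteq> LT ?C"
        using tl_scale[OF _ z] unfolding LT_def by blast
    qed
    show "len ((*) z' ` M) T = len M T + 2" if M: "M \<in> LT ?C" for M
    proof -
      have "T \<subseteq> M" using LTD(4)[OF M] C(3) by blast
      thus ?thesis
        using len_add[OF tlD(1)[OF z'M(3)[OF LTD(1)[OF M]]] LTD(3)[OF M] ordD(1)[OF T] _ z'M(1)[OF LTD(1)[OF M]]]
          z'M(2)[OF LTD(1)[OF M]] by simp
    qed
  qed
  let ?w = "\<lambda>M. of_nat (gauss (len M (?P M) - (if 1 \<in> ?P M then 0 else 1))) :: rat"
  have w1: "ser T (LT ?C) ?w = JC + of_nat q * (fps_X ^ 2 * JC)"
  proof -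
    have "ser T (LT ?C) ?w = ser T (LT ?C) (\<lambda>M. 1 + of_nat q * (if 1 \<in> (*) z ` M then 1 else 0))"
    proof (rule ser_cong[OF refl])
      fix M assume M: "M \<in> LT ?C"
      have e: "?P M = (*) z ` M" by (rule zM(1)[OF LTD(1)[OF M]])
      show "?w M = 1 + of_nat q * (if 1 \<in> (*) z ` M then 1 else 0)"
        unfolding e lz[OF LTD(1)[OF M]] by (simp add: gauss_simps)
    qed
    also have "\<dots> = JC + of_nat q * ser T (LT ?C) (\<lambda>M. if 1 \<in> (*) z ` M then 1 else 0)"
      unfolding JC_def ser_add ser_cmult ..
    finally show ?thesis using ser_if[OF T sub] shift by simp
  qed
  have w2: "ser T ?X ?w = Y - (1 - fps_X) * zeta T"
  proof -
    have "ser T ?X ?w = ser T ?X (\<lambda>M. if 1 \<in> ?P M then 1 else 0)"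
    proof (rule ser_cong[OF refl])
      fix M assume "M \<in> ?X"
      hence "len M (?P M) = 1" using gor_dichotomy(1)[OF T g m ninv LTD(1)] by blast
      thus "?w M = (if 1 \<in> ?P M then 1 else 0)" by (simp add: gauss_simps)
    qed
    also have "\<dots> = cnt T {M \<in> ?X. 1 \<in> ?P M}" by (rule ser_if[OF T]) blast
    also have "\<dots> = Y - cnt T {M \<in> ?X. \<not> 1 \<in> ?P M}"
      unfolding Y_def using ser_split[OF T, of ?X "\<lambda>_. 1" "\<lambda>M. 1 \<in> ?P M"] by auto
    also have "{M \<in> ?X. \<not> 1 \<in> ?P M} = {M \<in> LT T. \<not> tl ?C M \<and> 1 \<notin> ?P M}" by blast
    finally show ?thesis using gor_term[OF T g m ninv] by simp
  qed
  let ?v = "\<lambda>M. of_nat (gauss (len (colon M m) M)) :: rat"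
  have v1: "ser T (LT ?C) ?v = of_nat (1 + q) * JC"
  proof -
    have "ser T (LT ?C) ?v = ser T (LT ?C) (\<lambda>M. of_nat (1 + q) * 1)"
    proof (rule ser_cong[OF refl])
      fix M assume M: "M \<in> LT ?C"
      have "len (colon M m) M = 2"
        unfolding zM(2)[OF LTD(1)[OF M]] by (rule z'M(2)[OF LTD(1)[OF M]])
      thus "?v M = of_nat (1 + q) * 1" by (simp only: gauss_simps mult_1_right)
    qed
    thus ?thesis unfolding JC_def ser_cmult .
  qed
  have v2: "ser T ?X ?v = Y" unfolding Y_def
  proof (rule ser_cong[OF refl])
    fix M assume "M \<in> ?X"
    hence "len (colon M m) M = 1" using gor_dichotomy(2)[OF T g m ninv LTD(1)] by blast
    thus "?v M = 1" by (simp add: gauss_simps)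
  qed
  have "JC + of_nat q * (fps_X ^ 2 * JC) + (Y - (1 - fps_X) * zeta T) = fps_X * (of_nat (1 + q) * JC + Y)"
    using hecke[OF T m G(1)] unfolding split w1 w2 v1 v2 .
  hence "(1 - fps_X) * J T = (1 - fps_X) * (zeta T + of_nat q * fps_X ^ 2 * J ?C)"
    unfolding JT JC by (simp add: algebra_simps power2_eq_square)
  thus ?thesis by (rule one_X_cancel)
qed

section \<open>Lattices over \<open>\<int>\<^sub>q + qC\<close>\<close>

lemma product_image:
  assumes "a * b = (1 :: 'e)"
  shows "((*) a ` A) \<cdot> M = (*) a ` (A \<cdot> M)"
proof
  have ag: "additive_subgroup ((*) c ` (A' \<cdot> M'))" for c and A' M' :: "'e set"
    using submod_image[of "{}" "A' \<cdot> M'" c] subgroup_product[of A' M']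
    unfolding submodule_over_def by blast
  show "((*) a ` A) \<cdot> M \<subseteq> (*) a ` (A \<cdot> M)"
    by (rule product_least[OF ag]) (auto simp: mult.assoc intro!: product_mem)
  have "A \<cdot> M \<subseteq> (*) b ` (((*) a ` A) \<cdot> M)"
  proof (rule product_least[OF ag])
    fix x y assume "x \<in> A" "y \<in> M"
    hence "(a * x) * y \<in> ((*) a ` A) \<cdot> M" by (intro product_mem) auto
    moreover have "x * y = b * ((a * x) * y)" using unit_cancel(1)[OF assms] by (simp add: mult.assoc)
    ultimately show "x * y \<in> (*) b ` (((*) a ` A) \<cdot> M)" by blast
  qed
  hence "(*) a ` (A \<cdot> M) \<subseteq> (*) a ` (*) b ` (((*) a ` A) \<cdot> M)"
    by (rule image_mono)
  thus "(*) a ` (A \<cdot> M) \<subseteq> ((*) a ` A) \<cdot> M"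
    unfolding scale_scale[OF assms] .
qed

lemma colon_image:
  assumes "a * b = (1 :: 'e)"
  shows "colon M ((*) a ` A) = (*) b ` colon M A"
proof -
  have ba: "b * a = 1" using assms by (simp add: mult.commute)
  have "x \<in> colon M ((*) a ` A) \<longleftrightarrow> a * x \<in> colon M A" for x
    unfolding colon_def by (simp add: mult_ac)
  thus ?thesis using mem_scale_iff[OF ba] by blast
qed

text \<open>The smallest \<open>C\<close>-lattice that contains \<open>M\<close> and the largest one in \<open>M\<close>.\<close>

definition up :: "'e set \<Rightarrow> 'e set \<Rightarrow> 'e set" where "up C M = C \<cdot> M"
definition lo :: "'e set \<Rightarrow> 'e set \<Rightarrow> 'e set" where "lo C M = colon M C"

lemma thin_tl:
  assumes C: "order C" and N: "tl C N" and M: "lat M" "(*) Q ` N \<subseteq> M" "M \<subseteq> N"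
  shows "tl (thin C) M"
proof -
  have "a * x \<in> M" if a: "a \<in> thin C" and x: "x \<in> M" for a x
  proof -
    obtain b z where b: "a = b + z * 1" "b \<in> (*) Q ` C" "z \<in> Z" using a by (rule lineE)
    then obtain c where c: "b = Q * c" "c \<in> C" by blast
    have "c * x \<in> N" using tl_mult[OF N c(2)] x M(3) by blast
    hence "Q * (c * x) \<in> M" using M(2) by blast
    moreover have "z * x \<in> M" using submodD(6)[OF lat_mod[OF M(1)] b(3) x] .
    ultimately have "Q * (c * x) + z * x \<in> M" using subgroupD(4)[OF lat_add[OF M(1)]] by blast
    thus ?thesis by (simp add: b c distrib_right mult.assoc)
  qed
  thus ?thesis using M(1) lat_add unfolding tl_def submodule_over_def by blast
qed

lemma up_lo:
  assumes C: "order C" and M: "tl (thin C) M"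
  shows "tl C (up C M)" "tl C (lo C M)" "(*) Q ` up C M \<subseteq> lo C M" "lo C M \<subseteq> M" "M \<subseteq> up C M"
    "((*) Q ` C) \<cdot> M = (*) Q ` up C M" "colon M ((*) Q ` C) = (*) r ` lo C M"
    "\<And>N. tl C N \<Longrightarrow> M \<subseteq> N \<Longrightarrow> up C M \<subseteq> N" "\<And>N. tl C N \<Longrightarrow> N \<subseteq> M \<Longrightarrow> N \<subseteq> lo C M"
proof -
  note lM = tlD(1)[OF M]
  show u: "tl C (up C M)" unfolding up_def using tl_product'[OF ordD(5)[OF C] lM] .
  show l: "tl C (lo C M)" unfolding lo_def using tl_colon'[OF lM ordD(5)[OF C]] .
  show "lo C M \<subseteq> M" unfolding lo_def using colonD[of _ M C 1] ordD(2)[OF C] by auto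
  show "M \<subseteq> up C M" unfolding up_def using product_mem[OF ordD(2)[OF C], of _ M] by auto
  show e: "((*) Q ` C) \<cdot> M = (*) Q ` up C M"
    unfolding up_def by (rule product_image[OF Q_r(1)])
  show "colon M ((*) Q ` C) = (*) r ` lo C M" unfolding lo_def by (rule colon_image[OF Q_r(1)])
  have "(*) Q ` C \<subseteq> thin C" using thin_facts(4)[OF C] .
  hence "(*) Q ` up C M \<subseteq> M" unfolding e[symmetric] using product_sub[OF M] by blast
  thus "(*) Q ` up C M \<subseteq> lo C M"
    unfolding lo_def using tl_mult'[OF tl_Q[OF u]] by (blast intro: colonI)
  show "up C M \<subseteq> N" if "tl C N" "M \<subseteq> N" for N
    unfolding up_def using tl_mult[OF that(1)] that(2) by (intro product_least[OF tlD(3)[OF that(1)]]) blast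
  show "N \<subseteq> lo C M" if "tl C N" "N \<subseteq> M" for N
    unfolding lo_def using tl_mult'[OF that(1)] that(2) by (blast intro: colonI)
qed

lemma up_lo_stable:
  assumes C: "order C" and M: "tl C M"
  shows "up C M = M" "lo C M = M"
proof -
  have M': "tl (thin C) M" using tl_mono[OF M thin_facts(5)[OF C]] .
  show "up C M = M" "lo C M = M"
    using up_lo(8)[OF C M' M order_refl] up_lo(9)[OF C M' M order_refl] up_lo(4,5)[OF C M'] by blast+
qed

lemma up_lo_len:
  assumes C: "order C" and M: "tl (thin C) M"
  shows "len (up C M) M + len M ((*) Q ` up C M) = 3" "len M (lo C M) + len ((*) r ` lo C M) M = 3"
    "len (up C M) M + len M (lo C M) \<le> 3" "M \<subseteq> (*) r ` lo C M"
    "len (up C M) M = 0 \<Longrightarrow> tl C M" "len M (lo C M) = 0 \<Longrightarrow> tl C M"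
proof -
  note f = up_lo[OF C M]
  note lM = tlD(1)[OF M] and lu = tlD(1)[OF f(1)] and ll = tlD(1)[OF f(2)]
  have QuM: "(*) Q ` up C M \<subseteq> M" using f(3,4) by blast
  show 1: "len (up C M) M + len M ((*) Q ` up C M) = 3"
    using len_add[OF lu lM lat_Q[OF lu] QuM f(5)] len_Q[OF lu] by simp
  have "(*) Q ` M \<subseteq> lo C M" using f(3,5) by blast
  thus Mr: "M \<subseteq> (*) r ` lo C M" by (auto simp: mem_r_iff)
  have e: "(*) Q ` (*) r ` lo C M = lo C M" by (rule scale_scale[OF Q_r(1)])
  have "len ((*) r ` lo C M) (lo C M) = 3" using len_Q[OF lat_r[OF ll]] e by simp
  thus "len M (lo C M) + len ((*) r ` lo C M) M = 3"
    using len_add[OF lat_r[OF ll] lM ll f(4) Mr] by simp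
  have "len M (lo C M) \<le> len M ((*) Q ` up C M)" using len_mono(2)[OF lM ll lat_Q[OF lu] f(3,4)] .
  thus "len (up C M) M + len M (lo C M) \<le> 3" using 1 by linarith
  show "tl C M" if "len (up C M) M = 0" using len_0[OF lu lM f(5) that] f(1) by simp
  show "tl C M" if "len M (lo C M) = 0" using len_0[OF lM ll f(4) that] f(2) by simp
qed

lemma up_lo_types:
  assumes C: "order C" and M: "tl (thin C) M" and n: "\<not> tl C M"
  shows "(len (up C M) M = 1 \<and> len M (lo C M) = 1) \<or> (len (up C M) M = 1 \<and> len M (lo C M) = 2) \<or>
    (len (up C M) M = 2 \<and> len M (lo C M) = 1)"
proof -
  have "len (up C M) M \<noteq> 0" "len M (lo C M) \<noteq> 0" using up_lo_len(5,6)[OF C M] n by auto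
  thus ?thesis using up_lo_len(3)[OF C M] by linarith
qed

lemma thin_cyclic:
  assumes C: "order C" and M: "M \<in> LT (thin C)" and a: "len (up C M) M = 2" and one: "1 \<notin> (*) Q ` up C M"
  shows "M = thin C"
proof -
  note f = up_lo[OF C LTD(1)[OF M]]
  let ?N = "up C M"
  have lN: "lat ?N" "lat ((*) Q ` ?N)" using tlD(1)[OF f(1)] lat_Q by blast+
  have l1: "len M ((*) Q ` ?N) = 1" using up_lo_len(1)[OF C LTD(1)[OF M]] a by simp
  have QN: "(*) Q ` ?N \<subseteq> M" using f(3,4) by blast
  have oneN: "1 \<in> ?N" using f(5) LTD(2)[OF M] by blast
  have "M \<in> lines ((*) Q ` ?N) ?N" unfolding lines_def using LTD(3)[OF M] QN f(5) l1 by blast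
  hence e: "M = line ((*) Q ` ?N) 1"
    using lines_eq_line[OF lN(2) order_refl _ LTD(2)[OF M] one] by blast
  have CN: "C \<subseteq> ?N" using one_in_ideal[OF tlD(2)[OF f(1)] oneN] .
  have s: "tl C (sum_set C ((*) Q ` ?N))" using tl_sum[OF ordD(5)[OF C] tl_Q[OF f(1)]] .
  have sup: "C \<subseteq> sum_set C ((*) Q ` ?N)" "(*) Q ` ?N \<subseteq> sum_set C ((*) Q ` ?N)"
    using sum_set_upper[OF tlD(3)[OF ordD(5)[OF C]] tlD(3)[OF tl_Q[OF f(1)]]] by auto
  have "line ((*) Q ` ?N) 1 \<subseteq> sum_set C ((*) Q ` ?N)"
    using ordD(2)[OF C] sup by (intro line_least[OF lat_mod[OF tlD(1)[OF s]]]) auto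
  hence "M \<subseteq> sum_set C ((*) Q ` ?N)" by (rule ord_eq_le_trans[OF e])
  hence "?N \<subseteq> sum_set C ((*) Q ` ?N)" using f(8)[OF s] by blast
  hence "C = ?N" using nakayama[OF lN(1) lat_mod[OF ordD(1)[OF C]] CN] by blast
  hence "line ((*) Q ` ?N) 1 = thin C" by (rule arg_cong[OF sym])
  with e show ?thesis by (rule trans)
qed

lemma thin_self:
  assumes C: "order C"
  shows "thin C \<in> LT (thin C)" "up C (thin C) = C" "len (up C (thin C)) (thin C) = 2" "\<not> tl C (thin C)"
    "1 \<notin> (*) Q ` up C (thin C)"
proof -
  note t = thin_facts[OF C]
  have T: "tl (thin C) (thin C)" using ordD(5)[OF t(1)] .
  show LT: "thin C \<in> LT (thin C)" unfolding LT_def using T ordD(2)[OF t(1)] by blast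
  note f = up_lo[OF C T]
  have "C \<subseteq> up C (thin C)" using one_in_ideal[OF tlD(2)[OF f(1)]] f(5) ordD(2)[OF t(1)] by blast
  thus u: "up C (thin C) = C" using f(8)[OF ordD(5)[OF C] t(5)] by blast
  show "len (up C (thin C)) (thin C) = 2" using u t(3) by simp
  show "\<not> tl C (thin C)"
  proof
    assume "tl C (thin C)"
    from up_lo_stable(1)[OF C this] have "len C (thin C) = 0" using u ordD(1)[OF C] by simp
    thus False using t(3) by simp
  qed
  show "1 \<notin> (*) Q ` up C (thin C)" using u one_notin_Q[OF C] by simp
qed

text \<open>The lattices with \<open>1 \<in> qM\<close> are the \<open>q\<^sup>-\<^sup>1M'\<close> with \<open>1 \<in> M'\<close>.\<close>

lemma shift_Q:
  assumes T: "order T" and C: "order C" "T \<subseteq> C" and P: "\<And>M. P ((*) r ` M) \<longleftrightarrow> P M"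
  shows "cnt T {M \<in> LT C. P M \<and> 1 \<in> (*) Q ` M} = fps_X ^ 3 * cnt T {M \<in> LT C. P M}"
proof (rule ser_bij[where f = "(`) ((*) r)"])
  have e: "(*) Q ` (*) r ` M = M" "(*) r ` (*) Q ` M = M" for M :: "'e set"
    using scale_scale Q_r by blast+
  have rM: "M \<subseteq> (*) r ` M" if "tl C M" for M using Q_sub[OF tlD(1)[OF that]] by (auto simp: mem_r_iff)
  show "bij_betw ((`) ((*) r)) {M \<in> LT C. P M} {M \<in> LT C. P M \<and> 1 \<in> (*) Q ` M}"
  proof (rule bij_betw_byWitness[where f' = "(`) ((*) Q)"])
    show "(`) ((*) r) ` {M \<in> LT C. P M} \<subseteq> {M \<in> LT C. P M \<and> 1 \<in> (*) Q ` M}"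
    proof
      fix N assume "N \<in> (`) ((*) r) ` {M \<in> LT C. P M}"
      then obtain M where M: "M \<in> LT C" "P M" "N = (*) r ` M" by blast
      have "1 \<in> N" using rM[OF LTD(1)[OF M(1)]] LTD(2)[OF M(1)] M(3) by blast
      thus "N \<in> {M \<in> LT C. P M \<and> 1 \<in> (*) Q ` M}"
        using tl_r[OF LTD(1)[OF M(1)]] M P[of M] LTD(2)[OF M(1)] e(1)[of M] unfolding LT_def by simp
    qed
    show "(`) ((*) Q) ` {M \<in> LT C. P M \<and> 1 \<in> (*) Q ` M} \<subseteq> {M \<in> LT C. P M}"
    proof
      fix N assume "N \<in> (`) ((*) Q) ` {M \<in> LT C. P M \<and> 1 \<in> (*) Q ` M}"
      then obtain M where M: "M \<in> LT C" "P M" "1 \<in> (*) Q ` M" "N = (*) Q ` M" by blast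
      thus "N \<in> {M \<in> LT C. P M}"
        using tl_Q[OF LTD(1)[OF M(1)]] P[of "(*) Q ` M"] e(2)[of M] unfolding LT_def by simp
    qed
    show "\<forall>a\<in>{M \<in> LT C. P M}. (*) Q ` (*) r ` a = a" using e(1) by blast
    show "\<forall>a'\<in>{M \<in> LT C. P M \<and> 1 \<in> (*) Q ` M}. (*) r ` (*) Q ` a' = a'" using e(2) by blast
  qed
  show "len ((*) r ` M) T = len M T + 3" if M: "M \<in> {M \<in> LT C. P M}" for M
  proof -
    have M': "M \<in> LT C" using M by blast
    have "T \<subseteq> M" using LTD(4)[OF M'] C(2) by blast
    moreover have "len ((*) r ` M) M = 3" using len_Q[OF lat_r[OF LTD(3)[OF M']]] e(1) by simp
    ultimately show ?thesis
      using len_add[OF lat_r[OF LTD(3)[OF M']] LTD(3)[OF M'] ordD(1)[OF T] _ rM[OF LTD(1)[OF M']]] by simp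
  qed
qed

text \<open>The series of the types in \<open>up_lo_types\<close>, counted from below and from above.\<close>

definition Alo :: "'e set \<Rightarrow> rat fps" where
  "Alo C = cnt (thin C) {M \<in> LT (thin C). len M (lo C M) = 1}"
definition Gam :: "'e set \<Rightarrow> rat fps" where
  "Gam C = cnt (thin C) {M \<in> LT (thin C). len M (lo C M) = 2}"
definition Bet :: "'e set \<Rightarrow> rat fps" where
  "Bet C = cnt (thin C) {M \<in> LT (thin C). len (up C M) M = 2}"
definition Aup :: "'e set \<Rightarrow> rat fps" where
  "Aup C = cnt (thin C) {M \<in> LT (thin C). len (up C M) M = 1}"

lemma thin_split:
  assumes C: "order C"
  shows "ser (thin C) (LT (thin C)) w = ser (thin C) (LT C) w
      + ser (thin C) {M \<in> LT (thin C). len M (lo C M) = 1} w + ser (thin C) {M \<in> LT (thin C). len M (lo C M) = 2} w"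
    "ser (thin C) (LT (thin C)) w = ser (thin C) (LT C) w
      + ser (thin C) {M \<in> LT (thin C). len (up C M) M = 2} w + ser (thin C) {M \<in> LT (thin C). len (up C M) M = 1} w"
proof -
  let ?T = "thin C"
  note t = thin_facts[OF C]
  have ab: "len M (lo C M) = 0 \<and> len (up C M) M = 0" if M: "tl C M" for M
    using up_lo_stable[OF C M] tlD(1)[OF M] by simp
  let ?X = "{M \<in> LT ?T. \<not> tl C M}"
  have s: "ser ?T (LT ?T) w = ser ?T (LT C) w + ser ?T ?X w"
    using ser_split[OF t(1) order_refl, of w "tl C"] stable_LT[OF t(1) C t(5)] by simp
  have "ser ?T ?X w = ser ?T {M \<in> ?X. len M (lo C M) = 1} w + ser ?T {M \<in> ?X. \<not> len M (lo C M) = 1} w"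
    by (rule ser_split[OF t(1)]) blast
  moreover have "{M \<in> ?X. len M (lo C M) = 1} = {M \<in> LT ?T. len M (lo C M) = 1}" using ab by fastforce
  moreover have "{M \<in> ?X. \<not> len M (lo C M) = 1} = {M \<in> LT ?T. len M (lo C M) = 2}"
    using ab up_lo_types[OF C LTD(1)] by fastforce
  ultimately show "ser ?T (LT ?T) w = ser ?T (LT C) w + ser ?T {M \<in> LT ?T. len M (lo C M) = 1} w
      + ser ?T {M \<in> LT ?T. len M (lo C M) = 2} w" using s by simp
  have "ser ?T ?X w = ser ?T {M \<in> ?X. len (up C M) M = 2} w + ser ?T {M \<in> ?X. \<not> len (up C M) M = 2} w"
    by (rule ser_split[OF t(1)]) blast
  moreover have "{M \<in> ?X. len (up C M) M = 2} = {M \<in> LT ?T. len (up C M) M = 2}" using ab by fastforce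
  moreover have "{M \<in> ?X. \<not> len (up C M) M = 2} = {M \<in> LT ?T. len (up C M) M = 1}"
    using ab up_lo_types[OF C LTD(1)] by fastforce
  ultimately show "ser ?T (LT ?T) w = ser ?T (LT C) w + ser ?T {M \<in> LT ?T. len (up C M) M = 2} w
      + ser ?T {M \<in> LT ?T. len (up C M) M = 1} w" using s by simp
qed

lemma thin_ser_stable:
  assumes C: "order C" shows "cnt (thin C) (LT C) = fps_X ^ 2 * J C"
  using ser_base[OF thin_facts(1)[OF C] C thin_facts(5)[OF C] order_refl] thin_facts(3)[OF C] unfolding J_def by simp

text \<open>
  The Hecke relation at the maximal ideal \<open>qC\<close> of \<open>\<int>\<^sub>q + qC\<close>: here \<open>(qC)M\<close> is \<open>q (up C M)\<close> and \<open>(M : qC)\<close> is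
  \<open>q\<^sup>-\<^sup>1 (lo C M)\<close>.
\<close>

lemma thin_hecke:
  assumes C: "order C"
  defines "W \<equiv> cnt (thin C) {M \<in> LT (thin C). len (up C M) M = 1 \<and> 1 \<in> (*) Q ` up C M}"
    and "A \<equiv> fps_X ^ 2 * J C"
  shows "of_nat (1 + q) * A + of_nat (q ^ 2) * (fps_X ^ 3 * A) + (Bet C - 1) + Aup C + of_nat q * W
    = fps_X * (of_nat (1 + q + q ^ 2) * A + of_nat (1 + q) * Alo C + Gam C)"
proof -
  let ?T = "thin C" and ?m = "(*) Q ` C"
  let ?L1 = "{M \<in> LT ?T. len M (lo C M) = 1}"
  let ?U1 = "{M \<in> LT ?T. len (up C M) M = 1}"
  let ?U2 = "{M \<in> LT ?T. len (up C M) M = 2}"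
  note t = thin_facts[OF C]
  have m: "?m \<in> Specm ?T" using thin_max(1)[OF C] by simp
  let ?w = "\<lambda>M. of_nat (gauss (len M (?m \<cdot> M) - (if 1 \<in> ?m \<cdot> M then 0 else 1))) :: rat"
  let ?v = "\<lambda>M. of_nat (gauss (len (colon M ?m) M)) :: rat"
  have A: "cnt ?T (LT C) = A" unfolding A_def using thin_ser_stable[OF C] .
  have sub: "LT C \<subseteq> LT ?T" using stable_LT[OF t(1) C t(5)] by blast
  have w: "?w M = of_nat (gauss (3 - len (up C M) M - (if 1 \<in> (*) Q ` up C M then 0 else 1)))"
    if M: "M \<in> LT ?T" for M
  proof -
    have "len M ((*) Q ` up C M) = 3 - len (up C M) M" using up_lo_len(1)[OF C LTD(1)[OF M]] by simp
    thus ?thesis unfolding up_lo(6)[OF C LTD(1)[OF M]] by simp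
  qed
  have v: "?v M = of_nat (gauss (3 - len M (lo C M)))" if M: "M \<in> LT ?T" for M
  proof -
    have "len ((*) r ` lo C M) M = 3 - len M (lo C M)" using up_lo_len(2)[OF C LTD(1)[OF M]] by simp
    thus ?thesis unfolding up_lo(7)[OF C LTD(1)[OF M]] by simp
  qed
  have w1: "ser ?T (LT C) ?w = of_nat (1 + q) * A + of_nat (q ^ 2) * (fps_X ^ 3 * A)"
  proof -
    have "ser ?T (LT C) ?w = ser ?T (LT C) (\<lambda>M. of_nat (1 + q) * 1 + of_nat (q ^ 2) * (if 1 \<in> (*) Q ` M then 1 else 0))"
    proof (rule ser_cong[OF refl])
      fix M assume M: "M \<in> LT C"
      hence M': "M \<in> LT ?T" using sub by blast
      have "len (up C M) M = 0" using up_lo_stable(1)[OF C LTD(1)[OF M]] LTD(3)[OF M] by simp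
      thus "?w M = of_nat (1 + q) * 1 + of_nat (q ^ 2) * (if 1 \<in> (*) Q ` M then 1 else 0)"
        unfolding w[OF M'] up_lo_stable(1)[OF C LTD(1)[OF M]] by (auto simp: gauss_simps)
    qed
    also have "\<dots> = of_nat (1 + q) * A + of_nat (q ^ 2) * ser ?T (LT C) (\<lambda>M. if 1 \<in> (*) Q ` M then 1 else 0)"
      unfolding ser_add ser_cmult A ..
    also have "ser ?T (LT C) (\<lambda>M. if 1 \<in> (*) Q ` M then 1 else 0) = cnt ?T {M \<in> LT C. 1 \<in> (*) Q ` M}"
      by (rule ser_if[OF t(1) sub])
    also have "\<dots> = fps_X ^ 3 * A" using shift_Q[OF t(1) C t(5), of "\<lambda>_. True"] A by simp
    finally show ?thesis .
  qed
  have w2: "ser ?T ?U2 ?w = Bet C - 1"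
  proof -
    let ?B = "?U2"
    have "ser ?T ?B ?w = ser ?T ?B (\<lambda>M. if 1 \<in> (*) Q ` up C M then 1 else 0)"
      by (rule ser_cong[OF refl]) (auto simp: w gauss_simps)
    also have "\<dots> = cnt ?T {M \<in> ?B. 1 \<in> (*) Q ` up C M}" by (rule ser_if[OF t(1)]) blast
    also have "\<dots> = Bet C - cnt ?T {M \<in> ?B. \<not> 1 \<in> (*) Q ` up C M}"
      unfolding Bet_def using ser_split[OF t(1), of ?B "\<lambda>_. 1" "\<lambda>M. 1 \<in> (*) Q ` up C M"] by auto
    also have "{M \<in> ?B. \<not> 1 \<in> (*) Q ` up C M} = {?T}"
      using thin_cyclic[OF C] thin_self[OF C] by auto
    finally show ?thesis using ser_singleton[OF t(1), of "\<lambda>_. 1"] by simp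
  qed
  have w3: "ser ?T ?U1 ?w = Aup C + of_nat q * W"
  proof -
    let ?B = "?U1"
    have "ser ?T ?B ?w = ser ?T ?B (\<lambda>M. 1 + of_nat q * (if 1 \<in> (*) Q ` up C M then 1 else 0))"
      by (rule ser_cong[OF refl]) (auto simp: w gauss_simps)
    also have "\<dots> = Aup C + of_nat q * ser ?T ?B (\<lambda>M. if 1 \<in> (*) Q ` up C M then 1 else 0)"
      unfolding ser_add ser_cmult Aup_def ..
    also have "ser ?T ?B (\<lambda>M. if 1 \<in> (*) Q ` up C M then 1 else 0) = cnt ?T {M \<in> ?B. 1 \<in> (*) Q ` up C M}"
      by (rule ser_if[OF t(1)]) blast
    also have "{M \<in> ?B. 1 \<in> (*) Q ` up C M} = {M \<in> LT ?T. len (up C M) M = 1 \<and> 1 \<in> (*) Q ` up C M}" by blast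
    finally show ?thesis unfolding W_def .
  qed
  have v1: "ser ?T (LT C) ?v = of_nat (1 + q + q ^ 2) * A"
  proof -
    have "ser ?T (LT C) ?v = ser ?T (LT C) (\<lambda>M. of_nat (1 + q + q ^ 2) * 1)"
    proof (rule ser_cong[OF refl])
      fix M assume M: "M \<in> LT C"
      hence M': "M \<in> LT ?T" using sub by blast
      have "len M (lo C M) = 0" using up_lo_stable(2)[OF C LTD(1)[OF M]] LTD(3)[OF M] by simp
      thus "?v M = of_nat (1 + q + q ^ 2) * 1" unfolding v[OF M'] by (simp add: gauss_simps)
    qed
    thus ?thesis unfolding ser_cmult A .
  qed
  have v2: "ser ?T ?L1 ?v = of_nat (1 + q) * Alo C"
  proof -
    have "ser ?T ?L1 ?v = ser ?T ?L1 (\<lambda>M. of_nat (1 + q) * 1)"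
      by (rule ser_cong[OF refl]) (auto simp: v gauss_simps)
    thus ?thesis unfolding ser_cmult Alo_def .
  qed
  have v3: "ser ?T {M \<in> LT ?T. len M (lo C M) = 2} ?v = Gam C"
    unfolding Gam_def by (rule ser_cong[OF refl]) (auto simp: v gauss_simps)
  from hecke[OF t(1) m t(2)]
  show ?thesis
    unfolding thin_split(2)[OF C, of ?w] thin_split(1)[OF C, of ?v] w1 w2 w3 v1 v2 v3
    by (simp add: algebra_simps)
qed

text \<open>
  Two counts of pairs of a lattice \<open>M\<close> and a \<open>C\<close>-lattice \<open>N\<close> with \<open>qN \<subseteq> M \<subseteq> N\<close>: those with
  \<open>len M (qN) = 1\<close>, and those with \<open>len N M = 1\<close> and \<open>1 \<in> qN\<close>. In both the contribution of the
  \<open>C\<close>-lattices \<open>M\<close> is given by the same series \<open>c\<close>, because \<open>N \<mapsto> qN\<close> exchanges the two conditions.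
\<close>

lemma thin_lower_count:
  assumes C: "order C"
  shows "\<exists>c. fps_X ^ 2 * (Alo C + c) = fps_X ^ 2 * J C + of_nat (q + q ^ 2) * (fps_X ^ 3 * (fps_X ^ 2 * J C)) \<and>
    of_nat (1 + q + q ^ 2) * (fps_X ^ 3 * (fps_X ^ 2 * J C)) =
    fps_X * (cnt (thin C) {M \<in> LT (thin C). len (up C M) M = 1 \<and> 1 \<in> (*) Q ` up C M} + fps_X ^ 2 * c)"
proof -
  let ?T = "thin C" and ?m = "(*) Q ` C"
  let ?L1 = "{M \<in> LT ?T. len M (lo C M) = 1}"
  let ?L2 = "{M \<in> LT ?T. len M (lo C M) = 2}"
  let ?U1 = "{M \<in> LT ?T. len (up C M) M = 1}"
  let ?U2 = "{M \<in> LT ?T. len (up C M) M = 2}"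
  note t = thin_facts[OF C]
  have sub: "LT C \<subseteq> LT ?T" using stable_LT[OF t(1) C t(5)] by blast
  have A: "cnt ?T (LT C) = fps_X ^ 2 * J C" using thin_ser_stable[OF C] .
  let ?A = "fps_X ^ 2 * J C"
  have A3: "cnt ?T {M \<in> LT C. 1 \<in> (*) Q ` M} = fps_X ^ 3 * ?A"
    using shift_Q[OF t(1) C t(5), of "\<lambda>_. True"] A by simp
  let ?R = "\<lambda>M N. (*) Q ` N \<subseteq> M \<and> M \<subseteq> N \<and> len M ((*) Q ` N) = 1"
  let ?R3 = "\<lambda>M N. M \<subseteq> N \<and> len N M = 1 \<and> (*) Q ` N \<subseteq> M \<and> 1 \<in> (*) Q ` N"
  let ?c = "\<lambda>M. of_nat (card {N \<in> LT C. ?R M N}) :: rat"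
  define c where "c = ser ?T (LT C) ?c"
  have lenR: "len N ?T = len M ?T + 2" if "M \<in> LT ?T" "N \<in> LT C" "?R M N" for M N
  proof -
    have N: "lat N" "lat M" using that LTD by blast+
    have "len N M = 2" using len_add[OF N(1,2) lat_Q[OF N(1)]] len_Q[OF N(1)] that(3) by simp
    thus ?thesis using len_add[OF N ordD(1)[OF t(1)] LTD(4)[OF that(1)]] that(3) by simp
  qed
  have up: "card {M \<in> LT ?T. ?R M N} = 1 + (q + q ^ 2) * (if 1 \<in> (*) Q ` N then 1 else 0)" if N: "N \<in> LT C" for N
  proof -
    have lN: "lat N" "lat ((*) Q ` N)" and QN: "(*) Q ` N \<subseteq> N" using LTD(3)[OF N] lat_Q Q_sub by blast+
    have tlb: "tl ?T M" if "lat M" "(*) Q ` N \<subseteq> M" "M \<subseteq> N" for M using thin_tl[OF C LTD(1)[OF N] that] .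
    show ?thesis
    proof (cases "1 \<in> (*) Q ` N")
      case True
      hence "{M \<in> LT ?T. ?R M N} = lines ((*) Q ` N) N"
        unfolding lines_def using tlb LTD(3) by (auto simp: LT_def)
      thus ?thesis using card_lines[OF lN(2,1) QN order_refl] len_Q[OF lN(1)] True by (simp add: gauss_simps)
    next
      case False
      have "{M \<in> LT ?T. ?R M N} = {line ((*) Q ` N) 1}"
      proof (intro equalityI subsetI)
        fix M assume M: "M \<in> {M \<in> LT ?T. ?R M N}"
        hence "M \<in> lines ((*) Q ` N) N" unfolding lines_def using LTD(3) by blast
        moreover have "1 \<in> M" using M LTD(2) by blast
        ultimately show "M \<in> {line ((*) Q ` N) 1}" using lines_eq_line[OF lN(2) order_refl _ _ False] by blast
      next
        fix M assume "M \<in> {line ((*) Q ` N) 1}"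
        hence e: "M = line ((*) Q ` N) 1" by simp
        have Q1: "Q * 1 \<in> (*) Q ` N" using LTD(2)[OF N] by (rule imageI)
        have "lat M" "(*) Q ` N \<subseteq> M" "1 \<in> M" "M \<subseteq> N" "len M ((*) Q ` N) = 1"
          unfolding e using line_lat[OF lN(2)] line_upper[OF lat_mod[OF lN(2)]]
            line_least[OF lat_mod[OF lN(1)] QN LTD(2)[OF N]] line_len[OF lN(2) False Q1] by blast+
        thus "M \<in> {M \<in> LT ?T. ?R M N}" using tlb unfolding LT_def by blast
      qed
      thus ?thesis using False by simp
    qed
  qed
  have down: "card {N \<in> LT C. ?R M N} = (if len M (lo C M) = 1 then 1 else 0)" if M: "M \<in> LT ?T" and n: "\<not> tl C M" for M
  proof -
    note f = up_lo[OF C LTD(1)[OF M]]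
    have Qr: "(*) Q ` (*) r ` lo C M = lo C M" by (rule scale_scale[OF Q_r(1)])
    have "{N \<in> LT C. ?R M N} = (if len M (lo C M) = 1 then {(*) r ` lo C M} else {})"
    proof (intro equalityI subsetI)
      fix N assume "N \<in> {N \<in> LT C. ?R M N}"
      hence N: "N \<in> LT C" "?R M N" by auto
      have tQ: "tl C ((*) Q ` N)" using tl_Q[OF LTD(1)[OF N(1)]] .
      have s: "(*) Q ` N \<subseteq> lo C M" using f(9)[OF tQ] N(2) by blast
      have "len M (lo C M) \<noteq> 0" using up_lo_len(6)[OF C LTD(1)[OF M]] n by blast
      hence e: "lo C M = (*) Q ` N"
        using len_eq'[OF LTD(3)[OF M] tlD(1)[OF f(2)] tlD(1)[OF tQ] s f(4)] N(2) by simp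
      have "(*) r ` lo C M = N" unfolding e by (rule scale_scale[OF Q_r(2)])
      thus "N \<in> (if len M (lo C M) = 1 then {(*) r ` lo C M} else {})" using e N(2) by simp
    next
      fix N assume "N \<in> (if len M (lo C M) = 1 then {(*) r ` lo C M} else {})"
      hence N: "len M (lo C M) = 1" "N = (*) r ` lo C M" by (auto split: if_splits)
      have MN: "M \<subseteq> N" using up_lo_len(4)[OF C LTD(1)[OF M]] N(2) by simp
      have QN: "(*) Q ` N = lo C M" unfolding N(2) by (rule Qr)
      have "tl C N" unfolding N(2) using tl_r[OF f(2)] .
      thus "N \<in> {N \<in> LT C. ?R M N}" unfolding LT_def using MN QN N(1) f(4) LTD(2)[OF M] by auto
    qed
    thus ?thesis by simp
  qed
  have e2: "ser ?T (LT C) (\<lambda>N. of_nat (card {M \<in> LT ?T. ?R M N})) = fps_X ^ 2 * ser ?T (LT ?T) ?c"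
    by (rule ser_double[OF t(1) order_refl sub lenR])
  have "ser ?T (LT C) (\<lambda>N. of_nat (card {M \<in> LT ?T. ?R M N})) =
      ser ?T (LT C) (\<lambda>N. 1 + of_nat (q + q ^ 2) * (if 1 \<in> (*) Q ` N then 1 else 0))"
  proof (rule ser_cong[OF refl])
    fix N assume N: "N \<in> LT C"
    show "of_nat (card {M \<in> LT ?T. ?R M N}) = (1 + of_nat (q + q ^ 2) * (if 1 \<in> (*) Q ` N then 1 else 0) :: rat)"
      unfolding up[OF N] by simp
  qed
  also have "\<dots> = ?A + of_nat (q + q ^ 2) * ser ?T (LT C) (\<lambda>N. if 1 \<in> (*) Q ` N then 1 else 0)"
    unfolding ser_add ser_cmult A ..
  also have "ser ?T (LT C) (\<lambda>N. if 1 \<in> (*) Q ` N then 1 else 0) = fps_X ^ 3 * ?A"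
    using ser_if[OF t(1) sub] A3 by simp
  finally have e2L: "ser ?T (LT C) (\<lambda>N. of_nat (card {M \<in> LT ?T. ?R M N})) = ?A + of_nat (q + q ^ 2) * (fps_X ^ 3 * ?A)" .
  have nst: "\<not> tl C M" if "len M (lo C M) \<noteq> 0 \<or> len (up C M) M \<noteq> 0" for M
    using up_lo_stable[OF C, of M] tlD(1)[of C M] that by auto
  have "ser ?T (LT ?T) ?c = c + ser ?T ?L1 ?c + ser ?T ?L2 ?c"
    unfolding c_def by (rule thin_split(1)[OF C])
  also have "ser ?T ?L1 ?c = Alo C"
    unfolding Alo_def by (rule ser_cong[OF refl]) (use down nst in simp)
  also have "ser ?T ?L2 ?c = ser ?T ?L2 (\<lambda>_. 0)"
    by (rule ser_cong[OF refl]) (use down nst in simp)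
  finally have e2R: "ser ?T (LT ?T) ?c = c + Alo C" by simp
  have E2: "fps_X ^ 2 * (Alo C + c) = ?A + of_nat (q + q ^ 2) * (fps_X ^ 3 * ?A)"
    using e2 unfolding e2L e2R by (simp add: add.commute)
  let ?c3 = "\<lambda>M. of_nat (card {N \<in> LT C. ?R3 M N}) :: rat"
  have lenR3: "len N ?T = len M ?T + 1" if "M \<in> LT ?T" "N \<in> LT C" "?R3 M N" for M N
    using len_add[OF LTD(3)[OF that(2)] LTD(3)[OF that(1)] ordD(1)[OF t(1)] LTD(4)[OF that(1)]] that(3) by simp
  have up3: "card {M \<in> LT ?T. ?R3 M N} = (1 + q + q ^ 2) * (if 1 \<in> (*) Q ` N then 1 else 0)" if N: "N \<in> LT C" for N
  proof (cases "1 \<in> (*) Q ` N")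
    case True
    have lN: "lat N" "lat ((*) Q ` N)" and QN: "(*) Q ` N \<subseteq> N" using LTD(3)[OF N] lat_Q Q_sub by blast+
    have "{M \<in> LT ?T. ?R3 M N} = hyperplanes ((*) Q ` N) N"
      unfolding hyperplanes_def using thin_tl[OF C LTD(1)[OF N]] LTD(3) True by (auto simp: LT_def)
    thus ?thesis using card_hyperplanes(1)[OF lN(2,1) QN order_refl] len_Q[OF lN(1)] True by (simp add: gauss_simps)
  qed simp
  have down3: "card {N \<in> LT C. ?R3 M N} = (if len (up C M) M = 1 \<and> 1 \<in> (*) Q ` up C M then 1 else 0)"
    if M: "M \<in> LT ?T" and n: "\<not> tl C M" for M
  proof -
    note f = up_lo[OF C LTD(1)[OF M]]
    have "{N \<in> LT C. ?R3 M N} = (if len (up C M) M = 1 \<and> 1 \<in> (*) Q ` up C M then {up C M} else {})"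
    proof (intro equalityI subsetI)
      fix N assume "N \<in> {N \<in> LT C. ?R3 M N}"
      hence N: "N \<in> LT C" "?R3 M N" by auto
      have s: "up C M \<subseteq> N" using f(8)[OF LTD(1)[OF N(1)]] N(2) by blast
      have "len (up C M) M \<noteq> 0" using up_lo_len(5)[OF C LTD(1)[OF M]] n by blast
      hence "up C M = N"
        using len_eq[OF LTD(3)[OF N(1)] tlD(1)[OF f(1)] LTD(3)[OF M] f(5) s] N(2) by simp
      thus "N \<in> (if len (up C M) M = 1 \<and> 1 \<in> (*) Q ` up C M then {up C M} else {})" using N(2) by simp
    next
      fix N assume "N \<in> (if len (up C M) M = 1 \<and> 1 \<in> (*) Q ` up C M then {up C M} else {})"
      hence N: "len (up C M) M = 1" "1 \<in> (*) Q ` up C M" "N = up C M" by (auto split: if_splits)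
      have "(*) Q ` N \<subseteq> M" using f(3,4) N(3) by blast
      thus "N \<in> {N \<in> LT C. ?R3 M N}" unfolding LT_def using N f(1,5) LTD(2)[OF M] by auto
    qed
    thus ?thesis by simp
  qed
  have e3: "ser ?T (LT C) (\<lambda>N. of_nat (card {M \<in> LT ?T. ?R3 M N})) = fps_X ^ 1 * ser ?T (LT ?T) ?c3"
    by (rule ser_double[OF t(1) order_refl sub lenR3])
  have "ser ?T (LT C) (\<lambda>N. of_nat (card {M \<in> LT ?T. ?R3 M N})) =
      ser ?T (LT C) (\<lambda>N. of_nat (1 + q + q ^ 2) * (if 1 \<in> (*) Q ` N then 1 else 0))"
  proof (rule ser_cong[OF refl])
    fix N assume N: "N \<in> LT C"
    show "of_nat (card {M \<in> LT ?T. ?R3 M N}) = (of_nat (1 + q + q ^ 2) * (if 1 \<in> (*) Q ` N then 1 else 0) :: rat)"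
      unfolding up3[OF N] by simp
  qed
  also have "\<dots> = of_nat (1 + q + q ^ 2) * (fps_X ^ 3 * ?A)"
    unfolding ser_cmult using ser_if[OF t(1) sub] A3 by simp
  finally have e3L: "ser ?T (LT C) (\<lambda>N. of_nat (card {M \<in> LT ?T. ?R3 M N})) = of_nat (1 + q + q ^ 2) * (fps_X ^ 3 * ?A)" .
  let ?W = "cnt ?T {M \<in> LT ?T. len (up C M) M = 1 \<and> 1 \<in> (*) Q ` up C M}"
  have "ser ?T (LT ?T) ?c3 = ser ?T (LT C) ?c3 + ser ?T ?U2 ?c3 + ser ?T ?U1 ?c3"
    by (rule thin_split(2)[OF C])
  also have "ser ?T ?U2 ?c3 = ser ?T ?U2 (\<lambda>_. 0)"
    by (rule ser_cong[OF refl]) (use down3 nst in simp)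
  also have "ser ?T ?U1 ?c3 =
      ser ?T ?U1 (\<lambda>M. if 1 \<in> (*) Q ` up C M then 1 else 0)"
    by (rule ser_cong[OF refl]) (use down3 nst in simp)
  also have "\<dots> = cnt ?T {M \<in> ?U1. 1 \<in> (*) Q ` up C M}"
    by (rule ser_if[OF t(1)]) blast
  also have "{M \<in> ?U1. 1 \<in> (*) Q ` up C M} =
      {M \<in> LT ?T. len (up C M) M = 1 \<and> 1 \<in> (*) Q ` up C M}" by blast
  finally have e3R: "ser ?T (LT ?T) ?c3 = ser ?T (LT C) ?c3 + ?W" by simp
  have "ser ?T (LT C) ?c3 = ser ?T (LT C) (\<lambda>N. of_nat (card {M \<in> LT C. ?R M N}))"
  proof (rule ser_cong[OF refl])
    fix y assume y: "y \<in> LT C"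
    have "bij_betw ((`) ((*) Q)) {N \<in> LT C. ?R3 y N} {M \<in> LT C. ?R M y}"
    proof (rule bij_betw_byWitness[where f' = "(`) ((*) r)"])
      show "\<forall>a\<in>{N \<in> LT C. ?R3 y N}. (*) r ` (*) Q ` a = a" "\<forall>a\<in>{M \<in> LT C. ?R M y}. (*) Q ` (*) r ` a = a"
        using scale_scale Q_r by blast+
      show "(`) ((*) Q) ` {N \<in> LT C. ?R3 y N} \<subseteq> {M \<in> LT C. ?R M y}"
      proof
        fix M assume "M \<in> (`) ((*) Q) ` {N \<in> LT C. ?R3 y N}"
        then obtain N where N: "N \<in> LT C" "?R3 y N" "M = (*) Q ` N" by blast
        have yN: "y \<subseteq> N" using N(2) by blast
        have "len M ((*) Q ` y) = 1" unfolding N(3)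
          using len_scale[OF LTD(3)[OF N(1)] LTD(3)[OF y] yN Q_r(1)] N(2) by simp
        thus "M \<in> {M \<in> LT C. ?R M y}" using N tl_Q[OF LTD(1)[OF N(1)]] unfolding LT_def by blast
      qed
      show "(`) ((*) r) ` {M \<in> LT C. ?R M y} \<subseteq> {N \<in> LT C. ?R3 y N}"
      proof
        fix N assume "N \<in> (`) ((*) r) ` {M \<in> LT C. ?R M y}"
        then obtain M where M: "M \<in> LT C" "?R M y" "N = (*) r ` M" by blast
        have e: "(*) Q ` N = M" unfolding M(3) by (rule scale_scale[OF Q_r(1)])
        have yN: "y \<subseteq> N" unfolding M(3) using M(2) by (auto simp: mem_r_iff)
        have tN: "tl C N" unfolding M(3) using tl_r[OF LTD(1)[OF M(1)]] .
        have "len N y = 1"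
          using len_scale[OF tlD(1)[OF tN] LTD(3)[OF y] yN Q_r(1)] M(2) e by simp
        moreover have "1 \<in> N" using yN LTD(2)[OF y] by blast
        ultimately show "N \<in> {N \<in> LT C. ?R3 y N}"
          using tN yN e M(2) LTD(2)[OF M(1)] unfolding LT_def by simp
      qed
    qed
    thus "?c3 y = of_nat (card {M \<in> LT C. ?R M y})" by (simp add: bij_betw_same_card)
  qed
  also have "\<dots> = fps_X ^ 2 * c" unfolding c_def
    by (rule ser_double[OF t(1) sub sub]) (use lenR sub in blast)
  finally have "ser ?T (LT C) ?c3 = fps_X ^ 2 * c" .
  hence "of_nat (1 + q + q ^ 2) * (fps_X ^ 3 * ?A) = fps_X * (?W + fps_X ^ 2 * c)"
    using e3 unfolding e3L e3R by (simp add: add.commute)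
  with E2 show ?thesis by blast
qed

lemma J_thin_split:
  assumes C: "order C"
  shows "J (thin C) = fps_X ^ 2 * J C + Alo C + Gam C" "J (thin C) = fps_X ^ 2 * J C + Bet C + Aup C"
  using thin_split[OF C, of "\<lambda>_. 1"] thin_ser_stable[OF C] unfolding J_def Alo_def Gam_def Bet_def Aup_def by simp_all

text \<open>The series \<open>c\<close> of \<open>thin_lower_count\<close> and the series \<open>W\<close> of \<open>thin_hecke\<close> are eliminated.\<close>

lemma J_thin:
  assumes C: "order C"
  shows "(1 - fps_X) * J (thin C) = 1 + (1 - fps_X) * (of_nat q * fps_X) *
    (fps_X ^ 2 * J C + Alo C + of_nat q * (1 - of_nat q * fps_X) * (fps_X ^ 2 * J C))"
proof -
  obtain c where c: "fps_X ^ 2 * (Alo C + c) = fps_X ^ 2 * J C + of_nat (q + q ^ 2) * (fps_X ^ 3 * (fps_X ^ 2 * J C))"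
    "of_nat (1 + q + q ^ 2) * (fps_X ^ 3 * (fps_X ^ 2 * J C)) =
      fps_X * (cnt (thin C) {M \<in> LT (thin C). len (up C M) M = 1 \<and> 1 \<in> (*) Q ` up C M} + fps_X ^ 2 * c)"
    using thin_lower_count[OF C] by blast
  define A where "A = fps_X ^ 2 * J C"
  define W where "W = cnt (thin C) {M \<in> LT (thin C). len (up C M) M = 1 \<and> 1 \<in> (*) Q ` up C M}"
  define X where "X = (fps_X :: rat fps)"
  define p where "p = (of_nat q :: rat fps)"
  have e2: "X ^ 2 * (Alo C + c) = A + (p + p ^ 2) * (X ^ 3 * A)"
    using c(1) unfolding A_def X_def p_def by simp
  have "X * ((1 + p + p ^ 2) * (X ^ 2 * A)) = X * (W + X ^ 2 * c)"
    using c(2) unfolding A_def X_def p_def W_def by (simp add: algebra_simps power3_eq_cube power2_eq_square)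
  hence e3: "(1 + p + p ^ 2) * (X ^ 2 * A) = W + X ^ 2 * c" by (simp add: X_def)
  have e1: "(1 + p) * A + p ^ 2 * (X ^ 3 * A) + (Bet C - 1) + Aup C + p * W
    = X * ((1 + p + p ^ 2) * A + (1 + p) * Alo C + Gam C)"
    using thin_hecke[OF C] unfolding A_def X_def p_def W_def by simp
  define K where "K = J (thin C)"
  have J: "K = A + Alo C + Gam C" "K = A + Bet C + Aup C"
    using J_thin_split[OF C] unfolding A_def K_def by auto
  have W: "W = (1 + p + p ^ 2) * (X ^ 2 * A) - (A + (p + p ^ 2) * (X ^ 3 * A) - X ^ 2 * Alo C)"
    using e2 e3 by (simp add: algebra_simps)
  have B: "Bet C = K - A - Aup C" and G: "Gam C = K - A - Alo C" using J by (simp_all add: algebra_simps)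
  have "(1 + p) * A + p ^ 2 * (X ^ 3 * A) + (K - A) - 1 + p * W
    = X * ((1 + p + p ^ 2) * A + (1 + p) * Alo C + (K - A - Alo C))"
    using e1 unfolding B G by (simp add: algebra_simps)
  hence "(1 - X) * K = 1 + (1 - X) * (p * X) * (A + Alo C + p * (1 - p * X) * A)"
    unfolding W by (simp add: poly_simps)
  thus ?thesis unfolding A_def X_def p_def K_def .
qed

lemma colon_line:
  assumes N: "tl S N" and sub: "colon N (line S y) \<subseteq> N" and S: "submodule_over Z S"
  shows "colon N (line S y) = {x \<in> N. y * x \<in> N}"
proof (intro equalityI subsetI)
  fix x assume "x \<in> colon N (line S y)"
  thus "x \<in> {x \<in> N. y * x \<in> N}" using sub colonD[of x N "line S y" y] line_upper(2)[OF S] by (auto simp: mult.commute)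
next
  fix x assume x: "x \<in> {x \<in> N. y * x \<in> N}"
  show "x \<in> colon N (line S y)"
  proof (rule colonI)
    fix v assume "v \<in> line S y"
    then obtain c z where v: "v = c + z * y" "c \<in> S" "z \<in> Z" by (rule lineE)
    have "c * x + z * (y * x) \<in> N"
      using tl_mult[OF N v(2)] submodD(6)[OF lat_mod[OF tlD(1)[OF N]] v(3)] x by (intro tl_add[OF N]) blast+
    thus "x * v \<in> N" by (simp add: v(1) algebra_simps)
  qed
qed

text \<open>Multiplication by \<open>y\<close> embeds \<open>N\<close> modulo this submodule into \<open>N'/N\<close>.\<close>

lemma len_kernel_le:
  assumes N': "lat N'" and N: "lat N" and sub: "N \<subseteq> N'" and y: "\<And>x. x \<in> N \<Longrightarrow> y * x \<in> N'"
    and F: "lat {x \<in> N. y * x \<in> N}"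
  shows "len N {x \<in> N. y * x \<in> N} \<le> len N' N"
proof -
  let ?F = "{x \<in> N. y * x \<in> N}"
  have "card (cosets ?F N) = card ((\<lambda>x. {z. z - y * x \<in> N}) ` N)"
    unfolding cosets_def
  proof (rule card_image_eqI)
    fix x x' assume x: "x \<in> N" "x' \<in> N"
    have "{z. z - x \<in> ?F} = {z. z - x' \<in> ?F} \<longleftrightarrow> x - x' \<in> ?F" by (rule coset_eq_iff[OF lat_add[OF F]])
    also have "\<dots> \<longleftrightarrow> y * x - y * x' \<in> N"
      using subgroupD(2)[OF lat_add[OF N] x] by (simp add: right_diff_distrib)
    also have "\<dots> \<longleftrightarrow> {z. z - y * x \<in> N} = {z. z - y * x' \<in> N}" by (rule coset_eq_iff[OF lat_add[OF N], symmetric])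
    finally show "{z. z - x \<in> ?F} = {z. z - x' \<in> ?F} \<longleftrightarrow> {z. z - y * x \<in> N} = {z. z - y * x' \<in> N}" .
  qed
  also have "\<dots> \<le> card (cosets N N')"
    using card_cosets(2)[OF N N' sub] y unfolding cosets_def by (intro card_mono) auto
  finally have "q ^ len N ?F \<le> q ^ len N' N"
    using card_cosets(1)[OF F N] card_cosets(1)[OF N N' sub] by simp
  thus ?thesis by (rule power_le_imp_le_exp[OF q_gt1])
qed

lemma zeta_local:
  assumes T: "order T" and m: "Specm T = {m}" and l: "len T m = 1"
  shows "(1 - fps_X) * zeta T = 1"
  using zeta_mult[OF T] m l by simp

lemma zeta_thin: assumes C: "order C" shows "(1 - fps_X) * zeta (thin C) = 1"
  using zeta_local[OF thin_facts(1)[OF C] thin_max(1)[OF C] thin_facts(2)[OF C]] .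

section \<open>Gorenstein orders whose minimal overorder is not Gorenstein\<close>

text \<open>
  The module \<open>V = q\<^sup>-\<^sup>1m\<close> has index \<open>q\<close> in \<open>D\<close>, contains \<open>\<int>\<^sub>q + qD\<close>, and is not a ring, as otherwise
  \<open>V \<subseteq> (T : m)\<close>. So every order that contains \<open>V\<close> contains \<open>D\<close>. If \<open>D\<close> were \<open>\<int>\<^sub>q + qW\<close>, then products of
  elements of \<open>V\<close> would be in \<open>V\<close>, because \<open>q\<^sup>2W \<subseteq> qD\<close>. The last claim follows from \<open>(N : m) = q\<^sup>-\<^sup>1(N : V)\<close>.
\<close>

lemma gor_thin_structure:
  assumes T: "order T" and g: "gor T" and m: "m \<in> Specm T" and ninv: "\<not> invertible T m"
    and D: "order D" and CD: "colon T m = thin D"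
  shows "gor D" "Specm T = {m}" "m \<subseteq> (*) Q ` D"
    "\<And>N. N \<in> LT (thin D) \<Longrightarrow> len (colon N m) N = (if tl D N then 3 else 2)"
proof -
  let ?C = "thin D"
  let ?V = "(*) r ` m"
  note C = ninv_order[OF T m ninv, unfolded CD] and G = gor_ninv[OF T g m ninv, unfolded CD]
  note M = max_lat[OF T m] and t = thin_facts[OF D]
  have mC: "tl ?C m" using C(2) .
  have "m \<subset> ?C" using M(3) C(3) by blast
  then obtain k where "k \<in> Specm ?C" "m \<subseteq> k" by (rule max_exists[OF C(1) tlD(2)[OF mC]])
  thus mQ: "m \<subseteq> (*) Q ` D" using thin_max(1)[OF D] by simp
  have lQ: "lat ((*) Q ` D)" using lat_Q[OF ordD(1)[OF D]] .
  have "len ?C m = 2"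
    using len_add[OF ordD(1)[OF C(1)] ordD(1)[OF T] tlD(1)[OF M(1)] _ C(3)] M(3) G(1,2) by auto
  hence lQm: "len ((*) Q ` D) m = 1"
    using len_add[OF ordD(1)[OF C(1)] lQ tlD(1)[OF M(1)] mQ t(4)] t(2) by simp
  have QV: "(*) Q ` ?V = m" by (rule scale_scale[OF Q_r(1)])
  have rQ: "(*) r ` (*) Q ` D = D" by (rule scale_scale[OF Q_r(2)])
  have V: "tl ?C ?V" using tl_r[OF mC] .
  have VD: "?V \<subseteq> D" using image_mono[OF mQ, of "(*) r"] rQ by simp
  have lV: "len D ?V = 1" using len_scale[OF lQ tlD(1)[OF M(1)] mQ Q_r(2)] rQ lQm by simp
  have Qm: "Q \<in> m" using M(2) ordD(2)[OF T] by (metis image_subset_iff mult_1_right)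
  hence oneV: "1 \<in> ?V" by (simp add: mem_r_iff)
  have CV: "?C \<subseteq> ?V" using one_in_ideal[OF tlD(2)[OF V] oneV] .
  have QDV: "(*) Q ` D \<subseteq> ?V" using CV t(4) by blast
  have notring: "\<not> (\<forall>x\<in>?V. \<forall>y\<in>?V. x * y \<in> ?V)"
  proof
    assume ring: "\<forall>x\<in>?V. \<forall>y\<in>?V. x * y \<in> ?V"
    have "?V \<subseteq> colon T m"
    proof (intro subsetI colonI)
      fix x y assume "x \<in> ?V" "y \<in> m"
      hence "x * (r * y) \<in> ?V" using ring by blast
      hence "Q * (x * (r * y)) \<in> m" by (simp add: mem_r_iff)
      hence "x * y \<in> m" by (simp add: mult.left_commute)
      thus "x * y \<in> T" using M(3) by blast
    qed
    hence "?V = ?C" using CV CD by blast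
    thus False using lV t(3) by simp
  qed
  have order_V: "D \<subseteq> S" if S: "order S" "?V \<subseteq> S" for S
  proof -
    have l: "lat (S \<inter> D)" using lat_Int[OF ordD(1)[OF S(1)] ordD(1)[OF D]] .
    have s: "?V \<subseteq> S \<inter> D" "S \<inter> D \<subseteq> D" using S(2) VD by auto
    have "len D (S \<inter> D) + len (S \<inter> D) ?V = 1"
      using len_add[OF ordD(1)[OF D] l tlD(1)[OF V] s] lV by simp
    moreover have "len (S \<inter> D) ?V \<noteq> 0"
    proof
      assume "len (S \<inter> D) ?V = 0"
      hence e: "?V = S \<inter> D" by (rule len_0[OF l tlD(1)[OF V] s(1)])
      have "\<forall>x\<in>S \<inter> D. \<forall>y\<in>S \<inter> D. x * y \<in> S \<inter> D"
        using ordD(3)[OF S(1)] ordD(3)[OF D] by blast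
      thus False using notring unfolding e by blast
    qed
    ultimately have "len D (S \<inter> D) = 0" by linarith
    hence "S \<inter> D = D" by (rule len_0[OF ordD(1)[OF D] l s(2)])
    thus ?thesis by blast
  qed
  show "gor D"
  proof (rule ccontr)
    assume "\<not> gor D"
    then obtain W where W: "order W" "D = thin W" using not_gor_thin[OF D] by blast
    have "x * y \<in> ?V" if xy: "x \<in> ?V" "y \<in> ?V" for x y
    proof -
      have "x \<in> line ((*) Q ` W) 1" "y \<in> line ((*) Q ` W) 1" using xy VD W(2) by blast+
      then obtain a z b w where a: "x = a + z * 1" "a \<in> (*) Q ` W" "z \<in> Z"
        and b: "y = b + w * 1" "b \<in> (*) Q ` W" "w \<in> Z" by (metis lineE)
      obtain a' b' where a': "a = Q * a'" "a' \<in> W" and b': "b = Q * b'" "b' \<in> W" using a(2) b(2) by blast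
      have "Q * (a' * b') \<in> D" using ordD(3)[OF W(1) a'(2) b'(2)] thin_facts(4)[OF W(1)] W(2) by blast
      hence "Q * (Q * (a' * b')) \<in> ?V" using QDV by blast
      moreover have "z * y \<in> ?V" "w * x \<in> ?V" using submodD(6)[OF lat_mod[OF tlD(1)[OF V]]] a(3) b(3) xy by blast+
      moreover have "z * w \<in> ?V" using submodD(6)[OF Z_mod a(3) b(3)] order_Z[OF C(1)] CV by blast
      ultimately have "Q * (Q * (a' * b')) + z * y + w * x - z * w \<in> ?V"
        by (intro tl_diff[OF V] tl_add[OF V])
      moreover have "Q * (Q * (a' * b')) + z * y + w * x - z * w = x * y"
        by (simp add: a(1) b(1) a'(1) b'(1) algebra_simps)
      ultimately show ?thesis by simp
    qed
    thus False using notring by blast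
  qed
  show "Specm T = {m}"
  proof -
    have "n = m" if n: "n \<in> Specm T" for n
    proof (rule ccontr)
      assume "n \<noteq> m"
      then obtain x where x: "x \<in> n" "x \<notin> m"
        using max_lat(5)[OF T n tlD(2)[OF M(1)]] M(3,4) by blast
      have xT: "x \<in> T" using x(1) max_lat(3)[OF T n] by blast
      have e: "T \<inter> (*) Q ` D = m"
      proof (rule M(5))
        show "submodule_over T (T \<inter> (*) Q ` D)"
          using submod_Int[OF ordD(4)[OF T]]
            submod_mono[OF tlD(2)[OF tl_Q[OF ordD(5)[OF D]]]] C(3) t(5) by blast
        show "m \<subseteq> T \<inter> (*) Q ` D" using mQ M(3) by blast
        show "1 \<notin> T \<inter> (*) Q ` D" using one_notin_Q[OF D] by blast
      qed blast
      have xC: "x \<in> ?C" using xT C(3) by blast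
      have "x \<notin> k" if "k \<in> Specm ?C" for k
        using that thin_max(1)[OF D] x(2) xT e by blast
      then obtain s where s: "s \<in> ?C" "x * s = 1" by (rule unit_iff_no_max[OF C(1) xC])
      have xs: "(*) x ` T \<subseteq> T" "(*) x ` ?C \<subseteq> ?C"
        using tl_multiples[OF ordD(5)[OF T] xT] tl_multiples[OF ordD(5)[OF C(1)] xC] .
      have "?C \<subseteq> (*) x ` ?C"
        using ordD(3)[OF C(1) _ s(1)] mem_scale_iff[OF s(2), of _ ?C] by (auto simp: mult.commute)
      hence "(*) x ` ?C = ?C" using xs(2) by blast
      hence "len T ((*) x ` T) = 0"
        using len_scale_const[OF ordD(1)[OF T] ordD(1)[OF C(1)] s(2) xs] ordD(1)[OF C(1)] by simp
      hence "(*) x ` T = T" using len_0[OF ordD(1)[OF T] lat_scale[OF ordD(1)[OF T] s(2)] xs(1)] by simp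
      hence "1 \<in> (*) x ` T" using ordD(2)[OF T] by simp
      then obtain u where u: "u \<in> T" "1 = x * u" by blast
      have "u * x \<in> n" using tl_mult[OF max_lat(1)[OF T n] u(1) x(1)] .
      thus False using u(2) max_lat(4)[OF T n] by (simp add: mult.commute)
    qed
    thus ?thesis using m by blast
  qed
  show "len (colon N m) N = (if tl D N then 3 else 2)" if N: "N \<in> LT ?C" for N
  proof -
    have lN: "lat N" and tN: "tl ?C N" using LTD[OF N] by auto
    let ?F = "colon N ?V"
    have "colon N ((*) Q ` ?V) = (*) r ` ?F" by (rule colon_image[OF Q_r(1)])
    hence cN: "colon N m = (*) r ` ?F" using QV by simp
    have lF: "lat ?F" using lat_colon[OF lN tlD(1)[OF V]] .
    have FN: "?F \<subseteq> N" using colonD[of _ N ?V 1] oneV by auto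
    have QNF: "(*) Q ` N \<subseteq> ?F"
    proof
      fix x assume "x \<in> (*) Q ` N"
      then obtain n where n: "n \<in> N" "x = Q * n" by blast
      show "x \<in> ?F"
      proof (rule colonI)
        fix v assume "v \<in> ?V"
        hence "Q * v \<in> ?C" using QV M(3) C(3) by (auto simp: mem_r_iff)
        hence "Q * v * n \<in> N" using tl_mult[OF tN _ n(1)] by blast
        thus "x * v \<in> N" by (simp add: n(2) mult_ac)
      qed
    qed
    have "(*) Q ` (*) r ` ?F = ?F" by (rule scale_scale[OF Q_r(1)])
    hence "len ((*) r ` ?F) ?F = 3" using len_Q[OF lat_r[OF lF]] by simp
    moreover have "N \<subseteq> (*) r ` ?F" using QNF by (auto simp: mem_r_iff)
    ultimately have l3: "len (colon N m) N + len N ?F = 3"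
      unfolding cN using len_add[OF lat_r[OF lF] lN lF FN] by simp
    show ?thesis
    proof (cases "tl D N")
      case True
      hence "N \<subseteq> ?F" using tl_mult' VD by (blast intro: colonI)
      hence "?F = N" using FN by blast
      thus ?thesis using True l3 lN by simp
    next
      case False
      note f = up_lo[OF D tN]
      have "?F \<noteq> N"
      proof
        assume e: "?F = N"
        have "order (colon N N)" unfolding order_in_def
        proof (intro conjI ballI)
          show "lat (colon N N)" using lat_colon[OF lN lN] .
          show "1 \<in> colon N N" by (rule colonI) simp
          show "x * y \<in> colon N N" if "x \<in> colon N N" "y \<in> colon N N" for x y
          proof (rule colonI)
            fix n assume "n \<in> N"
            thus "x * y * n \<in> N" using colonD[OF that(1) colonD[OF that(2)], of n] by (simp add: mult.assoc)
          qed
        qed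
        moreover have "?V \<subseteq> colon N N"
        proof (intro subsetI colonI)
          fix v n assume "v \<in> ?V" "n \<in> N"
          thus "v * n \<in> N" using colonD[of n N ?V v] e by (simp add: mult.commute)
        qed
        ultimately have "D \<subseteq> colon N N" by (rule order_V)
        hence "tl D N" unfolding tl_def submodule_over_def using lN lat_add[OF lN] colonD by blast
        thus False using False by blast
      qed
      hence pos: "len N ?F > 0" using len_pos[OF lN lF] FN by blast
      have Fle: "lo D N \<subseteq> ?F" unfolding lo_def using VD colonD by (blast intro: colonI)
      have "len N ?F \<le> 1"
      proof (cases "len N (lo D N) = 1")
        case True
        thus ?thesis using len_mono(2)[OF lN lF tlD(1)[OF f(2)] Fle FN] by simp
      next
        case nle: False
        hence a: "len (up D N) N = 1" using up_lo_types[OF D tN False] by blast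
        have "len ?V ?C = 1" using len_add[OF ordD(1)[OF D] tlD(1)[OF V] ordD(1)[OF C(1)] CV VD] lV t(3) by simp
        hence VL: "?V \<in> lines ?C ?V" unfolding lines_def using tlD(1)[OF V] CV by blast
        have "?V \<noteq> ?C" using \<open>len ?V ?C = 1\<close> ordD(1)[OF C(1)] by auto
        then obtain y where y: "y \<in> ?V" "y \<notin> ?C" using CV by blast
        have QVC: "(*) Q ` ?V \<subseteq> ?C" using QV M(3) C(3) by blast
        have Vy: "?V = line ?C y" using lines_eq_line[OF ordD(1)[OF C(1)] QVC VL y] .
        have eF: "?F = {x \<in> N. y * x \<in> N}"
          using colon_line[OF tN _ lat_mod[OF ordD(1)[OF C(1)]], of y] FN unfolding Vy[symmetric] by blast
        have yD: "y \<in> D" using y(1) VD by blast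
        have "y * x \<in> up D N" if "x \<in> N" for x using tl_mult[OF f(1) yD] f(5) that by blast
        hence "len N ?F \<le> len (up D N) N"
          using len_kernel_le[OF tlD(1)[OF f(1)] lN f(5)] lF unfolding eF by blast
        thus ?thesis using a by simp
      qed
      thus ?thesis using l3 pos False by simp
    qed
  qed
qed

text \<open>
  The pairs \<open>N \<subseteq> M\<close> with \<open>M/N \<cong> T/m\<close> for which \<open>N\<close> is a lattice over \<open>\<int>\<^sub>q + qD\<close> and \<open>M\<close> is not are counted
  in two ways: \<open>M\<close> determines \<open>N = mM\<close>, and \<open>N\<close> has \<open>q\<close> such extensions if \<open>len N (lo D N) = 2\<close>, otherwise none.
\<close>

lemma J_gor_thin:
  assumes T: "order T" and g: "gor T" and m: "m \<in> Specm T" and ninv: "\<not> invertible T m"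
    and D: "order D" and CD: "colon T m = thin D"
  shows "(1 - fps_X) * J T = 1 + (1 - fps_X) * (of_nat q * fps_X ^ 2) *
    (J (thin D) + of_nat q * fps_X ^ 2 * (1 - of_nat q * fps_X) * J D)"
proof -
  let ?C = "thin D" and ?P = "submodule_product m"
  let ?X = "{M \<in> LT T. \<not> tl ?C M}"
  note C = ninv_order[OF T m ninv, unfolded CD] and G = gor_ninv[OF T g m ninv, unfolded CD]
  note S = gor_thin_structure[OF T g m ninv D CD]
  have sub: "LT ?C \<subseteq> LT T" using stable_LT[OF T C(1,3)] by blast
  define Y where "Y = cnt T ?X"
  have JT: "J T = fps_X * J ?C + Y"
    using ser_split[OF T order_refl, of "\<lambda>_. 1" "tl ?C"] stable_LT[OF T C(1,3)]
      ser_base[OF T C(1,3) order_refl, of "\<lambda>_. 1"] G(2) unfolding J_def Y_def by simp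
  let ?R = "\<lambda>N M. N \<subseteq> M \<and> ?P M \<subseteq> N \<and> len M N = 1"
  have down: "of_nat (card {N \<in> LT ?C. ?R N M}) = (if 1 \<in> ?P M then 1 else 0 :: rat)" if M: "M \<in> ?X" for M
  proof -
    have M': "M \<in> LT T" "\<not> tl ?C M" using M by auto
    have l1: "len M (?P M) = 1"
      using gor_dichotomy(1)[OF T g m ninv LTD(1)[OF M'(1)]] M'(2) CD by simp
    have P: "tl T (?P M)" "?P M \<subseteq> M" using tl_max_prod[OF T m LTD(1)[OF M'(1)]] max_prod_sub[OF T m LTD(1)[OF M'(1)]] .
    have PC: "tl ?C (?P M)" using tl_product'[OF C(2) LTD(3)[OF M'(1)]] .
    have "N = ?P M" if "N \<in> LT ?C" "?R N M" for N
      using len_eq'[OF LTD(3)[OF M'(1)] LTD(3)[OF that(1)] tlD(1)[OF P(1)]] that(2) l1 by simp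
    hence "{N \<in> LT ?C. ?R N M} = (if 1 \<in> ?P M then {?P M} else {})"
      using PC P(2) l1 unfolding LT_def by auto
    thus ?thesis by simp
  qed
  have up: "card {M \<in> ?X. ?R N M} = q * (if len N (lo D N) = 2 then 1 else 0)" if N: "N \<in> LT ?C" for N
  proof -
    have N': "N \<in> LT T" using N sub by blast
    note k = Q_kills_colon[OF T m LTD(1)[OF N']]
    have m': "(*) Q ` D \<in> Specm ?C" using thin_max(1)[OF D] by simp
    note k' = Q_kills_colon[OF C(1) m' LTD(1)[OF N]]
    have all: "{M \<in> LT T. ?R N M} = lines N (colon N m)"
      by (rule extensions_eq_lines[OF T m G(1) N'])
    have stab: "{M \<in> LT ?C. ?R N M} = lines N (colon N ((*) Q ` D))"
    proof (intro equalityI subsetI)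
      fix M assume "M \<in> {M \<in> LT ?C. ?R N M}"
      hence M: "M \<in> LT ?C" "N \<subseteq> M" "len M N = 1" by auto
      have "simple ?C N M" by (rule simple_if_len_1[OF LTD(1)[OF N] LTD(1)[OF M(1)] M(2,3)])
      hence "annq ?C N M = (*) Q ` D" using simple_max(1)[OF C(1)] thin_max(1)[OF D] by blast
      hence "M \<subseteq> colon N ((*) Q ` D)" unfolding annq_def
        by (intro subsetI colonI) (metis (mono_tags, lifting) mem_Collect_eq mult.commute)
      thus "M \<in> lines N (colon N ((*) Q ` D))" unfolding lines_def using M LTD(3) by blast
    next
      fix M assume "M \<in> lines N (colon N ((*) Q ` D))"
      hence M: "lat M" "N \<subseteq> M" "M \<subseteq> colon N ((*) Q ` D)" "len M N = 1" unfolding lines_def by auto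
      have "tl ?C M" using tl_if_killed[OF C(1) m' thin_facts(2)[OF D] LTD(1)[OF N] M(1-3)] .
      moreover have "M \<subseteq> colon N m" using M(3) S(3) colonD by (blast intro: colonI)
      hence "?P M \<subseteq> N" using product_sub_iff[OF lat_add[OF LTD(3)[OF N]]] by blast
      ultimately show "M \<in> {M \<in> LT ?C. ?R N M}" using M LTD(2)[OF N] unfolding LT_def by blast
    qed
    have fin: "finite {M \<in> LT T. ?R N M}"
      unfolding all using card_lines_pred(2)[OF LTD(3)[OF N] tlD(1)[OF k(2)] k(3,1), of "\<lambda>_. True" "\<lambda>_. True"] by simp
    have "{M \<in> LT T. ?R N M} = {M \<in> ?X. ?R N M} \<union> {M \<in> LT ?C. ?R N M}"
      using sub stable_LT[OF T C(1,3)] by blast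
    moreover have "{M \<in> ?X. ?R N M} \<inter> {M \<in> LT ?C. ?R N M} = {}" using LTD(1) by blast
    ultimately have "card {M \<in> LT T. ?R N M} = card {M \<in> ?X. ?R N M} + card {M \<in> LT ?C. ?R N M}"
      using fin card_Un_disjoint by (metis (no_types, lifting) finite_Un)
    hence c: "gauss (len (colon N m) N) = card {M \<in> ?X. ?R N M} + gauss (len (colon N ((*) Q ` D)) N)"
      unfolding all stab
      using card_lines[OF LTD(3)[OF N] tlD(1)[OF k(2)] k(3,1)] card_lines[OF LTD(3)[OF N] tlD(1)[OF k'(2)] k'(3,1)]
      by simp
    have b: "len (colon N ((*) Q ` D)) N = 3 - len N (lo D N)"
      using up_lo_len(2)[OF D LTD(1)[OF N]] up_lo(7)[OF D LTD(1)[OF N]] by simp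
    show ?thesis
    proof (cases "tl D N")
      case True
      hence "len N (lo D N) = 0" using up_lo_stable(2)[OF D True] LTD(3)[OF N] by simp
      thus ?thesis using c b S(4)[OF N] True by (simp add: gauss_simps)
    next
      case False
      hence "len N (lo D N) = 1 \<or> len N (lo D N) = 2" using up_lo_types[OF D LTD(1)[OF N] False] by blast
      thus ?thesis using c b S(4)[OF N] False by (auto simp: gauss_simps)
    qed
  qed
  have Xs: "?X \<subseteq> LT T" by blast
  have lenR: "len M T = len N T + 1" if "N \<in> LT ?C" "M \<in> ?X" "?R N M" for N M
  proof -
    have N: "N \<in> LT T" and M: "M \<in> LT T" using that sub by auto
    show ?thesis using len_add[OF LTD(3)[OF M] LTD(3)[OF N] ordD(1)[OF T] LTD(4)[OF N]] that(3) by simp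
  qed
  have d: "ser T ?X (\<lambda>M. of_nat (card {N \<in> LT ?C. ?R N M})) = fps_X ^ 1 * ser T (LT ?C) (\<lambda>N. of_nat (card {M \<in> ?X. ?R N M}))"
    by (rule ser_double[OF T sub Xs lenR])
  have "ser T ?X (\<lambda>M. of_nat (card {N \<in> LT ?C. ?R N M})) = ser T ?X (\<lambda>M. if 1 \<in> ?P M then 1 else 0)"
    by (rule ser_cong[OF refl down])
  also have "\<dots> = cnt T {M \<in> ?X. 1 \<in> ?P M}" by (rule ser_if[OF T Xs])
  also have "\<dots> = Y - cnt T {M \<in> ?X. \<not> 1 \<in> ?P M}"
    unfolding Y_def using ser_split[OF T Xs, of "\<lambda>_. 1" "\<lambda>M. 1 \<in> ?P M"] by simp
  also have "{M \<in> ?X. \<not> 1 \<in> ?P M} = {M \<in> LT T. \<not> tl (colon T m) M \<and> 1 \<notin> ?P M}" using CD by auto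
  also have "cnt T \<dots> = (1 - fps_X) * zeta T" by (rule gor_term[OF T g m ninv])
  also have "\<dots> = 1" by (rule zeta_local[OF T S(2) G(1)])
  finally have dL: "ser T ?X (\<lambda>M. of_nat (card {N \<in> LT ?C. ?R N M})) = Y - 1" .
  have "ser T (LT ?C) (\<lambda>N. of_nat (card {M \<in> ?X. ?R N M}))
      = ser T (LT ?C) (\<lambda>N. of_nat q * (if len N (lo D N) = 2 then 1 else 0))"
  proof (rule ser_cong[OF refl])
    fix N assume N: "N \<in> LT ?C"
    show "of_nat (card {M \<in> ?X. ?R N M}) = (of_nat q * (if len N (lo D N) = 2 then 1 else 0) :: rat)"
      unfolding up[OF N] by simp
  qed
  also have "\<dots> = of_nat q * cnt T {N \<in> LT ?C. len N (lo D N) = 2}"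
    unfolding ser_cmult using ser_if[OF T sub] by simp
  also have "cnt T {N \<in> LT ?C. len N (lo D N) = 2} = fps_X * Gam D"
    unfolding Gam_def using ser_base[OF T C(1,3), of "{N \<in> LT ?C. len N (lo D N) = 2}"] G(2) by auto
  finally have dR: "ser T (LT ?C) (\<lambda>N. of_nat (card {M \<in> ?X. ?R N M})) = of_nat q * (fps_X * Gam D)" .
  have Y: "Y = 1 + fps_X * (of_nat q * (fps_X * Gam D))" using d unfolding dL dR by (simp add: algebra_simps)
  define X where "X = (fps_X :: rat fps)"
  define p where "p = (of_nat q :: rat fps)"
  define A where "A = X ^ 2 * J D"
  define K where "K = J ?C"
  have h1: "(1 - X) * K = 1 + (1 - X) * (p * X) * (A + Alo D + p * (1 - p * X) * A)"
    using J_thin[OF D] unfolding X_def p_def A_def K_def .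
  have h2: "Gam D = K - A - Alo D" using J_thin_split(1)[OF D] unfolding A_def X_def K_def by (simp add: algebra_simps)
  have "(1 - X) * J T = (1 - X) + X * ((1 - X) * K) + (1 - X) * (p * X ^ 2) * (K - A - Alo D)"
    unfolding JT Y h2[symmetric] K_def[symmetric] X_def[symmetric] p_def[symmetric]
    by (simp add: algebra_simps power2_eq_square)
  also have "\<dots> = 1 + (1 - X) * (p * X ^ 2) * (K + p * X ^ 2 * (1 - p * X) * J D)"
    unfolding h1 unfolding A_def by (simp add: algebra_simps power2_eq_square)
  finally show ?thesis unfolding X_def p_def K_def .
qed

section \<open>Cyclic lattices\<close>

definition cyc :: "'e set \<Rightarrow> 'e set \<Rightarrow> bool" where "cyc C N \<longleftrightarrow> (\<exists>x. N = (*) x ` C)"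

definition pser :: "'e set \<Rightarrow> rat fps" where "pser C = cnt C {N \<in> LT C. cyc C N}"

text \<open>The number of lines in \<open>C/qC\<close> that are spanned by a unit.\<close>

definition kap :: "'e set \<Rightarrow> nat" where
  "kap C = card {P \<in> lines ((*) Q ` C) C. up C P = C}"

lemma cyc_scale: "a * b = 1 \<Longrightarrow> cyc C ((*) a ` N) \<longleftrightarrow> cyc C N"
proof
  assume ab: "a * b = 1"
  assume "cyc C ((*) a ` N)"
  then obtain x where "(*) a ` N = (*) x ` C" unfolding cyc_def by blast
  hence "(*) b ` (*) a ` N = (*) (b * x) ` C" by (simp add: image_image mult.assoc)
  moreover have "(*) b ` (*) a ` N = N" using scale_scale[of b a] ab by (simp add: mult.commute)
  ultimately show "cyc C N" unfolding cyc_def by metis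
next
  assume "cyc C N"
  then obtain x where "N = (*) x ` C" unfolding cyc_def by blast
  hence "(*) a ` N = (*) (a * x) ` C" by (simp add: image_image mult.assoc)
  thus "cyc C ((*) a ` N)" unfolding cyc_def by blast
qed

lemma up_scale: assumes "a * b = 1" shows "up C ((*) a ` M) = (*) a ` up C M"
  unfolding up_def using product_image[OF assms, of M C] by (simp add: product_commute)

lemma sum_set_commute: "sum_set M N = sum_set N M"
  unfolding sum_set_def by (metis (lifting) add.commute)

text \<open>Multiplication by a generator of \<open>N\<close> carries the lines of \<open>C/qC\<close> to those of \<open>N/qN\<close>.\<close>

lemma generating_lines:
  assumes C: "order C" and N: "tl C N"
  shows "card {M \<in> lines ((*) Q ` N) N. up C M = N} = (if cyc C N then kap C else 0)"
proof (cases "cyc C N")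
  case True
  then obtain x where x: "N = (*) x ` C" unfolding cyc_def by blast
  obtain y where y: "x * y = 1" using cyclic_gen_unit[OF C N x] .
  have y': "y * x = 1" using y by (simp add: mult.commute)
  have bij: "(*) b ` M \<in> {M \<in> lines ((*) Q ` N') N'. up C M = N'}"
    if M: "M \<in> {M \<in> lines ((*) Q ` N0) N0. up C M = N0}" and ab: "b * a = 1" and N': "N' = (*) b ` N0" "lat N0" for M a b N' N0
  proof -
    have M': "lat M" "(*) Q ` N0 \<subseteq> M" "M \<subseteq> N0" "len M ((*) Q ` N0) = 1" "up C M = N0"
      using M unfolding lines_def by auto
    have e: "(*) Q ` N' = (*) b ` (*) Q ` N0" unfolding N'(1) by (simp add: image_image mult.left_commute)
    have "lat ((*) b ` M)" using lat_scale[OF M'(1) ab] .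
    moreover have "(*) Q ` N' \<subseteq> (*) b ` M" "(*) b ` M \<subseteq> N'" unfolding e unfolding N'(1) using M'(2,3) by (blast intro: image_mono)+
    moreover have "len ((*) b ` M) ((*) Q ` N') = 1"
      unfolding e using len_scale[OF M'(1) lat_Q[OF N'(2)] M'(2) ab] M'(4) by simp
    moreover have "up C ((*) b ` M) = N'" using up_scale[OF ab, of C M] M'(5) N'(1) by simp
    ultimately show ?thesis unfolding lines_def by blast
  qed
  have C': "C = (*) y ` N" unfolding x using scale_scale[OF y'] by simp
  have "bij_betw ((`) ((*) x)) {M \<in> lines ((*) Q ` C) C. up C M = C} {M \<in> lines ((*) Q ` N) N. up C M = N}"
  proof (rule bij_betw_byWitness[where f' = "(`) ((*) y)"])
    show "\<forall>a\<in>{M \<in> lines ((*) Q ` C) C. up C M = C}. (*) y ` (*) x ` a = a" using scale_scale[OF y'] by blast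
    show "\<forall>a\<in>{M \<in> lines ((*) Q ` N) N. up C M = N}. (*) x ` (*) y ` a = a" using scale_scale[OF y] by blast
    show "(`) ((*) x) ` {M \<in> lines ((*) Q ` C) C. up C M = C} \<subseteq> {M \<in> lines ((*) Q ` N) N. up C M = N}"
      using bij[OF _ y x ordD(1)[OF C]] by blast
    show "(`) ((*) y) ` {M \<in> lines ((*) Q ` N) N. up C M = N} \<subseteq> {M \<in> lines ((*) Q ` C) C. up C M = C}"
      using bij[OF _ y' C' tlD(1)[OF N]] by blast
  qed
  thus ?thesis unfolding kap_def using True by (simp add: bij_betw_same_card)
next
  case False
  have none: "{M \<in> lines ((*) Q ` N) N. up C M = N} = {}"
  proof (rule ccontr)
    assume "{M \<in> lines ((*) Q ` N) N. up C M = N} \<noteq> {}"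
    then obtain M where M: "M \<in> lines ((*) Q ` N) N" "up C M = N" by blast
    have lM: "lat M" "(*) Q ` N \<subseteq> M" "M \<subseteq> N" "len M ((*) Q ` N) = 1" using M(1) unfolding lines_def by auto
    have lQ: "lat ((*) Q ` N)" using lat_Q[OF tlD(1)[OF N]] .
    have "M \<noteq> (*) Q ` N" using lM(4) lQ by auto
    then obtain x where x: "x \<in> M" "x \<notin> (*) Q ` N" using lM(2) by blast
    have e: "M = line ((*) Q ` N) x" using lines_eq_line[OF lQ order_refl M(1) x] .
    have xN: "x \<in> N" using x lM(3) by blast
    note c = cyclic_quotient[OF C tl_Q[OF N] N Q_sub[OF tlD(1)[OF N]] xN]
    have "line ((*) Q ` N) x \<subseteq> sum_set ((*) Q ` N) ((*) x ` C)"
      using line_least[OF lat_mod[OF tlD(1)[OF c(1)]] c(3,4)] .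
    hence "M \<subseteq> sum_set ((*) Q ` N) ((*) x ` C)" using e by blast
    hence "N \<subseteq> sum_set ((*) Q ` N) ((*) x ` C)"
      using up_lo(8)[OF C thin_tl[OF C N lM(1-3)] c(1)] M(2) by blast
    hence "N \<subseteq> sum_set ((*) x ` C) ((*) Q ` N)" using sum_set_commute[of "(*) Q ` N"] by simp
    hence "(*) x ` C = N"
      using nakayama[OF tlD(1)[OF N] order_submod[OF C submod_image[OF ordD(4)[OF C]]] tl_multiples[OF N xN]] by blast
    thus False using False unfolding cyc_def by blast
  qed
  show ?thesis using False by (simp only: none card.empty if_False)
qed

text \<open>Apart from \<open>\<int>\<^sub>q + qC\<close>, such a lattice \<open>M\<close> is a generating line of the cyclic lattice \<open>up C M\<close>.\<close>

lemma Bet_eq: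
  assumes C: "order C" shows "Bet C = 1 + of_nat (kap C) * fps_X ^ 3 * pser C"
proof -
  let ?T = "thin C"
  note t = thin_facts[OF C]
  have sub: "LT C \<subseteq> LT ?T" using stable_LT[OF t(1) C t(5)] by blast
  let ?B = "{M \<in> LT ?T. len (up C M) M = 2}"
  let ?R = "\<lambda>M N. up C M = N \<and> 1 \<in> (*) Q ` N"
  have Bs: "?B \<subseteq> LT ?T" by blast
  have lenR: "len N ?T = len M ?T + 2" if "M \<in> ?B" "N \<in> LT C" "?R M N" for M N
  proof -
    have M: "M \<in> LT ?T" "len N M = 2" "M \<subseteq> N" using that up_lo(5)[OF C LTD(1)] by auto
    show ?thesis using len_add[OF LTD(3)[OF that(2)] LTD(3)[OF M(1)] ordD(1)[OF t(1)] LTD(4)[OF M(1)] M(3)] M(2) by simp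
  qed
  have d: "ser ?T (LT C) (\<lambda>N. of_nat (card {M \<in> ?B. ?R M N})) = fps_X ^ 2 * ser ?T ?B (\<lambda>M. of_nat (card {N \<in> LT C. ?R M N}))"
    by (rule ser_double[OF t(1) Bs sub lenR])
  have "ser ?T ?B (\<lambda>M. of_nat (card {N \<in> LT C. ?R M N})) = ser ?T ?B (\<lambda>M. if 1 \<in> (*) Q ` up C M then 1 else 0)"
  proof (rule ser_cong[OF refl])
    fix M assume "M \<in> ?B"
    hence M: "M \<in> LT ?T" by blast
    have "up C M \<in> LT C" unfolding LT_def using up_lo(1,5)[OF C LTD(1)[OF M]] LTD(2)[OF M] by blast
    hence "{N \<in> LT C. ?R M N} = (if 1 \<in> (*) Q ` up C M then {up C M} else {})" by auto
    thus "of_nat (card {N \<in> LT C. ?R M N}) = (if 1 \<in> (*) Q ` up C M then 1 else 0 :: rat)" by simp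
  qed
  also have "\<dots> = cnt ?T {M \<in> ?B. 1 \<in> (*) Q ` up C M}" by (rule ser_if[OF t(1) Bs])
  also have "\<dots> = Bet C - cnt ?T {M \<in> ?B. \<not> 1 \<in> (*) Q ` up C M}"
    unfolding Bet_def using ser_split[OF t(1) Bs, of "\<lambda>_. 1" "\<lambda>M. 1 \<in> (*) Q ` up C M"] by simp
  also have "{M \<in> ?B. \<not> 1 \<in> (*) Q ` up C M} = {?T}" using thin_cyclic[OF C] thin_self[OF C] by auto
  finally have R: "ser ?T ?B (\<lambda>M. of_nat (card {N \<in> LT C. ?R M N})) = Bet C - 1"
    using ser_singleton[OF t(1), of "\<lambda>_. 1"] by simp
  have "ser ?T (LT C) (\<lambda>N. of_nat (card {M \<in> ?B. ?R M N}))
      = ser ?T (LT C) (\<lambda>N. of_nat (kap C) * (if cyc C N \<and> 1 \<in> (*) Q ` N then 1 else 0))"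
  proof (rule ser_cong[OF refl])
    fix N assume N: "N \<in> LT C"
    have lN: "lat N" using LTD(3)[OF N] .
    have "{M \<in> ?B. ?R M N} = (if 1 \<in> (*) Q ` N then {M \<in> lines ((*) Q ` N) N. up C M = N} else {})"
    proof (intro equalityI subsetI)
      fix M assume M: "M \<in> {M \<in> ?B. ?R M N}"
      hence M': "tl ?T M" "up C M = N" "1 \<in> (*) Q ` N" "len N M = 2" using LTD(1) by auto
      have "len M ((*) Q ` N) = 1" using up_lo_len(1)[OF C M'(1)] M'(2,4) by simp
      moreover have "(*) Q ` N \<subseteq> M" "M \<subseteq> N" using up_lo(3-5)[OF C M'(1)] M'(2) by blast+
      ultimately show "M \<in> (if 1 \<in> (*) Q ` N then {M \<in> lines ((*) Q ` N) N. up C M = N} else {})"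
        unfolding lines_def using M'(2,3) tlD(1)[OF M'(1)] by simp
    next
      fix M assume "M \<in> (if 1 \<in> (*) Q ` N then {M \<in> lines ((*) Q ` N) N. up C M = N} else {})"
      hence M: "1 \<in> (*) Q ` N" "lat M" "(*) Q ` N \<subseteq> M" "M \<subseteq> N" "len M ((*) Q ` N) = 1" "up C M = N"
        unfolding lines_def by (auto split: if_splits)
      have tM: "tl ?T M" using thin_tl[OF C LTD(1)[OF N] M(2-4)] .
      have "len N M = 2" using up_lo_len(1)[OF C tM] M(5,6) by simp
      thus "M \<in> {M \<in> ?B. ?R M N}" unfolding LT_def using tM M by auto
    qed
    thus "of_nat (card {M \<in> ?B. ?R M N}) = (of_nat (kap C) * (if cyc C N \<and> 1 \<in> (*) Q ` N then 1 else 0) :: rat)"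
      using generating_lines[OF C LTD(1)[OF N]] by simp
  qed
  also have "\<dots> = of_nat (kap C) * cnt ?T {N \<in> LT C. cyc C N \<and> 1 \<in> (*) Q ` N}"
    unfolding ser_cmult using ser_if[OF t(1) sub] by simp
  also have "cnt ?T {N \<in> LT C. cyc C N \<and> 1 \<in> (*) Q ` N} = fps_X ^ 3 * cnt ?T {N \<in> LT C. cyc C N}"
    by (rule shift_Q[OF t(1) C t(5)]) (rule cyc_scale[OF Q_r(2)])
  also have "cnt ?T {N \<in> LT C. cyc C N} = fps_X ^ 2 * pser C"
    unfolding pser_def using ser_base[OF t(1) C t(5), of "{N \<in> LT C. cyc C N}"] t(3) by auto
  finally have "fps_X ^ 2 * (Bet C - 1) = fps_X ^ 2 * (of_nat (kap C) * fps_X ^ 3 * pser C)"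
    using d R by (simp add: mult_ac)
  hence "Bet C - 1 = of_nat (kap C) * fps_X ^ 3 * pser C" by simp
  thus ?thesis by (simp add: algebra_simps)
qed

section \<open>Counting units modulo \<open>q\<close>\<close>

lemma Collect_conj_Un: "{x \<in> A. P x \<or> R x} = {x \<in> A. P x} \<union> {x \<in> A. R x}"
  by blast

text \<open>
  Inclusion and exclusion over \<open>S\<close>; for empty \<open>S\<close> the length of the intersection of the ideals in \<open>R\<close>
  gives the number.
\<close>

lemma coset_inter_count:
  assumes C: "order C" and fS: "finite S" and S: "S \<subseteq> Specm C" "R \<subseteq> Specm C" "S \<inter> R = {}"
  shows "of_nat (card {X \<in> cosets ((*) Q ` C) C. \<exists>x\<in>X. (\<forall>n\<in>S. x \<notin> n) \<and> x \<in> inter C R})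
    = (of_nat q ^ 3 * (\<Prod>n\<in>R. 1 / of_nat q ^ len C n) * (\<Prod>n\<in>S. 1 - 1 / of_nat q ^ len C n) :: rat)"
  using fS S
proof (induction S arbitrary: R)
  case empty
  let ?P = "(*) Q ` C"
  have i: "tl C (inter C R)" "len C (inter C R) = (\<Sum>n\<in>R. len C n)" "?P \<subseteq> inter C R" "inter C R \<subseteq> C"
    using inter_facts[OF C empty(2)] unfolding inter_def by auto
  have lP: "lat ?P" using lat_Q[OF ordD(1)[OF C]] .
  have "{X \<in> cosets ?P C. \<exists>x\<in>X. (\<forall>n\<in>{}. x \<notin> n) \<and> x \<in> inter C R} = cosets ?P (inter C R)"
  proof (intro equalityI subsetI)
    fix X assume "X \<in> {X \<in> cosets ?P C. \<exists>x\<in>X. (\<forall>n\<in>{}. x \<notin> n) \<and> x \<in> inter C R}"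
    then obtain y x where x: "X = {z. z - y \<in> ?P}" "x \<in> X" "x \<in> inter C R" unfolding cosets_def by blast
    hence "x - y \<in> ?P" by blast
    hence "X = {z. z - x \<in> ?P}" using coset_eq_iff[OF lat_add[OF lP], of x y] x(1) by simp
    thus "X \<in> cosets ?P (inter C R)" unfolding cosets_def using x(3) by blast
  next
    fix X assume "X \<in> cosets ?P (inter C R)"
    then obtain x where x: "X = {z. z - x \<in> ?P}" "x \<in> inter C R" unfolding cosets_def by blast
    have "x \<in> X" using x(1) subgroupD(1)[OF lat_add[OF lP]] by simp
    thus "X \<in> {X \<in> cosets ?P C. \<exists>x\<in>X. (\<forall>n\<in>{}. x \<notin> n) \<and> x \<in> inter C R}"
      using x i(4) unfolding cosets_def by blast
  qed
  hence c: "card {X \<in> cosets ?P C. \<exists>x\<in>X. (\<forall>n\<in>{}. x \<notin> n) \<and> x \<in> inter C R} = q ^ len (inter C R) ?P"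
    using card_cosets(1)[OF lP tlD(1)[OF i(1)] i(3)] by simp
  have "(\<Sum>n\<in>R. len C n) + len (inter C R) ?P = 3"
    using len_add[OF ordD(1)[OF C] tlD(1)[OF i(1)] lP i(3,4)] len_Q[OF ordD(1)[OF C]] i(2) by simp
  hence "(of_nat q :: rat) ^ 3 = of_nat q ^ (\<Sum>n\<in>R. len C n) * of_nat q ^ len (inter C R) ?P"
    by (simp flip: power_add)
  moreover have "(of_nat q :: rat) \<noteq> 0" using q_gt1 by simp
  moreover have "finite R" using empty finite_max[OF C] finite_subset by blast
  ultimately show ?case unfolding c by (simp add: power_sum prod_dividef)
next
  case (insert n S)
  let ?P = "(*) Q ` C"
  let ?A = "\<lambda>S R. {X \<in> cosets ?P C. \<exists>x\<in>X. (\<forall>k\<in>S. x \<notin> k) \<and> x \<in> inter C R}"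
  have n: "n \<in> Specm C" "n \<notin> R" "S \<subseteq> Specm C" "S \<inter> R = {}" "S \<inter> insert n R = {}"
    using insert by auto
  have lP: "lat ?P" using lat_Q[OF ordD(1)[OF C]] .
  have inv: "x \<in> k \<longleftrightarrow> y \<in> k"
    if X: "X \<in> cosets ?P C" "x \<in> X" "y \<in> X" and k: "k \<in> Specm C" for X x y k
  proof -
    obtain z where z: "X = {y. y - z \<in> ?P}" using X(1) unfolding cosets_def by blast
    have "(x - z) - (y - z) \<in> ?P" using X(2,3) z subgroupD(2)[OF lat_add[OF lP]] by blast
    hence xy: "x - y \<in> k" using max_lat(2)[OF C k] by auto
    note K = subgroupD[OF tlD(3)[OF max_lat(1)[OF C k]]]
    show ?thesis using K(2)[OF _ xy, of x] K(4)[OF _ xy, of y] by auto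
  qed
  have fin: "finite (cosets ?P C)" using card_cosets(2)[OF lP ordD(1)[OF C] Q_sub[OF ordD(1)[OF C]]] .
  have iR: "x \<in> inter C (insert n R) \<longleftrightarrow> x \<in> inter C R \<and> x \<in> n" for x unfolding inter_def by auto
  have pt: "(\<exists>x\<in>X. (\<forall>k\<in>S. x \<notin> k) \<and> x \<in> inter C R) \<longleftrightarrow>
      (\<exists>x\<in>X. (\<forall>k\<in>insert n S. x \<notin> k) \<and> x \<in> inter C R) \<or> (\<exists>x\<in>X. (\<forall>k\<in>S. x \<notin> k) \<and> x \<in> inter C (insert n R))" for X
    unfolding iR by auto
  have dec: "?A S R = ?A (insert n S) R \<union> ?A S (insert n R)" unfolding pt by (rule Collect_conj_Un)
  have disj: "?A (insert n S) R \<inter> ?A S (insert n R) = {}"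
  proof (rule ccontr)
    assume "?A (insert n S) R \<inter> ?A S (insert n R) \<noteq> {}"
    then obtain X where "X \<in> ?A (insert n S) R" and X': "X \<in> ?A S (insert n R)"
      by (metis (no_types, lifting) Int_iff equals0I)
    then obtain x where X1: "X \<in> cosets ?P C" "x \<in> X" "x \<notin> n" by auto
    from X' obtain y where "y \<in> X" "y \<in> n" unfolding iR by auto
    note X = X1 this
    thus False using inv[OF X(1,2,4) n(1)] by blast
  qed
  have f: "finite (?A (insert n S) R)" "finite (?A S (insert n R))" using fin by auto
  have "card (?A S R) = card (?A (insert n S) R \<union> ?A S (insert n R))" by (rule arg_cong[OF dec])
  also have "\<dots> = card (?A (insert n S) R) + card (?A S (insert n R))" by (rule card_Un_disjoint[OF f disj])
  finally have c: "of_nat (card (?A (insert n S) R)) = (of_nat (card (?A S R)) - of_nat (card (?A S (insert n R))) :: rat)"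
    by simp
  have fR: "finite R" using insert(5) finite_max[OF C] finite_subset by blast
  have nR: "insert n R \<subseteq> Specm C" using n(1) insert(5) by blast
  let ?p = "\<lambda>n. 1 / of_nat q ^ len C n :: rat"
  have "prod ?p (insert n R) = ?p n * prod ?p R" by (rule prod.insert[OF fR n(2)])
  moreover have "(\<Prod>k\<in>insert n S. 1 - ?p k) = (1 - ?p n) * (\<Prod>k\<in>S. 1 - ?p k)" by (rule prod.insert[OF insert(1,2)])
  ultimately show ?case
    unfolding c insert(3)[OF n(3) insert(5) n(4)] insert(3)[OF n(3) nR n(5)] by (simp only: left_diff_distrib right_diff_distrib mult_ac mult_1_left)
qed

text \<open>The cosets outside all maximal ideals are the units modulo \<open>q\<close>, and \<open>q - 1\<close> of them span the same line.\<close>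

lemma kap_formula:
  assumes C: "order C"
  shows "of_nat (kap C) * (of_nat q - 1) = (of_nat q ^ 3 * (\<Prod>n\<in>Specm C. 1 - 1 / of_nat q ^ len C n) :: rat)"
proof -
  let ?P = "(*) Q ` C" and ?MM = "Specm C"
  have lP: "lat ?P" using lat_Q[OF ordD(1)[OF C]] .
  have QC: "?P \<subseteq> C" using Q_sub[OF ordD(1)[OF C]] .
  have pred: "up C P = C \<longleftrightarrow> (\<forall>n\<in>?MM. x \<notin> n)" if P: "P \<in> lines ?P C" "x \<in> P" "x \<notin> ?P" for P x
  proof -
    have lM: "lat P" "?P \<subseteq> P" "P \<subseteq> C" using P(1) unfolding lines_def by auto
    have tP: "tl (thin C) P" using thin_tl[OF C ordD(5)[OF C] lM] .
    note f = up_lo[OF C tP]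
    have uC: "up C P \<subseteq> C" using f(8)[OF ordD(5)[OF C] lM(3)] .
    have xC: "x \<in> C" using P(2) lM(3) by blast
    show ?thesis
    proof
      assume u: "up C P = C"
      show "\<forall>n\<in>?MM. x \<notin> n"
      proof (intro ballI notI)
        fix n assume n: "n \<in> ?MM" "x \<in> n"
        have "P = line ?P x" using lines_eq_line[OF lP order_refl P] .
        moreover have "line ?P x \<subseteq> n"
          using line_least[OF lat_mod[OF tlD(1)[OF max_lat(1)[OF C n(1)]]] max_lat(2)[OF C n(1)] n(2)] .
        ultimately have "up C P \<subseteq> n" using f(8)[OF max_lat(1)[OF C n(1)]] by blast
        thus False using u max_lat(3)[OF C n(1)] by blast
      qed
    next
      assume "\<forall>n\<in>?MM. x \<notin> n"
      hence nx: "\<And>n. n \<in> ?MM \<Longrightarrow> x \<notin> n" by blast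
      obtain s where s: "s \<in> C" "x * s = 1" by (rule unit_iff_no_max[OF C xC nx])
      have "s * x \<in> up C P" using tl_mult[OF f(1) s(1)] f(5) P(2) by blast
      hence "1 \<in> up C P" using s(2) by (simp add: mult.commute)
      thus "up C P = C" using one_in_ideal[OF tlD(2)[OF f(1)]] uC by blast
    qed
  qed
  have "kap C * (q - 1) = card {X \<in> cosets ?P C. \<exists>x\<in>X. x \<notin> ?P \<and> (\<forall>n\<in>?MM. x \<notin> n)}"
    unfolding kap_def by (rule card_lines_pred(1)[OF lP ordD(1)[OF C] QC order_refl pred])
  also have "{X \<in> cosets ?P C. \<exists>x\<in>X. x \<notin> ?P \<and> (\<forall>n\<in>?MM. x \<notin> n)}
      = {X \<in> cosets ?P C. \<exists>x\<in>X. (\<forall>n\<in>?MM. x \<notin> n) \<and> x \<in> inter C {}}"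
  proof -
    have "x \<notin> ?P \<and> (\<forall>n\<in>?MM. x \<notin> n) \<longleftrightarrow> (\<forall>n\<in>?MM. x \<notin> n) \<and> x \<in> inter C {}"
      if X: "X \<in> cosets ?P C" "x \<in> X" for X x
    proof -
      obtain z where z: "z \<in> C" "X = {y. y - z \<in> ?P}" using X(1) unfolding cosets_def by blast
      have "(x - z) + z \<in> C" using X(2) z QC by (intro tl_add[OF ordD(5)[OF C]]) auto
      moreover have "x \<notin> ?P" if "\<forall>n\<in>?MM. x \<notin> n" using that max_lat(2)[OF C] max_nonempty[OF C] by blast
      ultimately show ?thesis unfolding inter_def by auto
    qed
    thus ?thesis by blast
  qed
  finally have "of_nat (kap C * (q - 1)) = (of_nat q ^ 3 * (\<Prod>n\<in>?MM. 1 - 1 / of_nat q ^ len C n) :: rat)"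
    using coset_inter_count[OF C finite_max[OF C] order_refl, of "{}"] by simp
  thus ?thesis using q_gt1 by (simp add: of_nat_diff)
qed

text \<open>
  The Euler factor is expressed by the two quantities that count orders of index \<open>q\<close> and cyclic lattices: the
  number of maximal ideals of residue degree one, and \<open>kap\<close>. As the degrees \<open>f s\<close> have sum at most three, this
  is a check of seven cases.
\<close>

lemma euler_polynomial:
  fixes f :: "'i \<Rightarrow> nat" and p \<kappa> :: rat
  assumes S: "finite S" "S \<noteq> {}" and f: "\<And>s. s \<in> S \<Longrightarrow> f s > 0" and sum: "(\<Sum>s\<in>S. f s) \<le> 3"
    and p: "p > 1" and \<kappa>: "\<kappa> * (p - 1) = p ^ 3 * (\<Prod>s\<in>S. 1 - 1 / p ^ f s)"
  shows "(\<Prod>s\<in>S. 1 - fps_X ^ f s) = (1 - fps_X) * (1 + (1 - of_nat (card {s \<in> S. f s = 1})) * fps_X +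
    fps_const (\<kappa> - p * (p + 1 - of_nat (card {s \<in> S. f s = 1}))) * fps_X ^ 2)"
proof -
  note pw = power2_eq_square power3_eq_cube
  have k: "\<kappa> = k" if "p ^ 3 * (\<Prod>s\<in>S. 1 - 1 / p ^ f s) = k * (p - 1)" for k
    using that \<kappa> p by simp
  have one: "card {s \<in> S. f s = 1} = card A" if "{s \<in> S. f s = 1} = A" for A
    using that by simp
  have cS: "card S \<le> 3"
    using sum_mono[of S "\<lambda>_. 1" f] f sum by (simp add: Suc_leI)
  have "card S \<noteq> 0" using S by simp
  then consider "card S = 1" | "card S = 2" | "card S = 3" using cS by linarith
  thus ?thesis
  proof cases
    case 1
    then obtain a where a: "S = {a}" by (rule card_1_singletonE)
    have "f a = 1 \<or> f a = 2 \<or> f a = 3" using f[of a] sum a by auto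
    thus ?thesis
    proof (elim disjE)
      assume e: "f a = 1"
      have c: "card {s \<in> S. f s = 1} = card {a}" by (rule one) (use a e in auto)
      have "\<kappa> = p ^ 2" by (rule k) (use a e p in \<open>simp add: field_simps pw\<close>)
      thus ?thesis unfolding c using a e by (simp add: pw)
    next
      assume e: "f a = 2"
      have c: "card {s \<in> S. f s = 1} = card ({} :: 'i set)" by (rule one) (use a e in auto)
      have "\<kappa> = p ^ 2 + p" by (rule k) (use a e p in \<open>simp add: field_simps pw\<close>)
      thus ?thesis unfolding c using a e by (simp add: pw algebra_simps)
    next
      assume e: "f a = 3"
      have c: "card {s \<in> S. f s = 1} = card ({} :: 'i set)" by (rule one) (use a e in auto)
      have "\<kappa> = p ^ 2 + p + 1" by (rule k) (use a e p in \<open>simp add: field_simps pw\<close>)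
      thus ?thesis unfolding c using a e by (simp add: pw algebra_simps)
    qed
  next
    case 2
    then obtain a b where ab: "S = {a, b}" "a \<noteq> b" by (meson card_2_iff)
    have "f a > 0" "f b > 0" "f a + f b \<le> 3" using f sum ab by auto
    hence "(f a = 1 \<and> f b = 1) \<or> (f a = 1 \<and> f b = 2) \<or> (f a = 2 \<and> f b = 1)" by linarith
    thus ?thesis
    proof (elim disjE conjE)
      assume e: "f a = 1" "f b = 1"
      have c: "card {s \<in> S. f s = 1} = card {a, b}" by (rule one) (use ab e in auto)
      have "\<kappa> = p * (p - 1)" by (rule k) (use ab e p in \<open>simp add: field_simps pw\<close>)
      thus ?thesis unfolding c using ab e by (simp add: pw algebra_simps)
    next
      assume e: "f a = 1" "f b = 2"
      have c: "card {s \<in> S. f s = 1} = card {a}" by (rule one) (use ab e in auto)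
      have "\<kappa> = p ^ 2 - 1" by (rule k) (use ab e p in \<open>simp add: field_simps pw\<close>)
      thus ?thesis unfolding c using ab e by (simp add: pw algebra_simps)
    next
      assume e: "f a = 2" "f b = 1"
      have c: "card {s \<in> S. f s = 1} = card {b}" by (rule one) (use ab e in auto)
      have "\<kappa> = p ^ 2 - 1" by (rule k) (use ab e p in \<open>simp add: field_simps pw\<close>)
      thus ?thesis unfolding c using ab e by (simp add: pw algebra_simps)
    qed
  next
    case 3
    then obtain a b d where ab: "S = {a, b, d}" "a \<noteq> b" "b \<noteq> d" "a \<noteq> d" by (metis card_3_iff)
    have "f a > 0" "f b > 0" "f d > 0" "f a + f b + f d \<le> 3" using f sum ab by auto
    hence e: "f a = 1" "f b = 1" "f d = 1" by linarith+
    have c: "card {s \<in> S. f s = 1} = card {a, b, d}" by (rule one) (use ab e in auto)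
    have "\<kappa> = (p - 1) ^ 2" by (rule k) (use ab e p in \<open>simp add: field_simps pw\<close>)
    thus ?thesis
      unfolding c using ab e by (simp add: pw algebra_simps fps_const_add[symmetric] numeral_fps_const)
  qed
qed

lemma euler_order:
  assumes C: "order C"
  defines "c \<equiv> card {n \<in> Specm C. len C n = 1}"
  shows "(\<Prod>n\<in>Specm C. 1 - fps_X ^ len C n) = (1 - fps_X) * (1 + (1 - of_nat c) * fps_X +
    (of_nat (kap C) - of_nat q * (of_nat q + 1 - of_nat c)) * fps_X ^ 2 :: rat fps)"
proof -
  have "fps_const (of_nat (kap C) - of_nat q * (of_nat q + 1 - of_nat c)) =
      (of_nat (kap C) - of_nat q * (of_nat q + 1 - of_nat c) :: rat fps)"
    by (simp only: fps_const_sub[symmetric] fps_const_mult[symmetric] fps_const_add[symmetric] fps_of_nat fps_const_1_eq_1)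
  thus ?thesis
    using euler_polynomial[OF finite_max[OF C] max_nonempty[OF C] len_max_pos[OF C] sum_residue_le_3[OF C] _ kap_formula[OF C]]
      q_gt1 unfolding c_def by simp
qed

section \<open>Orders of index \<open>q\<close>\<close>

text \<open>The ideals \<open>K\<close> for which \<open>\<int>\<^sub>q + K\<close> is an order of index \<open>q\<close> in \<open>C\<close> (\<open>index_one_order\<close>).\<close>

definition KK :: "'e set \<Rightarrow> 'e set set" where
  "KK C = {K. tl C K \<and> (*) Q ` C \<subseteq> K \<and> K \<subseteq> C \<and> len K ((*) Q ` C) = 1}"

lemma KK_facts:
  assumes C: "order C" and K: "K \<in> KK C"
  shows "tl C K" "(*) Q ` C \<subseteq> K" "K \<subseteq> C" "1 \<notin> K" "order (line K 1)" "K \<subseteq> line K 1" "line K 1 \<subseteq> C"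
    "len (line K 1) K = 1" "len C (line K 1) = 1" "thin C \<subseteq> line K 1" "len (line K 1) (thin C) = 1"
    "colon (line K 1) C = K" "len C K = 2"
proof -
  show k: "tl C K" "(*) Q ` C \<subseteq> K" "K \<subseteq> C" using K unfolding KK_def by auto
  have l1: "len K ((*) Q ` C) = 1" using K unfolding KK_def by auto
  have lK: "lat K" using tlD(1)[OF k(1)] .
  have lQ: "lat ((*) Q ` C)" using lat_Q[OF ordD(1)[OF C]] .
  show l2: "len C K = 2" using len_add[OF ordD(1)[OF C] lK lQ k(2,3)] l1 len_Q[OF ordD(1)[OF C]] by simp
  show one: "1 \<notin> K"
  proof
    assume "1 \<in> K"
    hence "K = C" using one_in_ideal[OF tlD(2)[OF k(1)]] k(3) by blast
    thus False using l2 ordD(1)[OF C] by simp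
  qed
  have Q1: "Q * 1 \<in> K" using k(2) ordD(2)[OF C] by blast
  show s1: "len (line K 1) K = 1" using line_len[OF lK one Q1] .
  show s2: "K \<subseteq> line K 1" using line_upper(1)[OF lat_mod[OF lK]] .
  have o1: "1 \<in> line K 1" using line_upper(2)[OF lat_mod[OF lK]] .
  show s3: "line K 1 \<subseteq> C" using line_least[OF lat_mod[OF ordD(1)[OF C]] k(3) ordD(2)[OF C]] .
  have lS: "lat (line K 1)" using line_lat[OF lK] .
  show s4: "len C (line K 1) = 1" using len_add[OF ordD(1)[OF C] lS lK s2 s3] s1 l2 by simp
  have mult: "x * y \<in> line K 1" if x: "x \<in> line K 1" and y: "y \<in> line K 1" for x y
  proof -
    obtain a z where a: "x = a + z * 1" "a \<in> K" "z \<in> Z" using x by (rule lineE)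
    obtain b w where b: "y = b + w * 1" "b \<in> K" "w \<in> Z" using y by (rule lineE)
    have "a * b \<in> K" "z * b \<in> K" "w * a \<in> K"
      using tl_mult[OF k(1)] a b k(3) order_Z[OF C] by blast+
    hence "a * b + z * b + w * a \<in> K" using tl_add[OF k(1)] by blast
    moreover have "z * w \<in> Z" using submodD(6)[OF Z_mod] a b by blast
    ultimately have "(a * b + z * b + w * a) + (z * w) * 1 \<in> line K 1" by (rule lineI)
    thus ?thesis by (simp add: a b algebra_simps)
  qed
  show oS: "order (line K 1)" unfolding order_in_def using lS o1 mult by blast
  have "(*) Q ` C \<subseteq> line K 1" using k(2) s2 by blast
  thus s5: "thin C \<subseteq> line K 1" using line_least[OF lat_mod[OF lS] _ o1] by blast
  show "len (line K 1) (thin C) = 1"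
    using len_add[OF ordD(1)[OF C] lS ordD(1)[OF thin_facts(1)[OF C]] s5 s3] s4 thin_facts(3)[OF C] by simp
  show "colon (line K 1) C = K"
  proof -
    have Kc: "K \<subseteq> colon (line K 1) C" using tl_mult'[OF k(1)] s2 by (blast intro: colonI)
    have cS: "colon (line K 1) C \<subseteq> line K 1" using colonD[of _ "line K 1" C 1] ordD(2)[OF C] by auto
    have tc: "tl C (colon (line K 1) C)" using tl_colon'[OF lS ordD(5)[OF C]] .
    have "colon (line K 1) C \<noteq> line K 1"
    proof
      assume "colon (line K 1) C = line K 1"
      hence "C \<subseteq> line K 1" using one_in_ideal[OF tlD(2)[OF tc]] o1 by simp
      hence "line K 1 = C" using s3 by blast
      thus False using s4 ordD(1)[OF C] by simp
    qed
    hence "len (line K 1) (colon (line K 1) C) > 0" using len_pos[OF lS tlD(1)[OF tc]] cS by blast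
    thus ?thesis using len_eq'[OF lS tlD(1)[OF tc] lK Kc cS] s1 by simp
  qed
qed

lemma finite_KK: assumes C: "order C" shows "finite (KK C)"
  by (rule finite_subset[OF _ finite_between[OF lat_Q[OF ordD(1)[OF C]] ordD(1)[OF C] Q_sub[OF ordD(1)[OF C]]]])
    (auto simp: KK_def dest: tlD(1))

lemma annq_colon: "N \<subseteq> colon P (annq T P N)"
proof (intro subsetI colonI)
  fix x y assume "x \<in> N" "y \<in> annq T P N"
  hence "y * x \<in> P" unfolding annq_def by blast
  thus "x * y \<in> P" by (simp add: mult.commute)
qed

text \<open>
  The ideal is the conductor \<open>(S : C)\<close>, which is the annihilator of the simple \<open>S\<close>-module \<open>C/S\<close> and thus a
  maximal ideal of \<open>S\<close>.
\<close>

lemma index_one_order: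
  assumes C: "order C" and S: "order S" "thin C \<subseteq> S" "S \<subseteq> C" "len C S = 1"
  shows "colon S C \<in> KK C" "line (colon S C) 1 = S"
proof -
  let ?K = "colon S C"
  note t = thin_facts[OF C]
  have lS: "lat S" using ordD(1)[OF S(1)] .
  have K: "tl C ?K" using tl_colon'[OF lS ordD(5)[OF C]] .
  have KS: "?K \<subseteq> S" using colonD[of _ S C 1] ordD(2)[OF C] by auto
  have QS: "(*) Q ` C \<subseteq> S" using t(4) S(2) by blast
  have QK: "(*) Q ` C \<subseteq> ?K" using tl_mult'[OF tl_Q[OF ordD(5)[OF C]]] QS by (blast intro: colonI)
  have CS: "C \<in> lines S C" unfolding lines_def using ordD(1)[OF C] S(3,4) by blast
  have "S \<noteq> C" using S(4) lS by auto
  then obtain y where y: "y \<in> C" "y \<notin> S" using S(3) by blast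
  have Cy: "C = line S y" using lines_eq_line[OF lS QS CS y] .
  have tSC: "tl S C" using tl_mono[OF ordD(5)[OF C] S(3)] .
  note c = cyclic_quotient[OF S(1) ordD(5)[OF S(1)] tSC S(3) y(1)]
  have "C \<subseteq> sum_set S ((*) y ` S)" using line_least[OF lat_mod[OF tlD(1)[OF c(1)]] c(3,4)] Cy by simp
  hence "sum_set S ((*) y ` S) = C" using c(5) by blast
  hence l1: "len S {s \<in> S. s * y \<in> S} = 1" using c(6) S(4) by simp
  have "{s \<in> S. s * y \<in> S} = ?K"
  proof (intro equalityI subsetI)
    fix s assume s: "s \<in> {s \<in> S. s * y \<in> S}"
    show "s \<in> ?K"
    proof (rule colonI)
      fix x assume "x \<in> C"
      hence "x \<in> line S y" using Cy by simp
      then obtain a z where a: "x = a + z * y" "a \<in> S" "z \<in> Z" by (rule lineE)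
      have "s * a + z * (s * y) \<in> S"
        using ordD(3)[OF S(1)] s a order_Z[OF S(1)] by (intro tl_add[OF ordD(5)[OF S(1)]]) blast+
      thus "s * x \<in> S" by (simp add: a(1) algebra_simps)
    qed
  next
    fix s assume "s \<in> ?K"
    thus "s \<in> {s \<in> S. s * y \<in> S}" using KS colonD y(1) by blast
  qed
  hence lSK: "len S ?K = 1" using l1 by simp
  have "len S ((*) Q ` C) = 2"
    using len_add[OF ordD(1)[OF C] lS lat_Q[OF ordD(1)[OF C]] QS S(3)] S(4) len_Q[OF ordD(1)[OF C]] by simp
  hence "len ?K ((*) Q ` C) = 1"
    using len_add[OF lS tlD(1)[OF K] lat_Q[OF ordD(1)[OF C]] QK KS] lSK by simp
  thus KK: "?K \<in> KK C" unfolding KK_def using K QK KS S(3) by blast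
  note f = KK_facts[OF C KK]
  have "line ?K 1 \<subseteq> S" using line_least[OF lat_mod[OF lS] KS ordD(2)[OF S(1)]] .
  thus "line ?K 1 = S"
    using len_eq[OF lS ordD(1)[OF f(5)] tlD(1)[OF K] f(6)] f(8) lSK by simp
qed

text \<open>The order \<open>S \<inter> C\<close> has index \<open>q\<close> in \<open>C\<close>, because a simple extension of \<open>\<int>\<^sub>q + qC\<close> in \<open>S\<close> lies in \<open>C\<close>.\<close>

lemma thin_overorder:
  assumes C: "order C" and S: "order S" "thin C \<subseteq> S" "S \<noteq> thin C" "\<not> C \<subseteq> S"
  shows "\<exists>!K. K \<in> KK C \<and> line K 1 \<subseteq> S"
proof -
  let ?T = "thin C"
  note t = thin_facts[OF C]
  obtain N where N: "simple ?T ?T N" "N \<subseteq> S"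
    using exists_simple[OF t(1) ordD(5)[OF t(1)] tl_mono[OF ordD(5)[OF S(1)] S(2)]] S(2,3) by blast
  have "annq ?T ?T N = (*) Q ` C" using simple_max(1)[OF t(1) N(1)] thin_max(1)[OF C] by blast
  hence "N \<subseteq> colon ?T ((*) Q ` C)" using annq_colon[of N ?T ?T] by simp
  hence NC: "N \<subseteq> C" using thin_max(2)[OF C] by simp
  have oS: "order (S \<inter> C)" unfolding order_in_def
    using lat_Int[OF ordD(1)[OF S(1)] ordD(1)[OF C]] ordD(2,3)[OF S(1)] ordD(2,3)[OF C] by blast
  have TS: "?T \<subseteq> S \<inter> C" "?T \<noteq> S \<inter> C" using S(2) t(5) N NC unfolding simple_def by blast+
  have "len C (S \<inter> C) + len (S \<inter> C) ?T = 2"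
    using len_add[OF ordD(1)[OF C] ordD(1)[OF oS] ordD(1)[OF t(1)] TS(1)] t(3) by simp
  moreover have "len (S \<inter> C) ?T > 0" using len_pos[OF ordD(1)[OF oS] ordD(1)[OF t(1)]] TS by blast
  moreover have "len C (S \<inter> C) > 0" using len_pos[OF ordD(1)[OF C] ordD(1)[OF oS]] S(4) by blast
  ultimately have l: "len C (S \<inter> C) = 1" by linarith
  have i: "colon (S \<inter> C) C \<in> KK C" "line (colon (S \<inter> C) C) 1 = S \<inter> C"
    using index_one_order[OF C oS TS(1) _ l] by blast+
  have uni: "K = colon (S \<inter> C) C" if K: "K \<in> KK C" "line K 1 \<subseteq> S" for K
  proof -
    note f = KK_facts[OF C K(1)]
    have "line K 1 \<subseteq> S \<inter> C" using K(2) f(7) by blast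
    hence "line K 1 = S \<inter> C"
      using len_eq'[OF ordD(1)[OF C] ordD(1)[OF oS] ordD(1)[OF f(5)]] f(9) l by auto
    thus ?thesis using f(12) by simp
  qed
  show ?thesis
  proof (rule ex1I[of _ "colon (S \<inter> C) C"])
    have "line (colon (S \<inter> C) C) 1 \<subseteq> S" unfolding i(2) by blast
    thus "colon (S \<inter> C) C \<in> KK C \<and> line (colon (S \<inter> C) C) 1 \<subseteq> S" using i(1) by blast
  qed (elim conjE, rule uni)
qed

text \<open>
  In the sum over \<open>K\<close> of the overorders of \<open>\<int>\<^sub>q + K\<close>, those that contain \<open>C\<close> occur for every \<open>K\<close>, and the
  others except \<open>\<int>\<^sub>q + qC\<close> exactly once.
\<close>

lemma L_thin:
  assumes C: "order C"
  shows "(1 - fps_X) * (L (thin C) + of_nat (card (KK C)) * (of_nat q * fps_X ^ 2) ^ 2 * L C)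
    = (1 + of_nat q * fps_X) + (1 - fps_X) * (of_nat q * fps_X ^ 2 * (\<Sum>K\<in>KK C. L (line K 1))
      + (of_nat q * fps_X ^ 2) ^ 2 * L C)"
proof -
  let ?T = "thin C"
  note t = thin_facts[OF C]
  let ?R = "OV ?T - {?T} - OV C"
  have fin: "finite (OV ?T)" using finite_OV[OF t(1)] .
  have OC: "OV C \<subseteq> OV ?T" unfolding OV_def using t(5) by blast
  have TnC: "?T \<notin> OV C"
  proof
    assume "?T \<in> OV C"
    hence "?T = C" using t(5) unfolding OV_def by blast
    thus False using t(3) ordD(1)[OF C] by simp
  qed
  have T: "?T \<in> OV ?T" unfolding OV_def using t(1) by blast
  have s: "sum g (OV ?T) = g ?T + sum g (OV C) + sum g ?R" for g :: "'e set \<Rightarrow> rat fps"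
  proof -
    have e: "OV ?T = insert ?T (OV C \<union> ?R)" using T OC by blast
    have n: "?T \<notin> OV C \<union> ?R" using TnC by blast
    have f: "finite (OV C)" "finite ?R" using fin OC finite_subset by auto
    have d: "OV C \<inter> ?R = {}" by blast
    have "sum g (OV ?T) = sum g (insert ?T (OV C \<union> ?R))" by (rule arg_cong[OF e])
    also have "\<dots> = g ?T + sum g (OV C \<union> ?R)" by (rule sum.insert[OF finite_UnI[OF f] n])
    also have "sum g (OV C \<union> ?R) = sum g (OV C) + sum g ?R" by (rule sum.union_disjoint[OF f d])
    finally show ?thesis by (simp only: add.assoc)
  qed
  have OVK: "OV (line K 1) \<subseteq> OV ?T" if "K \<in> KK C" for K
    unfolding OV_def using KK_facts(10)[OF C that] by blast
  have "(\<Sum>K\<in>KK C. \<Sum>S\<in>OV (line K 1). Lterm ?T S) = (\<Sum>K\<in>KK C. \<Sum>S\<in>OV ?T. if S \<in> OV (line K 1) then Lterm ?T S else 0)"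
  proof (rule sum.cong[OF refl])
    fix K assume "K \<in> KK C"
    hence "OV (line K 1) = OV ?T \<inter> OV (line K 1)" using OVK by blast
    thus "(\<Sum>S\<in>OV (line K 1). Lterm ?T S) = (\<Sum>S\<in>OV ?T. if S \<in> OV (line K 1) then Lterm ?T S else 0)"
      using sum.inter_restrict[OF fin, of "Lterm ?T" "OV (line K 1)"] by simp
  qed
  also have "\<dots> = (\<Sum>S\<in>OV ?T. \<Sum>K\<in>KK C. if S \<in> OV (line K 1) then Lterm ?T S else 0)" by (rule sum.swap)
  also have "\<dots> = (\<Sum>S\<in>OV ?T. of_nat (card {K \<in> KK C. S \<in> OV (line K 1)}) * Lterm ?T S)"
    by (rule sum.cong[OF refl]) (simp add: finite_KK[OF C] flip: sum.inter_filter)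
  also have "\<dots> = of_nat (card {K \<in> KK C. ?T \<in> OV (line K 1)}) * Lterm ?T ?T
      + (\<Sum>S\<in>OV C. of_nat (card {K \<in> KK C. S \<in> OV (line K 1)}) * Lterm ?T S)
      + (\<Sum>S\<in>?R. of_nat (card {K \<in> KK C. S \<in> OV (line K 1)}) * Lterm ?T S)" by (rule s)
  also have "{K \<in> KK C. ?T \<in> OV (line K 1)} = {}"
  proof -
    have "?T \<notin> OV (line K 1)" if K: "K \<in> KK C" for K
    proof
      assume "?T \<in> OV (line K 1)"
      hence "line K 1 = ?T" using KK_facts(10)[OF C K] unfolding OV_def by blast
      thus False using KK_facts(11)[OF C K] ordD(1)[OF t(1)] by simp
    qed
    thus ?thesis by blast
  qed
  also have "(\<Sum>S\<in>OV C. of_nat (card {K \<in> KK C. S \<in> OV (line K 1)}) * Lterm ?T S)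
      = (\<Sum>S\<in>OV C. of_nat (card (KK C)) * Lterm ?T S)"
  proof (rule sum.cong[OF refl])
    fix S assume "S \<in> OV C"
    hence "{K \<in> KK C. S \<in> OV (line K 1)} = KK C" unfolding OV_def using KK_facts(7)[OF C] by blast
    thus "of_nat (card {K \<in> KK C. S \<in> OV (line K 1)}) * Lterm ?T S = of_nat (card (KK C)) * Lterm ?T S" by simp
  qed
  also have "(\<Sum>S\<in>?R. of_nat (card {K \<in> KK C. S \<in> OV (line K 1)}) * Lterm ?T S) = (\<Sum>S\<in>?R. Lterm ?T S)"
  proof (rule sum.cong[OF refl])
    fix S assume "S \<in> ?R"
    hence S: "order S" "?T \<subseteq> S" "S \<noteq> ?T" "\<not> C \<subseteq> S" unfolding OV_def by auto
    have "{K \<in> KK C. S \<in> OV (line K 1)} = {K. K \<in> KK C \<and> line K 1 \<subseteq> S}" unfolding OV_def using S(1) by blast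
    moreover have "card {K. K \<in> KK C \<and> line K 1 \<subseteq> S} = 1"
    proof -
      obtain K0 where K0: "K0 \<in> KK C \<and> line K0 1 \<subseteq> S" "\<And>K. K \<in> KK C \<and> line K 1 \<subseteq> S \<Longrightarrow> K = K0"
        using thin_overorder[OF C S] by (metis (no_types, lifting))
      hence "{K. K \<in> KK C \<and> line K 1 \<subseteq> S} = {K0}" by blast
      thus ?thesis by simp
    qed
    ultimately show "of_nat (card {K \<in> KK C. S \<in> OV (line K 1)}) * Lterm ?T S = Lterm ?T S" by simp
  qed
  finally have 1: "(\<Sum>K\<in>KK C. \<Sum>S\<in>OV (line K 1). Lterm ?T S)
      = of_nat (card (KK C)) * (\<Sum>S\<in>OV C. Lterm ?T S) + (\<Sum>S\<in>?R. Lterm ?T S)"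
    by (simp add: sum_distrib_left)
  have "(\<Sum>K\<in>KK C. \<Sum>S\<in>OV (line K 1). Lterm ?T S) = (\<Sum>K\<in>KK C. of_nat q * fps_X ^ 2 * L (line K 1))"
  proof (rule sum.cong[OF refl])
    fix K assume K: "K \<in> KK C"
    note f = KK_facts[OF C K]
    show "(\<Sum>S\<in>OV (line K 1). Lterm ?T S) = of_nat q * fps_X ^ 2 * L (line K 1)"
      using L_base[OF t(1) f(5,10)] f(11) by simp
  qed
  hence e1: "(\<Sum>K\<in>KK C. \<Sum>S\<in>OV (line K 1). Lterm ?T S) = of_nat q * fps_X ^ 2 * (\<Sum>K\<in>KK C. L (line K 1))"
    by (simp add: sum_distrib_left)
  have eC: "(\<Sum>S\<in>OV C. Lterm ?T S) = (of_nat q * fps_X ^ 2) ^ 2 * L C"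
    using L_base[OF t(1) C t(5)] t(3) by simp
  have 2: "(\<Sum>S\<in>?R. Lterm ?T S) = of_nat q * fps_X ^ 2 * (\<Sum>K\<in>KK C. L (line K 1))
      - of_nat (card (KK C)) * (of_nat q * fps_X ^ 2) ^ 2 * L C"
    using 1[unfolded e1 eC] by (simp add: algebra_simps)
  have "L ?T = h ?T * zeta ?T + (of_nat q * fps_X ^ 2) ^ 2 * L C + (\<Sum>S\<in>?R. Lterm ?T S)"
    unfolding L_sum[of ?T] s Lterm_self[OF t(1)] using L_base[OF t(1) C t(5)] t(3) by simp
  hence 3: "L ?T + of_nat (card (KK C)) * (of_nat q * fps_X ^ 2) ^ 2 * L C = h ?T * zeta ?T
      + (of_nat q * fps_X ^ 2 * (\<Sum>K\<in>KK C. L (line K 1)) + (of_nat q * fps_X ^ 2) ^ 2 * L C)"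
    unfolding 2 by (simp add: algebra_simps)
  have "(1 - fps_X) * (h ?T * zeta ?T) = 1 + of_nat q * fps_X"
    using zeta_thin[OF C] thin_not_gor[OF C] by (simp add: h_def mult.left_commute)
  thus ?thesis unfolding 3 by (simp add: distrib_left)
qed

text \<open>
  If \<open>M = lo C M + \<int>\<^sub>q x\<close>, such a \<open>K\<close> lies in the annihilator of \<open>x\<close> modulo \<open>lo C M\<close>, whose index is right
  exactly if \<open>len (up C M) M = 1\<close>. If \<open>len M (lo C M) = 2\<close>, a generator of \<open>C\<close> over \<open>\<int>\<^sub>q + K\<close> would embed
  \<open>M / lo C M\<close> into \<open>up C M / M\<close>, which is too small.
\<close>

lemma stable_ideal_count:
  assumes C: "order C" and M: "M \<in> LT (thin C)" and n: "\<not> tl C M"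
  shows "card {K \<in> KK C. tl (line K 1) M} = (if len M (lo C M) = 1 \<and> len (up C M) M = 1 then 1 else 0)"
proof -
  have lM: "lat M" and tM: "tl (thin C) M" using LTD[OF M] by auto
  note f = up_lo[OF C tM]
  have lL: "lat (lo C M)" and lN: "lat (up C M)" using tlD(1) f(1,2) by auto
  have into: "k * x \<in> lo C M" if K: "K \<in> KK C" "tl (line K 1) M" and kx: "k \<in> K" "x \<in> M" for K k x
    unfolding lo_def
  proof (rule colonI)
    fix c assume c: "c \<in> C"
    have "c * k \<in> line K 1" using tl_mult[OF KK_facts(1)[OF C K(1)] c kx(1)] KK_facts(6)[OF C K(1)] by blast
    hence "c * k * x \<in> M" using tl_mult[OF K(2) _ kx(2)] by blast
    thus "k * x * c \<in> M" by (simp add: mult_ac)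
  qed
  show ?thesis
  proof (cases "len M (lo C M) = 1")
    case b1: True
    have "M \<noteq> lo C M" using b1 lL by auto
    then obtain x where x: "x \<in> M" "x \<notin> lo C M" using f(4) by blast
    have QML: "(*) Q ` M \<subseteq> lo C M" using f(3,5) by blast
    have "M \<in> lines (lo C M) M" unfolding lines_def using lM f(4) b1 by blast
    hence Mx: "M = line (lo C M) x" using lines_eq_line[OF lL QML _ x] by blast
    have xN: "x \<in> up C M" using x(1) f(5) by blast
    have LN: "lo C M \<subseteq> up C M" using f(4,5) by blast
    note c = cyclic_quotient[OF C f(2,1) LN xN]
    let ?K = "{a \<in> C. a * x \<in> lo C M}"
    have "M \<subseteq> sum_set (lo C M) ((*) x ` C)"
      using line_least[OF lat_mod[OF tlD(1)[OF c(1)]] c(3,4)] Mx by simp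
    hence "sum_set (lo C M) ((*) x ` C) = up C M" using f(8)[OF c(1)] c(5) by blast
    hence lK: "len C ?K = len (up C M) M + 1"
      using c(6) len_add[OF lN lM lL f(4,5)] b1 by simp
    have QK: "(*) Q ` C \<subseteq> ?K"
    proof
      fix y assume "y \<in> (*) Q ` C"
      then obtain a where a: "a \<in> C" "y = Q * a" by blast
      have "Q * (a * x) \<in> lo C M" using f(3) tl_mult[OF f(1) a(1) xN] by blast
      thus "y \<in> ?K" using a Q_sub[OF ordD(1)[OF C]] by (auto simp: mult.assoc)
    qed
    have lKQ: "len ?K ((*) Q ` C) = 2 - len (up C M) M"
      using len_add[OF ordD(1)[OF C] tlD(1)[OF c(2)] lat_Q[OF ordD(1)[OF C]] QK] lK len_Q[OF ordD(1)[OF C]] by simp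
    have sub: "K \<subseteq> ?K" if "K \<in> KK C" "tl (line K 1) M" for K
      using into[OF that _ x(1)] KK_facts(3)[OF C that(1)] by blast
    show ?thesis
    proof (cases "len (up C M) M = 1")
      case True
      have KK: "?K \<in> KK C" unfolding KK_def using c(2) QK lKQ True by simp
      have "tl (line ?K 1) M"
      proof -
        have "a * y \<in> M" if a: "a \<in> line ?K 1" and y: "y \<in> M" for a y
        proof -
          obtain k z where k: "a = k + z * 1" "k \<in> ?K" "z \<in> Z" using a by (rule lineE)
          have "y \<in> line (lo C M) x" using y Mx by simp
          then obtain l w where l: "y = l + w * x" "l \<in> lo C M" "w \<in> Z" by (rule lineE)
          have "k * l \<in> lo C M" using tl_mult[OF f(2)] k(2) l(2) by blast
          moreover have "w * (k * x) \<in> lo C M" using submodD(6)[OF lat_mod[OF lL] l(3)] k(2) by blast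
          ultimately have "k * l + w * (k * x) \<in> M" using tl_add[OF f(2)] f(4) by blast
          moreover have "z * y \<in> M" using submodD(6)[OF lat_mod[OF lM] k(3) y] .
          ultimately have "(k * l + w * (k * x)) + z * y \<in> M" by (rule tl_add[OF tM])
          thus ?thesis by (simp add: k(1) l(1) algebra_simps)
        qed
        thus ?thesis using lM lat_add unfolding tl_def submodule_over_def by blast
      qed
      moreover have "K = ?K" if K: "K \<in> KK C" "tl (line K 1) M" for K
      proof -
        have "len ?K ((*) Q ` C) = len K ((*) Q ` C)" using KK K(1) unfolding KK_def by simp
        thus ?thesis
          using len_eq[OF tlD(1)[OF c(2)] tlD(1)[OF KK_facts(1)[OF C K(1)]] lat_Q[OF ordD(1)[OF C]] KK_facts(2)[OF C K(1)] sub[OF K]]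
          by simp
      qed
      ultimately have "{K \<in> KK C. tl (line K 1) M} = {?K}" using KK by blast
      thus ?thesis using b1 True by simp
    next
      case False
      hence a2: "len (up C M) M = 2" using up_lo_types[OF C tM n] by linarith
      have none: "{K \<in> KK C. tl (line K 1) M} = {}"
      proof (rule ccontr)
        assume "{K \<in> KK C. tl (line K 1) M} \<noteq> {}"
        then obtain K where K: "K \<in> KK C" "tl (line K 1) M" by blast
        have "len K ((*) Q ` C) \<le> len ?K ((*) Q ` C)"
          using len_mono(1)[OF tlD(1)[OF c(2)] tlD(1)[OF KK_facts(1)[OF C K(1)]] lat_Q[OF ordD(1)[OF C]] KK_facts(2)[OF C K(1)] sub[OF K]] .
        thus False using lKQ a2 K(1) unfolding KK_def by simp
      qed
      show ?thesis using a2 by (simp only: none card.empty) simp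
    qed
  next
    case False
    hence ab: "len M (lo C M) = 2" "len (up C M) M = 1" using up_lo_types[OF C tM n] by linarith+
    have none: "{K \<in> KK C. tl (line K 1) M} = {}"
    proof (rule ccontr)
      assume "{K \<in> KK C. tl (line K 1) M} \<noteq> {}"
      then obtain K where K: "K \<in> KK C" "tl (line K 1) M" by blast
      note k = KK_facts[OF C K(1)]
      have CS: "C \<in> lines (line K 1) C" unfolding lines_def using ordD(1)[OF C] k(7,9) by blast
      have "line K 1 \<noteq> C" using k(9) ordD(1)[OF C] by auto
      then obtain y where y: "y \<in> C" "y \<notin> line K 1" using k(7) by blast
      have "(*) Q ` C \<subseteq> line K 1" using k(2,6) by blast
      hence Cy: "C = line (line K 1) y" using lines_eq_line[OF ordD(1)[OF k(5)] _ CS y] by blast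
      have e: "lo C M = {x \<in> M. y * x \<in> M}"
        using colon_line[OF K(2) _ lat_mod[OF ordD(1)[OF k(5)]], of y] f(4) unfolding Cy[symmetric] lo_def by blast
      have "y * x \<in> up C M" if "x \<in> M" for x using tl_mult[OF f(1) y(1)] f(5) that by blast
      hence "len M (lo C M) \<le> len (up C M) M"
        using len_kernel_le[OF lN lM f(5)] lL unfolding e by blast
      thus False using ab by simp
    qed
    show ?thesis using ab by (simp only: none card.empty) simp
  qed
qed

text \<open>
  In the sum over \<open>K\<close> of the \<open>(\<int>\<^sub>q + K)\<close>-lattices, a \<open>C\<close>-lattice occurs for every \<open>K\<close>, and the others are
  counted by \<open>stable_ideal_count\<close>.
\<close>

lemma Alo_eq:
  assumes C: "order C"
  shows "Alo C + of_nat (card (KK C)) * (fps_X ^ 2 * J C) = Bet C + fps_X * (\<Sum>K\<in>KK C. J (line K 1))"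
proof -
  let ?T = "thin C"
  let ?L1 = "{M \<in> LT ?T. len M (lo C M) = 1}"
  let ?L2 = "{M \<in> LT ?T. len M (lo C M) = 2}"
  let ?U2 = "{M \<in> LT ?T. len (up C M) M = 2}"
  note t = thin_facts[OF C]
  let ?D = "{M \<in> LT ?T. len M (lo C M) = 1 \<and> len (up C M) M = 1}"
  let ?w = "\<lambda>M. of_nat (card {K \<in> KK C. tl (line K 1) M}) :: rat"
  have sub: "LT C \<subseteq> LT ?T" using stable_LT[OF t(1) C t(5)] by blast
  have nst: "\<not> tl C M" if "len M (lo C M) \<noteq> 0" for M
    using up_lo_stable(2)[OF C, of M] tlD(1)[of C M] that by auto
  have "fps_X * (\<Sum>K\<in>KK C. J (line K 1)) = (\<Sum>K\<in>KK C. cnt ?T (LT (line K 1)))"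
    unfolding sum_distrib_left
  proof (rule sum.cong[OF refl])
    fix K assume K: "K \<in> KK C"
    note f = KK_facts[OF C K]
    show "fps_X * J (line K 1) = cnt ?T (LT (line K 1))"
      using ser_base[OF t(1) f(5,10) order_refl, of "\<lambda>_. 1"] f(11) unfolding J_def by simp
  qed
  also have "\<dots> = ser ?T (LT ?T) ?w"
  proof (rule fps_ext)
    fix n
    let ?X = "{M \<in> LT ?T. len M ?T = n}"
    have fX: "finite ?X" using finite_LT[OF t(1)] .
    have "(\<Sum>K\<in>KK C. cnt ?T (LT (line K 1))) $ n = (\<Sum>K\<in>KK C. of_nat (card {M \<in> ?X. tl (line K 1) M}))"
      unfolding fps_sum_nth
    proof (rule sum.cong[OF refl])
      fix K assume K: "K \<in> KK C"
      note f = KK_facts[OF C K]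
      have "{M \<in> LT (line K 1). len M ?T = n} = {M \<in> ?X. tl (line K 1) M}"
        using stable_LT[OF t(1) f(5,10)] by blast
      thus "cnt ?T (LT (line K 1)) $ n = of_nat (card {M \<in> ?X. tl (line K 1) M})"
        by (simp add: ser_nth)
    qed
    also have "\<dots> = (\<Sum>M\<in>?X. of_nat (card {K \<in> KK C. tl (line K 1) M}))"
      using sum_multicount_gen[OF finite_KK[OF C] fX, of "\<lambda>K M. tl (line K 1) M" "\<lambda>M. card {K \<in> KK C. tl (line K 1) M}"]
      by (simp flip: of_nat_sum)
    finally show "(\<Sum>K\<in>KK C. cnt ?T (LT (line K 1))) $ n = ser ?T (LT ?T) ?w $ n" by (simp add: ser_nth)
  qed
  also have "\<dots> = ser ?T (LT C) ?w + ser ?T ?L1 ?w + ser ?T ?L2 ?w"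
    by (rule thin_split(1)[OF C])
  also have "ser ?T (LT C) ?w = of_nat (card (KK C)) * (fps_X ^ 2 * J C)"
  proof -
    have "ser ?T (LT C) ?w = ser ?T (LT C) (\<lambda>M. of_nat (card (KK C)) * 1)"
    proof (rule ser_cong[OF refl])
      fix M assume M: "M \<in> LT C"
      have "{K \<in> KK C. tl (line K 1) M} = KK C" using tl_mono[OF LTD(1)[OF M]] KK_facts(7)[OF C] by blast
      thus "?w M = of_nat (card (KK C)) * 1" by simp
    qed
    thus ?thesis unfolding ser_cmult thin_ser_stable[OF C] .
  qed
  also have "ser ?T ?L1 ?w = ser ?T ?L1 (\<lambda>M. if len (up C M) M = 1 then 1 else 0)"
  proof (rule ser_cong[OF refl])
    fix M assume "M \<in> ?L1"
    hence M: "M \<in> LT ?T" "len M (lo C M) = 1" by auto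
    have "\<not> tl C M" using nst M(2) by simp
    from stable_ideal_count[OF C M(1) this] M(2) show "?w M = (if len (up C M) M = 1 then 1 else 0)" by simp
  qed
  also have "\<dots> = cnt ?T {M \<in> ?L1. len (up C M) M = 1}"
    by (rule ser_if[OF t(1)]) blast
  also have "\<dots> = Alo C - cnt ?T {M \<in> ?L1. \<not> len (up C M) M = 1}"
    unfolding Alo_def using ser_split[OF t(1), of "?L1" "\<lambda>_. 1" "\<lambda>M. len (up C M) M = 1"] by auto
  also have "{M \<in> ?L1. \<not> len (up C M) M = 1} = ?U2"
  proof (intro equalityI subsetI)
    fix M assume "M \<in> {M \<in> ?L1. \<not> len (up C M) M = 1}"
    hence M: "M \<in> LT ?T" "len M (lo C M) = 1" "len (up C M) M \<noteq> 1" by auto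
    have "\<not> tl C M" using nst M(2) by simp
    thus "M \<in> ?U2" using up_lo_types[OF C LTD(1)[OF M(1)]] M by auto
  next
    fix M assume "M \<in> ?U2"
    hence M: "M \<in> LT ?T" "len (up C M) M = 2" by auto
    have "\<not> tl C M" using up_lo_stable(1)[OF C, of M] LTD(3)[OF M(1)] M(2) by auto
    thus "M \<in> {M \<in> ?L1. \<not> len (up C M) M = 1}"
      using up_lo_types[OF C LTD(1)[OF M(1)]] M by auto
  qed
  also have "cnt ?T ?U2 = Bet C" unfolding Bet_def ..
  also have "ser ?T ?L2 ?w = ser ?T ?L2 (\<lambda>_. 0)"
  proof (rule ser_cong[OF refl])
    fix M assume "M \<in> ?L2"
    hence M: "M \<in> LT ?T" "len M (lo C M) = 2" by auto
    have "\<not> tl C M" using nst M(2) by simp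
    from stable_ideal_count[OF C M(1) this] M(2) show "?w M = 0" by simp
  qed
  finally show ?thesis by (simp add: algebra_simps)
qed

lemma r_Q_image: "(*) r ` (*) Q ` M = M" "(*) Q ` (*) r ` M = M" for M :: "'e set"
  using scale_scale Q_r by blast+

lemma KK_thin: "line K 1 = thin ((*) r ` K)"
  by (simp only: r_Q_image)

lemma KK_gor:
  assumes C: "order C" and K: "K \<in> KK C" and n: "\<not> order ((*) r ` K)"
  shows "gor (line K 1)"
proof (rule ccontr)
  note f = KK_facts[OF C K]
  assume "\<not> gor (line K 1)"
  then obtain W where W: "order W" "line K 1 = thin W" using not_gor_thin[OF f(5)] by blast
  have "submodule_over (line K 1) K" using submod_mono[OF tlD(2)[OF f(1)] f(7)] .
  moreover have "K \<subset> line K 1" using f(4,6) ordD(2)[OF f(5)] by blast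
  ultimately obtain m where m: "m \<in> Specm (line K 1)" "K \<subseteq> m" by (rule max_exists[OF f(5)])
  have e: "m = (*) Q ` W" using m(1) thin_max(1)[OF W(1)] W(2) by simp
  have s: "(*) Q ` W \<subseteq> line K 1" using thin_facts(4)[OF W(1)] W(2) by simp
  have "len (line K 1) ((*) Q ` W) = 1" using thin_facts(2)[OF W(1)] W(2) by simp
  hence "(*) Q ` W = K"
    using len_eq'[OF ordD(1)[OF f(5)] lat_Q[OF ordD(1)[OF W(1)]] tlD(1)[OF f(1)] _ s] m(2) e f(8) by simp
  hence "(*) r ` K = W" using r_Q_image(1)[of W] by simp
  thus False using n W(1) by simp
qed

definition KO :: "'e set \<Rightarrow> 'e set set" where "KO C = {K \<in> KK C. order ((*) r ` K)}"

text \<open>The correction in \<open>good\<close> up to a factor \<open>q t\<^sup>2\<close>, summed over those orders \<open>\<int>\<^sub>q + K\<close> that have the form \<open>\<int>\<^sub>q + qS\<close>.\<close>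

definition Y :: "'e set \<Rightarrow> rat fps" where
  "Y C = (\<Sum>K\<in>KO C. L ((*) r ` K) - of_nat q * fps_X * J ((*) r ` K))"

text \<open>
  The claim of the induction over overorders. The second part is the corrected identity for the orders
  \<open>\<int>\<^sub>q + qC\<close>, which are not Gorenstein.
\<close>

definition good :: "'e set \<Rightarrow> bool" where
  "good T \<longleftrightarrow> (gor T \<longrightarrow> J T = L T) \<and> (\<forall>C. order C \<and> T = thin C \<longrightarrow>
     L T = J T + of_nat q * fps_X ^ 2 * (L C - of_nat q * fps_X * J C))"

text \<open>
  What remains of the corrected identity for \<open>\<int>\<^sub>q + qC\<close> once \<open>J_thin\<close>, \<open>L_thin\<close>, \<open>Alo_eq\<close>, \<open>Bet_eq\<close> and
  \<open>sum_L_KK\<close> are inserted: a relation between series of \<open>C\<close> and its overorders.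
\<close>

definition balanced :: "'e set \<Rightarrow> bool" where
  "balanced C \<longleftrightarrow> 1 - (1 - fps_X) * of_nat (kap C) * fps_X ^ 2 * pser C + (1 - fps_X) * (of_nat q * fps_X ^ 2) * Y C
    - (1 - fps_X) * (of_nat (card (KK C)) - 1) * (of_nat q * fps_X ^ 2) * L C
    + (1 - fps_X) * (of_nat (card (KK C)) - 1) * fps_X * J C
    - (1 - fps_X) * (of_nat q * fps_X) * (1 - of_nat q * fps_X) * J C
    = (1 - fps_X) * (L C - of_nat q * fps_X * J C)"

lemma sum_L_KK:
  assumes C: "order C" and good: "\<And>K. K \<in> KK C \<Longrightarrow> good (line K 1)"
  shows "(\<Sum>K\<in>KK C. L (line K 1)) = (\<Sum>K\<in>KK C. J (line K 1)) + of_nat q * fps_X ^ 2 * Y C"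
proof -
  have "(\<Sum>K\<in>KK C. L (line K 1)) = (\<Sum>K\<in>KK C. J (line K 1) +
      (if order ((*) r ` K) then of_nat q * fps_X ^ 2 * (L ((*) r ` K) - of_nat q * fps_X * J ((*) r ` K)) else 0))"
  proof (rule sum.cong[OF refl])
    fix K assume K: "K \<in> KK C"
    show "L (line K 1) = J (line K 1) +
        (if order ((*) r ` K) then of_nat q * fps_X ^ 2 * (L ((*) r ` K) - of_nat q * fps_X * J ((*) r ` K)) else 0)"
    proof (cases "order ((*) r ` K)")
      case True
      thus ?thesis using good[OF K] KK_thin[of K] unfolding good_def by auto
    next
      case False
      thus ?thesis using good[OF K] KK_gor[OF C K False] unfolding good_def by simp
    qed
  qed
  also have "\<dots> = (\<Sum>K\<in>KK C. J (line K 1)) +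
      (\<Sum>K\<in>KO C. of_nat q * fps_X ^ 2 * (L ((*) r ` K) - of_nat q * fps_X * J ((*) r ` K)))"
    unfolding sum.distrib KO_def using finite_KK[OF C] by (simp add: sum.inter_filter)
  finally show ?thesis unfolding Y_def sum_distrib_left .
qed

text \<open>
  The difference of both sides is a linear combination of the relations \<open>J_thin\<close>, \<open>L_thin\<close>, \<open>sum_L_KK\<close> and
  \<open>balanced\<close>.
\<close>

lemma thin_step:
  assumes C: "order C" and good: "\<And>K. K \<in> KK C \<Longrightarrow> good (line K 1)" and bal: "balanced C"
  shows "L (thin C) = J (thin C) + of_nat q * fps_X ^ 2 * (L C - of_nat q * fps_X * J C)"
proof -
  define X where "X = (fps_X :: rat fps)"
  define k where "k = (of_nat q :: rat fps)"
  define c where "c = (of_nat (card (KK C)) :: rat fps)"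
  define \<kappa> where "\<kappa> = (of_nat (kap C) :: rat fps)"
  define sJ sL where "sJ = (\<Sum>K\<in>KK C. J (line K 1))" and "sL = (\<Sum>K\<in>KK C. L (line K 1))"
  define JC LC JT LT' p y P where "JC = J C" and "LC = L C" and "JT = J (thin C)" and "LT' = L (thin C)"
    and "p = pser C" and "y = Y C" and "P = 1 - X"
  note defs = X_def k_def c_def \<kappa>_def sJ_def sL_def JC_def LC_def JT_def LT'_def p_def y_def P_def
  have a: "Alo C = 1 + \<kappa> * X ^ 3 * p + X * sJ - c * (X ^ 2 * JC)"
    using Alo_eq[OF C] Bet_eq[OF C] unfolding defs by (simp add: algebra_simps)
  have g1: "P * JT - (1 + P * (k * X) * (X ^ 2 * JC + Alo C + k * (1 - k * X) * (X ^ 2 * JC))) = 0"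
    using J_thin[OF C] unfolding defs by simp
  have g2: "P * (LT' + c * (k * X ^ 2) ^ 2 * LC) - ((1 + k * X) + P * (k * X ^ 2 * sL + (k * X ^ 2) ^ 2 * LC)) = 0"
    using L_thin[OF C] unfolding defs by simp
  have g3: "sL - (sJ + k * X ^ 2 * y) = 0" using sum_L_KK[OF C good] unfolding defs by simp
  have g4: "1 - P * \<kappa> * X ^ 2 * p + P * (k * X ^ 2) * y - P * (c - 1) * (k * X ^ 2) * LC + P * (c - 1) * X * JC
    - P * (k * X) * (1 - k * X) * JC - P * (LC - k * X * JC) = 0"
    using bal unfolding balanced_def defs by simp
  have "P * (LT' - JT - k * X ^ 2 * (LC - k * X * JC)) =
    (P * (LT' + c * (k * X ^ 2) ^ 2 * LC) - ((1 + k * X) + P * (k * X ^ 2 * sL + (k * X ^ 2) ^ 2 * LC)))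
    - (P * JT - (1 + P * (k * X) * (X ^ 2 * JC + Alo C + k * (1 - k * X) * (X ^ 2 * JC))))
    + P * k * X ^ 2 * (sL - (sJ + k * X ^ 2 * y))
    + k * X ^ 2 * (1 - P * \<kappa> * X ^ 2 * p + P * (k * X ^ 2) * y - P * (c - 1) * (k * X ^ 2) * LC + P * (c - 1) * X * JC
    - P * (k * X) * (1 - k * X) * JC - P * (LC - k * X * JC))"
    unfolding a P_def by (simp add: poly_simps)
  also have "\<dots> = 0" unfolding g1 g2 g3 g4 by simp
  finally have "(1 - fps_X) * (LT' - JT - k * X ^ 2 * (LC - k * X * JC)) = (1 - fps_X) * 0" unfolding P_def X_def by simp
  hence "LT' - JT - k * X ^ 2 * (LC - k * X * JC) = 0" by (rule one_X_cancel)
  thus ?thesis unfolding defs by (simp add: algebra_simps)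
qed

text \<open>As \<open>q\<^sup>-\<^sup>1K/C\<close> is simple, duality over \<open>C\<close> gives \<open>q\<^sup>-\<^sup>1K = (C : n)\<close> for a maximal ideal \<open>n\<close>.\<close>

lemma gor_KK:
  assumes C: "order C" and g: "gor C"
  shows "bij_betw (\<lambda>n. (*) Q ` colon C n) {n \<in> Specm C. len C n = 1} (KK C)"
proof (rule bij_betw_byWitness[where f' = "\<lambda>K. colon C ((*) r ` K)"])
  show "\<forall>n\<in>{n \<in> Specm C. len C n = 1}. colon C ((*) r ` (*) Q ` colon C n) = n"
    using star_facts(2)[OF C g max_lat(1)[OF C]] r_Q_image(1) by simp
  have K1: "(*) r ` K = colon C (annq C C ((*) r ` K))" "annq C C ((*) r ` K) \<in> Specm C"
    "len C (annq C C ((*) r ` K)) = 1" if K: "K \<in> KK C" for K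
  proof -
    note f = KK_facts[OF C K]
    let ?N = "(*) r ` K"
    have N: "tl C ?N" using tl_r[OF f(1)] .
    have CN: "C \<subseteq> ?N" using f(2) by (auto simp: mem_r_iff)
    have "len K ((*) Q ` C) = 1" using K unfolding KK_def by simp
    hence l: "len ?N C = 1"
      using len_scale[OF tlD(1)[OF f(1)] lat_Q[OF ordD(1)[OF C]] f(2) Q_r(2)] r_Q_image(1)[of C] by simp
    have s: "simple C C ?N" by (rule simple_if_len_1[OF ordD(5)[OF C] N CN l])
    show m: "annq C C ?N \<in> Specm C" using simple_max(1)[OF C s] .
    show "?N = colon C (annq C C ?N)" using simple_colon[OF C s len_gor_max[OF C g m]] .
    show "len C (annq C C ?N) = 1" using simple_max(2)[OF C s] l by simp
  qed
  have star: "colon C ((*) r ` K) = annq C C ((*) r ` K)" if K: "K \<in> KK C" for K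
  proof -
    have "colon C ((*) r ` K) = colon C (colon C (annq C C ((*) r ` K)))" by (rule arg_cong[OF K1(1)[OF K]])
    also have "\<dots> = annq C C ((*) r ` K)" by (rule star_facts(2)[OF C g max_lat(1)[OF C K1(2)[OF K]]])
    finally show ?thesis .
  qed
  show "\<forall>K\<in>KK C. (*) Q ` colon C (colon C ((*) r ` K)) = K"
  proof
    fix K assume K: "K \<in> KK C"
    have "(*) Q ` colon C (colon C ((*) r ` K)) = (*) Q ` (*) r ` K"
      unfolding star[OF K] by (rule arg_cong[OF K1(1)[OF K, symmetric]])
    thus "(*) Q ` colon C (colon C ((*) r ` K)) = K" unfolding r_Q_image .
  qed
  show "(\<lambda>K. colon C ((*) r ` K)) ` KK C \<subseteq> {n \<in> Specm C. len C n = 1}"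
    using star K1(2,3) by auto
  show "(\<lambda>n. (*) Q ` colon C n) ` {n \<in> Specm C. len C n = 1} \<subseteq> KK C"
  proof
    fix K assume "K \<in> (\<lambda>n. (*) Q ` colon C n) ` {n \<in> Specm C. len C n = 1}"
    then obtain n where n: "n \<in> Specm C" "len C n = 1" "K = (*) Q ` colon C n" by blast
    have t: "tl C (colon C n)" using tl_colon_max[OF C n(1)] .
    have "Q * 1 \<in> n" using max_lat(2)[OF C n(1)] ordD(2)[OF C] by blast
    hence "K \<subseteq> C" unfolding n(3) using colonD[of _ C n Q] by (auto simp: mult.commute)
    moreover have "(*) Q ` C \<subseteq> K" unfolding n(3) using colon_upper[OF C n(1)] by blast
    moreover have "len K ((*) Q ` C) = 1"
      unfolding n(3) len_scaled_colon[OF C n(1)] using len_gor_max[OF C g n(1)] n(2) by simp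
    ultimately show "K \<in> KK C" unfolding KK_def using tl_Q[OF t] n(3) by simp
  qed
qed

lemma cyc_not_stable:
  assumes C: "order C" and S: "order S" "C \<subseteq> S" "S \<noteq> C" and N: "tl C N" "cyc C N"
  shows "\<not> tl S N"
proof
  assume t: "tl S N"
  obtain x where x: "N = (*) x ` C" using N(2) unfolding cyc_def by blast
  obtain y where y: "x * y = 1" using cyclic_gen_unit[OF C N(1) x] .
  have "S \<subseteq> C"
  proof
    fix s assume s: "s \<in> S"
    have "x * 1 \<in> N" unfolding x using ordD(2)[OF C] by (rule imageI)
    hence "s * (x * 1) \<in> N" using tl_mult[OF t s] by blast
    hence "x * s \<in> (*) x ` C" unfolding x by (simp add: mult.commute)
    thus "s \<in> C" using scale_image_mem[OF y] by blast
  qed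
  thus False using S by blast
qed

lemma cyc_if_small:
  "order C \<Longrightarrow> tl C N \<Longrightarrow> (\<And>m. m \<in> Specm C \<Longrightarrow> len N (m \<cdot> N) \<le> len C m) \<Longrightarrow> cyc C N"
  using cyclic_if_small[of C N] unfolding cyc_def by metis

text \<open>
  By \<open>gor_KK\<close> and \<open>euler_order\<close> the relation is one for the Euler factor \<open>E\<close> of \<open>C\<close> (the fact \<open>key\<close>). Either
  all maximal ideals are invertible, and all lattices are cyclic; or the lattices that are not cyclic are
  those over \<open>(C : m)\<close>, and \<open>C\<close> has at most one maximal ideal besides \<open>m\<close>, of residue degree one.
\<close>

lemma balanced_gor:
  assumes C: "order C" and g: "gor C" and good: "\<And>S. order S \<Longrightarrow> C \<subseteq> S \<Longrightarrow> good S"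
  shows "balanced C"
proof -
  define X where "X = (fps_X :: rat fps)"
  define k where "k = (of_nat q :: rat fps)"
  define c where "c = (of_nat (card (KK C)) :: rat fps)"
  define \<kappa> where "\<kappa> = (of_nat (kap C) :: rat fps)"
  define JC p y P where "JC = J C" and "p = pser C" and "y = Y C" and "P = 1 - X"
  define E where "E = (\<Prod>n\<in>Specm C. 1 - X ^ len C n)"
  note defs = X_def k_def c_def \<kappa>_def JC_def p_def y_def P_def
  let ?MM = "Specm C"
  have JL: "J C = L C" using good[OF C order_refl] g unfolding good_def by blast
  have "card (KK C) = card {n \<in> ?MM. len C n = 1}" using bij_betw_same_card[OF gor_KK[OF C g]] by simp
  hence E: "E = P * (1 + (1 - c) * X + (\<kappa> - k * (k + 1 - c)) * X ^ 2)"
    using euler_order[OF C] unfolding E_def defs by simp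
  have zE: "E * zeta C = 1" using zeta_mult[OF C] unfolding E_def X_def .
  have key: "1 + P * (k * X ^ 2) * y + P * \<kappa> * X ^ 2 * (JC - p) = E * JC"
  proof (cases "\<forall>m\<in>?MM. invertible C m")
    case True
    hence inv: "\<And>m. m \<in> ?MM \<Longrightarrow> invertible C m" by blast
    have "cyc C N" if "N \<in> LT C" for N
      using cyc_if_small[OF C LTD(1)[OF that]] len_inv_product[OF C _ inv LTD(1)[OF that]] by simp
    hence "{N \<in> LT C. cyc C N} = LT C" by blast
    hence 1: "p = JC" unfolding p_def JC_def pser_def J_def by simp
    have "KO C = {}"
    proof (rule ccontr)
      assume "KO C \<noteq> {}"
      then obtain K where K: "K \<in> KK C" "order ((*) r ` K)" unfolding KO_def by blast
      then obtain n where n: "n \<in> ?MM" "K = (*) Q ` colon C n"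
        using bij_betw_imp_surj_on[OF gor_KK[OF C g]] by blast
      have e: "(*) r ` K = colon C n" unfolding n(2) r_Q_image ..
      have o: "order (colon C n)" using K(2) unfolding e .
      show False using invertible_not_sub[OF C o colon_upper[OF C n(1)] n(1) inv[OF n(1)]] by blast
    qed
    hence "y = 0" unfolding y_def Y_def by simp
    moreover have "JC = zeta C" unfolding JC_def using all_invertible(3)[OF C inv] .
    ultimately show ?thesis using 1 zE by simp
  next
    case False
    then obtain m where m: "m \<in> ?MM" and ninv: "\<not> invertible C m" by blast
    note N = ninv_order[OF C m ninv] and G = gor_ninv[OF C g m ninv]
    let ?C = "colon C m"
    have nC: "?C \<noteq> C" using G(2) ordD(1)[OF C] by auto
    have cyc: "{N \<in> LT C. cyc C N} = {N \<in> LT C. \<not> tl ?C N}"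
    proof -
      have "cyc C M" if M: "M \<in> LT C" "\<not> tl ?C M" for M
      proof (rule cyc_if_small[OF C LTD(1)[OF M(1)]])
        fix n assume n: "n \<in> ?MM"
        show "len M (n \<cdot> M) \<le> len C n"
          using gor_dichotomy(1)[OF C g m ninv LTD(1)[OF M(1)] M(2)] G(1)
            len_inv_product[OF C n G(3)[OF n] LTD(1)[OF M(1)]] by (cases "n = m") auto
      qed
      thus ?thesis using cyc_not_stable[OF C N(1,3) nC LTD(1)] by blast
    qed
    have p: "JC - p = X * J ?C"
    proof -
      have "JC = cnt C {N \<in> LT C. tl ?C N} + p"
        unfolding JC_def p_def J_def pser_def cyc by (rule ser_split[OF C order_refl])
      also have "{N \<in> LT C. tl ?C N} = LT ?C" by (rule stable_LT[OF C N(1,3)])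
      also have "cnt C (LT ?C) = X * J ?C"
        using ser_base[OF C N(1,3) order_refl, of "\<lambda>_. 1"] G(2) unfolding J_def X_def by simp
      finally show ?thesis by simp
    qed
    have KO: "KO C = {(*) Q ` ?C}"
    proof (intro equalityI subsetI)
      fix K assume "K \<in> KO C"
      hence K: "K \<in> KK C" "order ((*) r ` K)" unfolding KO_def by auto
      then obtain n where n: "n \<in> ?MM" "K = (*) Q ` colon C n"
        using bij_betw_imp_surj_on[OF gor_KK[OF C g]] by blast
      have e: "(*) r ` K = colon C n" unfolding n(2) r_Q_image ..
      have o: "order (colon C n)" using K(2) unfolding e .
      have "\<not> invertible C n" using invertible_not_sub[OF C o colon_upper[OF C n(1)] n(1)] by blast
      hence "n = m" using G(3)[OF n(1)] by blast
      thus "K \<in> {(*) Q ` ?C}" using n(2) by simp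
    next
      fix K assume "K \<in> {(*) Q ` ?C}"
      hence K: "K = (*) Q ` ?C" by simp
      have "K \<in> KK C" unfolding K using bij_betw_imp_surj_on[OF gor_KK[OF C g]] m G(1) by blast
      moreover have "order ((*) r ` K)" unfolding K r_Q_image by (rule N(1))
      ultimately show "K \<in> KO C" unfolding KO_def by blast
    qed
    have y: "y = L ?C - k * X * J ?C" unfolding y_def Y_def KO by (simp add: r_Q_image k_def X_def)
    have JC: "JC = zeta C + k * X ^ 2 * L ?C" unfolding JC_def JL k_def X_def by (rule L_gor[OF C g m ninv])
    have EJ: "E * JC = 1 + E * (k * X ^ 2 * L ?C)" unfolding JC distrib_left zE ..
    have kap: "of_nat (kap C) * (of_nat q - 1) = (of_nat q ^ 3 * (\<Prod>n\<in>?MM. 1 - 1 / of_nat q ^ len C n) :: rat)"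
      by (rule kap_formula[OF C])
    have q1: "(of_nat q :: rat) > 1" using q_gt1 by simp
    have fin: "finite (?MM - {m})" using finite_max[OF C] by simp
    show ?thesis
    proof (cases "?MM = {m}")
      case True
      have "(of_nat q ^ 3 * (\<Prod>n\<in>?MM. 1 - 1 / of_nat q ^ len C n) :: rat) = of_nat q ^ 2 * (of_nat q - 1)"
        using q1 G(1) by (simp add: True field_simps power2_eq_square power3_eq_cube)
      hence "(of_nat (kap C) :: rat) = of_nat q ^ 2" using kap q1 by simp
      hence "kap C = q ^ 2" by (metis of_nat_eq_iff of_nat_power)
      hence \<kappa>: "\<kappa> = k ^ 2" unfolding \<kappa>_def k_def by simp
      have E1: "E = P" unfolding E_def P_def using True G(1) by simp
      show ?thesis unfolding EJ unfolding p y \<kappa> E1 by (simp add: poly_simps)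
    next
      case False
      then obtain n where n: "n \<in> ?MM" "n \<noteq> m" using m by blast
      have "len C n \<le> (\<Sum>n\<in>?MM - {m}. len C n)" using n fin by (intro member_le_sum) auto
      hence ln: "len C n = 1" using G(4) len_max_pos[OF C n(1)] by linarith
      have "?MM - {m} = {n}"
      proof (rule ccontr)
        assume "?MM - {m} \<noteq> {n}"
        then obtain n' where n': "n' \<in> ?MM" "n' \<noteq> m" "n' \<noteq> n" using n by blast
        have "(\<Sum>i\<in>{n, n'}. len C i) \<le> (\<Sum>i\<in>?MM - {m}. len C i)" using n n' fin by (intro sum_mono2) auto
        thus False using G(4) ln len_max_pos[OF C n'(1)] n'(3) by auto
      qed
      hence MM: "?MM = {m, n}" using m by blast
      have "(of_nat q ^ 3 * (\<Prod>n\<in>?MM. 1 - 1 / of_nat q ^ len C n) :: rat) = (of_nat q ^ 2 - of_nat q) * (of_nat q - 1)"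
        using q1 G(1) ln n(2) by (simp add: MM field_simps power2_eq_square power3_eq_cube)
      hence "(of_nat (kap C) :: rat) = of_nat q ^ 2 - of_nat q" using kap q1 by simp
      hence "(of_nat (kap C + q) :: rat) = of_nat (q ^ 2)" by simp
      hence "kap C + q = q ^ 2" by (simp only: of_nat_eq_iff)
      hence "(of_nat (kap C) :: rat fps) + of_nat q = of_nat q ^ 2" by (metis of_nat_add of_nat_power)
      hence \<kappa>: "\<kappa> = k ^ 2 - k" unfolding \<kappa>_def k_def by (simp add: algebra_simps)
      have E1: "E = P * P" unfolding E_def P_def MM using G(1) ln n(2) by simp
      have "gor ?C"
      proof (rule ccontr)
        assume "\<not> gor ?C"
        then obtain D where D: "order D" "?C = thin D" using not_gor_thin[OF N(1)] by blast
        show False using gor_thin_structure(2)[OF C g m ninv D] False by blast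
      qed
      hence JL': "J ?C = L ?C" using good[OF N(1,3)] unfolding good_def by blast
      show ?thesis unfolding EJ unfolding p y \<kappa> E1 JL' P_def by (simp add: poly_simps)
    qed
  qed
  have "1 - P * \<kappa> * X ^ 2 * p + P * (k * X ^ 2) * y - P * (c - 1) * (k * X ^ 2) * JC + P * (c - 1) * X * JC
    - P * (k * X) * (1 - k * X) * JC - P * (JC - k * X * JC)
    = (1 + P * (k * X ^ 2) * y + P * \<kappa> * X ^ 2 * (JC - p)) - E * JC"
    unfolding E by (simp add: algebra_simps power2_eq_square)
  thus ?thesis unfolding balanced_def JL[symmetric] defs[symmetric] using key by simp
qed

text \<open>The ideals in question are the lines of \<open>qD\<close> modulo \<open>q(\<int>\<^sub>q + qD)\<close>.\<close>

lemma KK_thin_count: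
  assumes D: "order D"
  shows "card (KK (thin D)) = q + 1" "kap (thin D) = q ^ 2"
proof -
  let ?C = "thin D" and ?m = "(*) Q ` D"
  note t = thin_facts[OF D]
  have m: "?m \<in> Specm ?C" using thin_max(1)[OF D] by simp
  have lQ: "lat ((*) Q ` ?C)" "lat ?m" using lat_Q ordD(1) t(1) D by blast+
  have sub: "(*) Q ` ?C \<subseteq> ?m" using image_mono[OF t(5)] .
  have tQ: "tl ?C ((*) Q ` ?C)" using tl_Q[OF ordD(5)[OF t(1)]] .
  have "KK ?C = lines ((*) Q ` ?C) ?m"
  proof (intro equalityI subsetI)
    fix K assume K: "K \<in> KK ?C"
    note f = KK_facts[OF t(1) K]
    have "K \<subset> ?C" using f(3,4) ordD(2)[OF t(1)] by blast
    then obtain n where "n \<in> Specm ?C" "K \<subseteq> n" by (rule max_exists[OF t(1) tlD(2)[OF f(1)]])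
    hence "K \<subseteq> ?m" using thin_max(1)[OF D] by simp
    thus "K \<in> lines ((*) Q ` ?C) ?m" unfolding lines_def using tlD(1)[OF f(1)] f(2) K unfolding KK_def by blast
  next
    fix K assume "K \<in> lines ((*) Q ` ?C) ?m"
    hence K: "lat K" "(*) Q ` ?C \<subseteq> K" "K \<subseteq> ?m" "len K ((*) Q ` ?C) = 1" unfolding lines_def by auto
    have "?m \<subseteq> colon ((*) Q ` ?C) ?m"
    proof (intro subsetI colonI)
      fix x y assume "x \<in> ?m" "y \<in> ?m"
      then obtain a b where ab: "x = Q * a" "y = Q * b" "a \<in> D" "b \<in> D" by blast
      have "Q * (a * b) \<in> ?C" using ordD(3)[OF D ab(3,4)] t(4) by blast
      hence "Q * (Q * (a * b)) \<in> (*) Q ` ?C" by blast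
      thus "x * y \<in> (*) Q ` ?C" by (simp add: ab mult_ac)
    qed
    hence "K \<subseteq> colon ((*) Q ` ?C) ?m" using K(3) by blast
    hence "tl ?C K" using tl_if_killed[OF t(1) m t(2) tQ K(1,2)] by blast
    thus "K \<in> KK ?C" unfolding KK_def using K t(4) by blast
  qed
  moreover have "(*) Q ` ?m \<subseteq> (*) Q ` ?C" using image_mono[OF t(4)] .
  moreover have "len ?m ((*) Q ` ?C) = 2"
    using len_scale[OF ordD(1)[OF D] ordD(1)[OF t(1)] t(5) Q_r(1)] t(3) by simp
  ultimately show "card (KK ?C) = q + 1" using card_lines[OF lQ sub] by (simp add: gauss_simps)
  have q1: "(of_nat q :: rat) > 1" using q_gt1 by simp
  have pr: "(\<Prod>n\<in>Specm ?C. 1 - 1 / of_nat q ^ len ?C n :: rat) = 1 - 1 / of_nat q"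
    unfolding thin_max(1)[OF D] using t(2) by simp
  have "(of_nat q ^ 3 * (\<Prod>n\<in>Specm ?C. 1 - 1 / of_nat q ^ len ?C n) :: rat) = of_nat q ^ 2 * (of_nat q - 1)"
    unfolding pr using q1 by (simp add: field_simps power2_eq_square power3_eq_cube)
  hence "(of_nat (kap ?C) :: rat) = of_nat q ^ 2" using kap_formula[OF t(1)] q1 by simp
  thus "kap ?C = q ^ 2" by (metis of_nat_eq_iff of_nat_power)
qed

lemma thin_cyc:
  assumes D: "order D" and N: "N \<in> LT (thin D)"
  shows "cyc (thin D) N \<longleftrightarrow> len (up D N) N = 2"
proof
  let ?C = "thin D"
  note t = thin_facts[OF D]
  note f = up_lo[OF D LTD(1)[OF N]]
  {
    assume "cyc ?C N"
    then obtain x where x: "N = (*) x ` ?C" unfolding cyc_def by blast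
    obtain y where y: "x * y = 1" using cyclic_gen_unit[OF t(1) LTD(1)[OF N] x] .
    have "up D N = (*) x ` D" unfolding x up_scale[OF y] thin_self(2)[OF D] ..
    thus "len (up D N) N = 2" using len_scale[OF ordD(1)[OF D] ordD(1)[OF t(1)] t(5) y] t(3) x by simp
  next
    assume a: "len (up D N) N = 2"
    have m: "Specm ?C = {(*) Q ` D}" using thin_max(1)[OF D] .
    have "len N ((*) Q ` up D N) = 1" using up_lo_len(1)[OF D LTD(1)[OF N]] a by simp
    thus "cyc ?C N"
      using m f(6) t(2) by (intro cyc_if_small[OF t(1) LTD(1)[OF N]]) simp
  }
qed

lemma KO_thin:
  assumes D: "order D"
  shows "bij_betw (\<lambda>K. (*) Q ` line K 1) (KK D) (KO (thin D))"
proof (rule bij_betw_byWitness[where f' = "\<lambda>K. colon ((*) r ` K) D"])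
  let ?C = "thin D"
  note t = thin_facts[OF D]
  show "\<forall>K\<in>KK D. colon ((*) r ` (*) Q ` line K 1) D = K" using KK_facts(12)[OF D] r_Q_image(1) by simp
  show "(\<lambda>K. (*) Q ` line K 1) ` KK D \<subseteq> KO ?C"
  proof
    fix K assume "K \<in> (\<lambda>K. (*) Q ` line K 1) ` KK D"
    then obtain K' where K': "K' \<in> KK D" "K = (*) Q ` line K' 1" by blast
    note f = KK_facts[OF D K'(1)]
    have rK: "(*) r ` K = line K' 1" unfolding K'(2) r_Q_image ..
    have "tl ?C K" unfolding K'(2) using tl_Q[OF tl_mono[OF ordD(5)[OF f(5)] f(10)]] .
    moreover have "(*) Q ` ?C \<subseteq> K" unfolding K'(2) using image_mono[OF f(10)] .
    moreover have "K \<subseteq> ?C" unfolding K'(2) using image_mono[OF f(7), of "(*) Q"] t(4) by blast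
    moreover have "len K ((*) Q ` ?C) = 1"
      unfolding K'(2) using len_scale[OF ordD(1)[OF f(5)] ordD(1)[OF t(1)] f(10) Q_r(1)] f(11) by simp
    ultimately show "K \<in> KO ?C" unfolding KO_def KK_def using rK f(5) by simp
  qed
  have main: "colon ((*) r ` K) D \<in> KK D \<and> line (colon ((*) r ` K) D) 1 = (*) r ` K" if K: "K \<in> KO ?C" for K
  proof -
    let ?N = "(*) r ` K"
    have K': "K \<in> KK ?C" "order ?N" using K unfolding KO_def by auto
    note f = KK_facts[OF t(1) K'(1)]
    have "K \<subset> ?C" using f(3,4) ordD(2)[OF t(1)] by blast
    then obtain n where "n \<in> Specm ?C" "K \<subseteq> n" by (rule max_exists[OF t(1) tlD(2)[OF f(1)]])
    hence Km: "K \<subseteq> (*) Q ` D" using thin_max(1)[OF D] by simp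
    have ND: "?N \<subseteq> D" using image_mono[OF Km, of "(*) r"] unfolding r_Q_image .
    have CN: "?C \<subseteq> ?N" using image_mono[OF f(2), of "(*) r"] unfolding r_Q_image .
    have "len K ((*) Q ` ?C) = 1" using K'(1) unfolding KK_def by simp
    hence "len ?N ?C = 1"
      using len_scale[OF tlD(1)[OF f(1)] lat_Q[OF ordD(1)[OF t(1)]] f(2) Q_r(2)] unfolding r_Q_image by simp
    hence "len D ?N = 1"
      using len_add[OF ordD(1)[OF D] ordD(1)[OF K'(2)] ordD(1)[OF t(1)] CN ND] t(3) by simp
    thus ?thesis using index_one_order[OF D K'(2) CN ND] by blast
  qed
  show "\<forall>K\<in>KO ?C. (*) Q ` line (colon ((*) r ` K) D) 1 = K"
  proof
    fix K assume K: "K \<in> KO ?C"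
    have "(*) Q ` line (colon ((*) r ` K) D) 1 = (*) Q ` (*) r ` K" by (rule arg_cong[OF conjunct2[OF main[OF K]]])
    thus "(*) Q ` line (colon ((*) r ` K) D) 1 = K" unfolding r_Q_image .
  qed
  show "(\<lambda>K. colon ((*) r ` K) D) ` KO ?C \<subseteq> KK D" using main by blast
qed

text \<open>
  By \<open>KO_thin\<close> the series \<open>Y\<close> of \<open>\<int>\<^sub>q + qD\<close> is a sum over \<open>KK D\<close>. The relation then combines \<open>J_thin\<close> and
  \<open>L_thin\<close> for \<open>D\<close>, the corrected identity for \<open>\<int>\<^sub>q + qD\<close>, and \<open>d4\<close>: either \<open>L\<^sub>D = J\<^sub>D\<close>, or \<open>KK D\<close> has \<open>q + 1\<close>
  elements.
\<close>

lemma balanced_thin: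
  assumes D: "order D" and good: "\<And>S. order S \<Longrightarrow> thin D \<subseteq> S \<Longrightarrow> good S"
  shows "balanced (thin D)"
proof -
  let ?C = "thin D"
  note t = thin_facts[OF D]
  define X where "X = (fps_X :: rat fps)"
  define k where "k = (of_nat q :: rat fps)"
  define c where "c = (of_nat (card (KK D)) :: rat fps)"
  define sJ sL where "sJ = (\<Sum>K\<in>KK D. J (line K 1))" and "sL = (\<Sum>K\<in>KK D. L (line K 1))"
  define JC LC JD LD B P where "JC = J ?C" and "LC = L ?C" and "JD = J D" and "LD = L D" and "B = Bet D" and "P = 1 - X"
  note defs = X_def k_def c_def sJ_def sL_def JC_def LC_def JD_def LD_def B_def P_def
  have a: "Alo D = B + X * sJ - c * (X ^ 2 * JD)"
    using Alo_eq[OF D] unfolding defs by (simp add: algebra_simps)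
  have d1: "P * JC - (1 + P * (k * X) * (X ^ 2 * JD + Alo D + k * (1 - k * X) * (X ^ 2 * JD))) = 0"
    using J_thin[OF D] unfolding defs by simp
  have d2: "P * (LC + c * (k * X ^ 2) ^ 2 * LD) - ((1 + k * X) + P * (k * X ^ 2 * sL + (k * X ^ 2) ^ 2 * LD)) = 0"
    using L_thin[OF D] unfolding defs by simp
  have d3: "LC - (JC + k * X ^ 2 * (LD - k * X * JD)) = 0"
    using good[OF t(1) order_refl] D unfolding good_def defs by auto
  have d4: "(c - 1 - k) * (LD - JD) = 0"
  proof (cases "gor D")
    case True
    hence "JD = LD" using good[OF D t(5)] unfolding good_def defs by blast
    thus ?thesis by simp
  next
    case False
    then obtain W where W: "order W" "D = thin W" using not_gor_thin[OF D] by blast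
    have "c = 1 + k" unfolding c_def k_def using KK_thin_count(1)[OF W(1)] W(2) by simp
    thus ?thesis by simp
  qed
  have p: "pser ?C = B"
  proof -
    have "{N \<in> LT ?C. cyc ?C N} = {N \<in> LT ?C. len (up D N) N = 2}" using thin_cyc[OF D] by blast
    thus ?thesis unfolding pser_def B_def Bet_def by simp
  qed
  have y: "Y ?C = sL - k * X * sJ"
  proof -
    have "Y ?C = (\<Sum>K\<in>KK D. L ((*) r ` (*) Q ` line K 1) - of_nat q * fps_X * J ((*) r ` (*) Q ` line K 1))"
      unfolding Y_def by (rule sum.reindex_bij_betw[OF KO_thin[OF D], symmetric])
    thus ?thesis unfolding r_Q_image sum_subtractf sum_distrib_left[symmetric] defs .
  qed
  have cC: "of_nat (card (KK ?C)) - 1 = k" and kC: "of_nat (kap ?C) = k ^ 2"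
    unfolding k_def KK_thin_count[OF D] by simp_all
  have "1 - P * k ^ 2 * X ^ 2 * B + P * (k * X ^ 2) * (sL - k * X * sJ) - P * k * (k * X ^ 2) * LC + P * k * X * JC
    - P * (k * X) * (1 - k * X) * JC - P * (LC - k * X * JC)
    = k * X * (P * JC - (1 + P * (k * X) * (X ^ 2 * JD + Alo D + k * (1 - k * X) * (X ^ 2 * JD))))
    - (P * (LC + c * (k * X ^ 2) ^ 2 * LD) - ((1 + k * X) + P * (k * X ^ 2 * sL + (k * X ^ 2) ^ 2 * LD)))
    - P * k ^ 2 * X ^ 2 * (LC - (JC + k * X ^ 2 * (LD - k * X * JD)))
    + P * k ^ 2 * X ^ 4 * ((c - 1 - k) * (LD - JD))"
    unfolding a by (simp add: poly_simps power4_eq_xxxx)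
  also have "\<dots> = 0" unfolding d1 d2 d3 d4 by simp
  finally show ?thesis unfolding balanced_def p y cC kC unfolding defs by (simp only: right_minus_eq)
qed

section \<open>The formula for Gorenstein orders\<close>

text \<open>All results above relate an order to strictly larger ones, which have fewer overorders.\<close>

lemma good_order: "order T \<Longrightarrow> good T"
proof (induction "card (OV T)" arbitrary: T rule: less_induct)
  case less
  note T = less(2)
  have IH: "good S" if S: "order S" "T \<subseteq> S" "S \<noteq> T" for S
  proof (rule less(1)[OF _ S(1)])
    have "OV S \<subseteq> OV T" unfolding OV_def using S(2) by blast
    moreover have "T \<in> OV T" "T \<notin> OV S" unfolding OV_def using T S(2,3) by auto
    ultimately show "card (OV S) < card (OV T)" using psubset_card_mono[OF finite_OV[OF T]] by blast
  qed
  show ?case unfolding good_def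
  proof (intro conjI impI allI)
    assume g: "gor T"
    show "J T = L T"
    proof (cases "\<forall>m\<in>Specm T. invertible T m")
      case True
      thus ?thesis using all_invertible(3,4)[OF T] by simp
    next
      case False
      then obtain m where m: "m \<in> Specm T" and ninv: "\<not> invertible T m" by blast
      note C = ninv_order[OF T m ninv] and G = gor_ninv[OF T g m ninv]
      let ?C = "colon T m"
      have nC: "?C \<noteq> T" using G(2) ordD(1)[OF T] by auto
      note LT' = L_gor[OF T g m ninv]
      show ?thesis
      proof (cases "gor ?C")
        case True
        thus ?thesis using J_gor_gor[OF T g m ninv True] LT' IH[OF C(1,3) nC] unfolding good_def by simp
      next
        case False
        then obtain D where D: "order D" "?C = thin D" using not_gor_thin[OF C(1)] by blast
        note S = gor_thin_structure[OF T g m ninv D]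
        have TD: "T \<subseteq> D" using C(3) D(2) thin_facts(5)[OF D(1)] by blast
        have "D \<noteq> T"
        proof
          assume "D = T"
          hence "?C = T" using C(3) D(2) thin_facts(5)[OF D(1)] by blast
          thus False using nC by blast
        qed
        hence JD: "J D = L D" using IH[OF D(1) TD] S(1) unfolding good_def by blast
        have "L ?C = J ?C + of_nat q * fps_X ^ 2 * (L D - of_nat q * fps_X * J D)"
          using IH[OF C(1,3) nC] D unfolding good_def by blast
        hence LC: "L ?C = J (thin D) + of_nat q * fps_X ^ 2 * (1 - of_nat q * fps_X) * J D"
          unfolding JD D(2) by (simp add: algebra_simps)
        have z: "(1 - fps_X) * zeta T = 1" using zeta_local[OF T S(2) G(1)] .
        have "(1 - fps_X) * J T = 1 + (1 - fps_X) * (of_nat q * fps_X ^ 2) * L ?C"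
          unfolding LC using J_gor_thin[OF T g m ninv D] .
        also have "\<dots> = (1 - fps_X) * L T" unfolding LT' distrib_left z by (simp add: mult.assoc)
        finally show ?thesis by (rule one_X_cancel)
      qed
    qed
  next
    fix C assume "order C \<and> T = thin C"
    hence C: "order C" and e: "T = thin C" by auto
    note t = thin_facts[OF C]
    have nC: "C \<noteq> T" using t(3) e ordD(1)[OF C] by auto
    have up: "good S" if S: "order S" "C \<subseteq> S" for S
    proof (rule IH[OF S(1)])
      show "T \<subseteq> S" using t(5) e S(2) by blast
      show "S \<noteq> T" using t(5) e S(2) nC by blast
    qed
    have goodK: "good (line K 1)" if K: "K \<in> KK C" for K
    proof (rule IH)
      note f = KK_facts[OF C K]
      show "order (line K 1)" "T \<subseteq> line K 1" using f(5,10) e by auto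
      show "line K 1 \<noteq> T" using f(11) e ordD(1)[OF t(1)] by auto
    qed
    have "balanced C"
    proof (cases "gor C")
      case True
      show ?thesis by (rule balanced_gor[OF C True up])
    next
      case False
      then obtain D where D: "order D" "C = thin D" using not_gor_thin[OF C] by blast
      show ?thesis unfolding D(2) by (rule balanced_thin[OF D(1)]) (use up D(2) in blast)
    qed
    thus "L T = J T + of_nat q * fps_X ^ 2 * (L C - of_nat q * fps_X * J C)"
      unfolding e using thin_step[OF C goodK] by blast
  qed
qed

theorem J_eq_L: "order T \<Longrightarrow> gor T \<Longrightarrow> J T = L T"
  using good_order unfolding good_def by blast

end

section \<open>Divisibility in the \<open>q\<close>-adic integers\<close>

lemma padic_eqI: "(\<And>n. padic_res x n = padic_res y n) \<Longrightarrow> x = y"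
  using padic_res_inject by blast

lemma padic_res_of_nat:
  "padic_res (of_nat i :: 'q :: prime_card padic_int) n = int i mod int CARD('q) ^ n"
  by (induction i) (auto simp: zero_padic_int.rep_eq plus_padic_int.rep_eq one_padic_int.rep_eq mod_simps)

lemma padic_q_dvd:
  fixes x :: "'q :: prime_card padic_int"
  assumes "padic_res x 1 = 0"
  obtains y where "x = of_nat CARD('q) * y" "\<And>n. padic_res x (Suc n) = int CARD('q) * padic_res y n"
proof -
  let ?q = "int CARD('q)"
  have q0: "?q > 0" by (rule card_prime_pos)
  have dv: "?q dvd padic_res x (Suc n)" for n
    using padic_res_mod[of x 1 n] assms by (simp add: dvd_eq_mod_eq_0)
  let ?y = "\<lambda>n. padic_res x (Suc n) div ?q"
  have "0 \<le> ?y n \<and> ?y n < ?q ^ n \<and> ?y (Suc n) mod ?q ^ n = ?y n" for n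
  proof (intro conjI)
    show "0 \<le> ?y n" using padic_res_nonneg[of x "Suc n"] q0 by (simp add: pos_imp_zdiv_nonneg_iff)
    have "?q * ?y n < ?q * ?q ^ n" using padic_res_less[of x "Suc n"] dv[of n] by simp
    thus "?y n < ?q ^ n" using q0 by simp
    have "padic_res x (Suc (Suc n)) mod (?q * ?q ^ n) = padic_res x (Suc n)"
      using padic_res_mod[of x "Suc n" 1] by simp
    hence "?q * (?y (Suc n) mod ?q ^ n) = padic_res x (Suc n)"
      using zmod_zmult2_eq[of "?q ^ n" "padic_res x (Suc (Suc n))" ?q] dv[of "Suc n"] q0
      by (simp add: dvd_eq_mod_eq_0)
    thus "?y (Suc n) mod ?q ^ n = ?y n" using q0 by (metis nonzero_mult_div_cancel_left less_irrefl)
  qed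
  hence r: "padic_res (Abs_padic_int ?y :: 'q padic_int) = ?y"
    by (intro Abs_padic_int_inverse) blast
  define y where "y = (Abs_padic_int ?y :: 'q padic_int)"
  have e: "padic_res x (Suc n) = ?q * padic_res y n" for n
    unfolding y_def r using dv[of n] by simp
  have "x = of_nat CARD('q) * y"
  proof (rule padic_eqI)
    fix n
    have "padic_res x n = padic_res x (Suc n) mod ?q ^ n" using padic_res_mod[of x n 1] by simp
    thus "padic_res x n = padic_res (of_nat CARD('q) * y) n"
      unfolding times_padic_int.rep_eq padic_res_of_nat e by (simp add: mod_simps)
  qed
  with e show ?thesis by (rule that[rotated])
qed

text \<open>The inverse modulo \<open>q^n\<close> is unique and hence compatible with reduction.\<close>

lemma padic_unit:
  fixes x :: "'q :: prime_card padic_int"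
  assumes "padic_res x 1 \<noteq> 0"
  shows "x dvd 1"
proof -
  let ?q = "int CARD('q)"
  have q0: "?q > 0" by (rule card_prime_pos)
  have cop: "coprime (padic_res x n) (?q ^ n)" for n
  proof (cases n)
    case (Suc m)
    have "\<not> ?q dvd padic_res x n" using padic_res_mod[of x 1 m] assms Suc by (simp add: dvd_eq_mod_eq_0)
    thus ?thesis using prime_imp_coprime[OF prime_card_int] coprime_commute coprime_power_right_iff by blast
  qed simp
  have "\<exists>b. 0 \<le> b \<and> b < ?q ^ n \<and> padic_res x n * b mod ?q ^ n = 1 mod ?q ^ n" for n
  proof -
    obtain b where "[padic_res x n * b = 1] (mod ?q ^ n)" using cong_solve_coprime_int[OF cop] by blast
    hence "padic_res x n * (b mod ?q ^ n) mod ?q ^ n = 1 mod ?q ^ n" by (simp add: cong_def mod_simps)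
    thus ?thesis using q0 by (intro exI[of _ "b mod ?q ^ n"]) auto
  qed
  then obtain b where b: "\<And>n. 0 \<le> b n" "\<And>n. b n < ?q ^ n"
    "\<And>n. padic_res x n * b n mod ?q ^ n = 1 mod ?q ^ n" by metis
  have "b (Suc n) mod ?q ^ n = b n" for n
  proof -
    have "padic_res x n * b (Suc n) mod ?q ^ n = (padic_res x (Suc n) * b (Suc n) mod ?q ^ Suc n) mod ?q ^ n"
      using padic_res_mod[of x n 1] by (simp add: mod_mod_cancel) (metis mod_mult_left_eq)
    also have "\<dots> = 1 mod ?q ^ n" unfolding b(3) by (rule padic_mod_Suc)
    finally have "[padic_res x n * b (Suc n) = padic_res x n * b n] (mod ?q ^ n)" using b(3)[of n] by (simp add: cong_def)
    hence "[b (Suc n) = b n] (mod ?q ^ n)" using cong_mult_lcancel[OF cop] by blast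
    thus ?thesis using b(1,2)[of n] by (simp add: cong_def)
  qed
  hence r: "padic_res (Abs_padic_int b :: 'q padic_int) = b"
    using b by (intro Abs_padic_int_inverse) blast
  have "1 = x * Abs_padic_int b"
    by (rule padic_eqI) (simp add: times_padic_int.rep_eq one_padic_int.rep_eq r b(3))
  thus ?thesis by (rule dvdI)
qed

lemma padic_factor:
  fixes x :: "'q :: prime_card padic_int"
  assumes "x \<noteq> 0"
  obtains k u where "x = of_nat CARD('q) ^ k * u" "u dvd 1"
proof -
  have "\<exists>k u. x = of_nat CARD('q) ^ k * u \<and> u dvd 1" if "padic_res x n \<noteq> 0" for n and x :: "'q padic_int"
    using that
  proof (induction n arbitrary: x)
    case 0
    thus ?case using padic_res_nonneg[of x 0] padic_res_less[of x 0] by simp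
  next
    case (Suc n)
    show ?case
    proof (cases "padic_res x 1 = 0")
      case True
      from padic_q_dvd[OF this] obtain y where y: "x = of_nat CARD('q) * y"
        "\<And>n. padic_res x (Suc n) = int CARD('q) * padic_res y n" by metis
      hence "padic_res y n \<noteq> 0" using Suc(2) by auto
      then obtain k u where u: "y = of_nat CARD('q) ^ k * u" "u dvd 1" using Suc(1) by blast
      have "x = of_nat CARD('q) ^ Suc k * u" unfolding y(1) u(1) by (simp add: mult.assoc)
      thus ?thesis using u(2) by blast
    next
      case False
      thus ?thesis using padic_unit by (intro exI[of _ 0] exI[of _ x]) auto
    qed
  qed
  moreover obtain n where "padic_res x n \<noteq> 0"
    using assms padic_eqI[of x 0] by (auto simp: zero_padic_int.rep_eq)
  ultimately show ?thesis using that by blast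
qed

lemma padic_dvd_linear: "a dvd b \<or> b dvd (a :: 'q :: prime_card padic_int)"
proof (cases "a = 0 \<or> b = 0")
  case False
  then obtain k u l v where a: "a = of_nat CARD('q) ^ k * u" "u dvd 1"
    and b: "b = of_nat CARD('q) ^ l * v" "v dvd 1" by (metis padic_factor)
  have "k \<le> l \<Longrightarrow> a dvd b" "l \<le> k \<Longrightarrow> b dvd a"
    unfolding a(1) b(1) using a(2) b(2) by (simp_all add: le_imp_power_dvd mult_dvd_mono dvd_trans[OF _ one_dvd])
  thus ?thesis by linarith
qed auto

lemma padic_residue:
  obtains i w where "i < CARD('q)" "z = of_nat i + of_nat CARD('q) * (w :: 'q :: prime_card padic_int)"
proof -
  define i where "i = nat (padic_res z 1)"
  have i: "int i = padic_res z 1" "i < CARD('q)"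
    using padic_res_nonneg[of z 1] padic_res_less[of z 1] unfolding i_def by auto
  have "padic_res (z - of_nat i) 1 = 0"
    using i by (simp add: minus_padic_int.rep_eq padic_res_of_nat)
  from padic_q_dvd[OF this] obtain w where "z - of_nat i = of_nat CARD('q) * w" by metis
  hence "z = of_nat i + of_nat CARD('q) * w" by (simp add: algebra_simps)
  with i(2) show ?thesis by (rule that)
qed

lemma padic_res_q_mult: "padic_res (of_nat CARD('q) * (w :: 'q :: prime_card padic_int)) 1 = 0"
  by (simp add: times_padic_int.rep_eq padic_res_of_nat)

lemma padic_residue_unique:
  assumes "of_nat i - of_nat j = of_nat CARD('q) * (w :: 'q :: prime_card padic_int)"
    and "i < CARD('q)" "j < CARD('q)"
  shows "i = j"
proof -
  have "of_nat i = of_nat j + of_nat CARD('q) * w" using assms(1) by (simp add: algebra_simps)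
  hence "padic_res (of_nat i :: 'q padic_int) 1 = padic_res (of_nat j + of_nat CARD('q) * w) 1" by simp
  hence "int i = int j"
    using assms(2,3) padic_res_q_mult[of w] by (simp add: plus_padic_int.rep_eq padic_res_of_nat)
  thus ?thesis by simp
qed

lemma padic_one_minus_q_unit: "1 - of_nat CARD('q) * (w :: 'q :: prime_card padic_int) dvd 1"
proof (rule padic_unit)
  have "int CARD('q) > 1" using prime_gt_1_nat[OF prime_card[where 'a = 'q]] by simp
  thus "padic_res (1 - of_nat CARD('q) * w) 1 \<noteq> 0"
    using padic_res_q_mult[of w] by (simp add: minus_padic_int.rep_eq one_padic_int.rep_eq)
qed

lemma padic_of_nat_nonzero:
  assumes "n \<noteq> 0" shows "(of_nat n :: 'q :: prime_card padic_int) \<noteq> 0"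
proof
  assume 0: "(of_nat n :: 'q padic_int) = 0"
  have "n < CARD('q) ^ n" using prime_gt_1_nat[OF prime_card[where 'a = 'q]] by (intro power_gt_expt) simp
  hence "int n < int CARD('q) ^ n" by (metis of_nat_less_iff of_nat_power)
  thus False using padic_res_of_nat[of n n, where 'q = 'q] 0 assms by (simp add: zero_padic_int.rep_eq)
qed

section \<open>Bases of the cubic algebra over the \<open>q\<close>-adic integers\<close>

lemma padic_fraction_clear:
  obtains k where "\<And>j. j \<ge> k \<Longrightarrow> of_nat CARD('q) ^ j * (c :: 'q :: prime_card padic) \<in> range to_fract"
proof -
  obtain a b where c: "c = Fract a b" "b \<noteq> 0" by (rule Fract_cases)
  obtain k u v where b: "b = of_nat CARD('q) ^ k * u" "1 = u * v"
    using padic_factor[OF c(2)] by (metis dvdE)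
  have n: "to_fract (of_nat n :: 'q padic_int) = of_nat n" for n by (induction n) auto
  have p: "to_fract (x ^ j) = to_fract x ^ j" for x :: "'q padic_int" and j by (induction j) auto
  have "of_nat CARD('q) ^ j * c = to_fract (of_nat CARD('q) ^ (j - k) * a * v)" if "j \<ge> k" for j
  proof -
    have "to_fract b * (of_nat CARD('q) ^ j * c) = of_nat CARD('q) ^ j * to_fract a"
      using c by (simp add: Fract_conv_to_fract)
    also have "\<dots> = to_fract (of_nat CARD('q) ^ j * a * (u * v))" by (simp add: p n flip: b(2))
    also have "of_nat CARD('q) ^ j * a * (u * v) = b * (of_nat CARD('q) ^ (j - k) * a * v)"
      unfolding b(1) using that by (metis (no_types, lifting) le_add_diff_inverse mult.assoc mult.left_commute power_add)
    finally show ?thesis using c(2) by (metis mult_left_cancel to_fract_eq_0_iff to_fract_mult)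
  qed
  thus ?thesis using that by blast
qed

locale etale_cubic =
  fixes scl :: "'q :: prime_card padic \<Rightarrow> 'e :: comm_ring_1 \<Rightarrow> 'e"
  assumes etale: "etale_cubic_algebra scl"
begin

sublocale V: vector_space scl
  using etale unfolding etale_cubic_algebra_def by blast

sublocale Z: Modules.module "zscl scl"
  by unfold_locales
    (simp_all add: zscl_def V.scale_right_distrib V.scale_left_distrib)

lemma scl_mult: "scl c x * y = scl c (x * y)" "x * scl c y = scl c (x * y)"
proof -
  have "\<forall>c x y. scl c (x * y) = scl c x * y" using etale unfolding etale_cubic_algebra_def by blast
  thus "scl c x * y = scl c (x * y)" "x * scl c y = scl c (x * y)" by (metis mult.commute)+
qed

lemma zscl_mult: "zscl scl a x * y = zscl scl a (x * y)" "x * zscl scl a y = zscl scl a (x * y)"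
  unfolding zscl_def by (rule scl_mult)+

lemma scl_of_nat: "scl (of_nat n) x = of_nat n * x"
  by (induction n) (auto simp: V.scale_left_distrib algebra_simps)

lemma scl_of_nat_power: "scl (of_nat n ^ k) x = of_nat n ^ k * x"
  using scl_of_nat[of "n ^ k" x] by simp

lemma zscl_of_nat: "zscl scl (of_nat n) x = of_nat n * x"
  by (induction n) (auto simp: Z.scale_left_distrib algebra_simps)

lemma zscl_of_nat_power: "zscl scl (of_nat n ^ k) x = of_nat n ^ k * x"
  using zscl_of_nat[of "n ^ k" x] by simp

lemma zscl_cancel: "a \<noteq> 0 \<Longrightarrow> zscl scl a x = 0 \<Longrightarrow> x = 0"
  unfolding zscl_def by (simp add: V.scale_eq_0_iff)

lemma of_nat_nonzero: "n \<noteq> 0 \<Longrightarrow> (of_nat n :: 'q padic) \<noteq> 0"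
proof -
  have "to_fract (of_nat n :: 'q padic_int) = of_nat n" by (induction n) auto
  thus "n \<noteq> 0 \<Longrightarrow> (of_nat n :: 'q padic) \<noteq> 0"
    using padic_of_nat_nonzero[of n, where 'q = 'q] by (metis to_fract_eq_0_iff)
qed

lemma q_invertible: "\<exists>r. of_nat CARD('q) * r = (1 :: 'e)"
proof -
  have "of_nat CARD('q) * scl (inverse (of_nat CARD('q))) (1 :: 'e) = 1"
    using of_nat_nonzero[of "CARD('q)"] by (simp flip: scl_of_nat)
  thus ?thesis by blast
qed

definition Zs :: "'e set" where "Zs = range (\<lambda>a. zscl scl a 1)"

lemma submod_Zs_iff: "submodule_over Zs M \<longleftrightarrow> Z.subspace M"
proof
  assume "submodule_over Zs M"
  note M = submodD[OF this]
  have "zscl scl a x \<in> M" if "x \<in> M" for a x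
    using M(6)[of "zscl scl a 1" x] that by (simp add: Zs_def zscl_mult)
  thus "Z.subspace M" using M(2,5) by (intro Z.subspaceI)
next
  assume "Z.subspace M"
  thus "submodule_over Zs M"
    by (intro submodI) (auto simp: Zs_def Z.subspace_0 Z.subspace_diff Z.subspace_scale zscl_mult)
qed

definition base :: "'e set \<Rightarrow> bool" where
  "base B \<longleftrightarrow> finite B \<and> V.independent B \<and> V.span B = UNIV"

lemma base_exists: "\<exists>B. base B"
proof -
  obtain B where "V.independent B" "UNIV \<subseteq> V.span B" "card B = V.dim UNIV"
    by (rule V.basis_exists[of UNIV])
  moreover have "V.dim (UNIV :: 'e set) = 3" using etale unfolding etale_cubic_algebra_def by blast
  ultimately have "base B" unfolding base_def using card.infinite by fastforce
  thus ?thesis by blast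
qed

lemma base_findim: "base B \<Longrightarrow> finite_dimensional_vector_space scl B"
  unfolding base_def by unfold_locales auto

lemma base_iff_spanning: "base B \<longleftrightarrow> V.independent B \<and> V.span B = UNIV"
proof -
  obtain B0 where "base B0" using base_exists by blast
  then interpret F: finite_dimensional_vector_space scl B0 by (rule base_findim)
  have "V.independent B \<Longrightarrow> finite B" by (rule F.finiteI_independent)
  thus ?thesis unfolding base_def by (intro iffI conjI; elim conjE; assumption?; blast?)
qed

lemma base_iff_card: "base B \<longleftrightarrow> V.independent B \<and> card B = 3"
proof -
  have d: "V.dim (UNIV :: 'e set) = 3" using etale unfolding etale_cubic_algebra_def by blast
  obtain B0 where "base B0" using base_exists by blast
  then interpret F: finite_dimensional_vector_space scl B0 by (rule base_findim)
  have "V.independent B \<Longrightarrow> card B = 3 \<Longrightarrow> V.span B = UNIV"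
    by (intro top.extremum_uniqueI F.card_ge_dim_independent) (simp_all add: d del: F.dim_UNIV)
  moreover have "V.independent B \<Longrightarrow> V.span B = UNIV \<Longrightarrow> card B = 3"
    using V.dim_eq_card[of B UNIV] d by simp
  ultimately show ?thesis unfolding base_iff_spanning by (intro iffI conjI; elim conjE; assumption?; blast?)
qed

lemma base_expand: "base B \<Longrightarrow> (\<Sum>b\<in>B. scl (V.representation B x b) b) = x"
  unfolding base_def by (intro V.sum_representation_eq) auto

lemma base_representation_sum:
  assumes "base B" "b \<in> B"
  shows "V.representation B (\<Sum>v\<in>B. scl (c v) v) b = c b"
proof -
  have B: "V.independent B" "V.span B = UNIV" "finite B" using assms(1) unfolding base_def by auto
  have "V.representation B (\<Sum>v\<in>B. scl (c v) v) b = (\<Sum>v\<in>B. c v * (if b = v then 1 else 0))"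
    using B by (simp add: V.representation_sum V.representation_scale V.representation_basis)
  also have "\<dots> = c b" using B(3) assms(2) by (simp add: if_distrib cong: if_cong)
  finally show ?thesis .
qed

lemma mem_Z_span_iff:
  assumes "base B"
  shows "x \<in> Z.span B \<longleftrightarrow> (\<forall>b\<in>B. V.representation B x b \<in> range to_fract)"
proof
  have fin: "finite B" using assms unfolding base_def by blast
  assume "x \<in> Z.span B"
  then obtain u where "x = (\<Sum>v\<in>B. scl (to_fract (u v)) v)"
    using Z.span_finite[OF fin] by (auto simp: zscl_def)
  thus "\<forall>b\<in>B. V.representation B x b \<in> range to_fract"
    using base_representation_sum[OF assms, of _ "\<lambda>v. to_fract (u v)"] by simp
next
  assume "\<forall>b\<in>B. V.representation B x b \<in> range to_fract"
  hence "\<forall>b\<in>B. \<exists>a. V.representation B x b = to_fract a" by auto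
  then obtain u where u: "\<And>b. b \<in> B \<Longrightarrow> V.representation B x b = to_fract (u b)"
    using bchoice[of B "\<lambda>b a. V.representation B x b = to_fract a"] by auto
  have "x = (\<Sum>b\<in>B. zscl scl (u b) b)"
    using base_expand[OF assms, of x] u by (simp add: zscl_def)
  also have "\<dots> \<in> Z.span B" by (intro Z.span_sum Z.span_scale Z.span_base)
  finally show "x \<in> Z.span B" .
qed

lemma clear_denominators:
  assumes "finite S"
  obtains k where "\<And>v. v \<in> S \<Longrightarrow> of_nat CARD('q) ^ k * u v \<in> range (to_fract :: 'q padic_int \<Rightarrow> _)"
proof -
  have "\<exists>k. \<forall>j\<ge>k. of_nat CARD('q) ^ j * u v \<in> range (to_fract :: 'q padic_int \<Rightarrow> _)" for v
    using padic_fraction_clear[of "u v"] by metis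
  then obtain k where k: "\<And>v j. j \<ge> k v \<Longrightarrow> of_nat CARD('q) ^ j * u v \<in> range (to_fract :: 'q padic_int \<Rightarrow> _)" by metis
  show ?thesis by (rule that[of "\<Sum>v\<in>S. k v"], rule k, rule member_le_sum) (simp_all add: assms)
qed

lemma Z_independent_iff: "finite B \<Longrightarrow> Z.independent B \<longleftrightarrow> V.independent B"
proof (intro iffI notI)
  assume fin: "finite B" and i: "V.independent B" and "Z.dependent B"
  then obtain u v where "v \<in> B" "u v \<noteq> 0" "(\<Sum>v\<in>B. scl (to_fract (u v)) v) = 0"
    using Z.dependent_finite[OF fin] by (auto simp: zscl_def)
  thus False using V.independentD[OF i fin order_refl, of "\<lambda>v. to_fract (u v)"] by simp
next
  assume fin: "finite B" and i: "Z.independent B" and "V.dependent B"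
  then obtain u v where u: "v \<in> B" "u v \<noteq> 0" "(\<Sum>v\<in>B. scl (u v) v) = 0"
    using V.dependent_finite[OF fin] by auto
  obtain k where "\<And>v. v \<in> B \<Longrightarrow> of_nat CARD('q) ^ k * u v \<in> range (to_fract :: 'q padic_int \<Rightarrow> _)"
    using clear_denominators[OF fin, of u] by metis
  hence "\<forall>v\<in>B. \<exists>a. of_nat CARD('q) ^ k * u v = to_fract a" by auto
  then obtain w where w: "\<And>v. v \<in> B \<Longrightarrow> of_nat CARD('q) ^ k * u v = to_fract (w v)"
    using bchoice[of B "\<lambda>v a. of_nat CARD('q) ^ k * u v = to_fract a"] by auto
  have "(\<Sum>v\<in>B. zscl scl (w v) v) = scl (of_nat CARD('q) ^ k) (\<Sum>v\<in>B. scl (u v) v)"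
    unfolding V.scale_sum_right zscl_def by (intro sum.cong refl) (simp add: w[symmetric])
  hence "w v = 0" using Z.independentD[OF i fin order_refl _ u(1), of w] u(3) by simp
  thus False using w[OF u(1)] u(2) of_nat_nonzero[of "CARD('q)"] by simp
qed

lemma Z_absorb:
  assumes "base B" obtains k where "of_nat CARD('q) ^ k * x \<in> Z.span B"
proof -
  have fin: "finite B" and i: "V.independent B" "V.span B = UNIV" using assms unfolding base_def by auto
  obtain k where "\<And>v. v \<in> B \<Longrightarrow> of_nat CARD('q) ^ k * V.representation B x v \<in> range (to_fract :: 'q padic_int \<Rightarrow> _)"
    using clear_denominators[OF fin] by metis
  hence "scl (of_nat CARD('q) ^ k) x \<in> Z.span B"
    unfolding mem_Z_span_iff[OF assms] using i by (simp add: V.representation_scale)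
  thus ?thesis using that by (simp add: scl_of_nat_power)
qed

lemma Z_absorb_span:
  assumes M: "Z.subspace M" and "finite G" "\<And>x. x \<in> G \<Longrightarrow> \<exists>k. of_nat CARD('q) ^ k * x \<in> M"
  obtains k where "\<And>x. x \<in> Z.span G \<Longrightarrow> of_nat CARD('q) ^ k * x \<in> M"
proof -
  have "\<forall>x\<in>G. \<exists>k. of_nat CARD('q) ^ k * x \<in> M" using assms(3) by blast
  then obtain k where k: "\<And>x. x \<in> G \<Longrightarrow> of_nat CARD('q) ^ k x * x \<in> M"
    using bchoice[of G "\<lambda>x k. of_nat CARD('q) ^ k * x \<in> M"] by auto
  define K where "K = (\<Sum>x\<in>G. k x)"
  have G: "of_nat CARD('q) ^ K * x \<in> M" if "x \<in> G" for x
  proof -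
    have "of_nat CARD('q) ^ (K - k x) * (of_nat CARD('q) ^ k x * x) \<in> M"
      unfolding zscl_of_nat_power[symmetric, of _ "K - k x"] by (rule Z.subspace_scale[OF M k[OF that]])
    moreover have "k x \<le> K" unfolding K_def using that assms(2) by (intro member_le_sum) auto
    ultimately show ?thesis by (simp add: mult.assoc[symmetric] power_add[symmetric])
  qed
  have "Z.subspace {x. zscl scl (of_nat CARD('q) ^ K) x \<in> M}"
    using Z.subspace_0[OF M] Z.subspace_add[OF M] Z.subspace_scale[OF M]
    by (intro Z.subspaceI)
      (auto simp: Z.scale_right_distrib Z.scale_left_commute[of "of_nat CARD('q) ^ K"] simp del: Z.scale_scale)
  moreover have "G \<subseteq> {x. zscl scl (of_nat CARD('q) ^ K) x \<in> M}" using G by (auto simp: zscl_of_nat_power)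
  ultimately have "Z.span G \<subseteq> {x. zscl scl (of_nat CARD('q) ^ K) x \<in> M}" by (intro Z.span_minimal)
  thus ?thesis using that[of K] by (auto simp: zscl_of_nat_power)
qed

text \<open>
  The coefficients of a generator \<open>g\<close> in the elements of \<open>M\<close> form an ideal of \<open>\<int>\<^sub>q\<close>, which a power of \<open>q\<close>
  generates.
\<close>

lemma Z_finitely_generated:
  assumes "finite G" "Z.subspace M" "M \<subseteq> Z.span G"
  shows "\<exists>H. finite H \<and> Z.span H = M"
  using assms
proof (induction G arbitrary: M)
  case empty
  hence "M = {0}" using Z.subspace_0[of M] by auto
  thus ?case by (intro exI[of _ "{}"]) auto
next
  case (insert g G)
  have sM: "Z.subspace (M \<inter> Z.span G)" using insert(4) by (simp add: Z.subspace_inter)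
  obtain H where H: "finite H" "Z.span H = M \<inter> Z.span G" using insert(3)[OF sM] by blast
  define K where "K = {a. \<exists>m\<in>M. m - zscl scl a g \<in> Z.span G}"
  show ?case
  proof (cases "K \<subseteq> {0}")
    case True
    have "x \<in> Z.span G" if x: "x \<in> M" for x
    proof -
      obtain a where "x - zscl scl a g \<in> Z.span G"
        using x insert(5) Z.span_breakdown_eq[of x g G] by blast
      moreover hence "a = 0" using True x unfolding K_def by blast
      ultimately show ?thesis by simp
    qed
    hence "M \<inter> Z.span G = M" by blast
    thus ?thesis using H by metis
  next
    case False
    have K: "c * a \<in> K" if aK: "a \<in> K" for a c
    proof -
      obtain m where m: "m \<in> M" "m - zscl scl a g \<in> Z.span G" using aK unfolding K_def by blast
      have "zscl scl c m - zscl scl (c * a) g \<in> Z.span G"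
        using Z.span_scale[OF m(2), of c] by (simp add: Z.scale_right_diff_distrib)
      thus ?thesis unfolding K_def using Z.subspace_scale[OF insert(4) m(1)] by blast
    qed
    have qK: "of_nat CARD('q) ^ k \<in> K" if kK: "of_nat CARD('q) ^ k * u \<in> K" and u: "u dvd 1" for k u
    proof -
      obtain w where "1 = u * w" using u by (rule dvdE)
      hence "w * (of_nat CARD('q) ^ k * u) = of_nat CARD('q) ^ k" by (metis mult.commute mult.left_commute mult_1_right)
      thus ?thesis using K[OF kK, of w] by metis
    qed
    define n where "n = (LEAST n. of_nat CARD('q) ^ n \<in> K)"
    obtain a where a: "a \<in> K" "a \<noteq> 0" using False by blast
    from padic_factor[OF a(2)] obtain k u where ku: "a = of_nat CARD('q) ^ k * u" "u dvd 1" by metis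
    hence "of_nat CARD('q) ^ k \<in> K" using qK a(1) by blast
    hence nK: "of_nat CARD('q) ^ n \<in> K" unfolding n_def by (rule LeastI)
    then obtain m where m: "m \<in> M" "m - zscl scl (of_nat CARD('q) ^ n) g \<in> Z.span G" unfolding K_def by blast
    have "Z.span (insert m H) = M"
    proof
      have "insert m H \<subseteq> M" using m(1) H(2) Z.span_superset[of H] by blast
      thus "Z.span (insert m H) \<subseteq> M" using insert(4) by (rule Z.span_minimal)
    next
      show "M \<subseteq> Z.span (insert m H)"
      proof
        fix x assume x: "x \<in> M"
        obtain a where a: "x - zscl scl a g \<in> Z.span G"
          using x insert(5) Z.span_breakdown_eq[of x g G] by blast
        have "of_nat CARD('q) ^ n dvd a"
        proof (cases "a = 0")
          case False
          from padic_factor[OF this] obtain k u where ku: "a = of_nat CARD('q) ^ k * u" "u dvd 1" by metis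
          have "a \<in> K" using a x unfolding K_def by blast
          hence "of_nat CARD('q) ^ k \<in> K" using qK ku by blast
          hence "n \<le> k" unfolding n_def by (rule Least_le)
          thus ?thesis unfolding ku(1) by (simp add: le_imp_power_dvd)
        qed simp
        then obtain c where c: "a = of_nat CARD('q) ^ n * c" by (rule dvdE)
        have "x - zscl scl c m = (x - zscl scl a g) - zscl scl c (m - zscl scl (of_nat CARD('q) ^ n) g)"
          unfolding c by (simp add: Z.scale_right_diff_distrib mult.commute)
        also have "\<dots> \<in> Z.span G" by (rule Z.span_diff[OF a Z.span_scale[OF m(2)]])
        finally have "x - zscl scl c m \<in> Z.span H"
          using H(2) x m(1) insert(4) by (simp add: Z.subspace_diff Z.subspace_scale)
        thus "x \<in> Z.span (insert m H)" unfolding Z.span_breakdown_eq by blast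
      qed
    qed
    thus ?thesis using H(1) by blast
  qed
qed

text \<open>
  In a linear relation between generators some coefficient divides all others. As the module is
  torsion-free, the relation can be divided by it, and the generator is redundant.
\<close>

lemma Z_free:
  assumes "finite G" shows "\<exists>B. finite B \<and> Z.independent B \<and> Z.span B = Z.span G"
  using assms
proof (induction "card G" arbitrary: G rule: less_induct)
  case less
  show ?case
  proof (cases "Z.independent G")
    case False
    then obtain u w where u: "w \<in> G" "u w \<noteq> 0" "(\<Sum>v\<in>G. zscl scl (u v) v) = 0"
      using Z.dependent_finite[OF less(2)] by auto
    have "\<exists>m\<in>G. \<forall>v\<in>G. u m dvd u v"
    proof -
      have "H \<noteq> {} \<Longrightarrow> \<exists>m\<in>H. \<forall>v\<in>H. u m dvd u v" if "finite H" for H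
        using that
      proof (induction H)
        case (insert h H)
        show ?case
        proof (cases "H = {}")
          case False
          then obtain m where m: "m \<in> H" "\<forall>v\<in>H. u m dvd u v" using insert by blast
          show ?thesis
          proof (cases "u m dvd u h")
            case True
            thus ?thesis using m by auto
          next
            case False
            hence "u h dvd u m" using padic_dvd_linear by blast
            hence "\<forall>v\<in>insert h H. u h dvd u v" using m dvd_trans[of "u h" "u m"] by auto
            thus ?thesis by blast
          qed
        qed simp
      qed simp
      thus ?thesis using less(2) u(1) by blast
    qed
    then obtain m where m: "m \<in> G" "\<And>v. v \<in> G \<Longrightarrow> u m dvd u v" by blast
    have um: "u m \<noteq> 0" using m(2)[OF u(1)] u(2) by auto
    have "\<forall>v\<in>G. \<exists>a. u v = u m * a" using m(2) by (auto elim!: dvdE)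
    then obtain c where c: "\<And>v. v \<in> G \<Longrightarrow> u v = u m * c v"
      using bchoice[of G "\<lambda>v a. u v = u m * a"] by auto
    have "zscl scl (u m) (\<Sum>v\<in>G. zscl scl (c v) v) = 0"
      unfolding Z.scale_sum_right u(3)[symmetric] by (intro sum.cong refl) (use c in simp)
    hence "(\<Sum>v\<in>G. zscl scl (c v) v) = 0" using um zscl_cancel by blast
    moreover have "c m = 1" using c[OF m(1)] um by simp
    ultimately have "m = - (\<Sum>v\<in>G - {m}. zscl scl (c v) v)"
      using sum.remove[OF less(2) m(1), of "\<lambda>v. zscl scl (c v) v"] by (simp add: eq_neg_iff_add_eq_0)
    also have "\<dots> \<in> Z.span (G - {m})" by (intro Z.span_neg Z.span_sum Z.span_scale Z.span_base)
    finally have mem: "m \<in> Z.span (G - {m})" .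
    have "Z.span (G - {m}) = Z.span G"
    proof
      show "Z.span (G - {m}) \<subseteq> Z.span G" by (rule Z.span_mono) blast
      have "G \<subseteq> Z.span (G - {m})" using mem Z.span_superset[of "G - {m}"] by blast
      thus "Z.span G \<subseteq> Z.span (G - {m})" by (rule Z.span_minimal[OF _ Z.subspace_span])
    qed
    moreover have "card (G - {m}) < card G" using m(1) less(2) by (intro psubset_card_mono) auto
    ultimately show ?thesis using less(1)[of "G - {m}"] less(2) by auto
  qed (use less(2) in blast)
qed

text \<open>
  The generators are removed one at a time: \<open>g\<close> is \<open>qa g\<close> plus elements of \<open>N\<close> and of the span of the others,
  and \<open>1 - qa\<close> is a unit.
\<close>

lemma Z_nakayama:
  assumes "finite G" "Z.subspace N" "Z.subspace M" "N \<subseteq> M" "G \<subseteq> M"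
    and "M \<subseteq> sum_set N (Z.span G)" "M \<subseteq> sum_set N ((*) (of_nat CARD('q)) ` M)"
  shows "M \<subseteq> N"
  using assms(1,5,6)
proof (induction G)
  case empty
  thus ?case unfolding sum_set_def by auto
next
  case (insert g G)
  obtain n m where g: "g = n + of_nat CARD('q) * m" "n \<in> N" "m \<in> M"
    using assms(7) insert(4) by (auto simp: sum_set_def)
  obtain n' h where m: "m = n' + h" "n' \<in> N" "h \<in> Z.span (insert g G)"
    using insert(5) g(3) by (auto simp: sum_set_def)
  obtain a where a: "h - zscl scl a g \<in> Z.span G" using m(3) Z.span_breakdown_eq by blast
  obtain w where w: "1 = (1 - of_nat CARD('q) * a) * w" using padic_one_minus_q_unit by (rule dvdE)
  have sub: "Z.subspace (sum_set N (Z.span G))"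
    using submod_sum_set[of Zs N "Z.span G"] assms(2) Z.subspace_span by (simp add: submod_Zs_iff)
  have "zscl scl (1 - of_nat CARD('q) * a) g = (n + zscl scl (of_nat CARD('q)) n') + zscl scl (of_nat CARD('q)) (h - zscl scl a g)"
    unfolding Z.scale_left_diff_distrib Z.scale_right_diff_distrib
    using g(1) m(1) by (simp add: zscl_of_nat algebra_simps)
  also have "\<dots> \<in> sum_set N (Z.span G)"
    by (intro sum_setI Z.subspace_add[OF assms(2)] Z.subspace_scale[OF assms(2)] Z.span_scale a g m)
  finally have "zscl scl w (zscl scl (1 - of_nat CARD('q) * a) g) \<in> sum_set N (Z.span G)"
    by (rule Z.subspace_scale[OF sub])
  hence gm: "g \<in> sum_set N (Z.span G)"
    using w by (simp add: mult.commute)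
  have "N \<subseteq> sum_set N (Z.span G)" "Z.span G \<subseteq> sum_set N (Z.span G)"
    unfolding sum_set_def using Z.span_zero[of G] Z.subspace_0[OF assms(2)] by force+
  hence "Z.span (insert g G) \<subseteq> sum_set N (Z.span G)"
    using gm Z.span_superset[of G] by (intro Z.span_minimal[OF _ sub]) blast
  hence "sum_set N (Z.span (insert g G)) \<subseteq> sum_set N (Z.span G)"
    using \<open>N \<subseteq> sum_set N (Z.span G)\<close> Z.subspace_add[OF sub] unfolding sum_set_def[of N "Z.span (insert g G)"] by blast
  thus ?case using insert by blast
qed

end

section \<open>The trace form\<close>

text \<open>The coefficients in the proof are the cofactors of the matrix of the relations.\<close>

lemma cayley_hamilton_3:
  fixes t x y z :: "'a :: comm_ring_1"
  assumes "t * x = a1 * x + a2 * y + a3 * z"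
    and "t * y = b1 * x + b2 * y + b3 * z"
    and "t * z = c1 * x + c2 * y + c3 * z"
  defines "d \<equiv> t ^ 3 - (a1 + b2 + c3) * t ^ 2
    + ((a1 * b2 - a2 * b1) + (a1 * c3 - a3 * c1) + (b2 * c3 - b3 * c2)) * t
    - (a1 * (b2 * c3 - b3 * c2) - a2 * (b1 * c3 - b3 * c1) + a3 * (b1 * c2 - b2 * c1))"
  shows "d * x = 0" "d * y = 0" "d * z = 0"
proof -
  define u v w where "u = t * x - (a1 * x + a2 * y + a3 * z)"
    and "v = t * y - (b1 * x + b2 * y + b3 * z)" and "w = t * z - (c1 * x + c2 * y + c3 * z)"
  note uvw = u_def v_def w_def
  have 0: "u = 0" "v = 0" "w = 0" using assms(1-3) unfolding uvw by simp_all
  have "d * x = ((t - b2) * (t - c3) - b3 * c2) * u + (a2 * (t - c3) + a3 * c2) * v + (a2 * b3 + a3 * (t - b2)) * w"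
    unfolding uvw d_def by (simp add: poly_simps)
  thus "d * x = 0" by (simp add: 0)
  have "d * y = (b1 * (t - c3) + b3 * c1) * u + ((t - a1) * (t - c3) - a3 * c1) * v + (b3 * (t - a1) + a3 * b1) * w"
    unfolding uvw d_def by (simp add: poly_simps)
  thus "d * y = 0" by (simp add: 0)
  have "d * z = (b1 * c2 + c1 * (t - b2)) * u + ((t - a1) * c2 + a2 * c1) * v + ((t - a1) * (t - b2) - a2 * b1) * w"
    unfolding uvw d_def by (simp add: poly_simps)
  thus "d * z = 0" by (simp add: 0)
qed

context etale_cubic
begin

abbreviation tr :: "'e \<Rightarrow> 'q padic" where "tr \<equiv> alg_trace scl"

lemma representation_mult:
  assumes "base B" "base C"
  shows "V.representation B (x * y) b = (\<Sum>c\<in>C. V.representation C y c * V.representation B (x * c) b)"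
proof -
  have B: "V.independent B" "V.span B = UNIV" using assms(1) unfolding base_def by auto
  have "V.representation B (x * y) b = V.representation B (x * (\<Sum>c\<in>C. scl (V.representation C y c) c)) b"
    by (simp add: base_expand[OF assms(2)])
  also have "x * (\<Sum>c\<in>C. scl (V.representation C y c) c) = (\<Sum>c\<in>C. scl (V.representation C y c) (x * c))"
    by (simp add: sum_distrib_left scl_mult)
  finally show ?thesis
    using B by (simp add: V.representation_sum V.representation_scale)
qed

text \<open>Two bases, each expanded in the other, lead to the same double sum.\<close>

lemma trace_eq:
  assumes "base B" shows "tr x = (\<Sum>b\<in>B. V.representation B (x * b) b)"
proof -
  define C where "C = (SOME B. V.independent B \<and> V.span B = UNIV)"
  have "\<exists>B. V.independent B \<and> V.span B = UNIV" using base_exists unfolding base_def by blast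
  from someI_ex[OF this] have C: "base C" unfolding C_def[symmetric] base_iff_spanning .
  have e: "(\<Sum>b\<in>B. V.representation B z b * V.representation C b c) = V.representation C z c" for c z
    using representation_mult[OF C assms, of 1 z c] by simp
  have "tr x = (\<Sum>c\<in>C. V.representation C (x * c) c)"
    unfolding alg_trace_def Let_def C_def ..
  also have "\<dots> = (\<Sum>c\<in>C. \<Sum>b\<in>B. V.representation B (x * c) b * V.representation C b c)"
    by (intro sum.cong refl e[symmetric])
  also have "\<dots> = (\<Sum>b\<in>B. \<Sum>c\<in>C. V.representation C b c * V.representation B (x * c) b)"
    by (subst sum.swap) (simp add: mult.commute)
  also have "\<dots> = (\<Sum>b\<in>B. V.representation B (x * b) b)"
    by (intro sum.cong refl representation_mult[OF assms C, symmetric])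
  finally show ?thesis .
qed

lemma trace_add: "tr (x + y) = tr x + tr y" and trace_scl: "tr (scl c x) = c * tr x"
proof -
  obtain B where B: "base B" using base_exists by blast
  hence "V.independent B" "V.span B = UNIV" unfolding base_def by auto
  thus "tr (x + y) = tr x + tr y" "tr (scl c x) = c * tr x"
    unfolding trace_eq[OF B]
    by (simp_all add: distrib_right V.representation_add sum.distrib scl_mult V.representation_scale sum_distrib_left)
qed

lemma trace_sum: "tr (\<Sum>i\<in>S. f i) = (\<Sum>i\<in>S. tr (f i))"
proof -
  have "tr 0 = 0" using trace_scl[of 0 0] by simp
  thus ?thesis by (induction S rule: infinite_finite_induct) (auto simp: trace_add)
qed

lemma trace_diff: "tr (x - y) = tr x - tr y"
  using trace_add[of "x - y" y] by simp

text \<open>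
  In a basis that extends one of \<open>eE\<close>, multiplication by an idempotent \<open>e\<close> has diagonal entries
  \<open>1\<close> on \<open>eE\<close> and \<open>0\<close> elsewhere, so its trace is the dimension of \<open>eE\<close>.
\<close>

lemma trace_idempotent:
  assumes "e * e = e" "e \<noteq> 0" shows "tr e \<noteq> 0"
proof -
  obtain B1 where B1: "B1 \<subseteq> range ((*) e)" "V.independent B1" "range ((*) e) \<subseteq> V.span B1"
    using V.basis_exists[of "range ((*) e)"] by metis
  obtain B where B: "B1 \<subseteq> B" "V.independent B" "UNIV \<subseteq> V.span B"
    using V.maximal_independent_subset_extend[of B1 UNIV] B1(2) by (metis subset_UNIV)
  hence b: "base B" unfolding base_iff_spanning by blast
  hence fin: "finite B" unfolding base_def by blast
  have diag: "V.representation B (e * v) v = (if v \<in> B1 then 1 else 0)" if "v \<in> B" for v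
  proof (cases "v \<in> B1")
    case True
    then obtain y where "v = e * y" using B1(1) by blast
    hence "e * v = v" using assms(1) by (simp flip: mult.assoc)
    thus ?thesis using True V.representation_basis[OF B(2) that] by simp
  next
    case False
    have "e * v \<in> V.span B1" using B1(3) by blast
    hence "V.representation B (e * v) = V.representation B1 (e * v)"
      using V.representation_extend[OF B(2) _ B(1)] by blast
    thus ?thesis using False V.representation_ne_zero[of B1 "e * v" v] by auto
  qed
  have "tr e = (\<Sum>v\<in>B. if v \<in> B1 then 1 else 0)"
    unfolding trace_eq[OF b] by (intro sum.cong refl diag)
  also have "\<dots> = of_nat (card B1)"
    using fin B(1) by (simp add: sum.If_cases Int_absorb1)
  finally have t: "tr e = of_nat (card B1)" .
  have "e \<in> V.span B1" using B1(3) assms(1) by (metis rangeI subsetD)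
  hence "B1 \<noteq> {}" using assms(2) by auto
  hence "card B1 \<noteq> 0" using finite_subset[OF B(1) fin] by simp
  thus ?thesis unfolding t by (rule of_nat_nonzero)
qed

lemma trace_nondegenerate:
  assumes "x \<noteq> 0" shows "\<exists>y. tr (x * y) \<noteq> 0"
proof -
  obtain I where I: "\<forall>e\<in>I. field_idempotent e" "\<Sum>I = (1 :: 'e)"
    using etale unfolding etale_cubic_algebra_def by blast
  have "x = (\<Sum>e\<in>I. e * x)" using I(2) by (simp flip: sum_distrib_right)
  then obtain e where e: "e \<in> I" "e * x \<noteq> 0" using assms by (metis sum.neutral)
  hence f: "e * e = e" "e \<noteq> 0" "\<forall>x \<in> range ((*) e). x \<noteq> 0 \<longrightarrow> (\<exists>y \<in> range ((*) e). x * y = e)"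
    using I(1) unfolding field_idempotent_def by blast+
  then obtain y where "e * x * y = e" using e(2) by blast
  hence "x * (e * y) = e" by (simp add: mult_ac)
  thus ?thesis using trace_idempotent[OF f(1,2)] by metis
qed

text \<open>By nondegeneracy \<open>x \<mapsto> \<Sum>b\<in>B. tr(xb) b\<close> is injective, hence surjective.\<close>

lemma dual_basis:
  assumes "base B"
  obtains d where "\<And>x. x = (\<Sum>b\<in>B. scl (tr (x * b)) (d b))"
    "\<And>b b'. b \<in> B \<Longrightarrow> b' \<in> B \<Longrightarrow> tr (d b * b') = (if b = b' then 1 else 0)"
proof -
  interpret F: finite_dimensional_vector_space scl B using assms by (rule base_findim)
  define \<phi> where "\<phi> x = (\<Sum>b\<in>B. scl (tr (x * b)) b)" for x
  have B: "V.independent B" "finite B" "V.span B = UNIV" using assms unfolding base_def by auto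
  have 0: "x = 0" if x: "\<And>b. b \<in> B \<Longrightarrow> tr (x * b) = 0" for x
  proof (rule ccontr)
    assume "x \<noteq> 0"
    then obtain y where y: "tr (x * y) \<noteq> 0" using trace_nondegenerate by blast
    have "tr (x * y) = tr (x * (\<Sum>b\<in>B. scl (V.representation B y b) b))"
      by (simp add: base_expand[OF assms])
    also have "\<dots> = 0" using x by (simp add: sum_distrib_left trace_sum scl_mult trace_scl)
    finally show False using y by blast
  qed
  have "Vector_Spaces.linear scl scl \<phi>"
    by unfold_locales
      (simp_all add: \<phi>_def distrib_right trace_add V.scale_left_distrib sum.distrib scl_mult trace_scl V.scale_sum_right)
  moreover have "inj \<phi>"
  proof (rule injI)
    fix x y assume "\<phi> x = \<phi> y"
    hence "(\<Sum>b\<in>B. scl (tr ((x - y) * b)) b) = 0"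
      by (simp add: \<phi>_def left_diff_distrib trace_diff V.scale_left_diff_distrib sum_subtractf)
    hence "tr ((x - y) * b) = 0" if "b \<in> B" for b
      using V.independentD[OF B(1,2) order_refl, of "\<lambda>b. tr ((x - y) * b)"] that by blast
    from 0[OF this] show "x = y" by simp
  qed
  ultimately have "surj \<phi>" by (rule F.linear_inj_imp_surj)
  then obtain d where d: "\<And>b. \<phi> (d b) = b" by (metis surjD)
  have dd: "tr (d b * b') = (if b = b' then 1 else 0)" if "b \<in> B" "b' \<in> B" for b b'
    using base_representation_sum[OF assms that(2), of "\<lambda>v. tr (d b * v)"] d[of b]
      V.representation_basis[OF B(1) that(1)] unfolding \<phi>_def by auto
  have "x - (\<Sum>b\<in>B. scl (tr (x * b)) (d b)) = 0" for x
  proof (rule 0)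
    fix b' assume b': "b' \<in> B"
    have "tr ((\<Sum>b\<in>B. scl (tr (x * b)) (d b)) * b') = (\<Sum>b\<in>B. if b = b' then tr (x * b) else 0)"
      unfolding sum_distrib_right trace_sum scl_mult trace_scl
      by (intro sum.cong refl) (simp add: dd b')
    thus "tr ((x - (\<Sum>b\<in>B. scl (tr (x * b)) (d b))) * b') = 0"
      using b' B(2) by (simp add: left_diff_distrib trace_diff)
  qed
  thus ?thesis using that[of d] dd by simp
qed

lemma trace_integral:
  assumes "base B" "\<And>x y. x \<in> Z.span B \<Longrightarrow> y \<in> Z.span B \<Longrightarrow> x * y \<in> Z.span B" "x \<in> Z.span B"
  shows "tr x \<in> range to_fract"
proof -
  have "\<forall>b\<in>B. V.representation B (x * b) b \<in> range (to_fract :: 'q padic_int \<Rightarrow> _)"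
    using assms(2)[OF assms(3) Z.span_base] mem_Z_span_iff[OF assms(1)] by blast
  hence "\<forall>b\<in>B. \<exists>a. V.representation B (x * b) b = to_fract a" by auto
  then obtain a where "\<And>b. b \<in> B \<Longrightarrow> V.representation B (x * b) b = to_fract (a b)"
    using bchoice[of B "\<lambda>b a. V.representation B (x * b) b = to_fract a"] by auto
  hence "tr x = to_fract (\<Sum>b\<in>B. a b)" unfolding trace_eq[OF assms(1)] by simp
  thus ?thesis by blast
qed

text \<open>
  By Cayley and Hamilton, an element of an order is a root of the characteristic polynomial of its
  multiplication matrix in a basis of the order, which has coefficients in \<open>\<int>\<^sub>q\<close>.
\<close>

lemma order_integral:
  assumes "base B" "\<And>x y. x \<in> Z.span B \<Longrightarrow> y \<in> Z.span B \<Longrightarrow> x * y \<in> Z.span B" "1 \<in> Z.span B"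
  shows "Z.span B \<subseteq> maximal_order scl"
proof
  fix t assume t: "t \<in> Z.span B"
  have fin: "finite B" using assms(1) unfolding base_def by blast
  obtain x y z where B: "B = {x, y, z}" and ne: "x \<noteq> y" "y \<noteq> z" "x \<noteq> z"
    using assms(1) unfolding base_iff_card card_3_iff by blast
  define f where "f a = zscl scl a 1" for a
  have co: "\<exists>a b c. v = f a * x + f b * y + f c * z" if v: "v \<in> Z.span B" for v
  proof -
    obtain u where "v = (\<Sum>w\<in>B. zscl scl (u w) w)" using v Z.span_finite[OF fin] by auto
    hence "v = f (u x) * x + f (u y) * y + f (u z) * z"
      unfolding f_def zscl_mult B using ne by (simp add: add.assoc)
    thus ?thesis by blast
  qed
  have mem: "t * x \<in> Z.span B" "t * y \<in> Z.span B" "t * z \<in> Z.span B"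
    using assms(2)[OF t Z.span_base] B by auto
  obtain a1 a2 a3 where a: "t * x = f a1 * x + f a2 * y + f a3 * z" using co[OF mem(1)] by blast
  obtain b1 b2 b3 where b: "t * y = f b1 * x + f b2 * y + f b3 * z" using co[OF mem(2)] by blast
  obtain c1 c2 c3 where c: "t * z = f c1 * x + f c2 * y + f c3 * z" using co[OF mem(3)] by blast
  obtain d1 d2 d3 where d: "1 = f d1 * x + f d2 * y + f d3 * z" using co[OF assms(3)] by blast
  define s1 where "s1 = a1 + b2 + c3"
  define s2 where "s2 = (a1 * b2 - a2 * b1) + (a1 * c3 - a3 * c1) + (b2 * c3 - b3 * c2)"
  define s3 where "s3 = a1 * (b2 * c3 - b3 * c2) - a2 * (b1 * c3 - b3 * c1) + a3 * (b1 * c2 - b2 * c1)"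
  have fh: "f (u + v) = f u + f v" "f (u - v) = f u - f v" "f (u * v) = f u * f v" for u v
    unfolding f_def by (simp_all add: Z.scale_left_distrib Z.scale_left_diff_distrib zscl_mult mult.commute)
  let ?d = "t ^ 3 - f s1 * t ^ 2 + f s2 * t - f s3"
  have "?d * x = 0" "?d * y = 0" "?d * z = 0"
    unfolding s1_def s2_def s3_def fh by (rule cayley_hamilton_3[OF a b c])+
  hence "?d * (f d1 * x + f d2 * y + f d3 * z) = 0"
    unfolding distrib_left mult.left_commute[of ?d] by simp
  hence d0: "?d = 0" by (simp flip: d)
  let ?p = "[:- s3, s2, - s1, 1:]"
  have coe: "map_poly to_fract ?p = [:- to_fract s3, to_fract s2, - to_fract s1, 1:]"
    by (simp add: map_poly_pCons)
  have "alg_eval scl 1 (map_poly to_fract ?p) t = ?d"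
    unfolding coe alg_eval_def f_def zscl_def
    by (simp add: numeral_3_eq_3 numeral_2_eq_2 V.scale_minus_left scl_mult)
  hence "alg_eval scl 1 (map_poly to_fract ?p) t = 0" unfolding d0 .
  moreover have "lead_coeff ?p = 1" by simp
  ultimately show "t \<in> maximal_order scl"
    unfolding maximal_order_def integral_closure_def by (auto intro: exI[of _ ?p])
qed

end

section \<open>Orders of the cubic algebra\<close>

locale cubic_algebra_order = etale_cubic scl
  for scl :: "'q :: prime_card padic \<Rightarrow> 'e :: comm_ring_1 \<Rightarrow> 'e" +
  fixes A :: "'e set"
  assumes A_order: "cubic_order scl A"
begin

lemma A_base: obtains B where "base B" "Z.span B = A"
proof -
  obtain B where "finite B" "card B = 3" "Z.independent B" "Z.span B = A"
    using A_order unfolding cubic_order_def by blast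
  thus ?thesis using that unfolding base_iff_card by (simp add: Z_independent_iff)
qed

lemma A_subspace: "Z.subspace A"
  using A_order unfolding cubic_order_def by blast

lemma q_power_invertible: "of_nat CARD('q) ^ k * scl (inverse (of_nat CARD('q) ^ k)) x = x"
proof -
  have "scl (of_nat CARD('q) ^ k) (scl (inverse (of_nat CARD('q) ^ k)) x) = x"
    using of_nat_nonzero[of "CARD('q)"] by simp
  thus ?thesis by (simp only: scl_of_nat_power)
qed

text \<open>
  A lattice lies in a multiple \<open>q\<^sup>-\<^sup>kA\<close>, so it is finitely generated, hence free. Its basis spans \<open>E\<close> because
  every element has a multiple by a power of \<open>q\<close> in the lattice.
\<close>

lemma lattice_base:
  assumes "lattice_in CARD('q) Zs A M" obtains B where "base B" "Z.span B = M"
proof -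
  obtain B0 where B0: "base B0" "Z.span B0 = A" by (rule A_base)
  have fin: "finite B0" using B0(1) unfolding base_def by blast
  obtain k where k: "\<forall>x\<in>A. of_nat CARD('q) ^ k * x \<in> M" "\<forall>x\<in>M. of_nat CARD('q) ^ k * x \<in> A"
    and sM: "Z.subspace M" using assms unfolding lattice_in_def submod_Zs_iff by blast
  define r where "r x = scl (inverse (of_nat CARD('q) ^ k)) x" for x :: 'e
  have r: "of_nat CARD('q) ^ k * r x = x" "r (of_nat CARD('q) ^ k * x) = x" for x
    using q_power_invertible[of k x] unfolding r_def by (simp_all add: scl_mult)
  have "M \<subseteq> Z.span (r ` B0)"
  proof
    fix x assume "x \<in> M"
    hence "of_nat CARD('q) ^ k * x \<in> Z.span B0" using k(2) B0(2) by blast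
    then obtain u where u: "of_nat CARD('q) ^ k * x = (\<Sum>v\<in>B0. zscl scl (u v) v)"
      using Z.span_finite[OF fin] by auto
    have "x = r (\<Sum>v\<in>B0. zscl scl (u v) v)" by (simp only: r u[symmetric])
    also have "\<dots> = (\<Sum>v\<in>B0. zscl scl (u v) (r v))"
      unfolding r_def V.scale_sum_right zscl_def by (simp add: mult.commute)
    also have "\<dots> \<in> Z.span (r ` B0)" by (intro Z.span_sum Z.span_scale Z.span_base) auto
    finally show "x \<in> Z.span (r ` B0)" .
  qed
  then obtain H where H: "finite H" "Z.span H = M" using Z_finitely_generated[OF _ sM] fin by blast
  then obtain B where B: "finite B" "Z.independent B" "Z.span B = M" using Z_free by metis
  have "x \<in> V.span B" for x
  proof -
    obtain j where "of_nat CARD('q) ^ j * x \<in> A" using Z_absorb[OF B0(1)] B0(2) by blast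
    hence "of_nat CARD('q) ^ k * (of_nat CARD('q) ^ j * x) \<in> Z.span B" using k(1) B(3) by blast
    hence mem: "of_nat CARD('q) ^ (k + j) * x \<in> Z.span B" by (simp add: power_add mult.assoc)
    have "Z.subspace (V.span B)"
      by (intro Z.subspaceI) (auto simp: zscl_def V.span_zero intro: V.span_add V.span_scale)
    hence "Z.span B \<subseteq> V.span B" by (intro Z.span_minimal V.span_superset)
    with mem have "scl (inverse (of_nat CARD('q) ^ (k + j))) (of_nat CARD('q) ^ (k + j) * x) \<in> V.span B"
      by (intro V.span_scale) blast
    thus ?thesis using q_power_invertible[of "k + j" x] by (simp add: scl_mult)
  qed
  hence "base B" using B Z_independent_iff unfolding base_def by blast
  thus ?thesis using B(3) by (rule that)
qed

lemma lattice_inI: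
  assumes "Z.subspace M" "\<And>x. x \<in> A \<Longrightarrow> of_nat CARD('q) ^ j * x \<in> M"
    and "\<And>x. x \<in> M \<Longrightarrow> of_nat CARD('q) ^ k * x \<in> A"
  shows "lattice_in CARD('q) Zs A M"
proof -
  have "of_nat CARD('q) ^ (k + j) * x \<in> M" if "x \<in> A" for x
    using Z.subspace_scale[OF assms(1) assms(2)[OF that], of "of_nat CARD('q) ^ k"]
    by (simp add: zscl_of_nat_power power_add mult.assoc)
  moreover have "of_nat CARD('q) ^ (k + j) * x \<in> A" if "x \<in> M" for x
    using Z.subspace_scale[OF A_subspace assms(3)[OF that], of "of_nat CARD('q) ^ j"]
    by (simp add: zscl_of_nat_power power_add mult_ac)
  ultimately show ?thesis unfolding lattice_in_def submod_Zs_iff using assms(1) by blast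
qed

lemma base_lattice:
  assumes "base B" shows "lattice_in CARD('q) Zs A (Z.span B)"
proof -
  obtain B0 where B0: "base B0" "Z.span B0 = A" by (rule A_base)
  have fin: "finite B" "finite B0" using B0(1) assms unfolding base_def by auto
  obtain j where j: "\<And>x. x \<in> A \<Longrightarrow> of_nat CARD('q) ^ j * x \<in> Z.span B"
    using Z_absorb_span[OF Z.subspace_span fin(2)] Z_absorb[OF assms] B0(2) by metis
  obtain k where k: "\<And>x. x \<in> Z.span B \<Longrightarrow> of_nat CARD('q) ^ k * x \<in> A"
    using Z_absorb_span[OF A_subspace fin(1)] Z_absorb[OF B0(1)] B0(2) by metis
  show ?thesis using Z.subspace_span j k by (rule lattice_inI)
qed

lemma order_in_iff: "order_in CARD('q) Zs A T \<longleftrightarrow> cubic_order scl T"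
proof
  assume T: "order_in CARD('q) Zs A T"
  then obtain B where B: "base B" "Z.span B = T" using lattice_base unfolding order_in_def by metis
  have m: "1 \<in> T" "\<forall>x\<in>T. \<forall>y\<in>T. x * y \<in> T" using T unfolding order_in_def by blast+
  have "T \<subseteq> maximal_order scl" using order_integral[OF B(1)] m unfolding B(2) by blast
  moreover have "finite B" "card B = 3" "Z.independent B"
    using B(1) base_iff_card Z_independent_iff unfolding base_def by blast+
  moreover have "Z.subspace T" using Z.subspace_span[of B] unfolding B(2) .
  ultimately show "cubic_order scl T" unfolding cubic_order_def using m B(2) by blast
next
  assume T: "cubic_order scl T"
  then obtain B where B: "finite B" "card B = 3" "Z.independent B" "Z.span B = T"
    unfolding cubic_order_def by blast
  hence "base B" unfolding base_iff_card by (simp add: Z_independent_iff)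
  from base_lattice[OF this] show "order_in CARD('q) Zs A T"
    unfolding order_in_def B(4) using T unfolding cubic_order_def by blast
qed

lemma A_index: "subgroup_index A ((*) (of_nat CARD('q)) ` A) = CARD('q) ^ 3"
proof -
  obtain B where B: "base B" "Z.span B = A" by (rule A_base)
  have fin: "finite B" "card B = 3" "Z.independent B"
    using B(1) base_iff_card Z_independent_iff unfolding base_def by blast+
  let ?Q = "of_nat CARD('q) :: 'e" and ?q = "of_nat CARD('q) :: 'q padic_int"
  let ?N = "(*) ?Q ` A"
  define s where "s c = (\<Sum>b\<in>B. zscl scl (of_nat (c b)) b)" for c :: "'e \<Rightarrow> nat"
  define P where "P = PiE B (\<lambda>_. {..<CARD('q)})"
  have A: "submodule_over Zs A" "submodule_over Zs ?N"
    using A_subspace submod_image unfolding submod_Zs_iff[symmetric] by blast+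
  note add = submodD(1)[OF A(1)] submodD(1)[OF A(2)]
  have NA: "?N \<subseteq> A" using Z.subspace_scale[OF A_subspace, of _ ?q] by (auto simp: zscl_of_nat)
  have Qsum: "?Q * (\<Sum>b\<in>B. zscl scl (u b) b) = (\<Sum>b\<in>B. zscl scl (?q * u b) b)" for u
    unfolding zscl_of_nat[symmetric] Z.scale_sum_right by simp
  have "bij_betw (\<lambda>c. {y. y - s c \<in> ?N}) P (cosets ?N A)"
  proof (rule bij_betwI')
    fix c c' assume c: "c \<in> P" "c' \<in> P"
    show "{y. y - s c \<in> ?N} = {y. y - s c' \<in> ?N} \<longleftrightarrow> c = c'"
    proof
      assume "{y. y - s c \<in> ?N} = {y. y - s c' \<in> ?N}"
      hence "s c - s c' \<in> ?N" by (simp only: coset_eq_iff[OF add(2)])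
      then obtain x where x: "s c - s c' = ?Q * x" "x \<in> Z.span B" unfolding B(2) by blast
      then obtain u where u: "x = (\<Sum>b\<in>B. zscl scl (u b) b)" using Z.span_finite[OF fin(1)] by auto
      have "(\<Sum>b\<in>B. zscl scl (of_nat (c b) - of_nat (c' b) - ?q * u b) b) = 0"
        using x(1) unfolding s_def u Qsum by (simp add: Z.scale_left_diff_distrib sum_subtractf)
      hence "of_nat (c b) - of_nat (c' b) - ?q * u b = 0" if "b \<in> B" for b
        using Z.independentD[OF fin(3,1) order_refl _ that, of "\<lambda>b. of_nat (c b) - of_nat (c' b) - ?q * u b"] by blast
      hence "c b = c' b" if "b \<in> B" for b
        using padic_residue_unique[of "c b" "c' b" "u b"] c that unfolding P_def by auto
      thus "c = c'" using c unfolding P_def by (intro PiE_ext[of c B _ c']) auto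
    qed simp
  next
    fix c
    have "s c \<in> A" unfolding s_def B(2)[symmetric] by (intro Z.span_sum Z.span_scale Z.span_base)
    thus "{y. y - s c \<in> ?N} \<in> cosets ?N A" unfolding cosets_def by blast
  next
    fix X assume "X \<in> cosets ?N A"
    then obtain x where X: "X = {y. y - x \<in> ?N}" "x \<in> Z.span B" unfolding cosets_def B(2) by blast
    then obtain u where u: "x = (\<Sum>b\<in>B. zscl scl (u b) b)" using Z.span_finite[OF fin(1)] by auto
    have "\<exists>i w. i < CARD('q) \<and> u b = of_nat i + ?q * w" for b using padic_residue[of "u b"] by metis
    then obtain i w where i: "\<And>b. i b < CARD('q)" "\<And>b. u b = of_nat (i b) + ?q * w b" by metis
    have "restrict i B \<in> P" unfolding P_def using i(1) by auto
    moreover have "s (restrict i B) = (\<Sum>b\<in>B. zscl scl (of_nat (i b)) b)"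
      unfolding s_def by (intro sum.cong refl) simp
    hence "x - s (restrict i B) = ?Q * (\<Sum>b\<in>B. zscl scl (w b) b)"
      unfolding Qsum u i(2) by (simp add: Z.scale_left_distrib sum.distrib)
    moreover have "(\<Sum>b\<in>B. zscl scl (w b) b) \<in> A"
      unfolding B(2)[symmetric] by (intro Z.span_sum Z.span_scale Z.span_base)
    ultimately show "\<exists>c\<in>P. X = {y. y - s c \<in> ?N}" unfolding X(1) coset_eq_iff[OF add(2)] by blast
  qed
  hence "card (cosets ?N A) = card P" by (rule bij_betw_same_card[symmetric])
  also have "\<dots> = CARD('q) ^ 3" unfolding P_def using fin by (simp add: card_PiE)
  finally show ?thesis unfolding index_cosets[OF add(2,1) NA] .
qed

definition trace_int :: "'e set" where
  "trace_int = {x. tr x \<in> range to_fract}"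

lemma range_to_fract_closed:
  assumes "x \<in> range (to_fract :: 'q padic_int \<Rightarrow> _)" "y \<in> range to_fract"
  shows "x + y \<in> range to_fract" "x * y \<in> range to_fract"
  using assms by (auto simp flip: to_fract_add to_fract_mult)

lemma trace_int_subspace: "Z.subspace trace_int"
  unfolding trace_int_def
  by (intro Z.subspaceI)
    (auto simp: trace_add zscl_def trace_scl intro!: range_to_fract_closed intro: range_eqI[of _ _ 0] simp: trace_scl[of 0 0, simplified])

lemma order_trace_int:
  assumes "cubic_order scl T" shows "T \<subseteq> trace_int"
proof -
  obtain B where B: "base B" "Z.span B = T"
    using assms unfolding order_in_iff[symmetric] order_in_def using lattice_base by metis
  have "x * y \<in> Z.span B" if "x \<in> Z.span B" "y \<in> Z.span B" for x y
    using assms that unfolding B(2) cubic_order_def by blast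
  from trace_integral[OF B(1) this] show ?thesis unfolding B(2) trace_int_def by blast
qed

lemma colon_trace_int_mem:
  assumes "\<And>b. b \<in> B \<Longrightarrow> tr (x * b) \<in> range to_fract"
  shows "x \<in> colon trace_int (Z.span B)"
proof (rule colonI)
  fix y assume y: "y \<in> Z.span B"
  have "Z.subspace {y. x * y \<in> trace_int}"
    using Z.subspace_0[OF trace_int_subspace] Z.subspace_add[OF trace_int_subspace]
      Z.subspace_scale[OF trace_int_subspace]
    by (intro Z.subspaceI) (auto simp: distrib_left zscl_mult)
  moreover have "B \<subseteq> {y. x * y \<in> trace_int}" using assms unfolding trace_int_def by blast
  ultimately have "Z.span B \<subseteq> {y. x * y \<in> trace_int}" by (rule Z.span_minimal[rotated])
  thus "x * y \<in> trace_int" using y by blast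
qed

lemma dual_lattice:
  assumes M: "lattice_in CARD('q) Zs A M" shows "lattice_in CARD('q) Zs A (colon trace_int M)"
proof -
  obtain B where B: "base B" "Z.span B = M" using M by (rule lattice_base)
  obtain B0 where B0: "base B0" "Z.span B0 = A" by (rule A_base)
  have fin: "finite B" using B(1) unfolding base_def by blast
  obtain d where d: "\<And>x. x = (\<Sum>b\<in>B. scl (tr (x * b)) (d b))" using dual_basis[OF B(1)] by metis
  obtain k where k: "\<And>x. x \<in> Z.span (d ` B) \<Longrightarrow> of_nat CARD('q) ^ k * x \<in> A"
    using Z_absorb_span[OF A_subspace finite_imageI[OF fin]] Z_absorb[OF B0(1)] B0(2) by metis
  obtain j where j: "\<forall>x\<in>M. of_nat CARD('q) ^ j * x \<in> A" using M unfolding lattice_in_def by blast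
  show ?thesis
  proof (rule lattice_inI)
    show "Z.subspace (colon trace_int M)"
      using submod_colon trace_int_subspace unfolding submod_Zs_iff[symmetric] by blast
    fix x
    show "of_nat CARD('q) ^ j * x \<in> colon trace_int M" if x: "x \<in> A"
    proof (rule colonI)
      fix y assume "y \<in> M"
      hence "x * (of_nat CARD('q) ^ j * y) \<in> A" using j x A_order unfolding cubic_order_def by blast
      hence "x * (of_nat CARD('q) ^ j * y) \<in> trace_int" using order_trace_int[OF A_order] by blast
      thus "of_nat CARD('q) ^ j * x * y \<in> trace_int" by (simp add: mult_ac)
    qed
    show "of_nat CARD('q) ^ k * x \<in> A" if x: "x \<in> colon trace_int M"
    proof (rule k)
      have "scl (tr (x * b)) (d b) \<in> Z.span (d ` B)" if b: "b \<in> B" for b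
      proof -
        have "x * b \<in> trace_int" using x Z.span_base[OF b] B(2) colonD by blast
        then obtain a where a: "tr (x * b) = to_fract a" unfolding trace_int_def by blast
        show ?thesis unfolding a zscl_def[symmetric] using b by (intro Z.span_scale Z.span_base) blast
      qed
      hence "(\<Sum>b\<in>B. scl (tr (x * b)) (d b)) \<in> Z.span (d ` B)" by (rule Z.span_sum)
      thus "x \<in> Z.span (d ` B)" using d[of x] by simp
    qed
  qed
qed

lemma dual_dual_lattice:
  assumes M: "lattice_in CARD('q) Zs A M" shows "colon trace_int (colon trace_int M) = M"
proof
  show "M \<subseteq> colon trace_int (colon trace_int M)"
    by (auto intro!: colonI dest: colonD simp: mult.commute)
  obtain B where B: "base B" "Z.span B = M" using M by (rule lattice_base)
  obtain d where d: "\<And>b b'. b \<in> B \<Longrightarrow> b' \<in> B \<Longrightarrow> tr (d b * b') = (if b = b' then 1 else 0)"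
    using dual_basis[OF B(1)] by metis
  have fin: "finite B" using B(1) unfolding base_def by blast
  have db: "d b \<in> colon trace_int M" if "b \<in> B" for b
    unfolding B(2)[symmetric]
    by (rule colon_trace_int_mem) (auto simp: d[OF that] intro: range_eqI[of _ _ 0] range_eqI[of _ _ 1])
  show "colon trace_int (colon trace_int M) \<subseteq> M"
  proof
    fix x assume x: "x \<in> colon trace_int (colon trace_int M)"
    show "x \<in> M"
      unfolding B(2)[symmetric] mem_Z_span_iff[OF B(1)]
    proof
      fix b assume b: "b \<in> B"
      let ?c = "V.representation B x"
      have "tr (d b * x) = tr (\<Sum>v\<in>B. scl (?c v) (d b * v))"
        by (subst base_expand[OF B(1), of x, symmetric]) (simp add: sum_distrib_left scl_mult)
      also have "\<dots> = (\<Sum>v\<in>B. if b = v then ?c v else 0)"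
        unfolding trace_sum trace_scl by (intro sum.cong refl) (simp add: d b)
      also have "\<dots> = ?c b" using fin b by simp
      finally have "tr (x * d b) = ?c b" by (simp add: mult.commute)
      moreover have "tr (x * d b) \<in> range to_fract"
        using colonD[OF x db[OF b]] unfolding trace_int_def by blast
      ultimately show "?c b \<in> range to_fract" by simp
    qed
  qed
qed

lemma lattice_nakayama:
  assumes "lattice_in CARD('q) Zs A M" "submodule_over Zs N" "N \<subseteq> M"
    and "M \<subseteq> sum_set N ((*) (of_nat CARD('q)) ` M)"
  shows "N = M"
proof -
  obtain B where B: "base B" "Z.span B = M" using assms(1) by (rule lattice_base)
  have N: "Z.subspace N" "Z.subspace M"
    using assms(2) Z.subspace_span[of B] unfolding B(2) submod_Zs_iff by auto
  have "M \<subseteq> sum_set N (Z.span B)"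
    using sum_set_upper(2)[of N M] submodD(1)[OF assms(2)] submodD(1)[of Zs M] N(2)
    unfolding B(2) submod_Zs_iff by blast
  moreover have "finite B" "B \<subseteq> M" using B Z.span_superset[of B] unfolding base_def by auto
  ultimately show ?thesis using Z_nakayama[OF _ N assms(3) _ _ assms(4)] assms(3) by blast
qed

sublocale C: cubic_lattices "CARD('q)" Zs A trace_int
proof
  show "prime CARD('q)" by (rule prime_card)
  show "\<exists>r. of_nat CARD('q) * r = (1 :: 'e)" by (rule q_invertible)
  show "submodule_over Zs Zs"
    unfolding submod_Zs_iff unfolding Zs_def
    by (intro Z.subspaceI)
      (auto simp flip: Z.scale_left_distrib intro: range_eqI[of _ _ 0])
  show "1 \<in> Zs" unfolding Zs_def by (rule range_eqI[of _ _ 1]) simp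
  show "\<exists>i<CARD('q). \<exists>w\<in>Zs. z = of_nat i + of_nat CARD('q) * w" if z: "z \<in> Zs" for z
  proof -
    obtain a where a: "z = zscl scl a 1" using z unfolding Zs_def by blast
    obtain i w where i: "i < CARD('q)" "a = of_nat i + of_nat CARD('q) * w" by (rule padic_residue)
    have "z = of_nat i + of_nat CARD('q) * zscl scl w 1"
      unfolding a i(2) Z.scale_left_distrib Z.scale_scale[symmetric] zscl_of_nat by simp
    thus ?thesis using i(1) unfolding Zs_def by blast
  qed
  show "submodule_over Zs A" unfolding submod_Zs_iff by (rule A_subspace)
  show "1 \<in> A" using A_order unfolding cubic_order_def by blast
  show "x * y \<in> A" if "x \<in> A" "y \<in> A" for x y
    using A_order that unfolding cubic_order_def by blast
  show "\<exists>k. of_nat CARD('q) ^ k * x \<in> A" for x using A_base Z_absorb by metis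
  show "subgroup_index A ((*) (of_nat CARD('q)) ` A) = CARD('q) ^ 3" by (rule A_index)
  show "submodule_over Zs trace_int" unfolding submod_Zs_iff by (rule trace_int_subspace)
  show "T \<subseteq> trace_int" if "order_in CARD('q) Zs A T" for T
    using that order_trace_int unfolding order_in_iff by blast
qed (rule lattice_nakayama dual_lattice dual_dual_lattice; assumption)+

section \<open>The series of an order of the cubic algebra\<close>

lemma trace_dual_eq: "trace_dual scl M = C.dual M"
  unfolding trace_dual_def colon_def trace_int_def by simp

lemma gorenstein_iff: "C.order T \<Longrightarrow> gorenstein scl T \<longleftrightarrow> C.gor T"
  unfolding gorenstein_def trace_dual_eq by (rule C.gorenstein_iff_gor)

lemma overorders_eq: "overorders scl A = C.OV A"
  unfolding overorders_def C.OV_def order_in_iff ..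

lemma composition_chain:
  assumes "C.lat M" "C.lat N" "N \<subseteq> M"
  shows "\<exists>D. D 0 = N \<and> D (C.len M N) = M \<and> (\<forall>i\<le>C.len M N. Z.subspace (D i)) \<and>
    (\<forall>i<C.len M N. D i \<subset> D (Suc i))"
  using assms
proof (induction "C.len M N" arbitrary: N)
  case 0
  hence "N = M" using C.len_0[of M N] by simp
  thus ?case using 0 C.lat_mod[of M] unfolding submod_Zs_iff
    by (intro exI[of _ "\<lambda>_. M"]) simp
next
  case (Suc n)
  hence "N \<subset> M" by (metis C.len_self Suc_neq_Zero psubsetI)
  from C.exists_line[OF Suc(4,3) this] obtain P
    where P: "C.lat P" "N \<subset> P" "P \<subseteq> M" "C.len P N = 1" .
  have n: "n = C.len M P" using C.len_add[OF Suc(3) P(1) Suc(4) _ P(3)] P(2,4) Suc(2) by auto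
  obtain D where D: "D 0 = P" "D n = M" "\<forall>i\<le>n. Z.subspace (D i)" "\<forall>i<n. D i \<subset> D (Suc i)"
    using Suc(1)[OF n Suc(3) P(1,3)] unfolding n[symmetric] by blast
  let ?D = "\<lambda>i. case i of 0 \<Rightarrow> N | Suc j \<Rightarrow> D j"
  have "?D (Suc n) = M" using D(2) by simp
  moreover have "Z.subspace (?D i)" if "i \<le> Suc n" for i
    using that D(3) C.lat_mod[OF Suc(4)] unfolding submod_Zs_iff by (cases i) auto
  moreover have "?D i \<subset> ?D (Suc i)" if "i < Suc n" for i
    using that D(1,4) P(2) by (cases i) auto
  ultimately show ?case unfolding Suc(2)[symmetric] by (intro exI[of _ ?D]) simp
qed

lemma chain_length:
  assumes "C.lat M" "C.lat N" "D 0 = N" "D n = M" "\<forall>i\<le>n. Z.subspace (D i)" "\<forall>i<n. D i \<subset> D (Suc i)"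
  shows "n \<le> C.len M N"
proof -
  have up: "N \<subseteq> D i" if "i \<le> n" for i
    using that
  proof (induction i)
    case (Suc i)
    hence "N \<subseteq> D i" "D i \<subset> D (Suc i)" using assms(6) by auto
    thus ?case by blast
  qed (use assms(3) in simp)
  have down: "D i \<subseteq> M" if "i \<le> n" for i
    using that by (induction rule: inc_induct) (use assms(4,6) in force)+
  have lat: "C.lat (D i)" if "i \<le> n" for i
    using C.lat_between[OF assms(2,1) _ up[OF that] down[OF that]] assms(5) that
    unfolding submod_Zs_iff by blast
  have "i \<le> C.len (D i) N" if "i \<le> n" for i
    using that
  proof (induction i)
    case (Suc i)
    hence i: "i \<le> n" "D i \<subset> D (Suc i)" using assms(6) by auto
    have "C.len (D (Suc i)) N = C.len (D (Suc i)) (D i) + C.len (D i) N"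
      using C.len_add[OF lat[OF Suc(2)] lat[OF i(1)] assms(2) up[OF i(1)]] i(2) by blast
    moreover have "C.len (D (Suc i)) (D i) > 0" by (rule C.len_pos[OF lat[OF Suc(2)] lat[OF i(1)] i(2)])
    ultimately show ?case using Suc(1)[OF i(1)] by linarith
  qed simp
  from this[OF order_refl] show ?thesis unfolding assms(4) .
qed

lemma quotient_length_eq:
  assumes "C.lat M" "C.lat N" "N \<subseteq> M"
  shows "quotient_length scl M N = C.len M N"
  unfolding quotient_length_def
proof (rule Greatest_equality)
  show "\<exists>D. D 0 = N \<and> D (C.len M N) = M \<and> (\<forall>i\<le>C.len M N. Z.subspace (D i)) \<and>
    (\<forall>i<C.len M N. D i \<subset> D (Suc i))" by (rule composition_chain[OF assms])
qed (use chain_length[OF assms(1,2)] in blast)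

lemma overorder_series_eq: "overorder_series scl A = C.L A"
  unfolding overorder_series_def C.L_def overorders_eq
proof (rule sum.cong[OF refl])
  fix T assume "T \<in> C.OV A"
  hence T: "C.order T" "A \<subseteq> T" "C.lat T" unfolding C.OV_def order_in_def by blast+
  have "quotient_length scl T A = C.len T A" by (rule quotient_length_eq[OF T(3) C.lat_L T(2)])
  thus "index_factor scl T A * h_factor scl T * zeta_order CARD('q) T =
    of_nat (CARD('q) ^ C.len T A) * fps_X ^ (2 * C.len T A) * C.h T * C.zeta T"
    unfolding index_factor_def h_factor_def zeta_order_def C.h_def C.zeta_def gorenstein_iff[OF T(1)] by simp
qed

lemma Zs_subset_A: "Zs \<subseteq> A"
  using Z.subspace_scale[OF A_subspace C.L_one] unfolding Zs_def by blast

text \<open>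
  A submodule \<open>J\<close> of finite index contains a multiple of each element: two of the multiples
  \<open>0, x, \<dots>, [D : J] x\<close> agree modulo \<open>J\<close>, and their difference is a \<open>\<int>\<^sub>q\<close>-unit times a power of \<open>q\<close>
  times \<open>x\<close>.
\<close>

text \<open>
  Two of the multiples of \<open>x\<close> by natural numbers agree modulo \<open>J\<close>. Their difference is \<open>x\<close> times a power
  of \<open>q\<close> and a unit of \<open>\<int>\<^sub>q\<close>.
\<close>

lemma finite_index_absorb:
  assumes J: "Z.subspace J" and D: "Z.subspace D" "J \<subseteq> D" "C.ind D J \<noteq> 0" and x: "x \<in> D"
  shows "\<exists>k. of_nat CARD('q) ^ k * x \<in> J"
proof -
  note add = J[folded submod_Zs_iff, THEN submodD(1)]
    D(1)[folded submod_Zs_iff, THEN submodD(1)]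
  define f where "f i = {y. y - of_nat i * x \<in> J}" for i :: nat
  have fin: "finite (cosets J D)"
    using D(3) unfolding index_cosets[OF add D(2)] by (rule card_ge_0_finite[OF neq0_conv[THEN iffD1]])
  have "f ` UNIV \<subseteq> cosets J D"
    unfolding cosets_def f_def using subgroup_of_nat[OF add(2) x] by blast
  hence "finite (range f)" using fin by (rule finite_subset)
  hence "\<not> inj f" using finite_imageD by blast
  then obtain i j where ij: "f i = f j" "i < j" unfolding inj_def by (metis linorder_neq_iff)
  have "of_nat j * x - of_nat i * x \<in> J"
    using ij(1)[symmetric] unfolding f_def coset_eq_iff[OF add(1)] .
  hence m: "zscl scl (of_nat (j - i)) x \<in> J"
    using ij(2) unfolding zscl_of_nat by (simp add: of_nat_diff left_diff_distrib)
  have "(of_nat (j - i) :: 'q padic_int) \<noteq> 0" using ij(2) by (intro padic_of_nat_nonzero) simp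
  then obtain k u where k: "(of_nat (j - i) :: 'q padic_int) = of_nat CARD('q) ^ k * u" "u dvd 1"
    by (rule padic_factor)
  obtain w where w: "1 = u * w" using k(2) by (rule dvdE)
  have "zscl scl w (zscl scl (of_nat (j - i)) x) \<in> J" by (rule Z.subspace_scale[OF J m])
  also have "zscl scl w (zscl scl (of_nat (j - i)) x) = zscl scl (of_nat CARD('q) ^ k * (u * w)) x"
    unfolding k(1) by (simp add: mult_ac)
  finally show ?thesis unfolding w[symmetric] by (auto simp: zscl_of_nat_power)
qed

lemma finite_index_lattice:
  assumes D: "C.lat D" and J: "Z.subspace J" "J \<subseteq> D" "C.ind D J \<noteq> 0"
  shows "C.lat J"
proof -
  obtain B where B: "base B" "Z.span B = D" using D by (rule lattice_base)
  have fin: "finite B" using B(1) unfolding base_def by blast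
  have sD: "Z.subspace D" using Z.subspace_span[of B] unfolding B(2) .
  have "\<exists>k. of_nat CARD('q) ^ k * b \<in> J" if "b \<in> B" for b
    using finite_index_absorb[OF J(1) sD J(2,3)] Z.span_base[OF that] unfolding B(2) by blast
  then obtain k where k: "\<And>x. x \<in> D \<Longrightarrow> of_nat CARD('q) ^ k * x \<in> J"
    using Z_absorb_span[OF J(1) fin] B(2) by metis
  show ?thesis
    by (rule C.lat_between[OF C.lat_scale[OF D C.Qk_rk(1)] D])
      (use J(1,2) k submod_Zs_iff in blast)+
qed

text \<open>
  Duality exchanges the submodules of index \<open>q^n\<close> of \<open>A\<^sup>\<or>\<close> and the fractional ideals that contain
  \<open>A\<close> with index \<open>q^n\<close>.
\<close>

lemma yun_coeff_eq: "yun_coeff scl A n = card {M \<in> C.LT A. C.len M A = n}"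
proof -
  note A = C.lat_L
  have dA: "C.lat (C.dual A)" by (rule C.dual_lat[OF A])
  have "bij_betw C.dual {M \<in> C.LT A. C.len M A = n}
    {I. I \<subseteq> C.dual A \<and> submodule_over A I \<and> C.ind (C.dual A) I = CARD('q) ^ n}" (is "bij_betw _ ?X ?Y")
  proof (rule bij_betwI')
    fix M N assume "M \<in> ?X" "N \<in> ?X"
    hence "C.lat M" "C.lat N" by (auto intro: C.LTD(3)[of _ A])
    thus "C.dual M = C.dual N \<longleftrightarrow> M = N" using C.dual_inj[of M N] by blast
  next
    fix M assume "M \<in> ?X"
    hence mem: "M \<in> C.LT A" and "C.len M A = n" by simp_all
    hence M: "C.lat M" "submodule_over A M" "A \<subseteq> M" "C.len M A = n"
      using C.LTD(4)[OF mem] unfolding C.LT_def C.tl_def by simp_all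
    have s: "C.dual M \<subseteq> C.dual A" by (rule C.dual_antimono[OF M(3)])
    moreover have "submodule_over A (C.dual M)"
      using submodD(6)[OF M(2)] by (intro submod_colon' submodD(1)[OF C.I_mod])
    moreover have "C.ind (C.dual A) (C.dual M) = CARD('q) ^ n"
      using C.ind_len[OF dA C.dual_lat[OF M(1)] s] C.len_dual[OF M(1) A M(3)] M(4) by simp
    ultimately show "C.dual M \<in> ?Y" by blast
  next
    fix I assume "I \<in> ?Y"
    hence I: "I \<subseteq> C.dual A" "submodule_over A I" "C.ind (C.dual A) I = CARD('q) ^ n" by auto
    have "Z.subspace I" using submod_mono[OF I(2) Zs_subset_A] unfolding submod_Zs_iff .
    hence lI: "C.lat I" using finite_index_lattice[OF dA _ I(1)] I(3) by simp
    let ?M = "C.dual I"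
    have M: "C.lat ?M" "C.dual ?M = I" using C.dual_lat[OF lI] C.dual_dual[OF lI] by auto
    have one: "1 \<in> ?M"
    proof (rule colonI)
      fix y assume "y \<in> I"
      hence "y * 1 \<in> trace_int" using I(1) C.L_one colonD by blast
      thus "1 * y \<in> trace_int" by simp
    qed
    have sub: "submodule_over A ?M"
      using submodD(6)[OF I(2)] by (intro submod_colon' submodD(1)[OF C.I_mod])
    hence mem: "?M \<in> C.LT A" using M(1) one unfolding C.LT_def C.tl_def by blast
    have AM: "A \<subseteq> ?M" by (rule C.LTD(4)[OF mem])
    have "C.len (C.dual A) I = n" using I(3) by (rule C.len_eqI)
    hence "C.len ?M A = n" using C.len_dual[OF M(1) A AM] M(2) by simp
    thus "\<exists>M\<in>?X. I = C.dual M" using mem M(2) by (intro bexI[of _ ?M]) auto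
  qed
  thus ?thesis unfolding yun_coeff_def trace_dual_eq by (rule bij_betw_same_card[symmetric])
qed

lemma yun_J_eq: "yun_J scl A = C.J A"
  unfolding yun_J_def C.J_def C.ser_def yun_coeff_eq by simp

lemma yun_J_overorder_series:
  assumes "gorenstein scl A" shows "yun_J scl A = overorder_series scl A"
proof -
  have "C.order A" using A_order order_in_iff by blast
  thus ?thesis
    unfolding yun_J_eq overorder_series_eq using C.J_eq_L assms gorenstein_iff by blast
qed

end

theorem theorem1p1:
  fixes scl :: "'q :: prime_card padic \<Rightarrow> 'e :: comm_ring_1 \<Rightarrow> 'e"
    and A :: "'e set"
  assumes "etale_cubic_algebra scl"
    and "cubic_order scl A"
    and "gorenstein scl A"
  shows "yun_J scl A = overorder_series scl A \<and>
         normalized_J scl A = normalized_overorder_series scl A"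
proof
  interpret cubic_algebra_order scl A using assms(1,2) by unfold_locales
  show e: "yun_J scl A = overorder_series scl A" by (rule yun_J_overorder_series[OF assms(3)])
  \<comment> \<open>The normalization divides each summand by \<open>\<zeta>\<^sub>E\<close> and shifts it, so it commutes with the sum.\<close>
  have s: "fps_to_fls (\<Sum>T\<in>S. f T) = (\<Sum>T\<in>S. fps_to_fls (f T))" for S :: "'e set set" and f :: "'e set \<Rightarrow> rat fps"
    by (induction S rule: infinite_finite_induct) simp_all
  show "normalized_J scl A = normalized_overorder_series scl A"
    unfolding normalized_J_def normalized_overorder_series_def e overorder_series_def s
    by (simp add: fls_times_fps_to_fls sum_distrib_left divide_inverse mult_ac)
qed

end
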